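(* Let $(X,\mathscr B,m)$ be a Polish probability space, $(T,\mathscr A,p)$ a probability space and $(\Omega,\mathscr F,\mathbb P)=(T^{\mathbb N},\mathscr A^{\mathbb N},p^{\mathbb N})$. Let $f:T\times X\to X$ be a random map driven by the Bernoulli measure $\mathbb P$, and assume that its associated skew-product $F$ is $\bar m$-nonsingular, where $\bar m=\mathbb P\times m$. The following are equivalent: (i) $\mathcal L_f$ is (MC); (ii) $\mathcal L_f$ satisfies (FED); (iii) $\mathcal L_f$ is (APM); (iv) $f$ satisfies (FPM) with respect to $m$; (v) $\mathcal L_F$ is (MC); (vi) $\mathcal L_F$ satisfies (FED); (vii) $\mathcal L_F$ is (APM); (viii) $F$ satisfies (FPM) with respect to $\bar m$.
   Context: Random map: measurable $f:T\times X\to X$, $f_t=f(t,\cdot)$, $f^n_\omega=f_{\omega_{n-1}}\circ\dots\circ f_{\omega_0}$; skew-product $F(\omega,x)=(\sigma(\omega),f_{\omega_0}(x))$ on $\Omega\times X$, $\sigma$ the shift. A map is $\eta$-nonsingular if preimages of $\eta$-null sets are $\eta$-null. (If $F$ is $\bar m$-nonsingular then for every $m$-null set $A$, $f_t^{-1}(A)$ is $m$-null for $p$-a.e. $t$, so $\mathcal L_f$ below is well defined.) Annealed Perron--Frobenius operator: $\mathcal L_f:L^1(m)\to L^1(m)$, $\mathcal L_f\varphi=\frac{d}{dm}\int f_tm_\varphi\,dp(t)$ with $dm_\varphi=\varphi\,dm$ (Radon--Nikod\'ym derivative, pushforward). $\mathcal L_F:L^1(\bar m)\to L^1(\bar m)$,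 $\mathcal L_F\varphi=\frac{d}{d\bar m}F\bar m_\varphi$ with $d\bar m_\varphi=\varphi\,d\bar m$. Let $\mathcal L$ be either operator, acting on $L^1(\eta)$ of a probability space $(Y,\mathscr G,\eta)$, with dual $\mathcal L^*$ on $L^\infty(\eta)$; $D(\eta)=\{h\in L^1(\eta):h\ge0\ \eta\text{-a.e.},\ \|h\|=1\}$; $A_n\varphi=\frac1n\sum_{i=0}^{n-1}\mathcal L^i\varphi$; $\operatorname{supp}h=\{h\ne0\}$ (mod $\eta$-null sets). An invariant density is $h\in D(\eta)$ with $\mathcal Lh=h$; it is ergodic if the measure $d\eta_h=h\,d\eta$ satisfies $\eta_h(A)\in\{0,1\}$ for every $A\in\mathscr G$ with $\mathcal L^*1_A\ge1_A$. (MC) (mean constrictive): there is a compact set $K\subset L^1(\eta)$ such that $\inf_{\psi\in K}\|A_nh-\psi\|\to0$ as $n\to\infty$ for every $h\in D(\eta)$. (FED) (finitude of ergodic densities): $\mathcal L$ admits finitely many ergodic invariant densities $h_1,\dots,h_r$ with mutually disjoint supports (up to an $\eta$-null set) and the invariant density $h=\frac1r(h_1+\dots+h_r)$ has maximal support, i.e. $\lim_{n\to\infty}\mathcal L^{n*}1_{\operatorname{supp}h}(y)=1$ for $\eta$-a.e. $y$. (APM) (almost periodic in mean): there are finitely many ergodic invariant densities $h_1,\dots,h_r$ with mutually disjoint supports (up to an $\eta$-null set) and positive bounded linear functionals $\lambda_1,\dots,\lambda_r$ on $L^1(\eta)$ with $\lim_{n\to\infty}\|A_n\varphi-\sum_{i=1}^r\lambda_i(\varphi)h_i\|=0$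 for all $\varphi\in L^1(\eta)$. A probability $\mu$ on $X$ is $f$-stationary if $\mu=\int f_t\mu\,dp(t)$, and ergodic if $\mathbb P\times\mu$ is ergodic for $F$. (FPM) for $f$ with respect to $m$: there are finitely many ergodic $f$-stationary probability measures $\mu_1,\dots,\mu_r$ such that 1) each $\mu_i\ll m$; 2) their supports are pairwise disjoint up to an $m$-null set; 3) for every bounded measurable $\psi:X\to\mathbb R$, for $\mathbb P$-a.e. $\omega$, $m$-a.e. $x\in X$ lies in $\bigcup_iB_\omega(\mu_i,\psi)$, where $B_\omega(\mu_i,\psi)=\{x:\lim_n\frac1n\sum_{j=0}^{n-1}\psi(f^j_\omega(x))=\int\psi\,d\mu_i\}$. $\mathbb P$-Markovian measure: an $F$-invariant probability $\bar\mu$ on $\Omega\times X$ with first marginal $\mathbb P$ and disintegration $d\bar\mu=\bar\mu_{\omega_0}\,d\mathbb P(\omega)$ (fiber measures depending only on $\omega_0$). (FPM) for $F$ with respect to $\bar m$: there are finitely many ergodic $F$-invariant probability measures $\bar\mu_1,\dots,\bar\mu_r$ such that 1) each is $\mathbb P$-Markovian; 2) each $\bar\mu_i\ll\bar m$; 3) for every bounded measurable $\varphi:\Omega\times X\to\mathbb R$, $\bar m(\bigcup_iB(\bar\mu_i,\varphi))=1$, where $B(\bar\mu_i,\varphi)=\{(\omega,x):\lim_n\frac1n\sum_{j=0}^{n-1}\varphi(F^j(\omega,x))=\int\varphi\,d\bar\mu_i\}$. *)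

theory Defs
  imports "HOL-Probability.Probability"
begin

text \<open>
  The elements of \<open>L\<^sup>1(\<eta>)\<close> and \<open>L\<^sup>\<infinity>(\<eta>)\<close> are represented by functions, and equality in these spaces
  by \<open>\<eta>\<close>-a.e. equality. Thus \<open>L1_norm\<close> is a seminorm on representatives and \<open>L1_topology\<close> is the
  induced seminorm topology, i.e. the pullback of the norm topology under the quotient map. In
  particular a set of representatives is compact iff its image in the quotient is compact.
\<close>

definition L1 :: "'y measure \<Rightarrow> ('y \<Rightarrow> real) set" where
  "L1 \<eta> = {\<phi>. integrable \<eta> \<phi>}"

definition Linf :: "'y measure \<Rightarrow> ('y \<Rightarrow> real) set" where
  "Linf \<eta> = {g \<in> borel_measurable \<eta>. \<exists>C. AE y in \<eta>. \<bar>g y\<bar> \<le> C}"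

definition L1_norm :: "'y measure \<Rightarrow> ('y \<Rightarrow> real) \<Rightarrow> real" where
  "L1_norm \<eta> \<phi> = (LINT y|\<eta>. \<bar>\<phi> y\<bar>)"

definition L1_topology :: "'y measure \<Rightarrow> ('y \<Rightarrow> real) topology" where
  "L1_topology \<eta> = topology (\<lambda>U. U \<subseteq> L1 \<eta> \<and>
     (\<forall>\<phi>\<in>U. \<exists>e>0. \<forall>\<psi>\<in>L1 \<eta>. L1_norm \<eta> (\<lambda>y. \<psi> y - \<phi> y) < e \<longrightarrow> \<psi> \<in> U))"

lemma openin_L1_topology:
  "openin (L1_topology \<eta>) U \<longleftrightarrow> U \<subseteq> L1 \<eta> \<and>
     (\<forall>\<phi>\<in>U. \<exists>e>0. \<forall>\<psi>\<in>L1 \<eta>. L1_norm \<eta> (\<lambda>y. \<psi> y - \<phi> y) < e \<longrightarrow> \<psi> \<in> U)"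
proof -
  let ?P = "\<lambda>U. U \<subseteq> L1 \<eta> \<and>
     (\<forall>\<phi>\<in>U. \<exists>e>0. \<forall>\<psi>\<in>L1 \<eta>. L1_norm \<eta> (\<lambda>y. \<psi> y - \<phi> y) < e \<longrightarrow> \<psi> \<in> U)"
  have "istopology ?P"
    unfolding istopology_def
  proof (intro conjI allI impI)
    fix S T assume S: "?P S" and T: "?P T"
    show "S \<inter> T \<subseteq> L1 \<eta>" using S by blast
    show "\<forall>\<phi>\<in>S \<inter> T. \<exists>e>0. \<forall>\<psi>\<in>L1 \<eta>. L1_norm \<eta> (\<lambda>y. \<psi> y - \<phi> y) < e \<longrightarrow> \<psi> \<in> S \<inter> T"
    proof
      fix \<phi> assume "\<phi> \<in> S \<inter> T"
      then obtain d e where "d > 0" "e > 0"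
        and "\<forall>\<psi>\<in>L1 \<eta>. L1_norm \<eta> (\<lambda>y. \<psi> y - \<phi> y) < d \<longrightarrow> \<psi> \<in> S"
        and "\<forall>\<psi>\<in>L1 \<eta>. L1_norm \<eta> (\<lambda>y. \<psi> y - \<phi> y) < e \<longrightarrow> \<psi> \<in> T"
        using S T by (metis IntD1 IntD2)
      then show "\<exists>e>0. \<forall>\<psi>\<in>L1 \<eta>. L1_norm \<eta> (\<lambda>y. \<psi> y - \<phi> y) < e \<longrightarrow> \<psi> \<in> S \<inter> T"
        by (intro exI[of _ "min d e"]) auto
    qed
  next
    fix \<K> assume K: "\<forall>S\<in>\<K>. ?P S"
    show "\<Union>\<K> \<subseteq> L1 \<eta>" using K by blast
    show "\<forall>\<phi>\<in>\<Union>\<K>. \<exists>e>0. \<forall>\<psi>\<in>L1 \<eta>. L1_norm \<eta> (\<lambda>y. \<psi> y - \<phi> y) < e \<longrightarrow> \<psi> \<in> \<Union>\<K>"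
      using K by (metis UnionE UnionI)
  qed
  then show ?thesis
    unfolding L1_topology_def by simp
qed

definition densities :: "'y measure \<Rightarrow> ('y \<Rightarrow> real) set" where
  "densities \<eta> = {h \<in> L1 \<eta>. (AE y in \<eta>. 0 \<le> h y) \<and> L1_norm \<eta> h = 1}"

definition supp :: "'y measure \<Rightarrow> ('y \<Rightarrow> 'b::zero) \<Rightarrow> 'y set" where
  "supp \<eta> h = {y \<in> space \<eta>. h y \<noteq> 0}"

definition disjoint_supports :: "'y measure \<Rightarrow> nat \<Rightarrow> (nat \<Rightarrow> 'y \<Rightarrow> 'b::zero) \<Rightarrow> bool" where
  "disjoint_supports \<eta> r h \<longleftrightarrow>
     (\<forall>i<r. \<forall>j<r. i \<noteq> j \<longrightarrow> emeasure \<eta> (supp \<eta> (h i) \<inter> supp \<eta> (h j)) = 0)"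

text \<open>The dual operator is determined up to \<open>\<eta>\<close>-a.e. equality; some representative is chosen.\<close>

definition dual_op ::
    "'y measure \<Rightarrow> (('y \<Rightarrow> real) \<Rightarrow> 'y \<Rightarrow> real) \<Rightarrow> ('y \<Rightarrow> real) \<Rightarrow> 'y \<Rightarrow> real" where
  "dual_op \<eta> L g = (SOME h. h \<in> Linf \<eta> \<and>
     (\<forall>\<phi>\<in>L1 \<eta>. (LINT y|\<eta>. L \<phi> y * g y) = (LINT y|\<eta>. \<phi> y * h y)))"

definition cesaro ::
    "(('y \<Rightarrow> real) \<Rightarrow> 'y \<Rightarrow> real) \<Rightarrow> nat \<Rightarrow> ('y \<Rightarrow> real) \<Rightarrow> 'y \<Rightarrow> real" where
  "cesaro L n \<phi> = (\<lambda>y. (1 / real n) * (\<Sum>i<n. (L ^^ i) \<phi> y))"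

definition invariant_density ::
    "'y measure \<Rightarrow> (('y \<Rightarrow> real) \<Rightarrow> 'y \<Rightarrow> real) \<Rightarrow> ('y \<Rightarrow> real) \<Rightarrow> bool" where
  "invariant_density \<eta> L h \<longleftrightarrow> h \<in> densities \<eta> \<and> (AE y in \<eta>. L h y = h y)"

definition ergodic_density ::
    "'y measure \<Rightarrow> (('y \<Rightarrow> real) \<Rightarrow> 'y \<Rightarrow> real) \<Rightarrow> ('y \<Rightarrow> real) \<Rightarrow> bool" where
  "ergodic_density \<eta> L h \<longleftrightarrow> invariant_density \<eta> L h \<and>
     (\<forall>A\<in>sets \<eta>. (AE y in \<eta>. dual_op \<eta> L (indicator A) y \<ge> indicator A y) \<longrightarrow>
        measure (density \<eta> (\<lambda>y. ennreal (h y))) A \<in> {0, 1})"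

text \<open>
  \<open>K \<noteq> {}\<close> encodes the convention \<open>inf {} = \<infinity>\<close>, which real-valued \<open>INF\<close> does not follow.
\<close>

definition MC :: "'y measure \<Rightarrow> (('y \<Rightarrow> real) \<Rightarrow> 'y \<Rightarrow> real) \<Rightarrow> bool" where
  "MC \<eta> L \<longleftrightarrow> (\<exists>K. compactin (L1_topology \<eta>) K \<and> K \<noteq> {} \<and>
     (\<forall>h\<in>densities \<eta>.
        (\<lambda>n. INF \<psi>\<in>K. L1_norm \<eta> (\<lambda>y. cesaro L n h y - \<psi> y)) \<longlonglongrightarrow> 0))"

definition FED :: "'y measure \<Rightarrow> (('y \<Rightarrow> real) \<Rightarrow> 'y \<Rightarrow> real) \<Rightarrow> bool" where
  "FED \<eta> L \<longleftrightarrow> (\<exists>(r::nat) h. 1 \<le> r \<and>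
     (\<forall>i<r. ergodic_density \<eta> L (h i)) \<and>
     disjoint_supports \<eta> r h \<and>
     (let H = (\<lambda>y. (1 / real r) * (\<Sum>i<r. h i y)) in
        AE y in \<eta>. (\<lambda>n. dual_op \<eta> (L ^^ n) (indicator (supp \<eta> H)) y) \<longlonglongrightarrow> 1))"

text \<open>
  Linearity and boundedness force a functional on representatives to respect \<open>\<eta>\<close>-a.e. equality.
\<close>

definition positive_bounded_functional :: "'y measure \<Rightarrow> (('y \<Rightarrow> real) \<Rightarrow> real) \<Rightarrow> bool" where
  "positive_bounded_functional \<eta> l \<longleftrightarrow>
     (\<forall>\<phi>\<in>L1 \<eta>. \<forall>\<psi>\<in>L1 \<eta>. l (\<lambda>y. \<phi> y + \<psi> y) = l \<phi> + l \<psi>) \<and>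
     (\<forall>c. \<forall>\<phi>\<in>L1 \<eta>. l (\<lambda>y. c * \<phi> y) = c * l \<phi>) \<and>
     (\<exists>C. \<forall>\<phi>\<in>L1 \<eta>. \<bar>l \<phi>\<bar> \<le> C * L1_norm \<eta> \<phi>) \<and>
     (\<forall>\<phi>\<in>L1 \<eta>. (AE y in \<eta>. 0 \<le> \<phi> y) \<longrightarrow> 0 \<le> l \<phi>)"

definition APM :: "'y measure \<Rightarrow> (('y \<Rightarrow> real) \<Rightarrow> 'y \<Rightarrow> real) \<Rightarrow> bool" where
  "APM \<eta> L \<longleftrightarrow> (\<exists>(r::nat) h l.
     (\<forall>i<r. ergodic_density \<eta> L (h i)) \<and>
     disjoint_supports \<eta> r h \<and>
     (\<forall>i<r. positive_bounded_functional \<eta> (l i)) \<and>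
     (\<forall>\<phi>\<in>L1 \<eta>.
        (\<lambda>n. L1_norm \<eta> (\<lambda>y. cesaro L n \<phi> y - (\<Sum>i<r. l i \<phi> * h i y))) \<longlonglongrightarrow> 0))"

definition bernoulli :: "'t measure \<Rightarrow> (nat \<Rightarrow> 't) measure" where
  "bernoulli p = (\<Pi>\<^sub>M i\<in>(UNIV::nat set). p)"

definition skew :: "('t \<Rightarrow> 'x \<Rightarrow> 'x) \<Rightarrow> (nat \<Rightarrow> 't) \<times> 'x \<Rightarrow> (nat \<Rightarrow> 't) \<times> 'x" where
  "skew f = (\<lambda>(\<omega>, x). (\<lambda>n. \<omega> (Suc n), f (\<omega> 0) x))"

primrec random_iter :: "('t \<Rightarrow> 'x \<Rightarrow> 'x) \<Rightarrow> (nat \<Rightarrow> 't) \<Rightarrow> nat \<Rightarrow> 'x \<Rightarrow> 'x" where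
  "random_iter f \<omega> 0 x = x"
| "random_iter f \<omega> (Suc n) x = f (\<omega> n) (random_iter f \<omega> n x)"

definition nonsingular :: "'y measure \<Rightarrow> ('y \<Rightarrow> 'y) \<Rightarrow> bool" where
  "nonsingular \<eta> g \<longleftrightarrow> g \<in> measurable \<eta> \<eta> \<and>
     (\<forall>A\<in>null_sets \<eta>. g -` A \<inter> space \<eta> \<in> null_sets \<eta>)"

text \<open>The measure \<open>\<integral> f\<^sub>t \<nu> dp(t)\<close>.\<close>

definition annealed_push :: "'t measure \<Rightarrow> ('t \<Rightarrow> 'x \<Rightarrow> 'x) \<Rightarrow> 'x measure \<Rightarrow> 'x measure" where
  "annealed_push p f \<nu> =
     measure_of (space \<nu>) (sets \<nu>) (\<lambda>A. \<integral>\<^sup>+t. emeasure (distr \<nu> \<nu> (f t)) A \<partial>p)"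

text \<open>
  The Radon--Nikodym derivative of the image of the signed measure \<open>\<phi> d\<eta>\<close>, for a linear operation
  \<open>push\<close> on measures. The library's \<open>RN_deriv\<close> handles positive measures only, so the images of
  \<open>\<phi>\<^sup>+ d\<eta>\<close> and \<open>\<phi>\<^sup>- d\<eta>\<close> are differentiated separately; \<open>ennreal\<close> truncates negative values to 0.
\<close>

definition transfer_op ::
    "'y measure \<Rightarrow> ('y measure \<Rightarrow> 'y measure) \<Rightarrow> ('y \<Rightarrow> real) \<Rightarrow> 'y \<Rightarrow> real" where
  "transfer_op \<eta> push \<phi> = (\<lambda>y.
     enn2real (RN_deriv \<eta> (push (density \<eta> (\<lambda>z. ennreal (\<phi> z)))) y) -
     enn2real (RN_deriv \<eta> (push (density \<eta> (\<lambda>z. ennreal (- \<phi> z)))) y))"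

definition annealed_PF ::
    "'t measure \<Rightarrow> 'x measure \<Rightarrow> ('t \<Rightarrow> 'x \<Rightarrow> 'x) \<Rightarrow> ('x \<Rightarrow> real) \<Rightarrow> 'x \<Rightarrow> real" where
  "annealed_PF p m f = transfer_op m (annealed_push p f)"

definition PF :: "'y measure \<Rightarrow> ('y \<Rightarrow> 'y) \<Rightarrow> ('y \<Rightarrow> real) \<Rightarrow> 'y \<Rightarrow> real" where
  "PF \<eta> g = transfer_op \<eta> (\<lambda>\<nu>. distr \<nu> \<nu> g)"

definition invariant_prob :: "'y measure \<Rightarrow> ('y \<Rightarrow> 'y) \<Rightarrow> 'y measure \<Rightarrow> bool" where
  "invariant_prob \<eta> g \<nu> \<longleftrightarrow>
     prob_space \<nu> \<and> sets \<nu> = sets \<eta> \<and> g \<in> measurable \<nu> \<nu> \<and> distr \<nu> \<nu> g = \<nu>"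

definition ergodic :: "('y \<Rightarrow> 'y) \<Rightarrow> 'y measure \<Rightarrow> bool" where
  "ergodic g \<nu> \<longleftrightarrow> (\<forall>A\<in>sets \<nu>. g -` A \<inter> space \<nu> = A \<longrightarrow> measure \<nu> A \<in> {0, 1})"

definition stationary_prob ::
    "'t measure \<Rightarrow> 'x measure \<Rightarrow> ('t \<Rightarrow> 'x \<Rightarrow> 'x) \<Rightarrow> 'x measure \<Rightarrow> bool" where
  "stationary_prob p m f \<mu> \<longleftrightarrow>
     prob_space \<mu> \<and> sets \<mu> = sets m \<and> \<mu> = annealed_push p f \<mu>"

definition ergodic_stationary ::
    "'t measure \<Rightarrow> 'x measure \<Rightarrow> ('t \<Rightarrow> 'x \<Rightarrow> 'x) \<Rightarrow> 'x measure \<Rightarrow> bool" where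
  "ergodic_stationary p m f \<mu> \<longleftrightarrow>
     stationary_prob p m f \<mu> \<and> ergodic (skew f) (bernoulli p \<Otimes>\<^sub>M \<mu>)"

definition fiber_basin ::
    "('t \<Rightarrow> 'x \<Rightarrow> 'x) \<Rightarrow> (nat \<Rightarrow> 't) \<Rightarrow> 'x measure \<Rightarrow> ('x \<Rightarrow> real) \<Rightarrow> 'x set" where
  "fiber_basin f \<omega> \<mu> \<psi> = {x \<in> space \<mu>.
     (\<lambda>n. (1 / real n) * (\<Sum>j<n. \<psi> (random_iter f \<omega> j x))) \<longlonglongrightarrow> (LINT x|\<mu>. \<psi> x)}"

text \<open>The support of \<open>\<mu> \<lless> m\<close> is the support of its density, well defined modulo \<open>m\<close>-null sets.\<close>

definition FPM_random :: "'t measure \<Rightarrow> 'x measure \<Rightarrow> ('t \<Rightarrow> 'x \<Rightarrow> 'x) \<Rightarrow> bool" where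
  "FPM_random p m f \<longleftrightarrow> (\<exists>(r::nat) \<mu>.
     (\<forall>i<r. ergodic_stationary p m f (\<mu> i)) \<and>
     (\<forall>i<r. absolutely_continuous m (\<mu> i)) \<and>
     disjoint_supports m r (\<lambda>i. RN_deriv m (\<mu> i)) \<and>
     (\<forall>\<psi>\<in>borel_measurable m. bounded (\<psi> ` space m) \<longrightarrow>
        (AE \<omega> in bernoulli p. AE x in m. x \<in> (\<Union>i<r. fiber_basin f \<omega> (\<mu> i) \<psi>))))"

definition markovian ::
    "'t measure \<Rightarrow> 'x measure \<Rightarrow> ('t \<Rightarrow> 'x \<Rightarrow> 'x) \<Rightarrow> ((nat \<Rightarrow> 't) \<times> 'x) measure \<Rightarrow> bool" where
  "markovian p m f \<nu> \<longleftrightarrow>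
     invariant_prob (bernoulli p \<Otimes>\<^sub>M m) (skew f) \<nu> \<and>
     distr \<nu> (bernoulli p) fst = bernoulli p \<and>
     (\<exists>\<kappa>\<in>measurable p (prob_algebra m). \<forall>C\<in>sets \<nu>.
        emeasure \<nu> C = (\<integral>\<^sup>+\<omega>. emeasure (\<kappa> (\<omega> 0)) (Pair \<omega> -` C) \<partial>bernoulli p))"

definition basin :: "('y \<Rightarrow> 'y) \<Rightarrow> 'y measure \<Rightarrow> ('y \<Rightarrow> real) \<Rightarrow> 'y set" where
  "basin g \<nu> \<phi> = {z \<in> space \<nu>.
     (\<lambda>n. (1 / real n) * (\<Sum>j<n. \<phi> ((g ^^ j) z))) \<longlonglongrightarrow> (LINT z|\<nu>. \<phi> z)}"

definition FPM_skew :: "'t measure \<Rightarrow> 'x measure \<Rightarrow> ('t \<Rightarrow> 'x \<Rightarrow> 'x) \<Rightarrow> bool" where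
  "FPM_skew p m f \<longleftrightarrow> (let mbar = bernoulli p \<Otimes>\<^sub>M m; F = skew f in
     \<exists>(r::nat) \<nu>.
       (\<forall>i<r. invariant_prob mbar F (\<nu> i) \<and> ergodic F (\<nu> i)) \<and>
       (\<forall>i<r. markovian p m f (\<nu> i)) \<and>
       (\<forall>i<r. absolutely_continuous mbar (\<nu> i)) \<and>
       (\<forall>\<phi>\<in>borel_measurable mbar. bounded (\<phi> ` space mbar) \<longrightarrow>
          emeasure mbar (\<Union>i<r. basin F (\<nu> i) \<phi>) = 1))"

end

theory Submission
  imports Defs
begin

text \<open>
  The proof has two layers: a statement about arbitrary Markov operators, and a comparison of the
  annealed operator \<open>\<L>\<^sub>f\<close> with the operator \<open>\<L>\<^sub>F\<close> of the skew product.

  For a positive operator \<open>L\<close> on \<open>L\<^sup>1(\<eta>)\<close> that preserves integrals, (MC), (FED) and (APM) are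
  equivalent. Under (MC) the averages \<open>A\<^sub>n h\<close> of a density have a cluster point. Averages are almost
  invariant, so the cluster point is invariant and the whole sequence converges to it
  (\<open>cesaro_cluster_point_limit\<close>). Hence the compact set contains, up to null sets, all invariant
  densities. Those with disjoint supports have distance 2 from each other, so some disjoint family
  has the largest possible number of members. Its members are ergodic, because an absorbing set
  would split one of them in two, and its supports attract all mass, because invariant mass outside
  of them could be added to the family as a further member (\<open>MC_imp_FED\<close>). Under (FED) all mass flows
  into the support of the mean \<open>H\<close> of the ergodic densities, and there functions dominated by a
  multiple of \<open>H\<close> are dense. For these the averages converge by von Neumann's argument in the Hilbert
  norm \<open>\<integral> u\<^sup>2 / H d\<eta>\<close> (\<open>cesaro_converges_dominated\<close>). By ergodicity the limit is a multiple of each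
  \<open>h\<^sub>i\<close> on its support, and the factor is \<open>\<integral> \<phi> u\<^sub>i d\<eta>\<close>, where \<open>u\<^sub>i\<close> is the probability of being absorbed
  by the support of \<open>h\<^sub>i\<close> (\<open>FED_imp_APM\<close>). Under (APM) the limits of the averages of densities lie in a
  finite-dimensional box, which is compact (\<open>APM_imp_MC\<close>).

  The coordinates of the noise are independent, and each application of \<open>F\<close> discards one of them.
  Therefore \<open>\<L>\<^sub>F\<^sup>k \<phi>\<close> approaches the functions of \<open>x\<close> alone (\<open>integrable_forgets_noise\<close>), and on those
  \<open>\<L>\<^sub>F\<close> acts as \<open>\<L>\<^sub>f\<close> (\<open>LF_emb\<close>). Compact attractors of the averages can thus be carried from one
  operator to the other. Moreover every \<open>\<L>\<^sub>F\<close>-invariant function depends on \<open>x\<close> alone, so an ergodic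
  density \<open>h\<close> of \<open>\<L>\<^sub>f\<close> gives an ergodic measure \<open>\<P> \<times> h m\<close> of \<open>F\<close> (\<open>ergodic_density_product\<close>).

  Finally, (FED) for \<open>\<L>\<^sub>f\<close> yields both forms of (FPM): by Birkhoff's theorem almost every point of a
  support lies in the basin, almost every orbit enters a support, and basins are invariant
  (\<open>FED_f_basins\<close>). Conversely, the observable \<open>1\<^sub>S\<close>, where \<open>S\<close> is the union of the supports, has mean 1
  for each of the given measures. Along an orbit in a basin its averages tend to 1, so the orbit
  enters \<open>S\<close> (\<open>basin_enters\<close>), which is the maximality of the support in (FED).
\<close>

section \<open>Bounded test functions and the \<open>L\<^sup>1\<close> seminorm\<close>

text \<open>
  Test functions are bounded at every point of the space, not only almost everywhere. Composing them
  with a map or integrating them against a kernel then raises no question of representatives.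
\<close>

definition bmeas :: "'y measure \<Rightarrow> ('y \<Rightarrow> real) set" where
  "bmeas \<eta> = {g \<in> borel_measurable \<eta>. \<exists>C. \<forall>y\<in>space \<eta>. \<bar>g y\<bar> \<le> C}"

lemma bmeasI: "g \<in> borel_measurable \<eta> \<Longrightarrow> (\<And>y. y \<in> space \<eta> \<Longrightarrow> \<bar>g y\<bar> \<le> C) \<Longrightarrow> g \<in> bmeas \<eta>"
  unfolding bmeas_def by auto

lemma bmeas_measurable: "g \<in> bmeas \<eta> \<Longrightarrow> g \<in> borel_measurable \<eta>"
  unfolding bmeas_def by auto

lemma bmeasE:
  assumes "g \<in> bmeas \<eta>"
  obtains C where "0 \<le> C" "\<And>y. y \<in> space \<eta> \<Longrightarrow> \<bar>g y\<bar> \<le> C"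
proof -
  obtain C where C: "\<And>y. y \<in> space \<eta> \<Longrightarrow> \<bar>g y\<bar> \<le> C" using assms unfolding bmeas_def by auto
  show ?thesis by (rule that[of "\<bar>C\<bar>"]) (use C in \<open>force+\<close>)
qed

lemma bmeas_indicator [intro, simp]: "A \<in> sets \<eta> \<Longrightarrow> indicator A \<in> bmeas \<eta>"
  by (rule bmeasI[of _ _ 1]) (auto simp: indicator_def)

lemma bmeas_const [intro, simp]: "(\<lambda>_. c) \<in> bmeas \<eta>"
  by (rule bmeasI[of _ _ "\<bar>c\<bar>"]) auto

lemma bmeas_add: "f \<in> bmeas \<eta> \<Longrightarrow> g \<in> bmeas \<eta> \<Longrightarrow> (\<lambda>y. f y + g y) \<in> bmeas \<eta>"
proof -
  assume f: "f \<in> bmeas \<eta>" and g: "g \<in> bmeas \<eta>"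
  obtain C D where "\<And>y. y \<in> space \<eta> \<Longrightarrow> \<bar>f y\<bar> \<le> C" "\<And>y. y \<in> space \<eta> \<Longrightarrow> \<bar>g y\<bar> \<le> D"
    using f g by (metis bmeasE)
  then have "\<And>y. y \<in> space \<eta> \<Longrightarrow> \<bar>f y + g y\<bar> \<le> C + D"
    by (meson abs_triangle_ineq add_mono order_trans)
  then show ?thesis
    using bmeas_measurable[OF f] bmeas_measurable[OF g] by (intro bmeasI[of _ _ "C + D"]) auto
qed

lemma bmeas_mult: "f \<in> bmeas \<eta> \<Longrightarrow> g \<in> bmeas \<eta> \<Longrightarrow> (\<lambda>y. f y * g y) \<in> bmeas \<eta>"
proof -
  assume f: "f \<in> bmeas \<eta>" and g: "g \<in> bmeas \<eta>"
  obtain C where C: "0 \<le> C" "\<And>y. y \<in> space \<eta> \<Longrightarrow> \<bar>f y\<bar> \<le> C" using f by (metis bmeasE)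
  obtain D where D: "0 \<le> D" "\<And>y. y \<in> space \<eta> \<Longrightarrow> \<bar>g y\<bar> \<le> D" using g by (metis bmeasE)
  have "\<And>y. y \<in> space \<eta> \<Longrightarrow> \<bar>f y * g y\<bar> \<le> C * D"
    using C D by (simp add: abs_mult mult_mono')
  then show ?thesis
    using bmeas_measurable[OF f] bmeas_measurable[OF g] by (intro bmeasI[of _ _ "C * D"]) auto
qed

lemma bmeas_sum: "(\<And>i. i \<in> I \<Longrightarrow> g i \<in> bmeas \<eta>) \<Longrightarrow> (\<lambda>y. \<Sum>i\<in>I. g i y) \<in> bmeas \<eta>"
  by (induction I rule: infinite_finite_induct) (auto intro: bmeas_add)

lemma integrable_mult_bmeas:
  assumes "integrable \<eta> \<phi>" "g \<in> bmeas \<eta>"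
  shows "integrable \<eta> (\<lambda>y. \<phi> y * g y)"
proof -
  obtain C where C: "0 \<le> C" "\<And>y. y \<in> space \<eta> \<Longrightarrow> \<bar>g y\<bar> \<le> C" using assms by (metis bmeasE)
  have [measurable]: "g \<in> borel_measurable \<eta>" "\<phi> \<in> borel_measurable \<eta>"
    using assms bmeas_measurable by auto
  show ?thesis
  proof (rule Bochner_Integration.integrable_bound)
    show "integrable \<eta> (\<lambda>y. C * \<phi> y)" using assms by simp
    show "AE y in \<eta>. norm (\<phi> y * g y) \<le> norm (C * \<phi> y)"
      by (rule AE_I2)
        (metis C abs_mult abs_of_nonneg mult.commute mult_right_mono abs_ge_zero real_norm_def)
  qed measurable
qed

lemma (in prob_space) integrable_bmeas: "g \<in> bmeas M \<Longrightarrow> integrable M g"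
  using integrable_mult_bmeas[of M "\<lambda>_. 1" g] by simp

lemma AE_eq_by_testing:
  fixes u v :: "'y \<Rightarrow> real"
  assumes "integrable \<eta> u" "integrable \<eta> v"
    and "\<And>A. A \<in> sets \<eta> \<Longrightarrow> (LINT y|\<eta>. u y * indicator A y) = (LINT y|\<eta>. v y * indicator A y)"
  shows "AE y in \<eta>. u y = v y"
  using assms by (intro density_unique_real) (auto simp: set_lebesgue_integral_def mult.commute)

text \<open>It suffices to test on the set where the inequality fails.\<close>

lemma AE_le_by_testing:
  fixes u v :: "'y \<Rightarrow> real"
  assumes u: "integrable \<eta> u" and v: "integrable \<eta> v"
    and le: "\<And>A. A \<in> sets \<eta> \<Longrightarrow> (LINT y|\<eta>. u y * indicator A y) \<le> (LINT y|\<eta>. v y * indicator A y)"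
  shows "AE y in \<eta>. u y \<le> v y"
proof -
  have [measurable]: "u \<in> borel_measurable \<eta>" "v \<in> borel_measurable \<eta>" using u v by auto
  define A where "A = {y \<in> space \<eta>. v y < u y}"
  have A [measurable]: "A \<in> sets \<eta>" unfolding A_def by measurable
  have iu: "integrable \<eta> (\<lambda>y. u y * indicator A y)" and iv: "integrable \<eta> (\<lambda>y. v y * indicator A y)"
    using u v A by (auto intro!: integrable_mult_bmeas)
  have "(LINT y|\<eta>. u y * indicator A y - v y * indicator A y) = 0"
    apply (rule antisym)
    subgoal using le[OF A] iu iv by simp
    subgoal by (rule Bochner_Integration.integral_nonneg) (auto simp: A_def indicator_def)
    done
  moreover have "AE y in \<eta>. 0 \<le> u y * indicator A y - v y * indicator A y"
    by (auto simp: A_def indicator_def)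
  ultimately have "AE y in \<eta>. u y * indicator A y - v y * indicator A y = 0"
    using integral_nonneg_eq_0_iff_AE[of \<eta> "\<lambda>y. u y * indicator A y - v y * indicator A y"] iu iv by simp
  then show ?thesis
    using AE_space by eventually_elim (auto simp: A_def indicator_def split: if_splits)
qed

lemma AE_eq_if_le_integral_eq:
  fixes u v :: "'y \<Rightarrow> real"
  assumes "integrable \<eta> u" "integrable \<eta> v" "AE y in \<eta>. u y \<le> v y"
    and "(LINT y|\<eta>. v y) \<le> (LINT y|\<eta>. u y)"
  shows "AE y in \<eta>. u y = v y"
proof -
  have nn: "AE y in \<eta>. 0 \<le> v y - u y" using assms(3) by simp
  have "(LINT y|\<eta>. v y - u y) = 0"
    using assms integral_nonneg_AE[OF nn] by simp
  then have "AE y in \<eta>. v y - u y = 0"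
    using integral_nonneg_eq_0_iff_AE[OF _ nn] assms by simp
  then show ?thesis by eventually_elim simp
qed

lemma L1_norm_nonneg [simp]: "0 \<le> L1_norm \<eta> \<phi>"
  unfolding L1_norm_def by (rule Bochner_Integration.integral_nonneg) simp

lemma L1_norm_cong_AE:
  "\<phi> \<in> borel_measurable \<eta> \<Longrightarrow> \<psi> \<in> borel_measurable \<eta> \<Longrightarrow> AE y in \<eta>. \<phi> y = \<psi> y \<Longrightarrow>
   L1_norm \<eta> \<phi> = L1_norm \<eta> \<psi>"
  unfolding L1_norm_def by (rule integral_cong_AE) auto

lemma L1_norm_eq_0_iff:
  "integrable \<eta> \<phi> \<Longrightarrow> L1_norm \<eta> \<phi> = 0 \<longleftrightarrow> (AE y in \<eta>. \<phi> y = 0)"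
  unfolding L1_norm_def by (subst integral_nonneg_eq_0_iff_AE) auto

lemma L1_norm_triangle:
  "integrable \<eta> \<phi> \<Longrightarrow> integrable \<eta> \<psi> \<Longrightarrow> L1_norm \<eta> (\<lambda>y. \<phi> y + \<psi> y) \<le> L1_norm \<eta> \<phi> + L1_norm \<eta> \<psi>"
proof -
  assume i: "integrable \<eta> \<phi>" "integrable \<eta> \<psi>"
  have "L1_norm \<eta> (\<lambda>y. \<phi> y + \<psi> y) \<le> (LINT y|\<eta>. \<bar>\<phi> y\<bar> + \<bar>\<psi> y\<bar>)"
    unfolding L1_norm_def using i by (intro integral_mono) auto
  also have "\<dots> = L1_norm \<eta> \<phi> + L1_norm \<eta> \<psi>" unfolding L1_norm_def using i by simp
  finally show ?thesis .
qed

lemma L1_norm_scale: "L1_norm \<eta> (\<lambda>y. c * \<phi> y) = \<bar>c\<bar> * L1_norm \<eta> \<phi>"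
  unfolding L1_norm_def by (simp add: abs_mult)

lemma L1_norm_minus_commute: "L1_norm \<eta> (\<lambda>y. \<phi> y - \<psi> y) = L1_norm \<eta> (\<lambda>y. \<psi> y - \<phi> y)"
  unfolding L1_norm_def by (simp add: abs_minus_commute)

lemma L1_dist_triangle:
  assumes "integrable \<eta> \<phi>" "integrable \<eta> \<psi>" "integrable \<eta> \<xi>"
  shows "L1_norm \<eta> (\<lambda>y. \<phi> y - \<xi> y) \<le> L1_norm \<eta> (\<lambda>y. \<phi> y - \<psi> y) + L1_norm \<eta> (\<lambda>y. \<psi> y - \<xi> y)"
  using L1_norm_triangle[of \<eta> "\<lambda>y. \<phi> y - \<psi> y" "\<lambda>y. \<psi> y - \<xi> y"] assms by simp

lemma L1_norm_sum_le:
  assumes "\<And>i. i \<in> I \<Longrightarrow> integrable \<eta> (\<phi> i)"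
  shows "L1_norm \<eta> (\<lambda>y. \<Sum>i\<in>I. \<phi> i y) \<le> (\<Sum>i\<in>I. L1_norm \<eta> (\<phi> i))"
  using assms
proof (induction I rule: infinite_finite_induct)
  case (insert x F)
  have "L1_norm \<eta> (\<lambda>y. \<phi> x y + (\<Sum>i\<in>F. \<phi> i y)) \<le> L1_norm \<eta> (\<phi> x) + L1_norm \<eta> (\<lambda>y. \<Sum>i\<in>F. \<phi> i y)"
    using insert by (intro L1_norm_triangle) auto
  then show ?case using insert by simp
qed (auto simp: L1_norm_def)

lemma L1_norm_nonneg_eq_integral:
  "\<phi> \<in> borel_measurable \<eta> \<Longrightarrow> AE y in \<eta>. 0 \<le> \<phi> y \<Longrightarrow> L1_norm \<eta> \<phi> = (LINT y|\<eta>. \<phi> y)"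
  unfolding L1_norm_def by (rule integral_cong_AE) auto

section \<open>Markov operators and their duals\<close>

text \<open>
  Only duality with bounded test functions is assumed. Linearity, monotonicity and contractivity of
  \<open>L\<close> follow almost everywhere by testing with indicators. The conditions on \<open>U\<close> hold almost everywhere
  because \<open>L\<close> determines \<open>U g\<close> only up to null sets; this weak form passes to powers and averages.
\<close>

locale markov_operator = prob_space \<eta> for \<eta> :: "'y measure" +
  fixes L :: "('y \<Rightarrow> real) \<Rightarrow> 'y \<Rightarrow> real" and U :: "('y \<Rightarrow> real) \<Rightarrow> 'y \<Rightarrow> real"
  assumes L_integrable: "integrable \<eta> \<phi> \<Longrightarrow> integrable \<eta> (L \<phi>)"
    and U_bmeas: "g \<in> bmeas \<eta> \<Longrightarrow> U g \<in> bmeas \<eta>"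
    and duality: "integrable \<eta> \<phi> \<Longrightarrow> g \<in> bmeas \<eta> \<Longrightarrow>
        (LINT y|\<eta>. L \<phi> y * g y) = (LINT y|\<eta>. \<phi> y * U g y)"
    and U_indicator_nonneg: "A \<in> sets \<eta> \<Longrightarrow> AE y in \<eta>. 0 \<le> U (indicator A) y"
    and U_one: "AE y in \<eta>. U (\<lambda>_. 1) y = 1"
begin

lemma L_cong_AE:
  assumes "integrable \<eta> \<phi>" "integrable \<eta> \<psi>" "AE y in \<eta>. \<phi> y = \<psi> y"
  shows "AE y in \<eta>. L \<phi> y = L \<psi> y"
proof (rule AE_eq_by_testing)
  fix A assume A: "A \<in> sets \<eta>"
  have [measurable]: "\<phi> \<in> borel_measurable \<eta>" "\<psi> \<in> borel_measurable \<eta>" "U (indicator A) \<in> borel_measurable \<eta>"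
    using assms A U_bmeas bmeas_measurable by blast+
  have "(LINT y|\<eta>. \<phi> y * U (indicator A) y) = (LINT y|\<eta>. \<psi> y * U (indicator A) y)"
    by (rule integral_cong_AE) (use assms(3) in auto)
  then show "(LINT y|\<eta>. L \<phi> y * indicator A y) = (LINT y|\<eta>. L \<psi> y * indicator A y)"
    using A assms by (simp add: duality)
qed (use assms L_integrable in auto)

lemma L_lincomb:
  assumes "integrable \<eta> \<phi>" "integrable \<eta> \<psi>"
  shows "AE y in \<eta>. L (\<lambda>y. a * \<phi> y + b * \<psi> y) y = a * L \<phi> y + b * L \<psi> y"
proof (rule AE_eq_by_testing)
  fix A assume A: "A \<in> sets \<eta>"
  then have iA: "indicator A \<in> bmeas \<eta>" by simp
  have i: "integrable \<eta> (\<lambda>y. \<phi> y * U (indicator A) y)" "integrable \<eta> (\<lambda>y. \<psi> y * U (indicator A) y)"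
    "integrable \<eta> (\<lambda>y. L \<phi> y * indicator A y)" "integrable \<eta> (\<lambda>y. L \<psi> y * indicator A y)"
    using assms A by (auto intro!: integrable_mult_bmeas L_integrable U_bmeas)
  have "(LINT y|\<eta>. L (\<lambda>y. a * \<phi> y + b * \<psi> y) y * indicator A y)
      = (LINT y|\<eta>. (a * \<phi> y + b * \<psi> y) * U (indicator A) y)"
    using assms iA by (intro duality) auto
  also have "\<dots> = (LINT y|\<eta>. a * (\<phi> y * U (indicator A) y) + b * (\<psi> y * U (indicator A) y))"
    by (simp add: algebra_simps)
  also have "\<dots> = a * (LINT y|\<eta>. \<phi> y * U (indicator A) y) + b * (LINT y|\<eta>. \<psi> y * U (indicator A) y)"
    using i by simp
  also have "\<dots> = a * (LINT y|\<eta>. L \<phi> y * indicator A y) + b * (LINT y|\<eta>. L \<psi> y * indicator A y)"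
    using assms iA by (simp add: duality)
  also have "\<dots> = (LINT y|\<eta>. a * (L \<phi> y * indicator A y) + b * (L \<psi> y * indicator A y))"
    using i by simp
  also have "\<dots> = (LINT y|\<eta>. (a * L \<phi> y + b * L \<psi> y) * indicator A y)"
    by (simp add: algebra_simps)
  finally show "(LINT y|\<eta>. L (\<lambda>y. a * \<phi> y + b * \<psi> y) y * indicator A y)
      = (LINT y|\<eta>. (a * L \<phi> y + b * L \<psi> y) * indicator A y)" .
qed (use assms L_integrable in auto)

lemma L_add:
  "integrable \<eta> \<phi> \<Longrightarrow> integrable \<eta> \<psi> \<Longrightarrow> AE y in \<eta>. L (\<lambda>y. \<phi> y + \<psi> y) y = L \<phi> y + L \<psi> y"
  using L_lincomb[of \<phi> \<psi> 1 1] by simp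

lemma L_diff:
  "integrable \<eta> \<phi> \<Longrightarrow> integrable \<eta> \<psi> \<Longrightarrow> AE y in \<eta>. L (\<lambda>y. \<phi> y - \<psi> y) y = L \<phi> y - L \<psi> y"
  using L_lincomb[of \<phi> \<psi> 1 "-1"] by simp

lemma L_scale: "integrable \<eta> \<phi> \<Longrightarrow> AE y in \<eta>. L (\<lambda>y. c * \<phi> y) y = c * L \<phi> y"
  using L_lincomb[of \<phi> \<phi> c 0] by simp

lemma L_zero: "AE y in \<eta>. L (\<lambda>_. 0) y = 0"
  using L_scale[of "\<lambda>_. 0" 0] by simp

lemma L_sum:
  assumes "\<And>i. i \<in> I \<Longrightarrow> integrable \<eta> (\<phi> i)"
  shows "AE y in \<eta>. L (\<lambda>y. \<Sum>i\<in>I. \<phi> i y) y = (\<Sum>i\<in>I. L (\<phi> i) y)"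
  using assms
proof (induction I rule: infinite_finite_induct)
  case (insert x F)
  have "AE y in \<eta>. L (\<lambda>y. \<phi> x y + (\<Sum>i\<in>F. \<phi> i y)) y = L (\<phi> x) y + L (\<lambda>y. \<Sum>i\<in>F. \<phi> i y) y"
    using insert by (intro L_add) auto
  moreover have "AE y in \<eta>. L (\<lambda>y. \<Sum>i\<in>F. \<phi> i y) y = (\<Sum>i\<in>F. L (\<phi> i) y)" using insert by auto
  ultimately show ?case using insert by auto
qed (use L_zero in auto)

lemma L_mono:
  assumes "integrable \<eta> \<phi>" "integrable \<eta> \<psi>" "AE y in \<eta>. \<phi> y \<le> \<psi> y"
  shows "AE y in \<eta>. L \<phi> y \<le> L \<psi> y"
proof (rule AE_le_by_testing)
  fix A assume A: "A \<in> sets \<eta>"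
  have "(LINT y|\<eta>. \<phi> y * U (indicator A) y) \<le> (LINT y|\<eta>. \<psi> y * U (indicator A) y)"
  proof (rule integral_mono_AE)
    show "AE y in \<eta>. \<phi> y * U (indicator A) y \<le> \<psi> y * U (indicator A) y"
      using assms(3) U_indicator_nonneg[OF A] by eventually_elim (simp add: mult_right_mono)
  qed (use A assms in \<open>auto intro!: integrable_mult_bmeas U_bmeas\<close>)
  then show "(LINT y|\<eta>. L \<phi> y * indicator A y) \<le> (LINT y|\<eta>. L \<psi> y * indicator A y)"
    using A assms by (simp add: duality)
qed (use assms L_integrable in auto)

lemma L_nonneg:
  assumes "integrable \<eta> \<phi>" "AE y in \<eta>. 0 \<le> \<phi> y"
  shows "AE y in \<eta>. 0 \<le> L \<phi> y"
  using L_mono[of "\<lambda>_. 0" \<phi>] L_zero assms by auto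

lemma L_abs_le:
  assumes "integrable \<eta> \<phi>"
  shows "AE y in \<eta>. \<bar>L \<phi> y\<bar> \<le> L (\<lambda>y. \<bar>\<phi> y\<bar>) y"
proof -
  have 1: "AE y in \<eta>. L \<phi> y \<le> L (\<lambda>y. \<bar>\<phi> y\<bar>) y"
    using assms by (intro L_mono) auto
  have 2: "AE y in \<eta>. L (\<lambda>y. (-1) * \<phi> y) y \<le> L (\<lambda>y. \<bar>\<phi> y\<bar>) y"
    using assms by (intro L_mono) auto
  show ?thesis using 1 2 L_scale[OF assms, of "-1"] by eventually_elim auto
qed

lemma L_integral:
  assumes "integrable \<eta> \<phi>"
  shows "(LINT y|\<eta>. L \<phi> y) = (LINT y|\<eta>. \<phi> y)"
proof -
  have "(LINT y|\<eta>. L \<phi> y) = (LINT y|\<eta>. \<phi> y * U (\<lambda>_. 1) y)"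
    using duality[OF assms, of "\<lambda>_. 1"] by simp
  also have "\<dots> = (LINT y|\<eta>. \<phi> y)"
    using assms U_one
    by (intro integral_cong_AE) (auto intro!: borel_measurable_times bmeas_measurable[OF U_bmeas[OF bmeas_const]])
  finally show ?thesis .
qed

lemma L_norm_le:
  assumes "integrable \<eta> \<phi>"
  shows "L1_norm \<eta> (L \<phi>) \<le> L1_norm \<eta> \<phi>"
proof -
  have "L1_norm \<eta> (L \<phi>) \<le> (LINT y|\<eta>. L (\<lambda>y. \<bar>\<phi> y\<bar>) y)"
    unfolding L1_norm_def using assms
    by (intro integral_mono_AE L_abs_le) (auto intro!: L_integrable integrable_abs)
  also have "\<dots> = L1_norm \<eta> \<phi>" using assms by (simp add: L_integral L1_norm_def)
  finally show ?thesis .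
qed

lemma L_norm_diff_le:
  assumes "integrable \<eta> \<phi>" "integrable \<eta> \<psi>"
  shows "L1_norm \<eta> (\<lambda>y. L \<phi> y - L \<psi> y) \<le> L1_norm \<eta> (\<lambda>y. \<phi> y - \<psi> y)"
proof -
  have "L1_norm \<eta> (\<lambda>y. L \<phi> y - L \<psi> y) = L1_norm \<eta> (L (\<lambda>y. \<phi> y - \<psi> y))"
    using L_diff[OF assms] assms
    by (intro L1_norm_cong_AE) (auto simp: eq_commute intro!: L_integrable borel_measurable_integrable)
  also have "\<dots> \<le> L1_norm \<eta> (\<lambda>y. \<phi> y - \<psi> y)" using assms by (intro L_norm_le) auto
  finally show ?thesis .
qed

lemma U_mono:
  assumes "g \<in> bmeas \<eta>" "h \<in> bmeas \<eta>" "AE y in \<eta>. g y \<le> h y"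
  shows "AE y in \<eta>. U g y \<le> U h y"
proof (rule AE_le_by_testing)
  fix A assume A: "A \<in> sets \<eta>"
  have i: "integrable \<eta> (indicator A :: _ \<Rightarrow> real)" using A integrable_bmeas by auto
  have "AE y in \<eta>. 0 \<le> L (indicator A) y" using i by (intro L_nonneg) auto
  then have "(LINT y|\<eta>. L (indicator A) y * g y) \<le> (LINT y|\<eta>. L (indicator A) y * h y)"
    using assms i
    by (intro integral_mono_AE integrable_mult_bmeas L_integrable) (auto elim!: eventually_elim2 intro: mult_left_mono)
  then show "(LINT y|\<eta>. U g y * indicator A y) \<le> (LINT y|\<eta>. U h y * indicator A y)"
    using duality[OF i] assms by (simp add: mult.commute)
qed (use assms U_bmeas integrable_bmeas in auto)

lemma U_cong_AE:
  assumes "g \<in> bmeas \<eta>" "h \<in> bmeas \<eta>" "AE y in \<eta>. g y = h y"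
  shows "AE y in \<eta>. U g y = U h y"
proof -
  have "AE y in \<eta>. U g y \<le> U h y" "AE y in \<eta>. U h y \<le> U g y"
    using assms(3) by (intro U_mono assms(1,2); eventually_elim; simp)+
  then show ?thesis by eventually_elim simp
qed

lemma U_indicator_bounds:
  assumes "A \<in> sets \<eta>"
  shows "AE y in \<eta>. 0 \<le> U (indicator A) y \<and> U (indicator A) y \<le> 1"
proof -
  have "AE y in \<eta>. U (indicator A) y \<le> U (\<lambda>_. 1) y"
    using assms by (intro U_mono) (auto simp: indicator_def)
  then show ?thesis using U_indicator_nonneg[OF assms] U_one by eventually_elim auto
qed

text \<open>
  Powers, and likewise Cesaro averages, are again Markov operators, so that every fact of this locale
  can be used for them.
\<close>

lemma markov_operator_iter: "markov_operator \<eta> (L ^^ n) (U ^^ n)"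
proof (induction n)
  case 0
  show ?case by unfold_locales auto
next
  case (Suc n)
  interpret I: markov_operator \<eta> "L ^^ n" "U ^^ n" by fact
  show ?case
  proof unfold_locales
    fix \<phi> g :: "'y \<Rightarrow> real" assume \<phi>: "integrable \<eta> \<phi>" and g: "g \<in> bmeas \<eta>"
    have "(LINT y|\<eta>. (L ^^ Suc n) \<phi> y * g y) = (LINT y|\<eta>. (L ^^ n) \<phi> y * U g y)"
      using \<phi> g I.L_integrable duality by simp
    also have "\<dots> = (LINT y|\<eta>. \<phi> y * (U ^^ n) (U g) y)" using I.duality[OF \<phi> U_bmeas[OF g]] .
    finally show "(LINT y|\<eta>. (L ^^ Suc n) \<phi> y * g y) = (LINT y|\<eta>. \<phi> y * (U ^^ Suc n) g y)"
      by (simp add: funpow_swap1)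
  next
    fix A assume A: "A \<in> sets \<eta>"
    have "AE y in \<eta>. U (\<lambda>_. 0) y \<le> U ((U ^^ n) (indicator A)) y"
      using A I.U_indicator_nonneg by (intro U_mono I.U_bmeas) auto
    moreover have "AE y in \<eta>. 0 \<le> U (\<lambda>_. 0) y"
      using U_indicator_nonneg[of "{}"] by (simp add: indicator_def[abs_def])
    ultimately show "AE y in \<eta>. 0 \<le> (U ^^ Suc n) (indicator A) y" by eventually_elim simp
  next
    have "AE y in \<eta>. U ((U ^^ n) (\<lambda>_. 1 :: real)) y = U (\<lambda>_. 1) y"
      using I.U_one by (intro U_cong_AE I.U_bmeas) auto
    then show "AE y in \<eta>. (U ^^ Suc n) (\<lambda>_. 1) y = 1" using U_one by eventually_elim simp
  qed (auto intro: L_integrable I.L_integrable U_bmeas I.U_bmeas)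
qed

lemma markov_operator_cesaro:
  assumes "0 < n"
  shows "markov_operator \<eta> (cesaro L n) (cesaro U n)"
proof unfold_locales
  fix \<phi> :: "'y \<Rightarrow> real" assume \<phi>: "integrable \<eta> \<phi>"
  have i: "integrable \<eta> ((L ^^ k) \<phi>)" for k
    using markov_operator.L_integrable[OF markov_operator_iter \<phi>] .
  then show "integrable \<eta> (cesaro L n \<phi>)" unfolding cesaro_def by simp
  fix g :: "'y \<Rightarrow> real" assume g: "g \<in> bmeas \<eta>"
  have b: "(U ^^ k) g \<in> bmeas \<eta>" for k
    using markov_operator.U_bmeas[OF markov_operator_iter g] .
  have "(LINT y|\<eta>. cesaro L n \<phi> y * g y) = (LINT y|\<eta>. 1 / real n * (\<Sum>k<n. (L ^^ k) \<phi> y * g y))"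
    by (simp add: cesaro_def sum_distrib_right)
  also have "\<dots> = 1 / real n * (\<Sum>k<n. LINT y|\<eta>. (L ^^ k) \<phi> y * g y)"
    using integrable_mult_bmeas[OF i g] by simp
  also have "\<dots> = 1 / real n * (\<Sum>k<n. LINT y|\<eta>. \<phi> y * (U ^^ k) g y)"
    by (simp only: markov_operator.duality[OF markov_operator_iter \<phi> g])
  also have "\<dots> = (LINT y|\<eta>. 1 / real n * (\<Sum>k<n. \<phi> y * (U ^^ k) g y))"
    using integrable_mult_bmeas[OF \<phi> b] by simp
  also have "\<dots> = (LINT y|\<eta>. \<phi> y * cesaro U n g y)"
    by (simp add: cesaro_def sum_distrib_left mult_ac)
  finally show "(LINT y|\<eta>. cesaro L n \<phi> y * g y) = (LINT y|\<eta>. \<phi> y * cesaro U n g y)" .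
next
  fix g :: "'y \<Rightarrow> real" assume g: "g \<in> bmeas \<eta>"
  have b: "(U ^^ k) g \<in> bmeas \<eta>" for k
    using markov_operator.U_bmeas[OF markov_operator_iter g] .
  show "cesaro U n g \<in> bmeas \<eta>"
    unfolding cesaro_def using b by (intro bmeas_mult bmeas_sum) auto
next
  fix A assume A: "A \<in> sets \<eta>"
  have "AE y in \<eta>. \<forall>k. 0 \<le> (U ^^ k) (indicator A) y"
    unfolding AE_all_countable
    using markov_operator.U_indicator_nonneg[OF markov_operator_iter A] by auto
  then show "AE y in \<eta>. 0 \<le> cesaro U n (indicator A) y"
    by eventually_elim (auto simp: cesaro_def intro!: sum_nonneg divide_nonneg_nonneg)
next
  have "AE y in \<eta>. \<forall>k. (U ^^ k) (\<lambda>_. 1) y = 1"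
    unfolding AE_all_countable using markov_operator.U_one[OF markov_operator_iter] by auto
  then show "AE y in \<eta>. cesaro U n (\<lambda>_. 1) y = 1"
    by eventually_elim (use assms in \<open>simp add: cesaro_def\<close>)
qed

text \<open>The sums telescope: shifting the orbit by \<open>k\<close> exchanges only blocks of length \<open>k\<close> at its two ends.\<close>

lemma iter_cesaro:
  assumes \<phi>: "integrable \<eta> \<phi>" and n: "0 < n"
  shows "cesaro L N ((L ^^ k) \<phi>) y - cesaro L N \<phi> y
       = 1 / real N * (\<Sum>j<k. (L ^^ (N + j)) \<phi> y - (L ^^ j) \<phi> y)"
proof (induction k)
  case (Suc k)
  have *: "(\<Sum>i<N. (L ^^ i) \<psi> y) + (L ^^ N) \<psi> y = \<psi> y + (\<Sum>i<N. (L ^^ i) (L \<psi>) y)" for \<psi>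
    using sum.lessThan_Suc[of "\<lambda>i. (L ^^ i) \<psi> y" N] sum.lessThan_Suc_shift[of "\<lambda>i. (L ^^ i) \<psi> y" N]
    by (simp add: funpow_swap1)
  have "cesaro L N ((L ^^ Suc k) \<phi>) y - cesaro L N ((L ^^ k) \<phi>) y
     = 1 / real N * ((L ^^ (N + k)) \<phi> y - (L ^^ k) \<phi> y)"
  proof -
    have "(\<Sum>i<N. (L ^^ i) ((L ^^ Suc k) \<phi>) y) - (\<Sum>i<N. (L ^^ i) ((L ^^ k) \<phi>) y)
        = (L ^^ (N + k)) \<phi> y - (L ^^ k) \<phi> y"
      using *[of "(L ^^ k) \<phi>"] by (simp add: funpow_add)
    then show ?thesis unfolding cesaro_def by (simp only: right_diff_distrib[symmetric])
  qed
  with Suc show ?case by (simp add: algebra_simps)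
qed simp

end

section \<open>Densities, supports and absorbing sets\<close>

lemma AE_iff_cong:
  assumes "AE x in M. P x \<longleftrightarrow> Q x"
  shows "(AE x in M. P x) \<longleftrightarrow> (AE x in M. Q x)"
proof
  assume "AE x in M. P x"
  then show "AE x in M. Q x" using assms by eventually_elim simp
next
  assume "AE x in M. Q x"
  then show "AE x in M. P x" using assms by eventually_elim simp
qed

lemma measure_density_eq_integral:
  assumes "integrable \<eta> h" "AE y in \<eta>. 0 \<le> h y" "A \<in> sets \<eta>"
  shows "measure (density \<eta> (\<lambda>y. ennreal (h y))) A = (LINT y|\<eta>. h y * indicator A y)"
proof -
  have i: "integrable \<eta> (\<lambda>y. h y * indicator A y)"
    using assms by (auto intro: integrable_mult_bmeas)
  have "emeasure (density \<eta> (\<lambda>y. ennreal (h y))) A = (\<integral>\<^sup>+y. ennreal (h y * indicator A y) \<partial>\<eta>)"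
    using assms by (subst emeasure_density) (auto intro!: nn_integral_cong simp: indicator_def)
  also have "\<dots> = ennreal (LINT y|\<eta>. h y * indicator A y)"
    using i assms(2) by (intro nn_integral_eq_integral) (auto elim: eventually_mono)
  finally show ?thesis
    using assms(2) by (simp add: measure_def integral_nonneg_AE eventually_mono)
qed

lemma densitiesD:
  assumes "h \<in> densities \<eta>"
  shows "integrable \<eta> h" "AE y in \<eta>. 0 \<le> h y" "(LINT y|\<eta>. h y) = 1" "L1_norm \<eta> h = 1"
  using assms by (auto simp: densities_def L1_def L1_norm_nonneg_eq_integral)

lemma densitiesI:
  "integrable \<eta> h \<Longrightarrow> AE y in \<eta>. 0 \<le> h y \<Longrightarrow> (LINT y|\<eta>. h y) = 1 \<Longrightarrow> h \<in> densities \<eta>"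
  by (auto simp: densities_def L1_def L1_norm_nonneg_eq_integral)

lemma supp_sets [measurable]:
  fixes h :: "'y \<Rightarrow> 'b::{zero, second_countable_topology, t2_space}"
  shows "h \<in> borel_measurable \<eta> \<Longrightarrow> supp \<eta> h \<in> sets \<eta>"
  unfolding supp_def by measurable

lemma disjoint_supports_iff_AE:
  fixes h :: "nat \<Rightarrow> 'y \<Rightarrow> 'b::{zero, second_countable_topology, t2_space}"
  assumes "\<And>i. i < r \<Longrightarrow> h i \<in> borel_measurable \<eta>"
  shows "disjoint_supports \<eta> r h \<longleftrightarrow>
     (\<forall>i<r. \<forall>j<r. i \<noteq> j \<longrightarrow> (AE y in \<eta>. h i y = 0 \<or> h j y = 0))"
proof -
  have "emeasure \<eta> (supp \<eta> (h i) \<inter> supp \<eta> (h j)) = 0 \<longleftrightarrow> (AE y in \<eta>. h i y = 0 \<or> h j y = 0)"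
    if "i < r" "j < r" for i j
  proof -
    have "supp \<eta> (h i) \<inter> supp \<eta> (h j) \<in> sets \<eta>" using assms that by auto
    then show ?thesis
      by (subst AE_iff_measurable[of "supp \<eta> (h i) \<inter> supp \<eta> (h j)"]) (auto simp: supp_def)
  qed
  then show ?thesis unfolding disjoint_supports_def by auto
qed

text \<open>
  A monotone sequence below 1 has a limit below 1, which equals 1 almost everywhere iff its integral
  does. Maximality of a support thereby becomes a statement about a sequence of numbers.
\<close>

lemma (in prob_space) tendsto_one_AE_iff_integral:
  fixes u :: "nat \<Rightarrow> 'a \<Rightarrow> real"
  assumes meas: "\<And>n. u n \<in> borel_measurable M"
    and mono: "AE y in M. \<forall>n. u n y \<le> u (Suc n) y"
    and bounds: "AE y in M. \<forall>n. 0 \<le> u n y \<and> u n y \<le> 1"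
  shows "(AE y in M. (\<lambda>n. u n y) \<longlonglongrightarrow> 1) \<longleftrightarrow> (\<lambda>n. LINT y|M. u n y) \<longlonglongrightarrow> 1"
proof
  assume lim: "AE y in M. (\<lambda>n. u n y) \<longlonglongrightarrow> 1"
  have "(\<lambda>n. LINT y|M. u n y) \<longlonglongrightarrow> (LINT y|M. (1::real))"
  proof (rule integral_dominated_convergence)
    show "AE y in M. norm (u n y) \<le> 1" for n
      using bounds by eventually_elim auto
  qed (use meas lim in auto)
  then show "(\<lambda>n. LINT y|M. u n y) \<longlonglongrightarrow> 1" by (simp add: prob_space)
next
  assume lim: "(\<lambda>n. LINT y|M. u n y) \<longlonglongrightarrow> 1"
  note [measurable] = meas
  define g where "g y = lim (\<lambda>n. u n y)" for y
  have g [measurable]: "g \<in> borel_measurable M" unfolding g_def by measurable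
  have conv: "AE y in M. (\<lambda>n. u n y) \<longlonglongrightarrow> g y"
    using mono bounds
  proof eventually_elim
    case (elim y)
    have "convergent (\<lambda>n. u n y)"
      by (rule Bseq_mono_convergent[OF BseqI'[of _ 1]]) (use elim in \<open>auto intro: lift_Suc_mono_le[of "\<lambda>n. u n y"]\<close>)
    then show ?case unfolding g_def by (simp add: convergent_LIMSEQ_iff)
  qed
  have g_le: "AE y in M. 0 \<le> g y \<and> g y \<le> 1"
    using conv bounds
    by eventually_elim (auto intro: LIMSEQ_le_const LIMSEQ_le_const2)
  have "(\<lambda>n. LINT y|M. u n y) \<longlonglongrightarrow> (LINT y|M. g y)"
  proof (rule integral_dominated_convergence[where w = "\<lambda>_. 1"])
    show "AE y in M. norm (u n y) \<le> 1" for n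
      using bounds by eventually_elim auto
  qed (use meas conv in auto)
  then have "(LINT y|M. g y) = 1" using lim LIMSEQ_unique by blast
  then have "AE y in M. g y = 1"
    using g_le by (intro AE_eq_if_le_integral_eq)
      (auto intro: integrable_const_bound[of _ 1] elim: eventually_mono simp: prob_space)
  then show "AE y in M. (\<lambda>n. u n y) \<longlonglongrightarrow> 1" using conv by eventually_elim simp
qed

context markov_operator
begin

text \<open>The dual function that \<open>dual_op\<close> selects and \<open>U g\<close> represent the same functional on \<open>L\<^sup>1(\<eta>)\<close>.\<close>

lemma dual_op_AE:
  assumes g: "g \<in> bmeas \<eta>"
  shows "AE y in \<eta>. dual_op \<eta> L g y = U g y"
proof -
  let ?P = "\<lambda>h. h \<in> Linf \<eta> \<and> (\<forall>\<phi>\<in>L1 \<eta>. (LINT y|\<eta>. L \<phi> y * g y) = (LINT y|\<eta>. \<phi> y * h y))"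
  obtain C where "\<And>y. y \<in> space \<eta> \<Longrightarrow> \<bar>U g y\<bar> \<le> C" using U_bmeas[OF g] by (metis bmeasE)
  then have "?P (U g)"
    using g U_bmeas[OF g] by (auto simp: Linf_def L1_def duality bmeas_measurable intro!: exI[of _ C])
  then have P: "?P (dual_op \<eta> L g)" unfolding dual_op_def by (rule someI[where P = ?P])
  then obtain D where [measurable]: "dual_op \<eta> L g \<in> borel_measurable \<eta>" and D: "AE y in \<eta>. \<bar>dual_op \<eta> L g y\<bar> \<le> D"
    by (auto simp: Linf_def)
  show ?thesis
  proof (rule AE_eq_by_testing)
    show "integrable \<eta> (dual_op \<eta> L g)"
      using D by (intro integrable_const_bound[of _ D]) auto
    show "integrable \<eta> (U g)" using g U_bmeas integrable_bmeas by auto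
    fix A assume A: "A \<in> sets \<eta>"
    then have iA: "integrable \<eta> (indicator A :: _ \<Rightarrow> real)" using integrable_bmeas by auto
    have "(LINT y|\<eta>. indicator A y * dual_op \<eta> L g y) = (LINT y|\<eta>. indicator A y * U g y)"
      using P iA duality[OF iA g] by (auto simp: L1_def)
    then show "(LINT y|\<eta>. dual_op \<eta> L g y * indicator A y) = (LINT y|\<eta>. U g y * indicator A y)"
      by (simp add: mult.commute)
  qed
qed

text \<open>These are the sets that no mass leaves; ergodicity of a density quantifies over them.\<close>

definition absorbing :: "'y set \<Rightarrow> bool" where
  "absorbing A \<longleftrightarrow> A \<in> sets \<eta> \<and> (AE y in \<eta>. indicator A y \<le> U (indicator A) y)"

lemma invariant_densityD:
  assumes "invariant_density \<eta> L h"
  shows "integrable \<eta> h" "AE y in \<eta>. 0 \<le> h y" "(LINT y|\<eta>. h y) = 1" "AE y in \<eta>. L h y = h y"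
  using assms densitiesD[of h \<eta>] unfolding invariant_density_def by blast+

lemma ergodic_density_iff:
  "ergodic_density \<eta> L h \<longleftrightarrow> invariant_density \<eta> L h \<and>
     (\<forall>A. absorbing A \<longrightarrow> (LINT y|\<eta>. h y * indicator A y) \<in> {0, 1})"
proof (cases "invariant_density \<eta> L h")
  case True
  note h = invariant_densityD[OF True]
  have dual: "(AE y in \<eta>. dual_op \<eta> L (indicator A) y \<ge> indicator A y) \<longleftrightarrow>
      (AE y in \<eta>. U (indicator A) y \<ge> indicator A y)" if "A \<in> sets \<eta>" for A
  proof -
    have "AE y in \<eta>. dual_op \<eta> L (indicator A) y = U (indicator A) y"
      using that by (intro dual_op_AE) auto
    then show ?thesis by (intro AE_iff_cong) (auto elim: eventually_mono)
  qed
  show ?thesis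
    unfolding ergodic_density_def absorbing_def
    using True measure_density_eq_integral[OF h(1,2)] dual by (metis (no_types, lifting))
qed (simp add: ergodic_density_def)

text \<open>
  All the mass of \<open>w\<close> lies in its support, and so does that of \<open>L w = w\<close>; hence \<open>L\<close> sends none of it
  outside.
\<close>

lemma supp_absorbing:
  assumes w: "integrable \<eta> w" "AE y in \<eta>. 0 \<le> w y" "AE y in \<eta>. L w y = w y"
  shows "absorbing (supp \<eta> w)"
proof -
  let ?A = "supp \<eta> w"
  have A [measurable]: "?A \<in> sets \<eta>" using w by auto
  have iA: "indicator ?A \<in> bmeas \<eta>" by simp
  have i: "integrable \<eta> (\<lambda>y. w y * U (indicator ?A) y)"
    using w iA by (intro integrable_mult_bmeas U_bmeas)
  have "(LINT y|\<eta>. w y * U (indicator ?A) y) = (LINT y|\<eta>. L w y * indicator ?A y)"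
    using duality[OF w(1) iA] by simp
  also have "\<dots> = (LINT y|\<eta>. w y)"
  proof (rule integral_cong_AE)
    show "AE y in \<eta>. L w y * indicator ?A y = w y"
      using w(3) AE_space by eventually_elim (auto simp: supp_def indicator_def)
  qed (use w L_integrable in auto)
  finally have "AE y in \<eta>. w y * U (indicator ?A) y = w y"
    using i w U_indicator_bounds[OF A]
    by (intro AE_eq_if_le_integral_eq) (auto elim: eventually_elim2 intro: mult_left_le)
  then have "AE y in \<eta>. indicator ?A y \<le> U (indicator ?A) y"
    using U_indicator_bounds[OF A] by eventually_elim (auto simp: supp_def indicator_def)
  then show ?thesis unfolding absorbing_def using A by simp
qed

text \<open>
  \<open>L (h 1\<^sub>A)\<close> is carried by \<open>A\<close> and lies below \<open>L h = h\<close>, hence below \<open>h 1\<^sub>A\<close>; as the integrals agree, the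
  two functions are equal.
\<close>

lemma absorbing_restrict:
  assumes A: "absorbing A" and h: "integrable \<eta> h" "AE y in \<eta>. 0 \<le> h y" "AE y in \<eta>. L h y = h y"
  shows "AE y in \<eta>. L (\<lambda>y. h y * indicator A y) y = h y * indicator A y"
proof -
  define v where "v = (\<lambda>y. h y * indicator A y)"
  have As [measurable]: "A \<in> sets \<eta>" and Aa: "AE y in \<eta>. indicator A y \<le> U (indicator A) y"
    using A unfolding absorbing_def by auto
  have iA: "indicator A \<in> bmeas \<eta>" by simp
  have v: "integrable \<eta> v" "AE y in \<eta>. 0 \<le> v y" "AE y in \<eta>. v y \<le> h y"
    using integrable_real_mult_indicator[OF As h(1)] h(2) unfolding v_def
    by (auto elim: eventually_mono simp: indicator_def)
  have iLv: "integrable \<eta> (L v)" using v by (simp add: L_integrable)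
  have Lv0: "AE y in \<eta>. 0 \<le> L v y" using v by (intro L_nonneg)
  have Lvh: "AE y in \<eta>. L v y \<le> h y" using L_mono[OF v(1) h(1) v(3)] h(3) by eventually_elim simp
  \<comment> \<open>No mass of \<open>v\<close> leaves \<open>A\<close>.\<close>
  have "(LINT y|\<eta>. L v y) = (LINT y|\<eta>. v y * indicator A y)"
    unfolding L_integral[OF v(1)] by (simp add: v_def mult.assoc flip: indicator_inter_arith)
  also have "\<dots> \<le> (LINT y|\<eta>. v y * U (indicator A) y)"
    using v(2) Aa by (intro integral_mono_AE integrable_mult_bmeas U_bmeas v iA)
      (auto elim: eventually_elim2 intro: mult_left_mono)
  also have "\<dots> = (LINT y|\<eta>. L v y * indicator A y)" using duality[OF v(1) iA] by simp
  finally have "AE y in \<eta>. L v y * indicator A y = L v y"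
    using Lv0 by (intro AE_eq_if_le_integral_eq integrable_mult_bmeas iLv iA)
      (auto elim: eventually_mono simp: indicator_def)
  then have "AE y in \<eta>. L v y \<le> v y"
    using Lvh by eventually_elim (auto simp: v_def indicator_def split: if_splits)
  then have "AE y in \<eta>. L v y = v y"
    using iLv v by (intro AE_eq_if_le_integral_eq) (auto simp: L_integral)
  then show ?thesis unfolding v_def .
qed

lemma absorbing_restrict_complement:
  assumes A: "absorbing A" and h: "integrable \<eta> h" "AE y in \<eta>. 0 \<le> h y" "AE y in \<eta>. L h y = h y"
  shows "AE y in \<eta>. L (\<lambda>y. h y * indicator (space \<eta> - A) y) y = h y * indicator (space \<eta> - A) y"
proof -
  have As [measurable]: "A \<in> sets \<eta>" using A unfolding absorbing_def by auto
  have i: "integrable \<eta> (\<lambda>y. h y * indicator A y)" "integrable \<eta> (\<lambda>y. h y * indicator (space \<eta> - A) y)"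
    using h by (auto intro!: integrable_mult_bmeas)
  have eq: "AE y in \<eta>. h y * indicator (space \<eta> - A) y = h y - h y * indicator A y"
    using AE_space by eventually_elim (auto simp: indicator_def)
  have "AE y in \<eta>. L (\<lambda>y. h y * indicator (space \<eta> - A) y) y = L (\<lambda>y. h y - h y * indicator A y) y"
    using i h eq by (intro L_cong_AE) auto
  then show ?thesis
    using L_diff[OF h(1) i(1)] absorbing_restrict[OF A h] h(3) eq by eventually_elim simp
qed

text \<open>\<open>L \<psi>\<^sup>+\<close> lies above both \<open>L \<psi> = \<psi>\<close> and 0, hence above \<open>\<psi>\<^sup>+\<close>, and the integrals agree.\<close>

lemma invariant_pos_part:
  assumes \<psi>: "integrable \<eta> \<psi>" "AE y in \<eta>. L \<psi> y = \<psi> y"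
  shows "AE y in \<eta>. L (\<lambda>y. max 0 (\<psi> y)) y = max 0 (\<psi> y)"
proof -
  have i: "integrable \<eta> (\<lambda>y. max 0 (\<psi> y))" using \<psi> by auto
  have "AE y in \<eta>. L \<psi> y \<le> L (\<lambda>y. max 0 (\<psi> y)) y" using \<psi> i by (intro L_mono) auto
  moreover have "AE y in \<eta>. 0 \<le> L (\<lambda>y. max 0 (\<psi> y)) y" using i by (intro L_nonneg) auto
  ultimately have "AE y in \<eta>. max 0 (\<psi> y) \<le> L (\<lambda>y. max 0 (\<psi> y)) y"
    using \<psi>(2) by eventually_elim auto
  then have "AE y in \<eta>. max 0 (\<psi> y) = L (\<lambda>y. max 0 (\<psi> y)) y"
    using i by (intro AE_eq_if_le_integral_eq L_integrable) (auto simp: L_integral)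
  then show ?thesis by eventually_elim simp
qed

lemma iter_U_indicator:
  assumes "A \<in> sets \<eta>"
  shows "(U ^^ n) (indicator A) \<in> bmeas \<eta>"
    and "AE y in \<eta>. \<forall>n. 0 \<le> (U ^^ n) (indicator A) y \<and> (U ^^ n) (indicator A) y \<le> 1"
  using markov_operator.U_indicator_bounds[OF markov_operator_iter assms]
  by (auto intro!: markov_operator.U_bmeas[OF markov_operator_iter] assms simp: AE_all_countable)

lemma absorbing_iter_mono:
  assumes "absorbing A"
  shows "AE y in \<eta>. \<forall>n. (U ^^ n) (indicator A) y \<le> (U ^^ Suc n) (indicator A) y"
  unfolding AE_all_countable
proof
  fix n
  have A: "A \<in> sets \<eta>" and Aa: "AE y in \<eta>. indicator A y \<le> U (indicator A) y"
    using assms unfolding absorbing_def by auto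
  have "AE y in \<eta>. (U ^^ n) (indicator A) y \<le> (U ^^ n) (U (indicator A)) y"
    using A Aa by (intro markov_operator.U_mono[OF markov_operator_iter] U_bmeas) auto
  then show "AE y in \<eta>. (U ^^ n) (indicator A) y \<le> (U ^^ Suc n) (indicator A) y"
    by (simp add: funpow_swap1)
qed

text \<open>For an absorbing set the functions \<open>U\<^sup>n 1\<^sub>A\<close> increase with \<open>n\<close>, so only their integrals matter.\<close>

lemma absorbing_limit_iff:
  assumes A: "absorbing A"
  shows "(AE y in \<eta>. (\<lambda>n. dual_op \<eta> (L ^^ n) (indicator A) y) \<longlonglongrightarrow> 1) \<longleftrightarrow>
         (\<lambda>n. LINT y|\<eta>. (U ^^ n) (indicator A) y) \<longlonglongrightarrow> 1"
proof -
  have As: "A \<in> sets \<eta>" using A unfolding absorbing_def by auto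
  have "AE y in \<eta>. \<forall>n. dual_op \<eta> (L ^^ n) (indicator A) y = (U ^^ n) (indicator A) y"
    unfolding AE_all_countable
    using As markov_operator.dual_op_AE[OF markov_operator_iter] by auto
  then have "(AE y in \<eta>. (\<lambda>n. dual_op \<eta> (L ^^ n) (indicator A) y) \<longlonglongrightarrow> 1) \<longleftrightarrow>
      (AE y in \<eta>. (\<lambda>n. (U ^^ n) (indicator A) y) \<longlonglongrightarrow> 1)"
    by (intro AE_iff_cong) (auto elim: eventually_mono)
  also have "\<dots> \<longleftrightarrow> (\<lambda>n. LINT y|\<eta>. (U ^^ n) (indicator A) y) \<longlonglongrightarrow> 1"
    using iter_U_indicator[OF As] absorbing_iter_mono[OF A]
    by (intro tendsto_one_AE_iff_integral) (auto intro: bmeas_measurable)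
  finally show ?thesis .
qed

end

section \<open>Compactness and convergence in \<open>L\<^sup>1\<close>\<close>

lemma L1_iff [simp]: "\<phi> \<in> L1 \<eta> \<longleftrightarrow> integrable \<eta> \<phi>"
  by (simp add: L1_def)

lemma topspace_L1_topology [simp]: "topspace (L1_topology \<eta>) = L1 \<eta>"
proof
  show "topspace (L1_topology \<eta>) \<subseteq> L1 \<eta>" by (auto simp: topspace_def openin_L1_topology)
  have "openin (L1_topology \<eta>) (L1 \<eta>)" by (auto simp: openin_L1_topology intro: exI[of _ 1])
  then show "L1 \<eta> \<subseteq> topspace (L1_topology \<eta>)" by (rule openin_subset)
qed

lemma openin_L1_ball:
  assumes "integrable \<eta> \<phi>"
  shows "openin (L1_topology \<eta>) {\<psi> \<in> L1 \<eta>. L1_norm \<eta> (\<lambda>y. \<psi> y - \<phi> y) < e}"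
  unfolding openin_L1_topology
proof (intro conjI ballI)
  fix \<psi> assume "\<psi> \<in> {\<psi> \<in> L1 \<eta>. L1_norm \<eta> (\<lambda>y. \<psi> y - \<phi> y) < e}"
  then have \<psi>: "integrable \<eta> \<psi>" "L1_norm \<eta> (\<lambda>y. \<psi> y - \<phi> y) < e" by auto
  show "\<exists>d>0. \<forall>\<xi>\<in>L1 \<eta>. L1_norm \<eta> (\<lambda>y. \<xi> y - \<psi> y) < d \<longrightarrow>
      \<xi> \<in> {\<psi> \<in> L1 \<eta>. L1_norm \<eta> (\<lambda>y. \<psi> y - \<phi> y) < e}"
  proof (intro exI[of _ "e - L1_norm \<eta> (\<lambda>y. \<psi> y - \<phi> y)"] conjI ballI impI)
    fix \<xi> assume "\<xi> \<in> L1 \<eta>" "L1_norm \<eta> (\<lambda>y. \<xi> y - \<psi> y) < e - L1_norm \<eta> (\<lambda>y. \<psi> y - \<phi> y)"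
    then show "\<xi> \<in> {\<psi> \<in> L1 \<eta>. L1_norm \<eta> (\<lambda>y. \<psi> y - \<phi> y) < e}"
      using L1_dist_triangle[of \<eta> \<xi> \<psi> \<phi>] assms \<psi> by auto
  qed (use \<psi> in simp)
qed auto

text \<open>The radius may depend on the centre, as it does for balls that a given sequence eventually avoids.\<close>

lemma compactin_L1_finite_net:
  assumes K: "compactin (L1_topology \<eta>) K" and e: "\<And>\<psi>. \<psi> \<in> K \<Longrightarrow> 0 < e \<psi>"
  obtains T where "finite T" "T \<subseteq> K" "\<And>\<phi>. \<phi> \<in> K \<Longrightarrow> \<exists>\<psi>\<in>T. L1_norm \<eta> (\<lambda>y. \<phi> y - \<psi> y) < e \<psi>"
proof -
  have KL: "K \<subseteq> L1 \<eta>" using compactin_subset_topspace[OF K] by simp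
  define B where "B \<psi> = {\<phi> \<in> L1 \<eta>. L1_norm \<eta> (\<lambda>y. \<phi> y - \<psi> y) < e \<psi>}" for \<psi>
  have "\<exists>\<F>. finite \<F> \<and> \<F> \<subseteq> B ` K \<and> K \<subseteq> \<Union>\<F>"
    using K unfolding compactin_def
  proof (elim conjE allE[of _ "B ` K"] mp)
    have "\<psi> \<in> B \<psi>" if "\<psi> \<in> K" for \<psi>
      using that KL e[OF that] by (auto simp: B_def L1_norm_def)
    moreover have "openin (L1_topology \<eta>) (B \<psi>)" if "\<psi> \<in> K" for \<psi>
      unfolding B_def by (rule openin_L1_ball) (use KL that in auto)
    ultimately show "Ball (B ` K) (openin (L1_topology \<eta>)) \<and> K \<subseteq> \<Union> (B ` K)" by auto
  qed
  then obtain T where "finite T" "T \<subseteq> K" "K \<subseteq> \<Union> (B ` T)"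
    by (metis finite_subset_image)
  then show ?thesis by (intro that[of T]) (auto simp: B_def)
qed

text \<open>
  If no point of \<open>K\<close> were a cluster point, each would have a ball that the sequence eventually avoids.
  Finitely many of the balls of half the radius cover \<open>K\<close>, and the sequence would eventually stay away
  from a neighbourhood of \<open>K\<close>.
\<close>

lemma compactin_L1_cluster_point:
  assumes K: "compactin (L1_topology \<eta>) K" "K \<noteq> {}"
    and x: "\<And>n. integrable \<eta> (x n)"
    and lim: "(\<lambda>n. INF \<psi>\<in>K. L1_norm \<eta> (\<lambda>y. x n y - \<psi> y)) \<longlonglongrightarrow> 0"
  obtains \<psi> where "\<psi> \<in> K" "\<And>e N. 0 < e \<Longrightarrow> \<exists>n\<ge>N. L1_norm \<eta> (\<lambda>y. x n y - \<psi> y) < e"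
proof -
  have KL: "K \<subseteq> L1 \<eta>" using compactin_subset_topspace[OF K(1)] by simp
  have "\<exists>\<psi>\<in>K. \<forall>e>0. \<forall>N. \<exists>n\<ge>N. L1_norm \<eta> (\<lambda>y. x n y - \<psi> y) < e"
  proof (rule ccontr)
    assume "\<not> ?thesis"
    then have "\<forall>\<psi>\<in>K. \<exists>e N. 0 < e \<and> (\<forall>n\<ge>N. e \<le> L1_norm \<eta> (\<lambda>y. x n y - \<psi> y))"
      by (meson not_less)
    then obtain e N where e: "\<And>\<psi>. \<psi> \<in> K \<Longrightarrow> 0 < e \<psi>"
      and N: "\<And>\<psi> n. \<psi> \<in> K \<Longrightarrow> N \<psi> \<le> n \<Longrightarrow> e \<psi> \<le> L1_norm \<eta> (\<lambda>y. x n y - \<psi> y)"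
      by metis
    obtain T where T: "finite T" "T \<subseteq> K"
      and net: "\<And>\<phi>. \<phi> \<in> K \<Longrightarrow> \<exists>\<psi>\<in>T. L1_norm \<eta> (\<lambda>y. \<phi> y - \<psi> y) < e \<psi> / 2"
      using compactin_L1_finite_net[OF K(1), of "\<lambda>\<psi>. e \<psi> / 2"] e by auto
    have "T \<noteq> {}" using net K(2) by fastforce
    define d where "d = Min (e ` T) / 2"
    have d: "0 < d" unfolding d_def using T e \<open>T \<noteq> {}\<close> by auto
    have "eventually (\<lambda>n. (INF \<psi>\<in>K. L1_norm \<eta> (\<lambda>y. x n y - \<psi> y)) < d) sequentially"
      using order_tendstoD(2)[OF lim d] .
    moreover have "eventually (\<lambda>n. Max (N ` T) \<le> n) sequentially" by (rule eventually_ge_at_top)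
    ultimately have "eventually (\<lambda>n. (INF \<psi>\<in>K. L1_norm \<eta> (\<lambda>y. x n y - \<psi> y)) < d \<and> Max (N ` T) \<le> n) sequentially"
      by eventually_elim simp
    then obtain n where n: "(INF \<psi>\<in>K. L1_norm \<eta> (\<lambda>y. x n y - \<psi> y)) < d" "Max (N ` T) \<le> n"
      using eventually_happens[of _ sequentially] by auto
    have bdd: "bdd_below ((\<lambda>\<psi>. L1_norm \<eta> (\<lambda>y. x n y - \<psi> y)) ` K)"
      by (rule bdd_belowI2[of _ 0]) simp
    from n(1) obtain \<phi> where \<phi>: "\<phi> \<in> K" "L1_norm \<eta> (\<lambda>y. x n y - \<phi> y) < d"
      using cINF_less_iff[OF K(2) bdd] by auto
    obtain \<psi> where \<psi>: "\<psi> \<in> T" "L1_norm \<eta> (\<lambda>y. \<phi> y - \<psi> y) < e \<psi> / 2" using net[OF \<phi>(1)] by auto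
    have "d \<le> e \<psi> / 2" unfolding d_def using T \<psi> by simp
    moreover have "L1_norm \<eta> (\<lambda>y. x n y - \<psi> y) \<le> L1_norm \<eta> (\<lambda>y. x n y - \<phi> y) + L1_norm \<eta> (\<lambda>y. \<phi> y - \<psi> y)"
      using x KL \<phi> \<psi> T by (intro L1_dist_triangle) auto
    moreover have "e \<psi> \<le> L1_norm \<eta> (\<lambda>y. x n y - \<psi> y)"
    proof (rule N)
      have "N \<psi> \<le> Max (N ` T)" using T \<psi> by simp
      then show "N \<psi> \<le> n" using n by simp
    qed (use T \<psi> in auto)
    ultimately show False using \<phi> \<psi> by linarith
  qed
  then show ?thesis using that by blast
qed

lemma L1_limit_integral:
  assumes x: "\<And>n. integrable \<eta> (x n)" and \<psi>: "integrable \<eta> \<psi>" and g: "g \<in> bmeas \<eta>"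
    and lim: "(\<lambda>n. L1_norm \<eta> (\<lambda>y. x n y - \<psi> y)) \<longlonglongrightarrow> 0"
  shows "(\<lambda>n. LINT y|\<eta>. x n y * g y) \<longlonglongrightarrow> (LINT y|\<eta>. \<psi> y * g y)"
proof -
  obtain C where C: "0 \<le> C" "\<And>y. y \<in> space \<eta> \<Longrightarrow> \<bar>g y\<bar> \<le> C" using g by (metis bmeasE)
  have i: "integrable \<eta> (\<lambda>y. x n y * g y)" "integrable \<eta> (\<lambda>y. \<psi> y * g y)" for n
    using x \<psi> g by (auto intro: integrable_mult_bmeas)
  have "\<bar>(LINT y|\<eta>. x n y * g y) - (LINT y|\<eta>. \<psi> y * g y)\<bar> \<le> L1_norm \<eta> (\<lambda>y. x n y - \<psi> y) * C" for n
  proof -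
    have "(LINT y|\<eta>. x n y * g y) - (LINT y|\<eta>. \<psi> y * g y) = (LINT y|\<eta>. (x n y - \<psi> y) * g y)"
      using i by (simp add: left_diff_distrib)
    also have "\<bar>\<dots>\<bar> \<le> (LINT y|\<eta>. \<bar>(x n y - \<psi> y) * g y\<bar>)" by (rule integral_abs_bound)
    also have "\<dots> \<le> (LINT y|\<eta>. \<bar>x n y - \<psi> y\<bar> * C)"
      using x \<psi> g C by (intro integral_mono integrable_abs integrable_mult_bmeas integrable_mult_left)
        (auto simp: abs_mult intro: mult_left_mono)
    finally show ?thesis unfolding L1_norm_def by simp
  qed
  then have "(\<lambda>n. (LINT y|\<eta>. x n y * g y) - (LINT y|\<eta>. \<psi> y * g y)) \<longlonglongrightarrow> 0"
    by (intro Lim_null_comparison[OF always_eventually tendsto_mult_left_zero[OF lim]]) auto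
  then show ?thesis by (simp add: Lim_null[symmetric])
qed

lemma L1_limit_nonneg:
  assumes x: "\<And>n. integrable \<eta> (x n)" "\<And>n. AE y in \<eta>. 0 \<le> x n y" and \<psi>: "integrable \<eta> \<psi>"
    and lim: "(\<lambda>n. L1_norm \<eta> (\<lambda>y. x n y - \<psi> y)) \<longlonglongrightarrow> 0"
  shows "AE y in \<eta>. 0 \<le> \<psi> y"
proof (rule AE_le_by_testing)
  fix A assume "A \<in> sets \<eta>"
  then have "(\<lambda>n. LINT y|\<eta>. x n y * indicator A y) \<longlonglongrightarrow> (LINT y|\<eta>. \<psi> y * indicator A y)"
    by (intro L1_limit_integral x \<psi> lim) auto
  moreover have "0 \<le> (LINT y|\<eta>. x n y * indicator A y)" for n
    using x(2)[of n] by (intro integral_nonneg_AE) (auto elim: eventually_mono)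
  ultimately have "0 \<le> (LINT y|\<eta>. \<psi> y * indicator A y)"
    by (intro LIMSEQ_le_const) auto
  then show "(LINT y|\<eta>. 0 * indicator A y) \<le> (LINT y|\<eta>. \<psi> y * indicator A y)" by simp
qed (use \<psi> in auto)

section \<open>Averages along an orbit\<close>

context markov_operator
begin

lemma iter_integrable: "integrable \<eta> \<phi> \<Longrightarrow> integrable \<eta> ((L ^^ k) \<phi>)"
  using markov_operator.L_integrable[OF markov_operator_iter] .

lemma iter_norm_le: "integrable \<eta> \<phi> \<Longrightarrow> L1_norm \<eta> ((L ^^ k) \<phi>) \<le> L1_norm \<eta> \<phi>"
  using markov_operator.L_norm_le[OF markov_operator_iter] .

lemma cesaro_integrable: "integrable \<eta> \<phi> \<Longrightarrow> integrable \<eta> (cesaro L n \<phi>)"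
  unfolding cesaro_def by (intro integrable_mult_right Bochner_Integration.integrable_sum iter_integrable)

lemma iter_invariant:
  assumes "integrable \<eta> h" "AE y in \<eta>. L h y = h y"
  shows "AE y in \<eta>. (L ^^ k) h y = h y"
proof (induction k)
  case (Suc k)
  have "AE y in \<eta>. L ((L ^^ k) h) y = L h y"
    using assms Suc by (intro L_cong_AE iter_integrable)
  then show ?case using assms(2) by eventually_elim simp
qed simp

lemma cesaro_invariant:
  assumes "integrable \<eta> h" "AE y in \<eta>. L h y = h y" "0 < n"
  shows "AE y in \<eta>. cesaro L n h y = h y"
proof -
  have "AE y in \<eta>. \<forall>k. (L ^^ k) h y = h y"
    unfolding AE_all_countable using iter_invariant assms by auto
  then show ?thesis by eventually_elim (use assms(3) in \<open>simp add: cesaro_def\<close>)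
qed

lemma cesaro_cesaro:
  assumes \<phi>: "integrable \<eta> \<phi>" and n: "0 < n" and N: "0 < N"
  shows "AE y in \<eta>. cesaro L N (cesaro L n \<phi>) y - cesaro L N \<phi> y
     = 1 / real n * (\<Sum>k<n. cesaro L N ((L ^^ k) \<phi>) y - cesaro L N \<phi> y)"
proof -
  interpret C: markov_operator \<eta> "cesaro L N" "cesaro U N" using N by (rule markov_operator_cesaro)
  have "AE y in \<eta>. cesaro L N (\<lambda>y. 1 / real n * (\<Sum>k<n. (L ^^ k) \<phi> y)) y
      = 1 / real n * cesaro L N (\<lambda>y. \<Sum>k<n. (L ^^ k) \<phi> y) y"
    using \<phi> by (intro C.L_scale) (auto intro: iter_integrable)
  moreover have "AE y in \<eta>. cesaro L N (\<lambda>y. \<Sum>k<n. (L ^^ k) \<phi> y) y = (\<Sum>k<n. cesaro L N ((L ^^ k) \<phi>) y)"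
    using \<phi> by (intro C.L_sum iter_integrable)
  ultimately show ?thesis
  proof eventually_elim
    case (elim y)
    have "cesaro L N (cesaro L n \<phi>) y = 1 / real n * (\<Sum>k<n. cesaro L N ((L ^^ k) \<phi>) y)"
      unfolding cesaro_def[of L n] using elim by simp
    moreover have "cesaro L N \<phi> y = 1 / real n * (\<Sum>k<n. cesaro L N \<phi> y)" using n by simp
    ultimately show ?case by (simp only: sum_subtractf right_diff_distrib)
  qed
qed

lemma cesaro_shift_norm:
  assumes \<phi>: "integrable \<eta> \<phi>" and N: "0 < N"
  shows "L1_norm \<eta> (\<lambda>y. cesaro L N ((L ^^ k) \<phi>) y - cesaro L N \<phi> y) \<le> 2 * real k * L1_norm \<eta> \<phi> / real N"
proof -
  let ?d = "\<lambda>j y. (L ^^ (N + j)) \<phi> y - (L ^^ j) \<phi> y"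
  have i: "integrable \<eta> (?d j)" for j using \<phi> by (auto intro!: iter_integrable)
  have d: "L1_norm \<eta> (?d j) \<le> 2 * L1_norm \<eta> \<phi>" for j
    using L1_dist_triangle[of \<eta> "(L ^^ (N + j)) \<phi>" "\<lambda>_. 0" "(L ^^ j) \<phi>"] L1_norm_minus_commute[of \<eta> "\<lambda>_. 0" "(L ^^ j) \<phi>"]
      iter_norm_le[OF \<phi>, of "N + j"] iter_norm_le[OF \<phi>, of j] \<phi> by (simp add: iter_integrable)
  have "L1_norm \<eta> (\<lambda>y. cesaro L N ((L ^^ k) \<phi>) y - cesaro L N \<phi> y)
      = 1 / real N * L1_norm \<eta> (\<lambda>y. \<Sum>j<k. ?d j y)"
    unfolding iter_cesaro[OF \<phi> N] L1_norm_scale by simp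
  also have "\<dots> \<le> 1 / real N * (\<Sum>j<k. L1_norm \<eta> (?d j))" using i by (intro mult_left_mono L1_norm_sum_le) auto
  also have "\<dots> \<le> 1 / real N * (\<Sum>j<k. 2 * L1_norm \<eta> \<phi>)" using d by (intro mult_left_mono sum_mono) auto
  also have "\<dots> = 2 * real k * L1_norm \<eta> \<phi> / real N" by simp
  finally show ?thesis .
qed

lemma cesaro_shift_limit:
  assumes \<phi>: "integrable \<eta> \<phi>"
  shows "(\<lambda>N. L1_norm \<eta> (\<lambda>y. cesaro L N ((L ^^ k) \<phi>) y - cesaro L N \<phi> y)) \<longlonglongrightarrow> 0"
proof (rule Lim_null_comparison)
  show "eventually (\<lambda>N. norm (L1_norm \<eta> (\<lambda>y. cesaro L N ((L ^^ k) \<phi>) y - cesaro L N \<phi> y))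
      \<le> 2 * real k * L1_norm \<eta> \<phi> / real N) sequentially"
    using eventually_gt_at_top[of 0] by eventually_elim (simp add: cesaro_shift_norm[OF assms])
  show "(\<lambda>N. 2 * real k * L1_norm \<eta> \<phi> / real N) \<longlonglongrightarrow> 0"
    by (rule lim_const_over_n)
qed

lemma cesaro_cesaro_limit:
  assumes \<phi>: "integrable \<eta> \<phi>" and n: "0 < n"
  shows "(\<lambda>N. L1_norm \<eta> (\<lambda>y. cesaro L N (cesaro L n \<phi>) y - cesaro L N \<phi> y)) \<longlonglongrightarrow> 0"
proof (rule Lim_null_comparison)
  let ?s = "\<lambda>N k y. cesaro L N ((L ^^ k) \<phi>) y - cesaro L N \<phi> y"
  have i: "integrable \<eta> (?s N k)" for N k
    using \<phi> by (auto intro!: cesaro_integrable iter_integrable)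
  show "eventually (\<lambda>N. norm (L1_norm \<eta> (\<lambda>y. cesaro L N (cesaro L n \<phi>) y - cesaro L N \<phi> y))
      \<le> 1 / real n * (\<Sum>k<n. L1_norm \<eta> (?s N k))) sequentially"
    using eventually_gt_at_top[of 0]
  proof eventually_elim
    case (elim N)
    have "L1_norm \<eta> (\<lambda>y. cesaro L N (cesaro L n \<phi>) y - cesaro L N \<phi> y)
        = L1_norm \<eta> (\<lambda>y. 1 / real n * (\<Sum>k<n. ?s N k y))"
      using i cesaro_cesaro[OF \<phi> n elim] \<phi>
      by (intro L1_norm_cong_AE borel_measurable_integrable Bochner_Integration.integrable_diff
          integrable_mult_right Bochner_Integration.integrable_sum cesaro_integrable iter_integrable) auto
    also have "\<dots> = 1 / real n * L1_norm \<eta> (\<lambda>y. \<Sum>k<n. ?s N k y)" unfolding L1_norm_scale by simp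
    also have "\<dots> \<le> 1 / real n * (\<Sum>k<n. L1_norm \<eta> (?s N k))"
      using i by (intro mult_left_mono L1_norm_sum_le) auto
    finally show ?case by simp
  qed
  show "(\<lambda>N. 1 / real n * (\<Sum>k<n. L1_norm \<eta> (?s N k))) \<longlonglongrightarrow> 0"
    by (intro tendsto_mult_right_zero tendsto_null_sum cesaro_shift_limit \<phi>)
qed

lemma cesaro_almost_invariant:
  assumes \<phi>: "integrable \<eta> \<phi>" and n: "0 < n"
  shows "L1_norm \<eta> (\<lambda>y. L (cesaro L n \<phi>) y - cesaro L n \<phi> y) \<le> 2 * L1_norm \<eta> \<phi> / real n"
proof -
  have 1: "AE y in \<eta>. L (\<lambda>y. 1 / real n * (\<Sum>k<n. (L ^^ k) \<phi> y)) y = 1 / real n * L (\<lambda>y. \<Sum>k<n. (L ^^ k) \<phi> y) y"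
    using \<phi> by (intro L_scale) (auto intro: iter_integrable)
  have 2: "AE y in \<eta>. L (\<lambda>y. \<Sum>k<n. (L ^^ k) \<phi> y) y = (\<Sum>k<n. L ((L ^^ k) \<phi>) y)"
    using \<phi> by (intro L_sum iter_integrable)
  have "AE y in \<eta>. L (cesaro L n \<phi>) y - cesaro L n \<phi> y = 1 / real n * ((L ^^ n) \<phi> y - \<phi> y)"
    using 1 2
  proof eventually_elim
    case (elim y)
    have "L (cesaro L n \<phi>) y = cesaro L n (L \<phi>) y"
      using elim by (simp add: cesaro_def[abs_def] funpow_swap1)
    then show ?case using iter_cesaro[OF \<phi> n, of n 1 y] by simp
  qed
  then have "L1_norm \<eta> (\<lambda>y. L (cesaro L n \<phi>) y - cesaro L n \<phi> y)
      = L1_norm \<eta> (\<lambda>y. 1 / real n * ((L ^^ n) \<phi> y - \<phi> y))"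
    using \<phi> by (intro L1_norm_cong_AE)
      (auto intro!: borel_measurable_integrable cesaro_integrable L_integrable iter_integrable)
  also have "\<dots> = 1 / real n * L1_norm \<eta> (\<lambda>y. (L ^^ n) \<phi> y - \<phi> y)" unfolding L1_norm_scale by simp
  also have "\<dots> \<le> 1 / real n * (2 * L1_norm \<eta> \<phi>)"
    using L1_dist_triangle[of \<eta> "(L ^^ n) \<phi>" "\<lambda>_. 0" \<phi>] L1_norm_minus_commute[of \<eta> "\<lambda>_. 0" \<phi>]
      iter_norm_le[OF \<phi>, of n] \<phi> by (intro mult_left_mono) (auto simp: iter_integrable)
  finally show ?thesis by simp
qed

text \<open>
  The mean ergodic theorem along one orbit. Averages are almost invariant, so a cluster point \<open>\<psi>\<close> is
  invariant. Once \<open>A\<^sub>n h\<close> is close to \<open>\<psi>\<close>, so is \<open>A\<^sub>N (A\<^sub>n h)\<close> for all \<open>N\<close>, because \<open>A\<^sub>N\<close> contracts and fixes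
  \<open>\<psi>\<close>; and \<open>A\<^sub>N (A\<^sub>n h) - A\<^sub>N h\<close> tends to 0 as \<open>N\<close> grows.
\<close>

lemma cesaro_cluster_point_limit:
  assumes h: "integrable \<eta> h" and \<psi>: "integrable \<eta> \<psi>"
    and cluster: "\<And>e N. 0 < e \<Longrightarrow> \<exists>n\<ge>N. L1_norm \<eta> (\<lambda>y. cesaro L n h y - \<psi> y) < e"
  shows "AE y in \<eta>. L \<psi> y = \<psi> y" and "(\<lambda>n. L1_norm \<eta> (\<lambda>y. cesaro L n h y - \<psi> y)) \<longlonglongrightarrow> 0"
proof -
  let ?d = "\<lambda>u v. L1_norm \<eta> (\<lambda>y. u y - v y)"
  note [simp] = h \<psi> cesaro_integrable L_integrable
  have "?d (L \<psi>) \<psi> \<le> e" if e: "0 < e" for e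
  proof -
    obtain N :: nat where N: "8 * L1_norm \<eta> h / e < real N" using reals_Archimedean2 by blast
    obtain n where n: "Suc N \<le> n" "?d (cesaro L n h) \<psi> < e / 4" using cluster[of "e / 4" "Suc N"] e by auto
    have n0: "0 < n" using n by simp
    have "2 * L1_norm \<eta> h / real n \<le> e / 4"
    proof -
      have "8 * L1_norm \<eta> h / e < real n" using N n by linarith
      then have "8 * L1_norm \<eta> h < real n * e" using e by (simp add: pos_divide_less_eq)
      then show ?thesis using n0 by (simp add: pos_divide_le_eq mult.commute)
    qed
    then have "?d (L (cesaro L n h)) (cesaro L n h) \<le> e / 4"
      using cesaro_almost_invariant[OF h n0] by linarith
    moreover have "?d (L \<psi>) (L (cesaro L n h)) \<le> ?d (cesaro L n h) \<psi>"
      using L_norm_diff_le[of \<psi> "cesaro L n h"] by (simp add: L1_norm_minus_commute[of _ \<psi>])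
    moreover have "?d (L \<psi>) \<psi> \<le> ?d (L \<psi>) (L (cesaro L n h)) + ?d (L (cesaro L n h)) \<psi>"
      by (intro L1_dist_triangle) auto
    moreover have "?d (L (cesaro L n h)) \<psi> \<le> ?d (L (cesaro L n h)) (cesaro L n h) + ?d (cesaro L n h) \<psi>"
      by (intro L1_dist_triangle) auto
    ultimately show ?thesis using n(2) e by linarith
  qed
  then have "?d (L \<psi>) \<psi> \<le> 0" by (intro field_le_epsilon[of _ 0]) simp
  then have "?d (L \<psi>) \<psi> = 0" by (intro antisym L1_norm_nonneg)
  then show inv: "AE y in \<eta>. L \<psi> y = \<psi> y"
    by (subst (asm) L1_norm_eq_0_iff) (auto elim: eventually_mono)
  show "(\<lambda>n. ?d (cesaro L n h) \<psi>) \<longlonglongrightarrow> 0"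
  proof (rule LIMSEQ_I)
    fix e :: real assume e: "0 < e"
    obtain n where n: "1 \<le> n" "?d (cesaro L n h) \<psi> < e / 2" using cluster[of "e / 2" 1] e by auto
    have n0: "0 < n" using n by simp
    have "eventually (\<lambda>N. ?d (cesaro L N (cesaro L n h)) (cesaro L N h) < e / 2) sequentially"
      using order_tendstoD(2)[OF cesaro_cesaro_limit[OF h n0], of "e / 2"] e by simp
    then obtain M where M: "\<And>N. M \<le> N \<Longrightarrow> ?d (cesaro L N (cesaro L n h)) (cesaro L N h) < e / 2"
      by (auto simp: eventually_sequentially)
    show "\<exists>no. \<forall>N\<ge>no. norm (?d (cesaro L N h) \<psi> - 0) < e"
    proof (intro exI[of _ "Suc M"] allI impI)
      fix N assume N: "Suc M \<le> N"
      then have N0: "0 < N" by simp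
      interpret C: markov_operator \<eta> "cesaro L N" "cesaro U N" using N0 by (rule markov_operator_cesaro)
      have "?d (cesaro L N (cesaro L n h)) \<psi> = ?d (cesaro L N (cesaro L n h)) (cesaro L N \<psi>)"
        using cesaro_invariant[OF \<psi> inv N0]
        by (intro L1_norm_cong_AE) (auto intro!: borel_measurable_diff borel_measurable_integrable elim: eventually_mono)
      also have "\<dots> \<le> ?d (cesaro L n h) \<psi>" by (intro C.L_norm_diff_le) auto
      finally have "?d (cesaro L N (cesaro L n h)) \<psi> < e / 2" using n by simp
      moreover have "?d (cesaro L N h) \<psi> \<le> ?d (cesaro L N h) (cesaro L N (cesaro L n h)) + ?d (cesaro L N (cesaro L n h)) \<psi>"
        by (intro L1_dist_triangle) auto
      ultimately show "norm (?d (cesaro L N h) \<psi> - 0) < e"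
        using M[of N] N by (simp add: L1_norm_minus_commute[of _ "cesaro L N h"])
    qed
  qed
qed

end

section \<open>Disjoint families of invariant densities\<close>

context markov_operator
begin

definition invariant_family :: "nat \<Rightarrow> (nat \<Rightarrow> 'y \<Rightarrow> real) \<Rightarrow> bool" where
  "invariant_family r h \<longleftrightarrow> (\<forall>i<r. invariant_density \<eta> L (h i)) \<and> disjoint_supports \<eta> r h"

lemma invariant_family_iff:
  "invariant_family r h \<longleftrightarrow> (\<forall>i<r. invariant_density \<eta> L (h i)) \<and>
     (\<forall>i<r. \<forall>j<r. i \<noteq> j \<longrightarrow> (AE y in \<eta>. h i y = 0 \<or> h j y = 0))"
  unfolding invariant_family_def
  by (rule conj_cong[OF refl disjoint_supports_iff_AE]) (auto dest: invariant_densityD(1))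

lemma normalized_invariant_density:
  assumes "integrable \<eta> w" "AE y in \<eta>. 0 \<le> w y" "AE y in \<eta>. L w y = w y" "0 < (LINT y|\<eta>. w y)"
  shows "invariant_density \<eta> L (\<lambda>y. 1 / (LINT y|\<eta>. w y) * w y)"
  unfolding invariant_density_def
proof
  show "(\<lambda>y. 1 / (LINT y|\<eta>. w y) * w y) \<in> densities \<eta>"
    using assms by (intro densitiesI) (auto elim: eventually_mono)
  show "AE y in \<eta>. L (\<lambda>y. 1 / (LINT y|\<eta>. w y) * w y) y = 1 / (LINT y|\<eta>. w y) * w y"
    using L_scale[OF assms(1), of "1 / (LINT y|\<eta>. w y)"] assms(3) by eventually_elim simp
qed

lemma invariant_family_append:
  assumes "invariant_family r h" "invariant_density \<eta> L u"
    and "\<And>i. i < r \<Longrightarrow> AE y in \<eta>. h i y = 0 \<or> u y = 0"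
  shows "invariant_family (Suc r) (h(r := u))"
proof -
  have "AE y in \<eta>. u y = 0 \<or> h i y = 0" if "i < r" for i
    using assms(3)[OF that] by eventually_elim auto
  then show ?thesis
    using assms unfolding invariant_family_iff by (auto simp: less_Suc_eq)
qed

text \<open>
  An absorbing set that cuts through a member turns it into two invariant densities. Hence the members
  of a family of largest possible size are ergodic.
\<close>

lemma invariant_family_split:
  assumes fam: "invariant_family r h" and i: "i < r" and A: "absorbing A"
    and split: "0 < (LINT y|\<eta>. h i y * indicator A y)" "(LINT y|\<eta>. h i y * indicator A y) < 1"
  shows "\<exists>h'. invariant_family (Suc r) h'"
proof -
  have As [measurable]: "A \<in> sets \<eta>" using A unfolding absorbing_def by simp
  note hi = invariant_densityD[of "h i"]
  have hid: "invariant_density \<eta> L (h i)" using fam i unfolding invariant_family_iff by auto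
  define a where "a = (\<lambda>y. h i y * indicator A y)"
  define b where "b = (\<lambda>y. h i y * indicator (space \<eta> - A) y)"
  have ia: "integrable \<eta> a" and ib: "integrable \<eta> b"
    unfolding a_def b_def using hi(1)[OF hid] by (auto intro!: integrable_real_mult_indicator)
  have "(LINT y|\<eta>. a y) + (LINT y|\<eta>. b y) = (LINT y|\<eta>. a y + b y)" using ia ib by simp
  also have "\<dots> = (LINT y|\<eta>. h i y)"
    by (rule Bochner_Integration.integral_cong) (auto simp: indicator_def a_def b_def)
  finally have "(LINT y|\<eta>. a y) + (LINT y|\<eta>. b y) = (LINT y|\<eta>. h i y)" .
  then have b1: "0 < (LINT y|\<eta>. b y)" using split hi(3)[OF hid] unfolding a_def by linarith
  define a' where "a' = (\<lambda>y. 1 / (LINT y|\<eta>. a y) * a y)"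
  define b' where "b' = (\<lambda>y. 1 / (LINT y|\<eta>. b y) * b y)"
  have a': "invariant_density \<eta> L a'"
    unfolding a'_def using ia split hi[OF hid] absorbing_restrict[OF A] unfolding a_def
    by (intro normalized_invariant_density) (auto elim: eventually_mono)
  have b': "invariant_density \<eta> L b'"
    unfolding b'_def using ib b1 hi[OF hid] absorbing_restrict_complement[OF A] unfolding b_def
    by (intro normalized_invariant_density) (auto elim: eventually_mono)
  have a0: "a' y = 0" and b0: "b' y = 0" if "h i y = 0" for y
    using that by (auto simp: a'_def b'_def a_def b_def)
  have ab: "a' y = 0 \<or> b' y = 0" for y
    by (auto simp: a'_def b'_def a_def b_def indicator_def)
  have "invariant_family r (h(i := a'))"
    unfolding invariant_family_iff
  proof (intro conjI allI impI)
    fix j k assume jk: "j < r" "k < r" "j \<noteq> k"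
    then have "AE y in \<eta>. h j y = 0 \<or> h k y = 0" using fam unfolding invariant_family_iff by auto
    then show "AE y in \<eta>. (h(i := a')) j y = 0 \<or> (h(i := a')) k y = 0"
      by eventually_elim (auto simp: a0)
  qed (use fam a' in \<open>auto simp: invariant_family_iff\<close>)
  moreover have "AE y in \<eta>. (h(i := a')) j y = 0 \<or> b' y = 0" if "j < r" for j
  proof (cases "j = i")
    case False
    then have "AE y in \<eta>. h j y = 0 \<or> h i y = 0" using fam that i unfolding invariant_family_iff by auto
    then show ?thesis by eventually_elim (use False in \<open>auto simp: b0\<close>)
  qed (use ab in auto)
  ultimately show ?thesis using invariant_family_append[OF _ b'] by blast
qed

lemma MC_attractor_limit:
  assumes K: "compactin (L1_topology \<eta>) K" "K \<noteq> {}"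
    and lim: "(\<lambda>n. INF \<psi>\<in>K. L1_norm \<eta> (\<lambda>y. cesaro L n h y - \<psi> y)) \<longlonglongrightarrow> 0"
    and h: "integrable \<eta> h"
  obtains \<psi> where "\<psi> \<in> K" "integrable \<eta> \<psi>" "AE y in \<eta>. L \<psi> y = \<psi> y"
    "(\<lambda>n. L1_norm \<eta> (\<lambda>y. cesaro L n h y - \<psi> y)) \<longlonglongrightarrow> 0"
proof -
  obtain \<psi> where \<psi>: "\<psi> \<in> K" "\<And>e N. 0 < e \<Longrightarrow> \<exists>n\<ge>N. L1_norm \<eta> (\<lambda>y. cesaro L n h y - \<psi> y) < e"
    using compactin_L1_cluster_point[OF K _ lim] cesaro_integrable[OF h] by metis
  have i: "integrable \<eta> \<psi>" using \<psi>(1) compactin_subset_topspace[OF K(1)] by auto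
  show ?thesis
    using that[OF \<psi>(1) i] cesaro_cluster_point_limit[OF h i \<psi>(2)] by blast
qed

lemma invariant_densities_dist:
  assumes u: "invariant_density \<eta> L u" and v: "invariant_density \<eta> L v" and disj: "AE y in \<eta>. u y = 0 \<or> v y = 0"
  shows "L1_norm \<eta> (\<lambda>y. u y - v y) = 2"
proof -
  note u = invariant_densityD[OF u] and v = invariant_densityD[OF v]
  have "L1_norm \<eta> (\<lambda>y. u y - v y) = (LINT y|\<eta>. u y + v y)"
    unfolding L1_norm_def
  proof (rule integral_cong_AE)
    show "AE y in \<eta>. \<bar>u y - v y\<bar> = u y + v y" using disj u(2) v(2) by eventually_elim auto
  qed (use u v in auto)
  also have "\<dots> = 2" using u v by simp
  finally show ?thesis .
qed

text \<open>
  An invariant density is the limit of its own averages and so has distance 0 from \<open>K\<close>. Disjointly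
  supported densities have distance 2, so two of them never share a ball of a net of radius 1.
\<close>

lemma MC_invariant_family_bounded:
  assumes "MC \<eta> L"
  obtains N where "\<And>r h. invariant_family r h \<Longrightarrow> r \<le> N"
proof -
  obtain K where K: "compactin (L1_topology \<eta>) K" "K \<noteq> {}"
    and lim: "\<And>h. h \<in> densities \<eta> \<Longrightarrow> (\<lambda>n. INF \<psi>\<in>K. L1_norm \<eta> (\<lambda>y. cesaro L n h y - \<psi> y)) \<longlonglongrightarrow> 0"
    using assms unfolding MC_def by auto
  have KL: "\<And>\<psi>. \<psi> \<in> K \<Longrightarrow> integrable \<eta> \<psi>" using compactin_subset_topspace[OF K(1)] by auto
  obtain T where T: "finite T" "T \<subseteq> K" "\<And>\<phi>. \<phi> \<in> K \<Longrightarrow> \<exists>\<psi>\<in>T. L1_norm \<eta> (\<lambda>y. \<phi> y - \<psi> y) < 1"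
    using compactin_L1_finite_net[OF K(1), of "\<lambda>_. 1"] by auto
  have near: "\<exists>\<psi>\<in>T. L1_norm \<eta> (\<lambda>y. u y - \<psi> y) < 1" if u: "invariant_density \<eta> L u" for u
  proof -
    note ud = invariant_densityD[OF u]
    have "u \<in> densities \<eta>" using u unfolding invariant_density_def by simp
    from MC_attractor_limit[OF K lim[OF this] ud(1)] obtain \<phi> where \<phi>: "\<phi> \<in> K"
      "(\<lambda>n. L1_norm \<eta> (\<lambda>y. cesaro L n u y - \<phi> y)) \<longlonglongrightarrow> 0" by blast
    have "eventually (\<lambda>n. L1_norm \<eta> (\<lambda>y. cesaro L n u y - \<phi> y) = L1_norm \<eta> (\<lambda>y. u y - \<phi> y)) sequentially"
      using eventually_gt_at_top[of 0]
    proof eventually_elim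
      case (elim n)
      show ?case
        using cesaro_invariant[OF ud(1,4) elim] ud(1) KL[OF \<phi>(1)]
        by (intro L1_norm_cong_AE) (auto intro!: borel_measurable_diff borel_measurable_integrable cesaro_integrable elim: eventually_mono)
    qed
    then have "(\<lambda>n::nat. L1_norm \<eta> (\<lambda>y. u y - \<phi> y)) \<longlonglongrightarrow> 0"
      using \<phi>(2) by (rule Lim_transform_eventually[rotated])
    then have z: "L1_norm \<eta> (\<lambda>y. u y - \<phi> y) = 0" by (simp add: LIMSEQ_const_iff)
    obtain \<psi> where \<psi>: "\<psi> \<in> T" "L1_norm \<eta> (\<lambda>y. \<phi> y - \<psi> y) < 1" using T(3)[OF \<phi>(1)] by auto
    then have "L1_norm \<eta> (\<lambda>y. u y - \<psi> y) < 1"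
      using L1_dist_triangle[of \<eta> u \<phi> \<psi>] z ud(1) KL \<phi>(1) T(2) by auto
    then show ?thesis using \<psi> by auto
  qed
  have "r \<le> card T" if fam: "invariant_family r h" for r h
  proof -
    have "\<forall>i\<in>{..<r}. \<exists>\<psi>. \<psi> \<in> T \<and> L1_norm \<eta> (\<lambda>y. h i y - \<psi> y) < 1"
      using fam near unfolding invariant_family_iff Bex_def by simp
    from bchoice[OF this] obtain c where
      c: "\<And>i. i < r \<Longrightarrow> c i \<in> T" "\<And>i. i < r \<Longrightarrow> L1_norm \<eta> (\<lambda>y. h i y - c i y) < 1"
      by (metis lessThan_iff)
    have "inj_on c {..<r}"
    proof (rule inj_onI, rule ccontr)
      fix i j assume ij: "i \<in> {..<r}" "j \<in> {..<r}" "c i = c j" "i \<noteq> j"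
      then have fi: "invariant_density \<eta> L (h i)" and fj: "invariant_density \<eta> L (h j)"
        and disj: "AE y in \<eta>. h i y = 0 \<or> h j y = 0"
        using fam unfolding invariant_family_iff by auto
      have "L1_norm \<eta> (\<lambda>y. h i y - h j y) \<le> L1_norm \<eta> (\<lambda>y. h i y - c i y) + L1_norm \<eta> (\<lambda>y. c i y - h j y)"
        using fi fj ij c T(2) KL by (intro L1_dist_triangle) (auto dest: invariant_densityD(1))
      moreover have "L1_norm \<eta> (\<lambda>y. c i y - h j y) < 1"
        using c(2)[of j] ij by (simp add: L1_norm_minus_commute[of _ "c j"])
      ultimately show False
        using invariant_densities_dist[OF fi fj disj] c(2)[of i] ij by simp
    qed
    then show ?thesis
      using card_inj_on_le[of c "{..<r}" T] c(1) T(1) by auto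
  qed
  then show ?thesis using that by blast
qed

text \<open>
  The mean of the members is the reference density for the whole family: its support is the union of
  their supports, and it dominates each of them up to the factor \<open>r\<close>.
\<close>

lemma invariant_mean:
  assumes fam: "\<And>i. i < r \<Longrightarrow> invariant_density \<eta> L (h i)" and r: "1 \<le> r"
  defines "H \<equiv> \<lambda>y. (1 / real r) * (\<Sum>i<r. h i y)"
  shows "invariant_density \<eta> L H" and "absorbing (supp \<eta> H)"
    and "AE y in \<eta>. \<forall>i<r. h i y \<le> real r * H y"
proof -
  note hd = invariant_densityD[OF fam]
  have iH: "integrable \<eta> H" unfolding H_def
    by (intro integrable_mult_right Bochner_Integration.integrable_sum hd(1)) auto
  have all: "AE y in \<eta>. \<forall>i<r. 0 \<le> h i y" "AE y in \<eta>. \<forall>i<r. L (h i) y = h i y"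
    using hd(2,4) by (auto simp: AE_all_countable)
  have H0: "AE y in \<eta>. 0 \<le> H y" using all(1)
    by eventually_elim (auto simp: H_def intro!: divide_nonneg_nonneg sum_nonneg)
  have "(LINT y|\<eta>. H y) = 1" unfolding H_def using hd(1,3) r by simp
  then have d: "H \<in> densities \<eta>" by (rule densitiesI[OF iH H0])
  have "AE y in \<eta>. L (\<lambda>y. \<Sum>i<r. h i y) y = (\<Sum>i<r. L (h i) y)" using hd(1) by (intro L_sum) auto
  moreover have "AE y in \<eta>. L H y = (1 / real r) * L (\<lambda>y. \<Sum>i<r. h i y) y"
    unfolding H_def using hd(1) by (intro L_scale) auto
  ultimately have LH: "AE y in \<eta>. L H y = H y" using all(2) by eventually_elim (simp add: H_def)
  show "invariant_density \<eta> L H" unfolding invariant_density_def using d LH by simp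
  show "absorbing (supp \<eta> H)" by (rule supp_absorbing[OF iH H0 LH])
  show "AE y in \<eta>. \<forall>i<r. h i y \<le> real r * H y" using all(1)
    by eventually_elim (use r in \<open>auto simp: H_def intro!: member_le_sum\<close>)
qed

text \<open>A disjoint family of invariant densities that cannot be enlarged has all the required properties.\<close>

theorem MC_imp_FED:
  assumes MC: "MC \<eta> L"
  shows "FED \<eta> L"
proof -
  obtain K where K: "compactin (L1_topology \<eta>) K" "K \<noteq> {}"
    and lim: "\<And>h. h \<in> densities \<eta> \<Longrightarrow> (\<lambda>n. INF \<psi>\<in>K. L1_norm \<eta> (\<lambda>y. cesaro L n h y - \<psi> y)) \<longlonglongrightarrow> 0"
    using MC unfolding MC_def by auto
  obtain N where N: "\<And>r h. invariant_family r h \<Longrightarrow> r \<le> N" using MC_invariant_family_bounded[OF MC] by blast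
  have "\<exists>h. invariant_family 0 h" by (simp add: invariant_family_iff)
  then have "\<exists>r. (\<exists>h. invariant_family r h) \<and> (\<forall>s. (\<exists>h. invariant_family s h) \<longrightarrow> s \<le> r)"
    using ex_has_greatest_nat[of "\<lambda>r. \<exists>h. invariant_family r h" 0 "\<lambda>r. r" "Suc N"] N
    by (meson le_imp_less_Suc)
  then obtain r h where fam: "invariant_family r h" and max: "\<And>h'. \<not> invariant_family (Suc r) h'"
    by (metis not_less_eq_eq order_refl)
  have inv: "\<And>i. i < r \<Longrightarrow> invariant_density \<eta> L (h i)" using fam unfolding invariant_family_iff by auto
  \<comment> \<open>The averages of 1 converge to an invariant density \<open>\<psi>\<close>, which measures where mass ends up.\<close>
  have d1: "(\<lambda>_. 1) \<in> densities \<eta>" by (rule densitiesI) (auto simp: prob_space)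
  obtain \<psi> where \<psi>: "integrable \<eta> \<psi>" "AE y in \<eta>. L \<psi> y = \<psi> y"
    "(\<lambda>n. L1_norm \<eta> (\<lambda>y. cesaro L n (\<lambda>_. 1) y - \<psi> y)) \<longlonglongrightarrow> 0"
    using MC_attractor_limit[OF K lim[OF d1]] by auto
  have iter_nonneg: "AE y in \<eta>. 0 \<le> (L ^^ k) (\<lambda>_. 1) y" for k
    using markov_operator.L_nonneg[OF markov_operator_iter] by auto
  have "AE y in \<eta>. \<forall>k. 0 \<le> (L ^^ k) (\<lambda>_. 1) y"
    unfolding AE_all_countable using iter_nonneg by auto
  then have ces_nonneg: "AE y in \<eta>. 0 \<le> cesaro L n (\<lambda>_. 1) y" for n
    by eventually_elim (auto simp: cesaro_def intro!: divide_nonneg_nonneg sum_nonneg)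
  have \<psi>0: "AE y in \<eta>. 0 \<le> \<psi> y"
    by (rule L1_limit_nonneg[OF cesaro_integrable ces_nonneg \<psi>(1,3)]) simp
  have ces_int: "(LINT y|\<eta>. cesaro L n (\<lambda>_. 1) y) = 1" if "0 < n" for n
    using markov_operator.L_integral[OF markov_operator_cesaro[OF that], of "\<lambda>_. 1"] by (simp add: prob_space)
  have \<psi>1: "(LINT y|\<eta>. \<psi> y) = 1"
  proof -
    have "(\<lambda>n. LINT y|\<eta>. cesaro L n (\<lambda>_. 1) y * 1) \<longlonglongrightarrow> (LINT y|\<eta>. \<psi> y * 1)"
      by (rule L1_limit_integral[OF cesaro_integrable \<psi>(1) _ \<psi>(3)]) auto
    moreover have "(\<lambda>n. LINT y|\<eta>. cesaro L n (\<lambda>_. 1) y * 1) \<longlonglongrightarrow> 1"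
      by (rule tendsto_eventually) (use eventually_gt_at_top[of 0] in \<open>eventually_elim, simp add: ces_int\<close>)
    ultimately show ?thesis using LIMSEQ_unique by force
  qed
  have \<psi>d: "invariant_density \<eta> L \<psi>"
    unfolding invariant_density_def using \<psi> \<psi>0 \<psi>1 densitiesI by auto
  have r: "1 \<le> r"
  proof (rule ccontr)
    assume "\<not> 1 \<le> r"
    then have "invariant_family (Suc r) (\<lambda>_. \<psi>)" using \<psi>d by (simp add: invariant_family_iff)
    then show False using max by blast
  qed
  have erg: "ergodic_density \<eta> L (h i)" if i: "i < r" for i
    unfolding ergodic_density_iff
  proof (intro conjI allI impI)
    show "invariant_density \<eta> L (h i)" using inv i .
    note hd = invariant_densityD[OF this]
    fix A assume A: "absorbing A"
    then have [measurable]: "A \<in> sets \<eta>" unfolding absorbing_def by simp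
    have "0 \<le> (LINT y|\<eta>. h i y * indicator A y)"
      using hd(2) by (intro integral_nonneg_AE) (auto elim: eventually_mono)
    moreover have "(LINT y|\<eta>. h i y * indicator A y) \<le> (LINT y|\<eta>. h i y)"
      using hd(1,2) by (intro integral_mono_AE integrable_real_mult_indicator)
        (auto elim: eventually_mono simp: indicator_def)
    ultimately show "(LINT y|\<eta>. h i y * indicator A y) \<in> {0, 1}"
      using invariant_family_split[OF fam i A] max hd(3) by fastforce
  qed
  define H where "H = (\<lambda>y. (1 / real r) * (\<Sum>i<r. h i y))"
  have Hd: "invariant_density \<eta> L H" and S: "absorbing (supp \<eta> H)"
    and hH: "AE y in \<eta>. \<forall>i<r. h i y \<le> real r * H y"
    using invariant_mean[OF inv r] unfolding H_def by auto
  define S where "S = supp \<eta> H"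
  have Sm [measurable]: "S \<in> sets \<eta>" and Sa: "absorbing S" using S unfolding absorbing_def S_def by auto
  \<comment> \<open>The part of \<open>\<psi>\<close> outside \<open>S\<close> is invariant; were it nonzero, it could be appended to the family.\<close>
  define v where "v = (\<lambda>y. \<psi> y * indicator (space \<eta> - S) y)"
  have iv: "integrable \<eta> v" unfolding v_def using \<psi>(1) by (auto intro!: integrable_real_mult_indicator)
  have v0: "AE y in \<eta>. 0 \<le> v y" unfolding v_def using \<psi>0 by eventually_elim auto
  have v_int: "(LINT y|\<eta>. v y) = 0"
  proof (rule ccontr)
    assume "(LINT y|\<eta>. v y) \<noteq> 0"
    then have pos: "0 < (LINT y|\<eta>. v y)" using integral_nonneg_AE[OF v0] by linarith
    have "AE y in \<eta>. L v y = v y"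
      unfolding v_def by (rule absorbing_restrict_complement[OF Sa \<psi>(1) \<psi>0 \<psi>(2)])
    then have "invariant_density \<eta> L (\<lambda>y. 1 / (LINT y|\<eta>. v y) * v y)"
      using iv v0 pos by (intro normalized_invariant_density)
    moreover have "AE y in \<eta>. h i y = 0 \<or> 1 / (LINT y|\<eta>. v y) * v y = 0" if "i < r" for i
      using hH invariant_densityD(2)[OF inv[OF that]] AE_space
    proof eventually_elim
      case (elim y)
      show ?case
      proof (cases "y \<in> S")
        case False
        then have "H y = 0" using elim unfolding S_def supp_def by simp
        then show ?thesis using elim that by fastforce
      qed (simp add: v_def)
    qed
    ultimately show False using invariant_family_append[OF fam] max by blast
  qed
  have \<psi>S: "(LINT y|\<eta>. \<psi> y * indicator S y) = 1"
  proof -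
    have "(LINT y|\<eta>. \<psi> y * indicator S y) + (LINT y|\<eta>. v y) = (LINT y|\<eta>. \<psi> y * indicator S y + v y)"
      using integrable_real_mult_indicator[OF Sm \<psi>(1)] iv by simp
    also have "\<dots> = (LINT y|\<eta>. \<psi> y)"
      by (rule Bochner_Integration.integral_cong) (auto simp: indicator_def v_def)
    finally have "(LINT y|\<eta>. \<psi> y * indicator S y) + (LINT y|\<eta>. v y) = (LINT y|\<eta>. \<psi> y)" .
    then show ?thesis using v_int \<psi>1 by simp
  qed
  \<comment> \<open>The integrals \<open>a k\<close> increase, so they dominate their averages, which tend to \<open>\<integral>\<^sub>S \<psi> = 1\<close>.\<close>
  define a where "a k = (LINT y|\<eta>. (U ^^ k) (indicator S) y)" for k
  have ia: "integrable \<eta> ((U ^^ k) (indicator S))" for k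
    using iter_U_indicator(1)[OF Sm] integrable_bmeas by auto
  have a_mono: "incseq a"
    unfolding incseq_Suc_iff a_def
  proof
    fix k
    show "(LINT y|\<eta>. (U ^^ k) (indicator S) y) \<le> (LINT y|\<eta>. (U ^^ Suc k) (indicator S) y)"
      using absorbing_iter_mono[OF Sa] ia[of k] ia[of "Suc k"]
      by (intro integral_mono_AE) (auto elim: eventually_mono)
  qed
  have a_le: "a k \<le> 1" for k
  proof -
    have "a k \<le> (LINT y|\<eta>. 1)"
      unfolding a_def using iter_U_indicator(2)[OF Sm] ia
      by (intro integral_mono_AE) (auto elim: eventually_mono)
    then show ?thesis by (simp add: prob_space)
  qed
  have avg: "(LINT y|\<eta>. cesaro L n (\<lambda>_. 1) y * indicator S y) \<le> a n" if n: "0 < n" for n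
  proof -
    have "(LINT y|\<eta>. cesaro L n (\<lambda>_. 1) y * indicator S y) = (LINT y|\<eta>. 1 / real n * (\<Sum>k<n. (U ^^ k) (indicator S) y))"
      using markov_operator.duality[OF markov_operator_cesaro[OF n], of "\<lambda>_. 1" "indicator S"] by (simp add: cesaro_def)
    also have "\<dots> = 1 / real n * (\<Sum>k<n. a k)" unfolding a_def using ia by simp
    also have "\<dots> \<le> 1 / real n * (\<Sum>k<n. a n)"
      using a_mono by (intro mult_left_mono sum_mono) (auto simp: incseq_def)
    also have "\<dots> = a n" using n by simp
    finally show ?thesis .
  qed
  have "a \<longlonglongrightarrow> 1"
  proof (rule tendsto_sandwich[OF _ _ _ tendsto_const])
    show "(\<lambda>n. LINT y|\<eta>. cesaro L n (\<lambda>_. 1) y * indicator S y) \<longlonglongrightarrow> 1"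
      using L1_limit_integral[OF cesaro_integrable \<psi>(1) bmeas_indicator[OF Sm] \<psi>(3)] \<psi>S by simp
    show "eventually (\<lambda>n. (LINT y|\<eta>. cesaro L n (\<lambda>_. 1) y * indicator S y) \<le> a n) sequentially"
      using eventually_gt_at_top[of 0] by eventually_elim (rule avg)
  qed (use a_le in auto)
  then have "AE y in \<eta>. (\<lambda>n. dual_op \<eta> (L ^^ n) (indicator (supp \<eta> H)) y) \<longlonglongrightarrow> 1"
    using absorbing_limit_iff[OF S] unfolding a_def S_def by simp
  then show ?thesis
    unfolding FED_def Let_def using r erg fam unfolding invariant_family_def H_def by auto
qed

end

section \<open>The mean ergodic theorem below an invariant density\<close>

text \<open>
  The discriminant of a nonnegative quadratic. Rational parameters suffice, and there are only
  countably many of them, so exceptional null sets that depend on the parameter can be collected.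
\<close>

lemma quadratic_nonneg_imp_bound:
  fixes a b h :: real
  assumes a: "0 \<le> a" and h: "0 \<le> h" and q: "\<And>t. t \<in> \<rat> \<Longrightarrow> 0 \<le> a - 2 * t * b + t\<^sup>2 * h"
  shows "b\<^sup>2 / h \<le> a"
proof (cases "h = 0")
  case False
  with h have h: "0 < h" by simp
  show ?thesis
  proof (rule ccontr)
    assume "\<not> b\<^sup>2 / h \<le> a"
    then have gap: "0 < (b\<^sup>2 / h - a) / h" using h by simp
    define d where "d = sqrt ((b\<^sup>2 / h - a) / h)"
    have d: "0 < d" "d\<^sup>2 = (b\<^sup>2 / h - a) / h" using gap unfolding d_def by auto
    obtain t where t: "t \<in> \<rat>" "b / h < t" "t < b / h + d" using Rats_dense_in_real[of "b / h" "b / h + d"] d by auto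
    have "(t - b / h)\<^sup>2 < d\<^sup>2" using t by (intro power_strict_mono) auto
    then have "h * (t - b / h)\<^sup>2 < b\<^sup>2 / h - a" using d(2) h by (simp add: pos_less_divide_eq mult.commute)
    moreover have "h * (t - b / h)\<^sup>2 = t\<^sup>2 * h - 2 * t * b + b\<^sup>2 / h"
      using h by (simp add: power2_eq_square field_simps)
    ultimately show False using q[OF t(1)] by linarith
  qed
qed (use a in simp)

text \<open>
  The square of the norm of \<open>u / H\<close> in \<open>L\<^sup>2(H \<eta>)\<close>. It is used for \<open>u\<close> dominated by a multiple of \<open>H\<close>; such
  \<open>u\<close> vanishes with \<open>H\<close>, which agrees with the convention \<open>x / 0 = 0\<close>.
\<close>

definition energy :: "'y measure \<Rightarrow> ('y \<Rightarrow> real) \<Rightarrow> ('y \<Rightarrow> real) \<Rightarrow> real" where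
  "energy \<eta> H u = (LINT y|\<eta>. (u y)\<^sup>2 / H y)"

lemma square_div_le:
  fixes u H a :: real
  assumes "\<bar>u\<bar> \<le> a * H" "0 \<le> H"
  shows "u\<^sup>2 / H \<le> a\<^sup>2 * H"
proof (cases "H = 0")
  case False
  have "u\<^sup>2 \<le> (a * H)\<^sup>2" using assms(1) by (metis abs_ge_zero power2_abs power_mono)
  then show ?thesis using False assms(2) by (simp add: power2_eq_square field_simps)
qed simp

context
  fixes \<eta> :: "'y measure" and H :: "'y \<Rightarrow> real"
  assumes H: "integrable \<eta> H" "AE y in \<eta>. 0 \<le> H y" "(LINT y|\<eta>. H y) = 1"
begin

lemma dominated_integrable:
  assumes "u \<in> borel_measurable \<eta>" "AE y in \<eta>. \<bar>u y\<bar> \<le> a * H y"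
  shows "integrable \<eta> u"
  by (rule Bochner_Integration.integrable_bound[of \<eta> "\<lambda>y. a * H y"])
    (use assms H in \<open>auto elim: eventually_mono\<close>)

lemma energy_integrable:
  assumes "u \<in> borel_measurable \<eta>" "AE y in \<eta>. \<bar>u y\<bar> \<le> a * H y"
  shows "integrable \<eta> (\<lambda>y. (u y)\<^sup>2 / H y)"
proof (rule Bochner_Integration.integrable_bound[of \<eta> "\<lambda>y. a\<^sup>2 * H y"])
  show "AE y in \<eta>. norm ((u y)\<^sup>2 / H y) \<le> norm (a\<^sup>2 * H y)"
    using assms(2) H(2)
  proof eventually_elim
    case (elim y)
    then show ?case using square_div_le[OF elim] by (simp add: abs_mult)
  qed
qed (use assms H in auto)

lemma energy_nonneg: "0 \<le> energy \<eta> H u"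
  unfolding energy_def using H(2) by (intro integral_nonneg_AE) (auto elim: eventually_mono)

text \<open>The Cauchy--Schwarz inequality in the form \<open>\<bar>u\<bar> \<le> s H / 2 + u\<^sup>2 / (2 s H)\<close>.\<close>

lemma energy_controls_L1:
  assumes u: "u \<in> borel_measurable \<eta>" "AE y in \<eta>. \<bar>u y\<bar> \<le> a * H y"
    and s: "0 < s" "energy \<eta> H u \<le> s\<^sup>2"
  shows "L1_norm \<eta> u \<le> s"
proof -
  have rhs: "integrable \<eta> (\<lambda>y. s / 2 * H y + 1 / (2 * s) * ((u y)\<^sup>2 / H y))"
    by (intro Bochner_Integration.integrable_add integrable_mult_right H(1) energy_integrable[OF u])
  have "L1_norm \<eta> u \<le> (LINT y|\<eta>. s / 2 * H y + 1 / (2 * s) * ((u y)\<^sup>2 / H y))"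
    unfolding L1_norm_def
  proof (rule integral_mono_AE)
    show "AE y in \<eta>. \<bar>u y\<bar> \<le> s / 2 * H y + 1 / (2 * s) * ((u y)\<^sup>2 / H y)"
      using u(2) H(2)
    proof eventually_elim
      case (elim y)
      show ?case
      proof (cases "H y = 0")
        case False
        have "0 \<le> (\<bar>u y\<bar> - s * H y)\<^sup>2" by simp
        then have "2 * s * H y * \<bar>u y\<bar> \<le> (u y)\<^sup>2 + s\<^sup>2 * (H y)\<^sup>2"
          by (simp add: power2_diff power_mult_distrib algebra_simps)
        then show ?thesis using False elim s by (simp add: field_simps power2_eq_square)
      qed (use elim in simp)
    qed
  qed (rule integrable_abs[OF dominated_integrable[OF u]], rule rhs)
  also have "\<dots> = s / 2 + 1 / (2 * s) * energy \<eta> H u"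
  proof -
    have "(LINT y|\<eta>. c * p y + d * q y) = c * (LINT y|\<eta>. p y) + d * (LINT y|\<eta>. q y)"
      if "integrable \<eta> p" "integrable \<eta> q" for p q :: "'y \<Rightarrow> real" and c d
      using that by simp
    from this[OF H(1) energy_integrable[OF u], of "s / 2" "1 / (2 * s)"]
    show ?thesis unfolding energy_def H(3) mult_1_right .
  qed
  also have "\<dots> \<le> s / 2 + 1 / (2 * s) * s\<^sup>2" using s by (intro add_left_mono mult_left_mono) auto
  also have "\<dots> = s" using s by (simp add: power2_eq_square)
  finally show ?thesis .
qed

lemma energy_perturb:
  assumes u: "u \<in> borel_measurable \<eta>" "AE y in \<eta>. \<bar>u y\<bar> \<le> a * H y"
    and v: "v \<in> borel_measurable \<eta>" "AE y in \<eta>. \<bar>v y\<bar> \<le> a * H y"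
    and uv: "AE y in \<eta>. \<bar>u y - v y\<bar> \<le> e * H y"
  shows "energy \<eta> H u \<le> energy \<eta> H v + 2 * a * e"
proof -
  have "energy \<eta> H u \<le> (LINT y|\<eta>. (v y)\<^sup>2 / H y + 2 * a * e * H y)"
    unfolding energy_def
  proof (rule integral_mono_AE)
    show "AE y in \<eta>. (u y)\<^sup>2 / H y \<le> (v y)\<^sup>2 / H y + 2 * a * e * H y"
      using u(2) v(2) uv H(2)
    proof eventually_elim
      case (elim y)
      show ?case
      proof (cases "H y = 0")
        case False
        then have Hy: "0 < H y" using elim by simp
        have "\<bar>u y + v y\<bar> \<le> 2 * a * H y" using elim by linarith
        then have "\<bar>u y - v y\<bar> * \<bar>u y + v y\<bar> \<le> (e * H y) * (2 * a * H y)"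
          using elim by (intro mult_mono') auto
        moreover have "(u y)\<^sup>2 - (v y)\<^sup>2 \<le> \<bar>u y - v y\<bar> * \<bar>u y + v y\<bar>"
          using abs_ge_self[of "(u y - v y) * (u y + v y)"]
          by (simp add: abs_mult[symmetric] power2_eq_square algebra_simps)
        ultimately have "(u y)\<^sup>2 - (v y)\<^sup>2 \<le> 2 * a * e * H y * H y" by (simp add: mult_ac)
        then have "((u y)\<^sup>2 - (v y)\<^sup>2) / H y \<le> 2 * a * e * H y"
          using Hy by (simp add: pos_divide_le_eq)
        then show ?thesis by (simp add: diff_divide_distrib)
      qed simp
    qed
  qed (use H energy_integrable[OF u] energy_integrable[OF v] in auto)
  also have "\<dots> = energy \<eta> H v + 2 * a * e"
    unfolding energy_def using H energy_integrable[OF v] by simp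
  finally show ?thesis .
qed

lemma energy_parallelogram:
  assumes u: "u \<in> borel_measurable \<eta>" "AE y in \<eta>. \<bar>u y\<bar> \<le> a * H y"
    and v: "v \<in> borel_measurable \<eta>" "AE y in \<eta>. \<bar>v y\<bar> \<le> a * H y"
  shows "energy \<eta> H (\<lambda>y. u y - v y)
    = 2 * energy \<eta> H u + 2 * energy \<eta> H v - 4 * energy \<eta> H (\<lambda>y. 1 / 2 * u y + 1 / 2 * v y)"
proof -
  have "AE y in \<eta>. \<bar>1 / 2 * u y + 1 / 2 * v y\<bar> \<le> a * H y"
    using u(2) v(2) by eventually_elim linarith
  then have m: "integrable \<eta> (\<lambda>y. (1 / 2 * u y + 1 / 2 * v y)\<^sup>2 / H y)"
    using u v by (intro energy_integrable) auto
  have "energy \<eta> H (\<lambda>y. u y - v y) = (LINT y|\<eta>. 2 * ((u y)\<^sup>2 / H y) + 2 * ((v y)\<^sup>2 / H y)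
      - 4 * ((1 / 2 * u y + 1 / 2 * v y)\<^sup>2 / H y))"
    unfolding energy_def
  proof (rule Bochner_Integration.integral_cong[OF refl])
    fix y
    have "(u y - v y)\<^sup>2 = 2 * (u y)\<^sup>2 + 2 * (v y)\<^sup>2 - 4 * (1 / 2 * u y + 1 / 2 * v y)\<^sup>2"
      by (simp add: power2_eq_square field_simps)
    then show "(u y - v y)\<^sup>2 / H y = 2 * ((u y)\<^sup>2 / H y) + 2 * ((v y)\<^sup>2 / H y)
        - 4 * ((1 / 2 * u y + 1 / 2 * v y)\<^sup>2 / H y)"
      by (simp only: diff_divide_distrib add_divide_distrib times_divide_eq_right)
  qed
  also have "\<dots> = 2 * energy \<eta> H u + 2 * energy \<eta> H v - 4 * energy \<eta> H (\<lambda>y. 1 / 2 * u y + 1 / 2 * v y)"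
  proof -
    have "(LINT y|\<eta>. 2 * p y + 2 * q y - 4 * s y) = 2 * (LINT y|\<eta>. p y) + 2 * (LINT y|\<eta>. q y) - 4 * (LINT y|\<eta>. s y)"
      if "integrable \<eta> p" "integrable \<eta> q" "integrable \<eta> s" for p q s :: "'y \<Rightarrow> real"
      using that by simp
    from this[OF energy_integrable[OF u] energy_integrable[OF v] m] show ?thesis unfolding energy_def .
  qed
  finally show ?thesis .
qed

end

context markov_operator
begin

lemma L_dominated:
  assumes H: "integrable \<eta> H" "AE y in \<eta>. L H y = H y"
    and u: "integrable \<eta> u" "AE y in \<eta>. \<bar>u y\<bar> \<le> a * H y"
  shows "AE y in \<eta>. \<bar>L u y\<bar> \<le> a * H y"
proof -
  have "AE y in \<eta>. L (\<lambda>y. \<bar>u y\<bar>) y \<le> L (\<lambda>y. a * H y) y" using H u by (intro L_mono) auto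
  then show ?thesis using L_abs_le[OF u(1)] L_scale[OF H(1), of a] H(2) by eventually_elim simp
qed

text \<open>
  For every \<open>t\<close> the function \<open>(u - t H)\<^sup>2 / H\<close> is nonnegative, and so is its image under \<open>L\<close>. The
  discriminant of this quadratic in \<open>t\<close> gives \<open>(L u)\<^sup>2 \<le> H L(u\<^sup>2 / H)\<close>, and \<open>L\<close> preserves integrals.
\<close>

lemma energy_contraction:
  assumes H: "invariant_density \<eta> L H"
    and u: "integrable \<eta> u" "AE y in \<eta>. \<bar>u y\<bar> \<le> a * H y"
  shows "energy \<eta> H (L u) \<le> energy \<eta> H u"
proof -
  note Hd = invariant_densityD[OF H]
  define v where "v = (\<lambda>y. (u y)\<^sup>2 / H y)"
  have um: "u \<in> borel_measurable \<eta>" using u by simp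
  have v: "integrable \<eta> v" unfolding v_def by (rule energy_integrable[OF Hd(1-3) um u(2)])
  have v0: "AE y in \<eta>. 0 \<le> v y" using Hd(2) by eventually_elim (simp add: v_def)
  have "AE y in \<eta>. \<forall>t\<in>\<rat>. 0 \<le> L v y - 2 * t * L u y + t\<^sup>2 * H y"
  proof (subst AE_ball_countable[OF countable_rat], rule ballI)
    fix t :: real
    have "AE y in \<eta>. 0 \<le> (1 * v y + (- 2 * t) * u y) + t\<^sup>2 * H y"
      using u(2) Hd(2)
    proof eventually_elim
      case (elim y)
      show ?case
      proof (cases "H y = 0")
        case False
        have "v y - 2 * t * u y + t\<^sup>2 * H y = (u y - t * H y)\<^sup>2 / H y"
          using False by (simp add: v_def power2_eq_square field_simps)
        then show ?thesis using elim by simp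
      qed (use elim in \<open>simp add: v_def\<close>)
    qed
    then have "AE y in \<eta>. 0 \<le> L (\<lambda>y. 1 * (1 * v y + (- 2 * t) * u y) + t\<^sup>2 * H y) y"
      using v u Hd by (intro L_nonneg) auto
    moreover have "AE y in \<eta>. L (\<lambda>y. 1 * v y + (- 2 * t) * u y) y = 1 * L v y + (- 2 * t) * L u y"
      using v u by (intro L_lincomb)
    moreover have "AE y in \<eta>. L (\<lambda>y. 1 * (1 * v y + (- 2 * t) * u y) + t\<^sup>2 * H y) y
        = 1 * L (\<lambda>y. 1 * v y + (- 2 * t) * u y) y + t\<^sup>2 * L H y"
      using v u Hd by (intro L_lincomb) auto
    ultimately show "AE y in \<eta>. 0 \<le> L v y - 2 * t * L u y + t\<^sup>2 * H y"
      using Hd(4) by eventually_elim simp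
  qed
  then have le: "AE y in \<eta>. (L u y)\<^sup>2 / H y \<le> L v y"
    using Hd(2) L_nonneg[OF v v0]
    by eventually_elim (rule quadratic_nonneg_imp_bound, auto)
  have Lu: "AE y in \<eta>. \<bar>L u y\<bar> \<le> a * H y" by (rule L_dominated[OF Hd(1,4) u])
  have Lum: "L u \<in> borel_measurable \<eta>" using L_integrable[OF u(1)] by simp
  have "energy \<eta> H (L u) \<le> (LINT y|\<eta>. L v y)"
    unfolding energy_def
    by (rule integral_mono_AE[OF energy_integrable[OF Hd(1-3) Lum Lu] L_integrable[OF v] le])
  also have "\<dots> = energy \<eta> H u" using L_integral[OF v] unfolding energy_def v_def .
  finally show ?thesis .
qed

lemma invariant_density_iter: "invariant_density \<eta> L H \<Longrightarrow> invariant_density \<eta> (L ^^ n) H"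
  using iter_invariant[of H n] invariant_densityD[of H] unfolding invariant_density_def by auto

lemma invariant_density_cesaro: "invariant_density \<eta> L H \<Longrightarrow> 0 < n \<Longrightarrow> invariant_density \<eta> (cesaro L n) H"
  using cesaro_invariant[of H n] invariant_densityD[of H] unfolding invariant_density_def by auto

lemma cesaro_dominated:
  assumes H: "invariant_density \<eta> L H" and u: "integrable \<eta> u" "AE y in \<eta>. \<bar>u y\<bar> \<le> a * H y"
  shows "AE y in \<eta>. \<bar>cesaro L n u y\<bar> \<le> a * H y"
proof (cases "n = 0")
  case False
  then show ?thesis
    using markov_operator.L_dominated[OF markov_operator_cesaro, of n H u a] u
      invariant_density_cesaro[OF H, of n] invariant_densityD(1)[OF H]
    unfolding invariant_density_def by auto
qed (use u(2) in \<open>auto simp: cesaro_def elim: eventually_mono\<close>)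

lemma cesaro_cesaro_dominated:
  assumes H: "invariant_density \<eta> L H" and u: "integrable \<eta> u" "AE y in \<eta>. \<bar>u y\<bar> \<le> a * H y"
    and n: "0 < n" and N: "0 < N"
  shows "AE y in \<eta>. \<bar>cesaro L N (cesaro L n u) y - cesaro L N u y\<bar> \<le> 2 * real n * a / real N * H y"
proof -
  have "AE y in \<eta>. \<bar>(L ^^ k) u y\<bar> \<le> a * H y" for k
    using markov_operator.L_dominated[OF markov_operator_iter, of H k u a] u
      invariant_density_iter[OF H, of k] invariant_densityD(1)[OF H]
    unfolding invariant_density_def by auto
  then have "AE y in \<eta>. \<forall>k. \<bar>(L ^^ k) u y\<bar> \<le> a * H y" by (simp add: AE_all_countable)
  then show ?thesis
    using cesaro_cesaro[OF u(1) n N]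
  proof eventually_elim
    case (elim y)
    have aH: "0 \<le> a * H y" using elim(1) by (meson abs_ge_zero order_trans)
    have shift: "\<bar>cesaro L N ((L ^^ k) u) y - cesaro L N u y\<bar> \<le> 1 / real N * (real n * (2 * (a * H y)))" if "k < n" for k
    proof -
      have "\<bar>\<Sum>j<k. (L ^^ (N + j)) u y - (L ^^ j) u y\<bar> \<le> (\<Sum>j<k. \<bar>(L ^^ (N + j)) u y - (L ^^ j) u y\<bar>)"
        by (rule sum_abs)
      also have "\<dots> \<le> (\<Sum>j<k. 2 * (a * H y))"
      proof (rule sum_mono)
        fix j
        show "\<bar>(L ^^ (N + j)) u y - (L ^^ j) u y\<bar> \<le> 2 * (a * H y)"
          using elim(1)[rule_format, of "N + j"] elim(1)[rule_format, of j] by linarith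
      qed
      also have "\<dots> \<le> real n * (2 * (a * H y))" using that aH by (simp add: mult_right_mono)
      finally show ?thesis
        unfolding iter_cesaro[OF u(1) N] abs_mult by (simp add: divide_right_mono)
    qed
    have "\<bar>\<Sum>k<n. cesaro L N ((L ^^ k) u) y - cesaro L N u y\<bar>
        \<le> (\<Sum>k<n. \<bar>cesaro L N ((L ^^ k) u) y - cesaro L N u y\<bar>)"
      by (rule sum_abs)
    also have "\<dots> \<le> (\<Sum>k<n. 1 / real N * (real n * (2 * (a * H y))))"
      using shift by (intro sum_mono) auto
    also have "\<dots> = real n * (2 * real n * a / real N * H y)" by simp
    finally show ?case
      unfolding elim(2) abs_mult using n by (simp add: pos_divide_le_eq mult.commute)
  qed
qed

text \<open>
  Von Neumann's argument. Let \<open>d\<close> be the infimum of the energies of the midpoints of two averages.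
  Averaging such a midpoint does not raise its energy and gives nearly a late average, so the energies
  of late averages approach \<open>d\<close> from above. As midpoints of late averages have energy at least \<open>d\<close>, the
  parallelogram law makes the averages a Cauchy sequence in energy, hence in \<open>L\<^sup>1\<close>.
\<close>

lemma cesaro_converges_dominated:
  assumes H: "invariant_density \<eta> L H" and a: "0 \<le> a"
    and u: "integrable \<eta> u" "AE y in \<eta>. \<bar>u y\<bar> \<le> a * H y"
  obtains \<psi> where "integrable \<eta> \<psi>" "AE y in \<eta>. L \<psi> y = \<psi> y" "AE y in \<eta>. \<bar>\<psi> y\<bar> \<le> a * H y"
    "(\<lambda>n. L1_norm \<eta> (\<lambda>y. cesaro L n u y - \<psi> y)) \<longlonglongrightarrow> 0"
proof -
  note Hd = invariant_densityD[OF H]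
  define A where "A n = cesaro L n u" for n
  have Ai: "integrable \<eta> (A n)" for n unfolding A_def by (rule cesaro_integrable[OF u(1)])
  then have Am [measurable]: "A n \<in> borel_measurable \<eta>" for n by simp
  have Ad: "AE y in \<eta>. \<bar>A n y\<bar> \<le> a * H y" for n unfolding A_def by (rule cesaro_dominated[OF H u])
  define mid where "mid n k = (\<lambda>y. 1 / 2 * A n y + 1 / 2 * A k y)" for n k
  have midi: "integrable \<eta> (mid n k)" for n k unfolding mid_def using Ai by auto
  have midd: "AE y in \<eta>. \<bar>mid n k y\<bar> \<le> a * H y" for n k
    using Ad[of n] Ad[of k] unfolding mid_def by eventually_elim linarith
  define D where "D = (\<lambda>(n, k). energy \<eta> H (mid n k)) ` ({1..} \<times> {1..})"
  define d where "d = Inf D"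
  have bdd: "bdd_below D" unfolding D_def using energy_nonneg[OF Hd(1-3)] by (intro bdd_belowI2[of _ 0]) auto
  have d_le: "d \<le> energy \<eta> H (mid n k)" if "1 \<le> n" "1 \<le> k" for n k
    unfolding d_def by (rule cInf_lower[OF _ bdd]) (use that in \<open>force simp: D_def\<close>)
  have almost_min: "\<exists>N0. \<forall>N\<ge>N0. 0 < N \<and> energy \<eta> H (A N) \<le> d + e" if e: "0 < e" for e
  proof -
    have "D \<noteq> {}" unfolding D_def by auto
    then obtain x where "x \<in> D" "x < d + e / 2"
      unfolding d_def using cInf_lessD[of D "Inf D + e / 2"] e by auto
    then obtain n k where nk: "1 \<le> n" "1 \<le> k" "energy \<eta> H (mid n k) < d + e / 2"
      unfolding D_def by auto
    obtain N0 :: nat where N0: "4 * a * ((real n + real k) * a) / e < real N0" using reals_Archimedean2 by blast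
    have "0 < N \<and> energy \<eta> H (A N) \<le> d + e" if N: "Suc N0 \<le> N" for N
    proof
      show N': "0 < N" using N by simp
      interpret C: markov_operator \<eta> "cesaro L N" "cesaro U N" using N' by (rule markov_operator_cesaro)
      define B where "B = cesaro L N (mid n k)"
      have Bm: "B \<in> borel_measurable \<eta>" unfolding B_def using C.L_integrable[OF midi] by simp
      have Bd: "AE y in \<eta>. \<bar>B y\<bar> \<le> a * H y" unfolding B_def by (rule cesaro_dominated[OF H midi midd])
      have lin: "AE y in \<eta>. B y = 1 / 2 * cesaro L N (A n) y + 1 / 2 * cesaro L N (A k) y"
        unfolding B_def mid_def by (rule C.L_lincomb[OF Ai Ai])
      have "AE y in \<eta>. \<bar>A N y - B y\<bar> \<le> (real n + real k) * a / real N * H y"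
        using lin cesaro_cesaro_dominated[OF H u, of n N] cesaro_cesaro_dominated[OF H u, of k N] nk N'
      proof -
        have "AE y in \<eta>. \<bar>cesaro L N (A n) y - A N y\<bar> \<le> 2 * real n * a / real N * H y"
          "AE y in \<eta>. \<bar>cesaro L N (A k) y - A N y\<bar> \<le> 2 * real k * a / real N * H y"
          using cesaro_cesaro_dominated[OF H u, of n N] cesaro_cesaro_dominated[OF H u, of k N] nk N'
          unfolding A_def by auto
        then show ?thesis using lin
        proof eventually_elim
          case (elim y)
          have "(real n + real k) * a / real N * H y = 1 / 2 * (2 * real n * a / real N * H y) + 1 / 2 * (2 * real k * a / real N * H y)"
            by (simp add: algebra_simps add_divide_distrib)
          then show ?case using elim by linarith
        qed
      qed
      then have "energy \<eta> H (A N) \<le> energy \<eta> H B + 2 * a * ((real n + real k) * a / real N)"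
        by (rule energy_perturb[OF Hd(1-3) Am Ad Bm Bd])
      moreover have "energy \<eta> H B \<le> energy \<eta> H (mid n k)"
        unfolding B_def by (rule C.energy_contraction[OF invariant_density_cesaro[OF H N'] midi midd])
      moreover have "2 * a * ((real n + real k) * a / real N) \<le> e / 2"
      proof -
        have "4 * a * ((real n + real k) * a) / e < real N" using N0 N by linarith
        then show ?thesis using e N' by (simp add: field_simps)
      qed
      ultimately show "energy \<eta> H (A N) \<le> d + e" using nk(3) by linarith
    qed
    then show ?thesis by blast
  qed
  have cauchy: "\<exists>N. \<forall>i\<ge>N. \<forall>j\<ge>N. (LINT y|\<eta>. norm (A i y - A j y)) < e" if e: "0 < e" for e
  proof -
    define s where "s = e / 2"
    have s: "0 < s" "s < e" using e unfolding s_def by auto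
    obtain N0 where N0: "\<And>N. N0 \<le> N \<Longrightarrow> 0 < N \<and> energy \<eta> H (A N) \<le> d + s\<^sup>2 / 4"
      using almost_min[of "s\<^sup>2 / 4"] s by auto
    have "(LINT y|\<eta>. norm (A i y - A j y)) < e" if ij: "N0 \<le> i" "N0 \<le> j" for i j
    proof -
      have "1 \<le> i" "1 \<le> j" using N0[OF ij(1)] N0[OF ij(2)] by auto
      have "energy \<eta> H (\<lambda>y. A i y - A j y) \<le> s\<^sup>2"
        using energy_parallelogram[OF Hd(1-3) Am Ad Am Ad, of i j] N0[OF ij(1)] N0[OF ij(2)]
          d_le[OF \<open>1 \<le> i\<close> \<open>1 \<le> j\<close>] unfolding mid_def by linarith
      moreover have "AE y in \<eta>. \<bar>A i y - A j y\<bar> \<le> (2 * a) * H y"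
        using Ad[of i] Ad[of j] by eventually_elim linarith
      ultimately have "L1_norm \<eta> (\<lambda>y. A i y - A j y) \<le> s"
        using s by (intro energy_controls_L1[OF Hd(1-3)]) auto
      then show ?thesis using s unfolding L1_norm_def by simp
    qed
    then show ?thesis by blast
  qed
  obtain \<rho> where \<rho>: "strict_mono \<rho>" "AE y in \<eta>. Cauchy (\<lambda>i. A (\<rho> i) y)"
    by (rule cauchy_L1_AE_cauchy_subseq[of \<eta> A]) (use Ai cauchy in auto)
  define \<psi> where "\<psi> y = lim (\<lambda>i. A (\<rho> i) y)" for y
  have \<psi>m [measurable]: "\<psi> \<in> borel_measurable \<eta>" unfolding \<psi>_def by measurable
  have conv: "AE y in \<eta>. (\<lambda>i. A (\<rho> i) y) \<longlonglongrightarrow> \<psi> y"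
    using \<rho>(2) by eventually_elim (simp add: \<psi>_def Cauchy_convergent_iff convergent_LIMSEQ_iff)
  have all: "AE y in \<eta>. \<forall>n. \<bar>A n y\<bar> \<le> a * H y" using Ad by (simp add: AE_all_countable)
  have \<psi>d: "AE y in \<eta>. \<bar>\<psi> y\<bar> \<le> a * H y"
    using conv all
  proof eventually_elim
    case (elim y)
    have "(\<lambda>i. \<bar>A (\<rho> i) y\<bar>) \<longlonglongrightarrow> \<bar>\<psi> y\<bar>" using elim(1) by (rule tendsto_rabs)
    then show ?case using elim(2) by (intro LIMSEQ_le_const2) auto
  qed
  have \<psi>i: "integrable \<eta> \<psi>" by (rule dominated_integrable[OF Hd(1-3) \<psi>m \<psi>d])
  have "(\<lambda>i. LINT y|\<eta>. \<bar>A (\<rho> i) y - \<psi> y\<bar>) \<longlonglongrightarrow> (LINT y|\<eta>. 0)"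
  proof (rule integral_dominated_convergence[where w = "\<lambda>y. 2 * a * H y"])
    show "AE y in \<eta>. (\<lambda>i. \<bar>A (\<rho> i) y - \<psi> y\<bar>) \<longlonglongrightarrow> 0"
      using conv by eventually_elim (simp add: tendsto_rabs_zero_iff LIM_zero)
    show "AE y in \<eta>. norm \<bar>A (\<rho> i) y - \<psi> y\<bar> \<le> 2 * a * H y" for i
      using all \<psi>d
    proof eventually_elim
      case (elim y)
      then have "\<bar>A (\<rho> i) y\<bar> \<le> a * H y" by blast
      then show ?case using elim(2) unfolding real_norm_def abs_idempotent by linarith
    qed
  qed (use Hd in auto)
  then have sub: "(\<lambda>i. L1_norm \<eta> (\<lambda>y. A (\<rho> i) y - \<psi> y)) \<longlonglongrightarrow> 0" unfolding L1_norm_def by simp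
  have cluster: "\<exists>n\<ge>N. L1_norm \<eta> (\<lambda>y. cesaro L n u y - \<psi> y) < e" if e: "0 < e" for e N
  proof -
    have "eventually (\<lambda>i. L1_norm \<eta> (\<lambda>y. A (\<rho> i) y - \<psi> y) < e) sequentially"
      using order_tendstoD(2)[OF sub e] .
    then obtain I where I: "\<And>i. I \<le> i \<Longrightarrow> L1_norm \<eta> (\<lambda>y. A (\<rho> i) y - \<psi> y) < e"
      by (auto simp: eventually_sequentially)
    have "N \<le> \<rho> (max I N)" using seq_suble[OF \<rho>(1), of "max I N"] by simp
    then show ?thesis using I[of "max I N"] unfolding A_def by auto
  qed
  show ?thesis
    using that[OF \<psi>i _ \<psi>d] cesaro_cluster_point_limit[OF u(1) \<psi>i cluster] by blast
qed

end

section \<open>Convergence of averages under maximal support\<close>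

context markov_operator
begin

text \<open>\<open>u\<close> is the increasing limit of \<open>U\<^sup>n 1\<^sub>A\<close>: the probability that a point is ever absorbed by \<open>A\<close>.\<close>

lemma absorbing_hitting_probability:
  assumes A: "absorbing A"
  obtains u where "u \<in> bmeas \<eta>" "\<And>y. 0 \<le> u y" "\<And>y. u y \<le> 1"
    "\<And>\<phi>. integrable \<eta> \<phi> \<Longrightarrow> (\<lambda>n. LINT y|\<eta>. (L ^^ n) \<phi> y * indicator A y) \<longlonglongrightarrow> (LINT y|\<eta>. \<phi> y * u y)"
proof -
  have As [measurable]: "A \<in> sets \<eta>" using A unfolding absorbing_def by simp
  define P where "P n = (U ^^ n) (indicator A)" for n
  have Pb: "P n \<in> bmeas \<eta>" for n unfolding P_def by (rule iter_U_indicator(1)[OF As])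
  then have [measurable]: "P n \<in> borel_measurable \<eta>" for n by (rule bmeas_measurable)
  have bounds: "AE y in \<eta>. \<forall>n. 0 \<le> P n y \<and> P n y \<le> 1" unfolding P_def by (rule iter_U_indicator(2)[OF As])
  define u where "u y = max 0 (min 1 (lim (\<lambda>n. P n y)))" for y
  have um [measurable]: "u \<in> borel_measurable \<eta>" unfolding u_def by measurable
  have conv: "AE y in \<eta>. (\<lambda>n. P n y) \<longlonglongrightarrow> u y"
    using bounds absorbing_iter_mono[OF A]
  proof eventually_elim
    case (elim y)
    have "convergent (\<lambda>n. P n y)"
      by (rule Bseq_mono_convergent[OF BseqI'[of _ 1]])
        (use elim in \<open>auto simp: P_def intro: lift_Suc_mono_le[of "\<lambda>n. (U ^^ n) (indicator A) y"]\<close>)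
    then have l: "(\<lambda>n. P n y) \<longlonglongrightarrow> lim (\<lambda>n. P n y)" by (simp add: convergent_LIMSEQ_iff)
    then have "0 \<le> lim (\<lambda>n. P n y)" "lim (\<lambda>n. P n y) \<le> 1"
      using elim(1) by (auto intro: LIMSEQ_le_const LIMSEQ_le_const2)
    then show ?case using l by (simp add: u_def)
  qed
  show ?thesis
  proof (rule that[of u])
    show "u \<in> bmeas \<eta>" by (rule bmeasI[of _ _ 1]) (auto simp: u_def)
    fix \<phi> :: "'y \<Rightarrow> real" assume \<phi>: "integrable \<eta> \<phi>"
    then have [measurable]: "\<phi> \<in> borel_measurable \<eta>" by simp
    have "(\<lambda>n. LINT y|\<eta>. \<phi> y * P n y) \<longlonglongrightarrow> (LINT y|\<eta>. \<phi> y * u y)"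
    proof (rule integral_dominated_convergence[where w = "\<lambda>y. \<bar>\<phi> y\<bar>"])
      show "AE y in \<eta>. (\<lambda>n. \<phi> y * P n y) \<longlonglongrightarrow> \<phi> y * u y"
        using conv by eventually_elim (rule tendsto_mult_left)
      show "AE y in \<eta>. norm (\<phi> y * P n y) \<le> \<bar>\<phi> y\<bar>" for n
        using bounds by eventually_elim (auto simp: abs_mult intro: mult_left_le)
    qed (use \<phi> in auto)
    moreover have "(LINT y|\<eta>. (L ^^ n) \<phi> y * indicator A y) = (LINT y|\<eta>. \<phi> y * P n y)" for n
      unfolding P_def by (rule markov_operator.duality[OF markov_operator_iter \<phi>]) simp
    ultimately show "(\<lambda>n. LINT y|\<eta>. (L ^^ n) \<phi> y * indicator A y) \<longlonglongrightarrow> (LINT y|\<eta>. \<phi> y * u y)" by simp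
  qed (auto simp: u_def)
qed

text \<open>
  With this \<open>c\<close> the function \<open>w = \<psi> - c h\<close> has integral 0 over the support of \<open>h\<close>. The support of \<open>w\<^sup>+\<close> is
  absorbing, so by ergodicity \<open>w\<close> has one sign on the support of \<open>h\<close>, and therefore vanishes there.
\<close>

lemma ergodic_invariant_proportional:
  assumes h: "ergodic_density \<eta> L h" and \<psi>: "integrable \<eta> \<psi>" "AE y in \<eta>. L \<psi> y = \<psi> y"
  defines "c \<equiv> LINT y|\<eta>. \<psi> y * indicator (supp \<eta> h) y"
  shows "AE y in \<eta>. h y \<noteq> 0 \<longrightarrow> \<psi> y = c * h y"
proof -
  let ?S = "supp \<eta> h"
  have hd: "invariant_density \<eta> L h" using h unfolding ergodic_density_iff by simp
  note hd = invariant_densityD[OF hd]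
  have [measurable]: "?S \<in> sets \<eta>" using hd(1) by auto
  define w where "w = (\<lambda>y. \<psi> y - c * h y)"
  have wi: "integrable \<eta> w" unfolding w_def using \<psi> hd by auto
  have "AE y in \<eta>. L (\<lambda>y. 1 * \<psi> y + (- c) * h y) y = 1 * L \<psi> y + (- c) * L h y"
    using \<psi> hd by (intro L_lincomb)
  then have Lw: "AE y in \<eta>. L w y = w y" using \<psi>(2) hd(4) unfolding w_def by eventually_elim simp
  define A where "A = supp \<eta> (\<lambda>y. max 0 (w y))"
  have A: "absorbing A" unfolding A_def
    using wi invariant_pos_part[OF wi Lw] by (intro supp_absorbing) auto
  then have [measurable]: "A \<in> sets \<eta>" unfolding absorbing_def by simp
  have ihA: "integrable \<eta> (\<lambda>y. h y * indicator A y)" using hd by (intro integrable_real_mult_indicator) auto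
  have hS: "(LINT y|\<eta>. h y * indicator ?S y) = 1"
    unfolding hd(3)[symmetric] by (rule Bochner_Integration.integral_cong) (auto simp: supp_def indicator_def)
  have iwS: "integrable \<eta> (\<lambda>y. w y * indicator ?S y)" using wi by (intro integrable_real_mult_indicator) auto
  have "(LINT y|\<eta>. w y * indicator ?S y) = (LINT y|\<eta>. \<psi> y * indicator ?S y - c * (h y * indicator ?S y))"
    by (simp add: w_def algebra_simps)
  also have "\<dots> = (LINT y|\<eta>. \<psi> y * indicator ?S y) - c * (LINT y|\<eta>. h y * indicator ?S y)"
    using integrable_real_mult_indicator[OF _ \<psi>(1), of ?S] integrable_real_mult_indicator[OF _ hd(1), of ?S] by simp
  finally have w0: "(LINT y|\<eta>. w y * indicator ?S y) = 0" unfolding hS c_def by simp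
  consider "(LINT y|\<eta>. h y * indicator A y) = 0" | "(LINT y|\<eta>. h y * indicator A y) = 1"
    using h A unfolding ergodic_density_iff by blast
  then have "AE y in \<eta>. w y * indicator ?S y = 0"
  proof cases
    case 1
    moreover have "AE y in \<eta>. 0 \<le> h y * indicator A y" using hd(2) by eventually_elim auto
    ultimately have "AE y in \<eta>. h y * indicator A y = 0"
      using integral_nonneg_eq_0_iff_AE[OF ihA] by simp
    then have "AE y in \<eta>. w y * indicator ?S y \<le> 0"
      using AE_space by eventually_elim (auto simp: A_def supp_def indicator_def max_def split: if_splits)
    then show ?thesis
      using AE_eq_if_le_integral_eq[OF iwS, of "\<lambda>_. 0"] w0 by simp
  next
    case 2
    have "AE y in \<eta>. h y * indicator A y = h y"
      using hd 2 by (intro AE_eq_if_le_integral_eq ihA) (auto elim: eventually_mono simp: indicator_def)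
    then have "AE y in \<eta>. 0 \<le> w y * indicator ?S y"
      using AE_space by eventually_elim (auto simp: A_def supp_def indicator_def max_def split: if_splits)
    then have "AE y in \<eta>. 0 = w y * indicator ?S y"
      using AE_eq_if_le_integral_eq[OF _ iwS, of "\<lambda>_. 0"] w0 by simp
    then show ?thesis by eventually_elim simp
  qed
  then show ?thesis using AE_space by eventually_elim (auto simp: w_def supp_def indicator_def)
qed

text \<open>
  Let \<open>R \<phi>\<close> be the claimed limit. The functions whose averages converge to it form a closed set that
  contains \<open>\<phi>\<close> as soon as it contains functions arbitrarily close to iterates of \<open>\<phi>\<close>. It contains the
  functions dominated by a multiple of \<open>H\<close>; truncation extends this to all functions that vanish off
  the support of \<open>H\<close>, and maximality of the support to all integrable functions.
\<close>

theorem FED_imp_APM: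
  assumes FED: "FED \<eta> L"
  shows "APM \<eta> L"
proof -
  obtain r :: nat and h where r: "1 \<le> r" and erg: "\<And>i. i < r \<Longrightarrow> ergodic_density \<eta> L (h i)"
    and disj: "disjoint_supports \<eta> r h"
    and maxsupp: "AE y in \<eta>. (\<lambda>n. dual_op \<eta> (L ^^ n) (indicator (supp \<eta> (\<lambda>y. (1 / real r) * (\<Sum>i<r. h i y)))) y) \<longlonglongrightarrow> 1"
    using FED unfolding FED_def Let_def by auto
  have inv: "\<And>i. i < r \<Longrightarrow> invariant_density \<eta> L (h i)" using erg unfolding ergodic_density_iff by auto
  note hd = invariant_densityD[OF inv]
  have disjAE: "AE y in \<eta>. \<forall>i<r. \<forall>j<r. i \<noteq> j \<longrightarrow> h i y = 0 \<or> h j y = 0"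
    using disj disjoint_supports_iff_AE[of r h \<eta>] hd(1) by (auto simp: AE_all_countable)
  define H where "H = (\<lambda>y. (1 / real r) * (\<Sum>i<r. h i y))"
  have Hinv: "invariant_density \<eta> L H" and Sa: "absorbing (supp \<eta> H)" and hH: "AE y in \<eta>. \<forall>i<r. h i y \<le> real r * H y"
    using invariant_mean[OF inv r] unfolding H_def by auto
  note Hd = invariant_densityD[OF Hinv]
  define S where "S = supp \<eta> H"
  have Sm [measurable]: "S \<in> sets \<eta>" using Sa unfolding absorbing_def S_def by auto
  have "\<forall>i\<in>{..<r}. \<exists>u. u \<in> bmeas \<eta> \<and> (\<forall>y. 0 \<le> u y) \<and> (\<forall>y. u y \<le> 1) \<and> (\<forall>\<phi>. integrable \<eta> \<phi> \<longrightarrow>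
      (\<lambda>n. LINT y|\<eta>. (L ^^ n) \<phi> y * indicator (supp \<eta> (h i)) y) \<longlonglongrightarrow> (LINT y|\<eta>. \<phi> y * u y))"
  proof
    fix i assume "i \<in> {..<r}"
    then have i: "i < r" by simp
    have "absorbing (supp \<eta> (h i))" using hd[OF i] by (intro supp_absorbing)
    then obtain u where "u \<in> bmeas \<eta>" "\<And>y. 0 \<le> u y" "\<And>y. u y \<le> 1"
      "\<And>\<phi>. integrable \<eta> \<phi> \<Longrightarrow>
        (\<lambda>n. LINT y|\<eta>. (L ^^ n) \<phi> y * indicator (supp \<eta> (h i)) y) \<longlonglongrightarrow> (LINT y|\<eta>. \<phi> y * u y)"
      by (rule absorbing_hitting_probability) blast
    then show "\<exists>u. u \<in> bmeas \<eta> \<and> (\<forall>y. 0 \<le> u y) \<and> (\<forall>y. u y \<le> 1) \<and> (\<forall>\<phi>. integrable \<eta> \<phi> \<longrightarrow>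
      (\<lambda>n. LINT y|\<eta>. (L ^^ n) \<phi> y * indicator (supp \<eta> (h i)) y) \<longlonglongrightarrow> (LINT y|\<eta>. \<phi> y * u y))"
      by (intro exI[of _ u] conjI allI impI)
  qed
  from bchoice[OF this] obtain u where u_all: "\<forall>i\<in>{..<r}. u i \<in> bmeas \<eta> \<and> (\<forall>y. 0 \<le> u i y) \<and> (\<forall>y. u i y \<le> 1) \<and>
      (\<forall>\<phi>. integrable \<eta> \<phi> \<longrightarrow>
      (\<lambda>n. LINT y|\<eta>. (L ^^ n) \<phi> y * indicator (supp \<eta> (h i)) y) \<longlonglongrightarrow> (LINT y|\<eta>. \<phi> y * u i y))"
    by (elim exE)
  have u: "\<And>i. i < r \<Longrightarrow> u i \<in> bmeas \<eta>" "\<And>i y. i < r \<Longrightarrow> 0 \<le> u i y" "\<And>i y. i < r \<Longrightarrow> u i y \<le> 1"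
    and ulim: "\<And>i \<phi>. i < r \<Longrightarrow> integrable \<eta> \<phi> \<Longrightarrow>
      (\<lambda>n. LINT y|\<eta>. (L ^^ n) \<phi> y * indicator (supp \<eta> (h i)) y) \<longlonglongrightarrow> (LINT y|\<eta>. \<phi> y * u i y)"
    using u_all by simp_all
  define l where "l i \<phi> = (LINT y|\<eta>. \<phi> y * u i y)" for i \<phi>
  have il: "integrable \<eta> (\<lambda>y. \<phi> y * u i y)" if "i < r" "integrable \<eta> \<phi>" for i \<phi>
    using integrable_mult_bmeas that u(1) by blast
  have l_bound: "\<bar>l i \<phi>\<bar> \<le> L1_norm \<eta> \<phi>" if i: "i < r" and \<phi>: "integrable \<eta> \<phi>" for i \<phi>
  proof -
    have "\<bar>l i \<phi>\<bar> \<le> (LINT y|\<eta>. \<bar>\<phi> y * u i y\<bar>)" unfolding l_def by (rule integral_abs_bound)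
    also have "\<dots> \<le> L1_norm \<eta> \<phi>" unfolding L1_norm_def
      using u(2,3)[OF i]
      by (intro integral_mono[OF integrable_abs[OF il[OF i \<phi>]] integrable_abs[OF \<phi>]]) (auto simp: abs_mult intro: mult_left_le)
    finally show ?thesis .
  qed
  have l_diff: "l i (\<lambda>y. \<phi> y - \<psi> y) = l i \<phi> - l i \<psi>" if "i < r" "integrable \<eta> \<phi>" "integrable \<eta> \<psi>" for i \<phi> \<psi>
    unfolding l_def using il[OF that(1,2)] il[OF that(1,3)] by (simp add: left_diff_distrib)
  have l_L: "l i (L \<phi>) = l i \<phi>" if i: "i < r" and \<phi>: "integrable \<eta> \<phi>" for i \<phi>
  proof (rule LIMSEQ_unique)
    show "(\<lambda>n. LINT y|\<eta>. (L ^^ n) (L \<phi>) y * indicator (supp \<eta> (h i)) y) \<longlonglongrightarrow> l i (L \<phi>)"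
      unfolding l_def by (rule ulim[OF i L_integrable[OF \<phi>]])
    show "(\<lambda>n. LINT y|\<eta>. (L ^^ n) (L \<phi>) y * indicator (supp \<eta> (h i)) y) \<longlonglongrightarrow> l i \<phi>"
      using LIMSEQ_Suc[OF ulim[OF i \<phi>]] unfolding l_def by (simp add: funpow_swap1)
  qed
  have l_iter: "l i ((L ^^ k) \<phi>) = l i \<phi>" if "i < r" "integrable \<eta> \<phi>" for i \<phi> k
    by (induction k) (use that in \<open>auto simp: l_L iter_integrable\<close>)
  have l_cesaro: "l i (cesaro L n \<phi>) = l i \<phi>" if "i < r" "integrable \<eta> \<phi>" "0 < n" for i \<phi> n
  proof -
    have "l i (cesaro L n \<phi>) = (LINT y|\<eta>. 1 / real n * (\<Sum>k<n. (L ^^ k) \<phi> y * u i y))"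
      unfolding l_def cesaro_def by (simp add: sum_distrib_right)
    also have "\<dots> = 1 / real n * (\<Sum>k<n. l i ((L ^^ k) \<phi>))"
      unfolding l_def using il[OF that(1) iter_integrable[OF that(2)]] by simp
    finally show ?thesis using that by (simp add: l_iter)
  qed
  have l_inv: "l i \<psi> = (LINT y|\<eta>. \<psi> y * indicator (supp \<eta> (h i)) y)"
    if i: "i < r" and \<psi>: "integrable \<eta> \<psi>" "AE y in \<eta>. L \<psi> y = \<psi> y" for i \<psi>
  proof -
    have [measurable]: "supp \<eta> (h i) \<in> sets \<eta>" using hd(1)[OF i] by auto
    have "(LINT y|\<eta>. (L ^^ n) \<psi> y * indicator (supp \<eta> (h i)) y) = (LINT y|\<eta>. \<psi> y * indicator (supp \<eta> (h i)) y)" for n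
    proof (rule integral_cong_AE)
      show "AE y in \<eta>. (L ^^ n) \<psi> y * indicator (supp \<eta> (h i)) y = \<psi> y * indicator (supp \<eta> (h i)) y"
        using iter_invariant[OF \<psi>, of n] by eventually_elim simp
    qed (use \<psi> iter_integrable[OF \<psi>(1), of n] in auto)
    then show ?thesis using ulim[OF i \<psi>(1)] LIMSEQ_unique[OF _ tendsto_const] unfolding l_def by simp
  qed
  define R where "R \<phi> = (\<lambda>y. \<Sum>i<r. l i \<phi> * h i y)" for \<phi>
  have Ri: "integrable \<eta> (R \<phi>)" for \<phi>
    unfolding R_def by (intro Bochner_Integration.integrable_sum integrable_mult_right hd(1)) auto
  let ?d = "\<lambda>u v. L1_norm \<eta> (\<lambda>y. u y - v y)"
  have R_lip: "?d (R \<phi>) (R \<psi>) \<le> real r * ?d \<phi> \<psi>" if \<phi>: "integrable \<eta> \<phi>" and \<psi>: "integrable \<eta> \<psi>" for \<phi> \<psi>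
  proof -
    have "R \<phi> y - R \<psi> y = (\<Sum>i<r. l i (\<lambda>y. \<phi> y - \<psi> y) * h i y)" for y
      unfolding R_def sum_subtractf[symmetric]
      by (rule sum.cong) (simp_all add: l_diff[OF _ \<phi> \<psi>] left_diff_distrib)
    then have "?d (R \<phi>) (R \<psi>) = L1_norm \<eta> (\<lambda>y. \<Sum>i<r. l i (\<lambda>y. \<phi> y - \<psi> y) * h i y)" by simp
    also have "\<dots> \<le> (\<Sum>i<r. L1_norm \<eta> (\<lambda>y. l i (\<lambda>y. \<phi> y - \<psi> y) * h i y))"
      using hd(1) by (intro L1_norm_sum_le) auto
    also have "\<dots> \<le> (\<Sum>i<r. ?d \<phi> \<psi>)"
    proof (rule sum_mono)
      fix i assume "i \<in> {..<r}"
      then have i: "i < r" by simp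
      have "h i \<in> densities \<eta>" using inv[OF i] unfolding invariant_density_def by simp
      then have "L1_norm \<eta> (h i) = 1" by (rule densitiesD(4))
      then show "L1_norm \<eta> (\<lambda>y. l i (\<lambda>y. \<phi> y - \<psi> y) * h i y) \<le> ?d \<phi> \<psi>"
        unfolding L1_norm_scale using l_bound[OF i, of "\<lambda>y. \<phi> y - \<psi> y"] that by simp
    qed
    finally show ?thesis by simp
  qed
  define G where "G \<phi> \<longleftrightarrow> (\<lambda>n. ?d (cesaro L n \<phi>) (R \<phi>)) \<longlonglongrightarrow> 0" for \<phi>
  have closure: "G \<phi>" if \<phi>: "integrable \<eta> \<phi>"
    and approx: "\<And>e. 0 < e \<Longrightarrow> \<exists>k \<psi>. integrable \<eta> \<psi> \<and> G \<psi> \<and> ?d ((L ^^ k) \<phi>) \<psi> < e" for \<phi>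
    unfolding G_def
  proof (rule LIMSEQ_I)
    fix e :: real assume e: "0 < e"
    \<comment> \<open>Three of the distances below are at most \<open>e'\<close> each, and \<open>R\<close> has Lipschitz constant \<open>r\<close>.\<close>
    define e' where "e' = e / (4 + real r)"
    have e': "0 < e'" "(3 + real r) * e' < e" unfolding e'_def using e by (auto simp: field_simps)
    obtain k \<psi> where \<psi>: "integrable \<eta> \<psi>" "G \<psi>" "?d ((L ^^ k) \<phi>) \<psi> < e'" using approx[OF e'(1)] by blast
    have ik: "integrable \<eta> ((L ^^ k) \<phi>)" by (rule iter_integrable[OF \<phi>])
    have "eventually (\<lambda>n. ?d (cesaro L n \<psi>) (R \<psi>) < e') sequentially"
      using \<psi>(2) e'(1) unfolding G_def by (rule order_tendstoD(2))
    moreover have "eventually (\<lambda>n. ?d (cesaro L n ((L ^^ k) \<phi>)) (cesaro L n \<phi>) < e') sequentially"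
      using cesaro_shift_limit[OF \<phi>] e'(1) by (rule order_tendstoD(2))
    moreover have "eventually (\<lambda>n. 0 < n) sequentially" by (rule eventually_gt_at_top)
    ultimately have "eventually (\<lambda>n. ?d (cesaro L n \<phi>) (R \<phi>) < e) sequentially"
    proof eventually_elim
      case (elim n)
      interpret C: markov_operator \<eta> "cesaro L n" "cesaro U n" using elim(3) by (rule markov_operator_cesaro)
      note [simp] = \<phi> \<psi>(1) ik cesaro_integrable Ri
      have RR: "R ((L ^^ k) \<phi>) = R \<phi>" unfolding R_def using \<phi> by (auto simp: l_iter)
      have "?d (cesaro L n \<phi>) (R \<phi>) \<le> ?d (cesaro L n \<phi>) (cesaro L n ((L ^^ k) \<phi>)) + ?d (cesaro L n ((L ^^ k) \<phi>)) (R \<phi>)"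
        by (intro L1_dist_triangle) auto
      moreover have "?d (cesaro L n ((L ^^ k) \<phi>)) (R \<phi>) \<le> ?d (cesaro L n ((L ^^ k) \<phi>)) (cesaro L n \<psi>) + ?d (cesaro L n \<psi>) (R \<phi>)"
        by (intro L1_dist_triangle) auto
      moreover have "?d (cesaro L n \<psi>) (R \<phi>) \<le> ?d (cesaro L n \<psi>) (R \<psi>) + ?d (R \<psi>) (R \<phi>)"
        by (intro L1_dist_triangle) auto
      moreover have "?d (cesaro L n ((L ^^ k) \<phi>)) (cesaro L n \<psi>) \<le> ?d ((L ^^ k) \<phi>) \<psi>"
        by (intro C.L_norm_diff_le) auto
      moreover have "?d (R \<psi>) (R \<phi>) \<le> real r * e'"
      proof -
        have "?d (R ((L ^^ k) \<phi>)) (R \<psi>) \<le> real r * ?d ((L ^^ k) \<phi>) \<psi>" by (intro R_lip) auto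
        also have "\<dots> \<le> real r * e'" using \<psi>(3) by (intro mult_left_mono) auto
        finally show ?thesis unfolding RR using L1_norm_minus_commute[of \<eta> "R \<phi>" "R \<psi>"] by simp
      qed
      moreover have "(3 + real r) * e' = 3 * e' + real r * e'" by (simp add: algebra_simps)
      ultimately show ?case
        using elim \<psi>(3) e'(2) L1_norm_minus_commute[of \<eta> "cesaro L n \<phi>" "cesaro L n ((L ^^ k) \<phi>)"] by linarith
    qed
    then show "\<exists>no. \<forall>n\<ge>no. norm (?d (cesaro L n \<phi>) (R \<phi>) - 0) < e"
      by (auto simp: eventually_sequentially)
  qed
  have G_dominated: "G \<phi>" if \<phi>: "integrable \<eta> \<phi>" and a: "0 \<le> a" and dom: "AE y in \<eta>. \<bar>\<phi> y\<bar> \<le> a * H y" for \<phi> a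
  proof -
    obtain \<psi> where \<psi>: "integrable \<eta> \<psi>" "AE y in \<eta>. L \<psi> y = \<psi> y" "AE y in \<eta>. \<bar>\<psi> y\<bar> \<le> a * H y"
      "(\<lambda>n. ?d (cesaro L n \<phi>) \<psi>) \<longlonglongrightarrow> 0"
      using cesaro_converges_dominated[OF Hinv a \<phi> dom] by blast
    have "l i \<phi> = l i \<psi>" if i: "i < r" for i
    proof -
      have "(\<lambda>n. l i (cesaro L n \<phi>)) \<longlonglongrightarrow> l i \<psi>"
        unfolding l_def by (rule L1_limit_integral[OF cesaro_integrable[OF \<phi>] \<psi>(1) u(1)[OF i] \<psi>(4)])
      moreover have "(\<lambda>n. l i (cesaro L n \<phi>)) \<longlonglongrightarrow> l i \<phi>"
        by (rule tendsto_eventually)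
          (use eventually_gt_at_top[of 0] in \<open>eventually_elim, simp add: l_cesaro i \<phi>\<close>)
      ultimately show ?thesis using LIMSEQ_unique by blast
    qed
    moreover have "AE y in \<eta>. \<forall>i<r. h i y \<noteq> 0 \<longrightarrow> \<psi> y = l i \<psi> * h i y"
      using ergodic_invariant_proportional[OF erg \<psi>(1,2)] l_inv[OF _ \<psi>(1,2)] by (auto simp: AE_all_countable)
    ultimately have "AE y in \<eta>. \<forall>i<r. h i y \<noteq> 0 \<longrightarrow> \<psi> y = l i \<phi> * h i y" by auto
    then have "AE y in \<eta>. \<psi> y = R \<phi> y"
      using disjAE \<psi>(3)
    proof eventually_elim
      case (elim y)
      show ?case
      proof (cases "\<exists>i<r. h i y \<noteq> 0")
        case True
        then obtain i where i: "i < r" "h i y \<noteq> 0" by auto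
        have "R \<phi> y = (\<Sum>j<r. if j = i then l i \<phi> * h i y else 0)"
          unfolding R_def using elim(2) i by (intro sum.cong) auto
        then show ?thesis using elim(1) i by simp
      next
        case False
        then have "H y = 0" "R \<phi> y = 0" by (auto simp: H_def R_def)
        then show ?thesis using elim(3) by simp
      qed
    qed
    then have "?d (cesaro L n \<phi>) (R \<phi>) = ?d (cesaro L n \<phi>) \<psi>" for n
      using \<psi>(1) cesaro_integrable[OF \<phi>] Ri
      by (intro L1_norm_cong_AE) (auto intro!: borel_measurable_diff elim: eventually_mono)
    then show ?thesis using \<psi>(4) unfolding G_def by simp
  qed
  have G_supported: "G \<phi>" if \<phi>: "integrable \<eta> \<phi>" and off: "AE y in \<eta>. H y = 0 \<longrightarrow> \<phi> y = 0" for \<phi>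
  proof (rule closure[OF \<phi>])
    fix e :: real assume e: "0 < e"
    have [measurable]: "\<phi> \<in> borel_measurable \<eta>" "H \<in> borel_measurable \<eta>" using \<phi> Hd by auto
    \<comment> \<open>truncation at height \<open>k H\<close>\<close>
    define \<psi> where "\<psi> k = (\<lambda>y. max (- real k * H y) (min (real k * H y) (\<phi> y)))" for k :: nat
    have \<psi>i: "integrable \<eta> (\<psi> k)" for k
      unfolding \<psi>_def using \<phi> Hd by (intro integrable_max integrable_min integrable_mult_right)
    have \<psi>G: "G (\<psi> k)" for k
    proof (rule G_dominated[OF \<psi>i, of "real k"])
      show "AE y in \<eta>. \<bar>\<psi> k y\<bar> \<le> real k * H y"
        using Hd(2)
      proof eventually_elim
        case (elim y)
        then have "0 \<le> real k * H y" by simp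
        then show ?case by (simp add: \<psi>_def)
      qed
    qed simp
    have "(\<lambda>k. LINT y|\<eta>. \<bar>\<phi> y - \<psi> k y\<bar>) \<longlonglongrightarrow> (LINT y|\<eta>. 0)"
    proof (rule integral_dominated_convergence[where w = "\<lambda>y. \<bar>\<phi> y\<bar>"])
      show "AE y in \<eta>. (\<lambda>k. \<bar>\<phi> y - \<psi> k y\<bar>) \<longlonglongrightarrow> 0"
        using Hd(2) off
      proof eventually_elim
        case (elim y)
        show ?case
        proof (cases "H y = 0")
          case False
          then have Hy: "0 < H y" using elim by simp
          obtain k0 :: nat where k0: "\<bar>\<phi> y\<bar> / H y < real k0" using reals_Archimedean2 by blast
          show ?thesis
          proof (rule tendsto_eventually)
            show "eventually (\<lambda>k. \<bar>\<phi> y - \<psi> k y\<bar> = 0) sequentially"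
              using eventually_ge_at_top[of k0]
            proof eventually_elim
              case (elim k)
              have "\<bar>\<phi> y\<bar> / H y \<le> real k" using k0 elim by linarith
              then have "\<bar>\<phi> y\<bar> \<le> real k * H y" using Hy by (simp add: pos_divide_le_eq)
              then show ?case by (simp add: \<psi>_def)
            qed
          qed
        qed (use elim in \<open>simp add: \<psi>_def\<close>)
      qed
      show "AE y in \<eta>. norm \<bar>\<phi> y - \<psi> k y\<bar> \<le> \<bar>\<phi> y\<bar>" for k
        using Hd(2)
      proof eventually_elim
        case (elim y)
        then have "0 \<le> real k * H y" by simp
        then show ?case by (simp add: \<psi>_def max_def min_def)
      qed
    qed (use \<phi> \<psi>i in auto)
    then have "(\<lambda>k. ?d \<phi> (\<psi> k)) \<longlonglongrightarrow> 0" unfolding L1_norm_def by simp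
    from order_tendstoD(2)[OF this e] obtain k where "?d \<phi> (\<psi> k) < e"
      by (auto simp: eventually_sequentially)
    then show "\<exists>k \<psi>. integrable \<eta> \<psi> \<and> G \<psi> \<and> ?d ((L ^^ k) \<phi>) \<psi> < e"
      using \<psi>i \<psi>G by (intro exI[of _ 0] exI[of _ "\<psi> k"]) simp
  qed
  have G_all: "G \<phi>" if \<phi>: "integrable \<eta> \<phi>" for \<phi>
  proof (rule closure[OF \<phi>])
    fix e :: real assume e: "0 < e"
    have [measurable]: "\<phi> \<in> borel_measurable \<eta>" using \<phi> by simp
    define P where "P n = (U ^^ n) (indicator S)" for n
    have Pb: "P n \<in> bmeas \<eta>" for n unfolding P_def by (rule iter_U_indicator(1)[OF Sm])
    then have [measurable]: "P n \<in> borel_measurable \<eta>" for n by (rule bmeas_measurable)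
    have bounds: "AE y in \<eta>. \<forall>n. 0 \<le> P n y \<and> P n y \<le> 1" unfolding P_def by (rule iter_U_indicator(2)[OF Sm])
    have "AE y in \<eta>. \<forall>n. dual_op \<eta> (L ^^ n) (indicator S) y = P n y"
      unfolding AE_all_countable P_def
      using Sm markov_operator.dual_op_AE[OF markov_operator_iter] by auto
    then have P1: "AE y in \<eta>. (\<lambda>n. P n y) \<longlonglongrightarrow> 1"
      using maxsupp unfolding H_def[symmetric] S_def[symmetric] by eventually_elim simp
    have "(\<lambda>n. LINT y|\<eta>. \<bar>\<phi> y\<bar> * P n y) \<longlonglongrightarrow> (LINT y|\<eta>. \<bar>\<phi> y\<bar> * 1)"
    proof (rule integral_dominated_convergence[where w = "\<lambda>y. \<bar>\<phi> y\<bar>"])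
      show "AE y in \<eta>. (\<lambda>n. \<bar>\<phi> y\<bar> * P n y) \<longlonglongrightarrow> \<bar>\<phi> y\<bar> * 1"
        using P1 by eventually_elim (rule tendsto_mult_left)
      show "AE y in \<eta>. norm (\<bar>\<phi> y\<bar> * P n y) \<le> \<bar>\<phi> y\<bar>" for n
        using bounds by eventually_elim (auto simp: abs_mult intro: mult_left_le)
    qed (use \<phi> in auto)
    then have "(\<lambda>n. LINT y|\<eta>. \<bar>\<phi> y\<bar> * P n y) \<longlonglongrightarrow> L1_norm \<eta> \<phi>" unfolding L1_norm_def by simp
    from order_tendstoD(1)[OF this, of "L1_norm \<eta> \<phi> - e"] e
    obtain n where n: "L1_norm \<eta> \<phi> - e < (LINT y|\<eta>. \<bar>\<phi> y\<bar> * P n y)"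
      by (auto simp: eventually_sequentially)
    interpret I: markov_operator \<eta> "L ^^ n" "U ^^ n" by (rule markov_operator_iter)
    define \<psi> where "\<psi> = (\<lambda>y. (L ^^ n) \<phi> y * indicator S y)"
    have Li: "integrable \<eta> ((L ^^ n) \<phi>)" by (rule I.L_integrable[OF \<phi>])
    have \<psi>i: "integrable \<eta> \<psi>" unfolding \<psi>_def using Li by (intro integrable_real_mult_indicator) auto
    have "G \<psi>" by (rule G_supported[OF \<psi>i]) (auto simp: \<psi>_def S_def supp_def)
    moreover have "?d ((L ^^ n) \<phi>) \<psi> < e"
    proof -
      have abs_i: "integrable \<eta> (\<lambda>y. \<bar>\<phi> y\<bar>)" using \<phi> by simp
      have iS: "integrable \<eta> (\<lambda>y. (L ^^ n) (\<lambda>y. \<bar>\<phi> y\<bar>) y * indicator S y)"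
        using I.L_integrable[OF abs_i] by (intro integrable_real_mult_indicator) auto
      have "?d ((L ^^ n) \<phi>) \<psi> \<le> (LINT y|\<eta>. (L ^^ n) (\<lambda>y. \<bar>\<phi> y\<bar>) y - (L ^^ n) (\<lambda>y. \<bar>\<phi> y\<bar>) y * indicator S y)"
        unfolding L1_norm_def
      proof (rule integral_mono_AE)
        show "AE y in \<eta>. \<bar>(L ^^ n) \<phi> y - \<psi> y\<bar> \<le> (L ^^ n) (\<lambda>y. \<bar>\<phi> y\<bar>) y - (L ^^ n) (\<lambda>y. \<bar>\<phi> y\<bar>) y * indicator S y"
          using I.L_abs_le[OF \<phi>] by eventually_elim (auto simp: \<psi>_def indicator_def)
      qed (use Li \<psi>i iS I.L_integrable[OF abs_i] in auto)
      also have "\<dots> = (LINT y|\<eta>. (L ^^ n) (\<lambda>y. \<bar>\<phi> y\<bar>) y) - (LINT y|\<eta>. (L ^^ n) (\<lambda>y. \<bar>\<phi> y\<bar>) y * indicator S y)"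
        using iS I.L_integrable[OF abs_i] by simp
      also have "\<dots> = L1_norm \<eta> \<phi> - (LINT y|\<eta>. \<bar>\<phi> y\<bar> * P n y)"
        using I.L_integral[OF abs_i] I.duality[OF abs_i bmeas_indicator[OF Sm]] unfolding L1_norm_def P_def by simp
      finally show ?thesis using n by linarith
    qed
    ultimately show "\<exists>k \<psi>. integrable \<eta> \<psi> \<and> G \<psi> \<and> ?d ((L ^^ k) \<phi>) \<psi> < e" using \<psi>i by blast
  qed
  have "positive_bounded_functional \<eta> (l i)" if i: "i < r" for i
    unfolding positive_bounded_functional_def
  proof (intro conjI allI ballI impI)
    fix \<phi> \<psi> :: "'y \<Rightarrow> real" assume "\<phi> \<in> L1 \<eta>" "\<psi> \<in> L1 \<eta>"
    then show "l i (\<lambda>y. \<phi> y + \<psi> y) = l i \<phi> + l i \<psi>"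
      unfolding l_def using il[OF i, of \<phi>] il[OF i, of \<psi>] by (simp add: distrib_right)
  next
    fix c :: real and \<phi> :: "'y \<Rightarrow> real"
    show "l i (\<lambda>y. c * \<phi> y) = c * l i \<phi>" unfolding l_def by (simp add: mult.assoc)
  next
    show "\<exists>C. \<forall>\<phi>\<in>L1 \<eta>. \<bar>l i \<phi>\<bar> \<le> C * L1_norm \<eta> \<phi>" using l_bound[OF i] by (intro exI[of _ 1]) auto
  next
    fix \<phi> :: "'y \<Rightarrow> real" assume "AE y in \<eta>. 0 \<le> \<phi> y"
    then show "0 \<le> l i \<phi>" unfolding l_def using u(2)[OF i] by (intro integral_nonneg_AE) (auto elim: eventually_mono)
  qed
  then show ?thesis
    unfolding APM_def using erg disj G_all unfolding G_def R_def
    by (intro exI[of _ r] exI[of _ h] exI[of _ l]) auto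
qed

end

section \<open>Compactness of finite-dimensional boxes\<close>

text \<open>Adding one coefficient at a time exhibits the box as a continuous image of a product of compact sets.\<close>

lemma compactin_L1_box:
  fixes h :: "nat \<Rightarrow> 'y \<Rightarrow> real"
  assumes "\<And>i. i < r \<Longrightarrow> integrable \<eta> (h i)"
  shows "compactin (L1_topology \<eta>) {\<phi>. \<exists>c. (\<forall>i<r. \<bar>c i\<bar> \<le> C) \<and> \<phi> = (\<lambda>y. \<Sum>i<r. c i * h i y)}"
  using assms
proof (induction r)
  case 0
  have "{\<phi>. \<exists>c::nat \<Rightarrow> real. (\<forall>i<0. \<bar>c i\<bar> \<le> C) \<and> \<phi> = (\<lambda>y. \<Sum>i<0. c i * h i y)} = {\<lambda>y. 0}" by auto
  then show ?case by (simp add: compactin_sing)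
next
  case (Suc r)
  let ?K = "\<lambda>r. {\<phi>. \<exists>c. (\<forall>i<r. \<bar>c i\<bar> \<le> C) \<and> \<phi> = (\<lambda>y. \<Sum>i<r. c i * h i y)}"
  let ?f = "\<lambda>(\<phi>, c) y. \<phi> y + c * h r y"
  have hr: "integrable \<eta> (h r)" using Suc by simp
  have "compactin (prod_topology (L1_topology \<eta>) euclideanreal) (?K r \<times> {- C..C})"
    using Suc by (simp add: compactin_Times)
  moreover have "continuous_map (prod_topology (L1_topology \<eta>) euclideanreal) (L1_topology \<eta>) ?f"
    unfolding continuous_map_def
  proof (intro conjI allI impI)
    show "?f \<in> topspace (prod_topology (L1_topology \<eta>) euclideanreal) \<rightarrow> topspace (L1_topology \<eta>)"
      using hr by auto
    fix V assume V: "openin (L1_topology \<eta>) V"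
    show "openin (prod_topology (L1_topology \<eta>) euclideanreal) {x \<in> topspace (prod_topology (L1_topology \<eta>) euclideanreal). ?f x \<in> V}"
      unfolding openin_prod_topology_alt
    proof (intro allI impI)
      fix \<phi> c assume "(\<phi>, c) \<in> {x \<in> topspace (prod_topology (L1_topology \<eta>) euclideanreal). ?f x \<in> V}"
      then have \<phi>: "integrable \<eta> \<phi>" and fV: "(\<lambda>y. \<phi> y + c * h r y) \<in> V" by auto
      obtain e where e: "0 < e" "\<And>\<psi>. integrable \<eta> \<psi> \<Longrightarrow> L1_norm \<eta> (\<lambda>y. \<psi> y - (\<phi> y + c * h r y)) < e \<Longrightarrow> \<psi> \<in> V"
        using V fV unfolding openin_L1_topology by fastforce
      define N where "N = L1_norm \<eta> (h r) + 1"
      have N: "0 < N" unfolding N_def using L1_norm_nonneg[of \<eta> "h r"] by linarith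
      let ?U = "{\<psi> \<in> L1 \<eta>. L1_norm \<eta> (\<lambda>y. \<psi> y - \<phi> y) < e / 2}"
      let ?W = "ball c (e / (2 * N))"
      have "?U \<times> ?W \<subseteq> {x \<in> topspace (prod_topology (L1_topology \<eta>) euclideanreal). ?f x \<in> V}"
      proof
        fix x assume "x \<in> ?U \<times> ?W"
        then obtain \<psi> b where x: "x = (\<psi>, b)"
          and \<psi>: "\<psi> \<in> L1 \<eta>" "L1_norm \<eta> (\<lambda>y. \<psi> y - \<phi> y) < e / 2" and b: "b \<in> ?W" by auto
        have "\<bar>b - c\<bar> * N < e / 2" using b N by (simp add: dist_real_def abs_minus_commute pos_less_divide_eq mult_ac)
        moreover have "\<bar>b - c\<bar> * L1_norm \<eta> (h r) \<le> \<bar>b - c\<bar> * N" unfolding N_def by (intro mult_left_mono) auto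
        moreover have "L1_norm \<eta> (\<lambda>y. (\<psi> y - \<phi> y) + (b - c) * h r y) \<le> L1_norm \<eta> (\<lambda>y. \<psi> y - \<phi> y) + L1_norm \<eta> (\<lambda>y. (b - c) * h r y)"
          using \<psi> \<phi> hr by (intro L1_norm_triangle) auto
        ultimately have "L1_norm \<eta> (\<lambda>y. (\<psi> y - \<phi> y) + (b - c) * h r y) < e"
          using \<psi>(2) unfolding L1_norm_scale by linarith
        then have "L1_norm \<eta> (\<lambda>y. (\<psi> y + b * h r y) - (\<phi> y + c * h r y)) < e"
          by (simp add: algebra_simps)
        then have "(\<lambda>y. \<psi> y + b * h r y) \<in> V" using \<psi> hr by (intro e(2)) auto
        then show "x \<in> {x \<in> topspace (prod_topology (L1_topology \<eta>) euclideanreal). ?f x \<in> V}"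
          using \<psi> by (simp add: x)
      qed
      moreover have "openin (L1_topology \<eta>) ?U" by (rule openin_L1_ball[OF \<phi>])
      moreover have "openin euclideanreal ?W" by simp
      moreover have "\<phi> \<in> ?U" "c \<in> ?W" using \<phi> e(1) N by (auto simp: L1_norm_def)
      ultimately show "\<exists>U W. openin (L1_topology \<eta>) U \<and> openin euclideanreal W \<and> \<phi> \<in> U \<and> c \<in> W \<and>
          U \<times> W \<subseteq> {x \<in> topspace (prod_topology (L1_topology \<eta>) euclideanreal). ?f x \<in> V}" by blast
    qed
  qed
  ultimately have "compactin (L1_topology \<eta>) (?f ` (?K r \<times> {- C..C}))" by (rule image_compactin)
  moreover have "?f ` (?K r \<times> {- C..C}) = ?K (Suc r)"
  proof (intro equalityI subsetI)
    fix \<xi> assume "\<xi> \<in> ?f ` (?K r \<times> {- C..C})"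
    then obtain c b where "\<forall>i<r. \<bar>c i\<bar> \<le> C" "- C \<le> b" "b \<le> C" "\<xi> = (\<lambda>y. (\<Sum>i<r. c i * h i y) + b * h r y)" by auto
    then show "\<xi> \<in> ?K (Suc r)" by (auto intro!: exI[of _ "c(r := b)"] simp: abs_le_iff)
  next
    fix \<xi> assume "\<xi> \<in> ?K (Suc r)"
    then obtain c where c: "\<forall>i<Suc r. \<bar>c i\<bar> \<le> C" "\<xi> = (\<lambda>y. \<Sum>i<Suc r. c i * h i y)" by auto
    then have "\<xi> = ?f ((\<lambda>y. \<Sum>i<r. c i * h i y), c r)" by simp
    moreover have "((\<lambda>y. \<Sum>i<r. c i * h i y), c r) \<in> ?K r \<times> {- C..C}"
    proof (rule SigmaI)
      show "(\<lambda>y. \<Sum>i<r. c i * h i y) \<in> ?K r" using c(1) by (intro CollectI exI[of _ c]) simp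
      show "c r \<in> {- C..C}" using c(1) by (auto simp: abs_le_iff)
    qed
    ultimately show "\<xi> \<in> ?f ` (?K r \<times> {- C..C})" by blast
  qed
  ultimately show ?case by simp
qed

context markov_operator
begin

theorem APM_imp_MC:
  assumes APM: "APM \<eta> L"
  shows "MC \<eta> L"
proof -
  obtain r :: nat and h l where *: "\<forall>i<r. ergodic_density \<eta> L (h i)" "\<forall>i<r. positive_bounded_functional \<eta> (l i)"
    "\<forall>\<phi>\<in>L1 \<eta>. (\<lambda>n. L1_norm \<eta> (\<lambda>y. cesaro L n \<phi> y - (\<Sum>i<r. l i \<phi> * h i y))) \<longlonglongrightarrow> 0"
    using APM unfolding APM_def by (elim exE conjE) (rule that)
  then have erg: "\<And>i. i < r \<Longrightarrow> ergodic_density \<eta> L (h i)"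
    and l: "\<And>i. i < r \<Longrightarrow> positive_bounded_functional \<eta> (l i)"
    and lim: "\<And>\<phi>. integrable \<eta> \<phi> \<Longrightarrow> (\<lambda>n. L1_norm \<eta> (\<lambda>y. cesaro L n \<phi> y - (\<Sum>i<r. l i \<phi> * h i y))) \<longlonglongrightarrow> 0"
    by simp_all
  have hi: "integrable \<eta> (h i)" if "i < r" for i
    using erg[OF that] invariant_densityD(1) unfolding ergodic_density_iff by auto
  have "\<forall>i\<in>{..<r}. \<exists>C. \<forall>\<phi>\<in>L1 \<eta>. \<bar>l i \<phi>\<bar> \<le> C * L1_norm \<eta> \<phi>"
    using l unfolding positive_bounded_functional_def by auto
  from bchoice[OF this] obtain B where "\<forall>i\<in>{..<r}. \<forall>\<phi>\<in>L1 \<eta>. \<bar>l i \<phi>\<bar> \<le> B i * L1_norm \<eta> \<phi>"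
    by (elim exE)
  then have B: "\<And>i \<phi>. i < r \<Longrightarrow> integrable \<eta> \<phi> \<Longrightarrow> \<bar>l i \<phi>\<bar> \<le> B i * L1_norm \<eta> \<phi>"
    by simp
  define C where "C = (\<Sum>i<r. \<bar>B i\<bar>)"
  define K where "K = {\<phi>. \<exists>c. (\<forall>i<r. \<bar>c i\<bar> \<le> C) \<and> \<phi> = (\<lambda>y. \<Sum>i<r. c i * h i y)}"
  have K: "compactin (L1_topology \<eta>) K" unfolding K_def by (rule compactin_L1_box[OF hi])
  have "0 \<le> C" unfolding C_def by (simp add: sum_nonneg)
  then have "(\<lambda>y. \<Sum>i<r. 0 * h i y) \<in> K"
    unfolding K_def by (intro CollectI exI[of _ "\<lambda>_. 0"]) simp
  then have ne: "K \<noteq> {}" by blast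
  have "(\<lambda>n. INF \<psi>\<in>K. L1_norm \<eta> (\<lambda>y. cesaro L n d y - \<psi> y)) \<longlonglongrightarrow> 0" if d: "d \<in> densities \<eta>" for d
  proof -
    note dd = densitiesD[OF d]
    define \<psi> where "\<psi> = (\<lambda>y. \<Sum>i<r. l i d * h i y)"
    have "\<bar>l i d\<bar> \<le> C" if i: "i < r" for i
    proof -
      have "\<bar>l i d\<bar> \<le> \<bar>B i\<bar>" using B[OF i dd(1)] dd(4) by simp
      also have "\<dots> \<le> C" unfolding C_def using i by (intro member_le_sum) auto
      finally show ?thesis .
    qed
    then have \<psi>K: "\<psi> \<in> K" unfolding K_def \<psi>_def by (intro CollectI exI[of _ "\<lambda>i. l i d"]) auto
    show ?thesis
    proof (rule tendsto_sandwich[OF _ _ tendsto_const lim[OF dd(1)]])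
      show "eventually (\<lambda>n. 0 \<le> (INF \<psi>\<in>K. L1_norm \<eta> (\<lambda>y. cesaro L n d y - \<psi> y))) sequentially"
        using ne by (intro always_eventually allI cINF_greatest) auto
      show "eventually (\<lambda>n. (INF \<psi>\<in>K. L1_norm \<eta> (\<lambda>y. cesaro L n d y - \<psi> y))
          \<le> L1_norm \<eta> (\<lambda>y. cesaro L n d y - (\<Sum>i<r. l i d * h i y))) sequentially"
      proof (intro always_eventually allI)
        fix n
        have "bdd_below ((\<lambda>\<psi>. L1_norm \<eta> (\<lambda>y. cesaro L n d y - \<psi> y)) ` K)"
          by (rule bdd_belowI2[of _ 0]) simp
        from cINF_lower[OF this \<psi>K] show "(INF \<psi>\<in>K. L1_norm \<eta> (\<lambda>y. cesaro L n d y - \<psi> y))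
          \<le> L1_norm \<eta> (\<lambda>y. cesaro L n d y - (\<Sum>i<r. l i d * h i y))" unfolding \<psi>_def .
      qed
    qed
  qed
  then show ?thesis unfolding MC_def using K ne by blast
qed

end

section \<open>Transfer operators of push-forwards\<close>

text \<open>
  A common frame for the annealed push-forward and for the push-forward by a single map: \<open>push\<close> acts on
  finite measures with a density, \<open>U\<close> is the dual action on test functions. The positive part \<open>max 0 w\<close>
  occurs because \<open>ennreal\<close> truncates in the density.
\<close>

locale measure_push = prob_space \<eta> for \<eta> :: "'y measure" +
  fixes push :: "'y measure \<Rightarrow> 'y measure" and U :: "('y \<Rightarrow> real) \<Rightarrow> 'y \<Rightarrow> real"
  assumes push_U_bmeas: "g \<in> bmeas \<eta> \<Longrightarrow> U g \<in> bmeas \<eta>"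
    and push_U_indicator_nonneg: "A \<in> sets \<eta> \<Longrightarrow> AE y in \<eta>. 0 \<le> U (indicator A) y"
    and push_U_one: "AE y in \<eta>. U (\<lambda>_. 1) y = 1"
    and push_sets: "integrable \<eta> w \<Longrightarrow> sets (push (density \<eta> (\<lambda>y. ennreal (w y)))) = sets \<eta>"
    and push_finite: "integrable \<eta> w \<Longrightarrow> finite_measure (push (density \<eta> (\<lambda>y. ennreal (w y))))"
    and push_ac: "integrable \<eta> w \<Longrightarrow> absolutely_continuous \<eta> (push (density \<eta> (\<lambda>y. ennreal (w y))))"
    and push_integral: "integrable \<eta> w \<Longrightarrow> g \<in> bmeas \<eta> \<Longrightarrow>
        (LINT y|push (density \<eta> (\<lambda>y. ennreal (w y))). g y) = (LINT y|\<eta>. max 0 (w y) * U g y)"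
begin

abbreviation "L \<equiv> transfer_op \<eta> push"

lemma push_RN_deriv:
  assumes w: "integrable \<eta> w"
  defines "D \<equiv> \<lambda>y. enn2real (RN_deriv \<eta> (push (density \<eta> (\<lambda>y. ennreal (w y)))) y)"
  shows "integrable \<eta> D"
    and "g \<in> bmeas \<eta> \<Longrightarrow> (LINT y|\<eta>. D y * g y) = (LINT y|\<eta>. max 0 (w y) * U g y)"
proof -
  let ?N = "push (density \<eta> (\<lambda>y. ennreal (w y)))"
  interpret N: finite_measure ?N by (rule push_finite[OF w])
  have sf: "sigma_finite_measure ?N" by unfold_locales
  note rn = sf push_ac[OF w] push_sets[OF w]
  have "integrable ?N (\<lambda>_. 1::real)" by simp
  then show "integrable \<eta> D" using RN_deriv_integrable[OF rn, of "\<lambda>_. 1"] unfolding D_def by simp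
  assume g: "g \<in> bmeas \<eta>"
  then show "(LINT y|\<eta>. D y * g y) = (LINT y|\<eta>. max 0 (w y) * U g y)"
    using RN_deriv_integral[OF rn, of g] push_integral[OF w g] bmeas_measurable[OF g] unfolding D_def by simp
qed

sublocale markov_operator \<eta> L U
proof unfold_locales
  fix \<phi> :: "'y \<Rightarrow> real" assume \<phi>: "integrable \<eta> \<phi>"
  then have \<phi>': "integrable \<eta> (\<lambda>y. - \<phi> y)" by simp
  note D1 = push_RN_deriv[OF \<phi>] and D2 = push_RN_deriv[OF \<phi>']
  show "integrable \<eta> (L \<phi>)"
    unfolding transfer_op_def by (intro Bochner_Integration.integrable_diff D1(1) D2(1))
  fix g :: "'y \<Rightarrow> real" assume g: "g \<in> bmeas \<eta>"
  have "(LINT y|\<eta>. L \<phi> y * g y) = (LINT y|\<eta>. max 0 (\<phi> y) * U g y) - (LINT y|\<eta>. max 0 (- \<phi> y) * U g y)"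
    unfolding transfer_op_def left_diff_distrib
    using integrable_mult_bmeas[OF D1(1) g] integrable_mult_bmeas[OF D2(1) g] D1(2)[OF g] D2(2)[OF g] by simp
  also have "\<dots> = (LINT y|\<eta>. max 0 (\<phi> y) * U g y - max 0 (- \<phi> y) * U g y)"
    using integrable_mult_bmeas[OF _ push_U_bmeas[OF g], of "\<lambda>y. max 0 (\<phi> y)"]
      integrable_mult_bmeas[OF _ push_U_bmeas[OF g], of "\<lambda>y. max 0 (- \<phi> y)"] \<phi> by simp
  also have "\<dots> = (LINT y|\<eta>. \<phi> y * U g y)"
    by (rule Bochner_Integration.integral_cong) (auto simp: max_def)
  finally show "(LINT y|\<eta>. L \<phi> y * g y) = (LINT y|\<eta>. \<phi> y * U g y)" .
qed (use push_U_bmeas push_U_indicator_nonneg push_U_one in auto)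

text \<open>Invariant densities are the densities of invariant measures.\<close>

lemma invariant_iff_push:
  assumes h: "integrable \<eta> h" "AE y in \<eta>. 0 \<le> h y"
  shows "(AE y in \<eta>. L h y = h y) \<longleftrightarrow>
    push (density \<eta> (\<lambda>y. ennreal (h y))) = density \<eta> (\<lambda>y. ennreal (h y))"
proof -
  let ?D = "density \<eta> (\<lambda>y. ennreal (h y))"
  interpret N: finite_measure "push ?D" by (rule push_finite[OF h(1)])
  have fin: "emeasure ?D A \<noteq> \<infinity>" if A: "A \<in> sets \<eta>" for A
  proof -
    have "emeasure ?D A \<le> emeasure ?D (space \<eta>)" using sets.sets_into_space[OF A] by (intro emeasure_mono) auto
    also have "\<dots> = (\<integral>\<^sup>+y. ennreal (h y) \<partial>\<eta>)" using h(1)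
      by (subst emeasure_density) (auto intro!: nn_integral_cong)
    also have "\<dots> < \<infinity>" using h nn_integral_eq_integral[OF h] by simp
    finally show ?thesis by simp
  qed
  have D: "measure ?D A = (LINT y|\<eta>. h y * indicator A y)" if "A \<in> sets \<eta>" for A
    using measure_density_eq_integral[OF h that] .
  have P: "measure (push ?D) A = (LINT y|\<eta>. L h y * indicator A y)" if A: "A \<in> sets \<eta>" for A
  proof -
    have "measure (push ?D) A = (LINT y|push ?D. indicator A y)" using A push_sets[OF h(1)] by simp
    also have "\<dots> = (LINT y|\<eta>. max 0 (h y) * U (indicator A) y)"
      using push_integral[OF h(1), of "indicator A"] A by simp
    also have "\<dots> = (LINT y|\<eta>. h y * U (indicator A) y)"
    proof (rule integral_cong_AE)
      have [measurable]: "U (indicator A) \<in> borel_measurable \<eta>" "h \<in> borel_measurable \<eta>"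
        using h(1) bmeas_measurable[OF U_bmeas[OF bmeas_indicator[OF A]]] by simp_all
      show "(\<lambda>y. max 0 (h y) * U (indicator A) y) \<in> borel_measurable \<eta>"
        "(\<lambda>y. h y * U (indicator A) y) \<in> borel_measurable \<eta>" by measurable
      show "AE y in \<eta>. max 0 (h y) * U (indicator A) y = h y * U (indicator A) y"
        using h(2) by eventually_elim (simp add: max_def)
    qed
    also have "\<dots> = (LINT y|\<eta>. L h y * indicator A y)" using duality[OF h(1), of "indicator A"] A by simp
    finally show ?thesis .
  qed
  show ?thesis
  proof
    assume inv: "AE y in \<eta>. L h y = h y"
    show "push ?D = ?D"
    proof (rule measure_eqI)
      show "sets (push ?D) = sets ?D" using push_sets[OF h(1)] by simp
      fix A assume "A \<in> sets (push ?D)"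
      then have A [measurable]: "A \<in> sets \<eta>" using push_sets[OF h(1)] by simp
      have "(LINT y|\<eta>. L h y * indicator A y) = (LINT y|\<eta>. h y * indicator A y)"
      proof (rule integral_cong_AE)
        show "AE y in \<eta>. L h y * indicator A y = h y * indicator A y" using inv by eventually_elim simp
      qed (use h L_integrable[OF h(1)] in auto)
      then have "measure (push ?D) A = measure ?D A" using D[OF A] P[OF A] by simp
      then show "emeasure (push ?D) A = emeasure ?D A"
        using fin[OF A] by (simp add: N.emeasure_eq_measure emeasure_eq_ennreal_measure)
    qed
  next
    assume "push ?D = ?D"
    then show "AE y in \<eta>. L h y = h y"
      using D P by (intro AE_eq_by_testing L_integrable h) auto
  qed
qed

end

section \<open>Birkhoff's theorem for bounded observables\<close>

lemma borel_measurable_birkhoff_sum: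
  assumes "g \<in> measurable M M" "\<phi> \<in> borel_measurable M"
  shows "(\<lambda>z. (1 / real n) * (\<Sum>j<n. \<phi> ((g ^^ j) z))) \<in> borel_measurable M"
proof -
  have [measurable]: "(g ^^ j) \<in> measurable M M" for j using assms(1) by (rule measurable_compose_n)
  show ?thesis using assms(2) by measurable
qed

lemma basin_sets:
  assumes g: "g \<in> measurable M M" and \<phi>: "\<phi> \<in> borel_measurable M" and \<nu>: "sets \<nu> = sets M"
  shows "basin g \<nu> \<phi> \<in> sets M"
proof -
  let ?X = "\<lambda>n z. (1 / real n) * (\<Sum>j<n. \<phi> ((g ^^ j) z))"
  have X [measurable]: "?X n \<in> borel_measurable M" for n by (rule borel_measurable_birkhoff_sum[OF g \<phi>])
  have "(\<lambda>n. ?X n z) \<longlonglongrightarrow> c \<longleftrightarrow> Cauchy (\<lambda>n. ?X n z) \<and> lim (\<lambda>n. ?X n z) = c" for z c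
    by (auto simp: Cauchy_convergent_iff convergent_LIMSEQ_iff limI)
  then have "basin g \<nu> \<phi> = {z \<in> space M. Cauchy (\<lambda>n. ?X n z) \<and> lim (\<lambda>n. ?X n z) = (LINT z|\<nu>. \<phi> z)}"
    unfolding basin_def using sets_eq_imp_space_eq[OF \<nu>] by auto
  also have "\<dots> = {z \<in> space M. Cauchy (\<lambda>n. ?X n z)} \<inter> {z \<in> space M. lim (\<lambda>n. ?X n z) = (LINT z|\<nu>. \<phi> z)}" by auto
  also have "\<dots> \<in> sets M"
    by (intro sets.Int sets_Collect_Cauchy X) measurable
  finally show ?thesis .
qed

text \<open>
  The maximum of 0 and the first \<open>n\<close> Birkhoff sums. This recursion is the identity on which the maximal
  ergodic argument rests.
\<close>

primrec birkhoff_max :: "('y \<Rightarrow> 'y) \<Rightarrow> ('y \<Rightarrow> real) \<Rightarrow> nat \<Rightarrow> 'y \<Rightarrow> real" where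
  "birkhoff_max g \<phi> 0 z = 0"
| "birkhoff_max g \<phi> (Suc n) z = max 0 (\<phi> z + birkhoff_max g \<phi> n (g z))"

lemma birkhoff_max_nonneg: "0 \<le> birkhoff_max g \<phi> n z"
  by (cases n) auto

lemma birkhoff_max_mono: "birkhoff_max g \<phi> n z \<le> birkhoff_max g \<phi> (Suc n) z"
proof (induction n arbitrary: z)
  case (Suc n)
  have "\<phi> z + birkhoff_max g \<phi> n (g z) \<le> \<phi> z + birkhoff_max g \<phi> (Suc n) (g z)" using Suc by (rule add_left_mono)
  then show ?case by (simp only: birkhoff_max.simps(2)[of g \<phi> n z] birkhoff_max.simps(2)[of g \<phi> "Suc n" z] max.mono[OF order_refl])
qed simp

lemma birkhoff_sum_le_max: "(\<Sum>j<n. \<phi> ((g ^^ j) z)) \<le> birkhoff_max g \<phi> n z"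
proof (induction n arbitrary: z)
  case (Suc n)
  have "(\<Sum>j<Suc n. \<phi> ((g ^^ j) z)) = \<phi> z + (\<Sum>j<n. \<phi> ((g ^^ j) (g z)))"
    by (simp add: sum.lessThan_Suc_shift funpow_swap1 del: sum.lessThan_Suc)
  also have "\<dots> \<le> \<phi> z + birkhoff_max g \<phi> n (g z)" using Suc by simp
  finally show ?case by simp
qed simp

lemma birkhoff_max_bmeas:
  assumes g: "g \<in> measurable M M" and \<phi>: "\<phi> \<in> bmeas M"
  shows "birkhoff_max g \<phi> n \<in> bmeas M"
proof -
  obtain C where C: "0 \<le> C" "\<And>z. z \<in> space M \<Longrightarrow> \<bar>\<phi> z\<bar> \<le> C" using \<phi> by (metis bmeasE)
  have meas: "birkhoff_max g \<phi> n \<in> borel_measurable M" for n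
  proof (induction n)
    case (Suc n)
    note [measurable] = Suc g bmeas_measurable[OF \<phi>]
    show ?case unfolding birkhoff_max.simps by measurable
  qed (simp add: birkhoff_max.simps(1)[abs_def] cong: measurable_cong)
  have "\<bar>birkhoff_max g \<phi> n z\<bar> \<le> real n * C" if "z \<in> space M" for z
    using that
  proof (induction n arbitrary: z)
    case (Suc n)
    have "birkhoff_max g \<phi> n (g z) \<le> real n * C" using Suc measurable_space[OF g] by (simp add: abs_le_iff)
    then show ?case using C(1) C(2)[OF Suc.prems] by (auto simp: algebra_simps abs_le_iff add_nonneg_nonneg)
  qed simp
  then show ?thesis by (intro bmeasI meas)
qed

text \<open>
  Write \<open>M\<^sub>n\<close> for \<open>birkhoff_max g \<phi> n\<close>. The set on which \<open>M\<^sub>n\<close> is unbounded is invariant, hence null or of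
  full measure. In the second case \<open>M\<^sub>n\<^sub>+\<^sub>1 - M\<^sub>n \<circ> g = max (- M\<^sub>n \<circ> g) \<phi>\<close> tends to \<open>\<phi>\<close> almost everywhere. By
  invariance of the measure its integral is that of \<open>M\<^sub>n\<^sub>+\<^sub>1 - M\<^sub>n\<close>, which is nonnegative, so the integral
  of \<open>\<phi>\<close> could not be negative.
\<close>

lemma ergodic_birkhoff_sum_bounded:
  assumes prob: "prob_space \<nu>" and g: "g \<in> measurable \<nu> \<nu>" and inv: "distr \<nu> \<nu> g = \<nu>"
    and erg: "ergodic g \<nu>" and \<phi>: "\<phi> \<in> bmeas \<nu>" and neg: "(LINT z|\<nu>. \<phi> z) < 0"
  shows "AE z in \<nu>. \<exists>B. \<forall>n. (\<Sum>j<n. \<phi> ((g ^^ j) z)) \<le> B"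
proof -
  interpret prob_space \<nu> by fact
  let ?M = "birkhoff_max g \<phi>"
  note [measurable] = g bmeas_measurable[OF \<phi>] bmeas_measurable[OF birkhoff_max_bmeas[OF g \<phi>]]
  obtain C where C: "0 \<le> C" "\<And>z. z \<in> space \<nu> \<Longrightarrow> \<bar>\<phi> z\<bar> \<le> C" using \<phi> by (metis bmeasE)
  define A where "A = {z \<in> space \<nu>. \<forall>k::nat. \<exists>n. real k < ?M n z}"
  have A [measurable]: "A \<in> sets \<nu>" unfolding A_def by measurable
  have unb: "(\<forall>k::nat. \<exists>n. real k < ?M n z) \<longleftrightarrow> (\<forall>k::nat. \<exists>n. real k < ?M n (g z))" if z: "z \<in> space \<nu>" for z
  proof -
    obtain c :: nat where c: "\<bar>\<phi> z\<bar> \<le> real c" using real_arch_simple by blast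
    show ?thesis
    proof (intro iffI allI)
      fix k :: nat
      assume "\<forall>k::nat. \<exists>n. real k < ?M n z"
      then obtain n where "real (k + c) < ?M n z" by blast
      then have "real (k + c) < ?M (Suc n) z" using birkhoff_max_mono[of g \<phi> n z] by linarith
      then have "real (k + c) < \<phi> z + ?M n (g z)" by (auto simp: max_def split: if_splits)
      then have "real k < ?M n (g z)" using c by simp
      then show "\<exists>n. real k < ?M n (g z)" ..
    next
      fix k :: nat
      assume "\<forall>k::nat. \<exists>n. real k < ?M n (g z)"
      then obtain n where "real (k + c) < ?M n (g z)" by blast
      then have "real k < \<phi> z + ?M n (g z)" using c by simp
      then have "real k < ?M (Suc n) z" by simp
      then show "\<exists>n. real k < ?M n z" ..
    qed
  qed
  have "g -` A \<inter> space \<nu> = A"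
    using unb measurable_space[OF g] unfolding A_def by auto
  then have "measure \<nu> A \<in> {0, 1}" using erg A unfolding ergodic_def by blast
  moreover have "measure \<nu> A \<noteq> 1"
  proof
    assume "measure \<nu> A = 1"
    then have AE_A: "AE z in \<nu>. z \<in> A" using A by (simp add: prob_eq_1)
    have AE_g: "AE z in \<nu>. g z \<in> A"
    proof -
      have "AE z in distr \<nu> \<nu> g. z \<in> A" unfolding inv by (rule AE_A)
      then show ?thesis by (rule AE_distrD[OF g])
    qed
    have iM: "integrable \<nu> (?M n)" for n using birkhoff_max_bmeas[OF g \<phi>] integrable_bmeas by blast
    have eq: "(LINT z|\<nu>. ?M n (g z)) = (LINT z|\<nu>. ?M n z)" for n
      using integral_distr[OF g, of "?M n"] unfolding inv by simp
    have iMg: "integrable \<nu> (\<lambda>z. ?M n (g z))" for n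
      using integrable_distr[OF g, of "?M n"] iM unfolding inv by simp
    have step: "?M (Suc n) z - ?M n (g z) = max (- ?M n (g z)) (\<phi> z)" for n z by (simp add: max_def)
    have nn: "0 \<le> (LINT z|\<nu>. max (- ?M n (g z)) (\<phi> z))" for n
    proof -
      have "(LINT z|\<nu>. max (- ?M n (g z)) (\<phi> z)) = (LINT z|\<nu>. ?M (Suc n) z) - (LINT z|\<nu>. ?M n (g z))"
        unfolding step[symmetric] by (rule Bochner_Integration.integral_diff[OF iM iMg])
      also have "\<dots> = (LINT z|\<nu>. ?M (Suc n) z - ?M n z)"
        unfolding eq by (rule Bochner_Integration.integral_diff[OF iM iM, symmetric])
      also have "0 \<le> \<dots>" by (intro Bochner_Integration.integral_nonneg) (simp add: birkhoff_max_mono del: birkhoff_max.simps)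
      finally show ?thesis .
    qed
    have "(\<lambda>n. LINT z|\<nu>. max (- ?M n (g z)) (\<phi> z)) \<longlonglongrightarrow> (LINT z|\<nu>. \<phi> z)"
    proof (rule integral_dominated_convergence[where w = "\<lambda>_. C"])
      show "AE z in \<nu>. (\<lambda>n. max (- ?M n (g z)) (\<phi> z)) \<longlonglongrightarrow> \<phi> z"
        using AE_g AE_space
      proof eventually_elim
        case (elim z)
        obtain c :: nat where c: "C \<le> real c" using real_arch_simple by blast
        obtain n0 where n0: "real c < ?M n0 (g z)" using elim(1) unfolding A_def by blast
        have "eventually (\<lambda>n. max (- ?M n (g z)) (\<phi> z) = \<phi> z) sequentially"
          using eventually_ge_at_top[of n0]
        proof eventually_elim
          case (elim n)
          have "?M n0 (g z) \<le> ?M n (g z)"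
            by (rule lift_Suc_mono_le[of "\<lambda>n. ?M n (g z)", OF birkhoff_max_mono elim])
          then show ?case using n0 c C(2)[OF \<open>z \<in> space \<nu>\<close>] by (auto simp: max_def)
        qed
        then show ?case by (rule tendsto_eventually)
      qed
      show "AE z in \<nu>. norm (max (- ?M n (g z)) (\<phi> z)) \<le> C" for n
        using AE_space
      proof eventually_elim
        case (elim z)
        show ?case using C(1) C(2)[OF elim] birkhoff_max_nonneg[of g \<phi> n "g z"] by (auto simp: max_def abs_le_iff)
      qed
    qed auto
    then have "0 \<le> (LINT z|\<nu>. \<phi> z)" using nn by (intro LIMSEQ_le_const) auto
    then show False using neg by simp
  qed
  ultimately have "measure \<nu> A = 0" by blast
  then have "AE z in \<nu>. z \<notin> A" using A by (simp add: prob_eq_0)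
  then show ?thesis
    using AE_space
  proof eventually_elim
    case (elim z)
    then have "\<exists>k::nat. \<forall>n. ?M n z \<le> real k" unfolding A_def by (simp add: not_less)
    then obtain k :: nat where "\<forall>n. ?M n z \<le> real k" by (elim exE)
    then have "\<forall>n. (\<Sum>j<n. \<phi> ((g ^^ j) z)) \<le> real k" by (intro allI order_trans[OF birkhoff_sum_le_max]) simp
    then show ?case by blast
  qed
qed

text \<open>Subtracting slightly more than the mean makes the mean negative, and the Birkhoff sums bounded above.\<close>

lemma ergodic_birkhoff_upper:
  assumes prob: "prob_space \<nu>" and g: "g \<in> measurable \<nu> \<nu>" and inv: "distr \<nu> \<nu> g = \<nu>"
    and erg: "ergodic g \<nu>" and \<phi>: "\<phi> \<in> bmeas \<nu>"
  shows "AE z in \<nu>. \<forall>e>0. eventually (\<lambda>n. (1 / real n) * (\<Sum>j<n. \<phi> ((g ^^ j) z)) < (LINT z|\<nu>. \<phi> z) + e) sequentially"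
proof -
  interpret prob_space \<nu> by fact
  let ?I = "LINT z|\<nu>. \<phi> z"
  have i\<phi>: "integrable \<nu> \<phi>" using \<phi> integrable_bmeas by blast
  have "AE z in \<nu>. \<exists>B. \<forall>n. (\<Sum>j<n. \<phi> ((g ^^ j) z) + (- ?I - 1 / real (Suc k))) \<le> B" for k :: nat
  proof (rule ergodic_birkhoff_sum_bounded[OF prob g inv erg, of "\<lambda>z. \<phi> z + (- ?I - 1 / real (Suc k))"])
    show "(\<lambda>z. \<phi> z + (- ?I - 1 / real (Suc k))) \<in> bmeas \<nu>" using \<phi> by (intro bmeas_add bmeas_const)
    show "(LINT z|\<nu>. \<phi> z + (- ?I - 1 / real (Suc k))) < 0" using i\<phi> by (simp add: prob_space)
  qed
  then have "AE z in \<nu>. \<forall>k::nat. \<exists>B. \<forall>n. (\<Sum>j<n. \<phi> ((g ^^ j) z) + (- ?I - 1 / real (Suc k))) \<le> B"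
    by (simp add: AE_all_countable)
  then show ?thesis
  proof eventually_elim
    case (elim z)
    show ?case
    proof (intro allI impI)
      fix e :: real assume e: "0 < e"
      obtain k where k: "1 / real (Suc k) < e / 2" using nat_approx_posE[of "e / 2"] e by auto
      obtain B where B: "\<And>n. (\<Sum>j<n. \<phi> ((g ^^ j) z) + (- ?I - 1 / real (Suc k))) \<le> B" using elim by blast
      obtain N :: nat where N: "2 * \<bar>B\<bar> / e < real N" using reals_Archimedean2 by blast
      show "eventually (\<lambda>n. (1 / real n) * (\<Sum>j<n. \<phi> ((g ^^ j) z)) < ?I + e) sequentially"
        using eventually_ge_at_top[of "Suc N"]
      proof eventually_elim
        case (elim n)
        then have n: "0 < real n" "2 * \<bar>B\<bar> / e < real n" using N by auto
        define d where "d = 1 / real (Suc k)"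
        have "(\<Sum>j<n. \<phi> ((g ^^ j) z)) + real n * (- ?I - d) \<le> B"
          using B[of n] unfolding sum.distrib sum_constant card_lessThan d_def .
        moreover have "B < real n * (e / 2)" using n e by (simp add: pos_divide_less_eq mult.commute)
        moreover have "real n * d < real n * (e / 2)"
          using k n unfolding d_def by (intro mult_strict_left_mono)
        ultimately have "(\<Sum>j<n. \<phi> ((g ^^ j) z)) < real n * (?I + e)" by (simp add: algebra_simps)
        then show ?case using n by (simp add: pos_divide_less_eq mult.commute)
      qed
    qed
  qed
qed

theorem ergodic_birkhoff:
  assumes prob: "prob_space \<nu>" and g: "g \<in> measurable \<nu> \<nu>" and inv: "distr \<nu> \<nu> g = \<nu>"
    and erg: "ergodic g \<nu>" and \<phi>: "\<phi> \<in> bmeas \<nu>"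
  shows "AE z in \<nu>. z \<in> basin g \<nu> \<phi>"
proof -
  have m\<phi>: "(\<lambda>z. (-1) * \<phi> z) \<in> bmeas \<nu>" using \<phi> by (intro bmeas_mult bmeas_const)
  show ?thesis
    using ergodic_birkhoff_upper[OF assms] ergodic_birkhoff_upper[OF prob g inv erg m\<phi>] AE_space
  proof eventually_elim
    case (elim z)
    have "(\<lambda>n. (1 / real n) * (\<Sum>j<n. \<phi> ((g ^^ j) z))) \<longlonglongrightarrow> (LINT z|\<nu>. \<phi> z)"
    proof (rule order_tendstoI)
      fix a assume "(LINT z|\<nu>. \<phi> z) < a"
      then show "eventually (\<lambda>n. (1 / real n) * (\<Sum>j<n. \<phi> ((g ^^ j) z)) < a) sequentially"
        using elim(1)[rule_format, of "a - (LINT z|\<nu>. \<phi> z)"] by simp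
    next
      fix a assume "a < (LINT z|\<nu>. \<phi> z)"
      then have "eventually (\<lambda>n. (1 / real n) * (\<Sum>j<n. (-1) * \<phi> ((g ^^ j) z)) < - a) sequentially"
        using elim(2)[rule_format, of "(LINT z|\<nu>. \<phi> z) - a"] by simp
      then show "eventually (\<lambda>n. a < (1 / real n) * (\<Sum>j<n. \<phi> ((g ^^ j) z))) sequentially"
        by eventually_elim (simp add: sum_negf)
    qed
    then show ?case using elim(3) unfolding basin_def by simp
  qed
qed

text \<open>Moving one step along the orbit changes a Birkhoff average only by two boundary terms.\<close>

lemma basin_invariant:
  assumes g: "g \<in> measurable \<nu> \<nu>" and \<phi>: "\<phi> \<in> bmeas \<nu>" and z: "z \<in> space \<nu>"
  shows "g z \<in> basin g \<nu> \<phi> \<longleftrightarrow> z \<in> basin g \<nu> \<phi>"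
proof -
  obtain C where C: "0 \<le> C" "\<And>z. z \<in> space \<nu> \<Longrightarrow> \<bar>\<phi> z\<bar> \<le> C" using \<phi> by (metis bmeasE)
  let ?X = "\<lambda>z n. (1 / real n) * (\<Sum>j<n. \<phi> ((g ^^ j) z))"
  have in_space: "(g ^^ j) z \<in> space \<nu>" for j
    using measurable_space[OF measurable_compose_n[OF g] z] .
  have "\<bar>?X (g z) n - ?X z n\<bar> \<le> 2 * C / real n" for n
  proof -
    have "(\<Sum>j<n. \<phi> ((g ^^ j) (g z))) - (\<Sum>j<n. \<phi> ((g ^^ j) z)) = \<phi> ((g ^^ n) z) - \<phi> z"
      using sum.lessThan_Suc[of "\<lambda>j. \<phi> ((g ^^ j) z)" n] sum.lessThan_Suc_shift[of "\<lambda>j. \<phi> ((g ^^ j) z)" n]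
      by (simp add: funpow_swap1)
    then have "?X (g z) n - ?X z n = 1 / real n * (\<phi> ((g ^^ n) z) - \<phi> z)"
      by (simp only: right_diff_distrib[symmetric])
    moreover have "\<bar>\<phi> ((g ^^ n) z) - \<phi> z\<bar> \<le> 2 * C" using C(2)[OF in_space[of n]] C(2)[OF z] by linarith
    ultimately show ?thesis by (simp add: abs_mult divide_right_mono)
  qed
  then have "(\<lambda>n. ?X (g z) n - ?X z n) \<longlonglongrightarrow> 0"
    by (intro Lim_null_comparison[OF always_eventually lim_const_over_n[of "2 * C"]]) auto
  from Lim_transform_eq[OF this] show ?thesis
    using z measurable_space[OF g z] unfolding basin_def by simp
qed

section \<open>Random maps and their skew products\<close>

lemma prob_space_bernoulli: "prob_space p \<Longrightarrow> prob_space (bernoulli p)"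
  unfolding bernoulli_def by (rule prob_space_PiM)

lemma finite_measure_density_integrable:
  assumes "integrable \<eta> w"
  shows "finite_measure (density \<eta> (\<lambda>y. ennreal (w y)))"
proof (rule finite_measureI)
  have "(\<integral>\<^sup>+y. ennreal (w y) \<partial>\<eta>) \<le> (\<integral>\<^sup>+y. ennreal (norm (w y)) \<partial>\<eta>)"
    by (intro nn_integral_mono ennreal_leI) simp
  also have "\<dots> < \<infinity>" using assms by (simp add: integrable_iff_bounded)
  finally have "(\<integral>\<^sup>+y. ennreal (w y) \<partial>\<eta>) \<noteq> \<infinity>" by simp
  then show "emeasure (density \<eta> (\<lambda>y. ennreal (w y))) (space (density \<eta> (\<lambda>y. ennreal (w y)))) \<noteq> \<infinity>"
    using assms by (simp add: emeasure_density cong: nn_integral_cong)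
qed

lemma integral_density_max:
  assumes w: "w \<in> borel_measurable \<eta>" and g: "g \<in> borel_measurable \<eta>"
  shows "(LINT y|density \<eta> (\<lambda>y. ennreal (w y)). g y) = (LINT y|\<eta>. max 0 (w y) * (g y :: real))"
proof -
  have "density \<eta> (\<lambda>y. ennreal (w y)) = density \<eta> (\<lambda>y. ennreal (max 0 (w y)))"
    by (simp add: ennreal_max_0)
  then show ?thesis using w g integral_density[of g \<eta> "\<lambda>y. max 0 (w y)"] by simp
qed

text \<open>Fubini: averaging the images is taking the image of the product measure.\<close>

lemma annealed_push_eq_distr:
  assumes "sigma_finite_measure p" and sf: "sigma_finite_measure \<nu>"
    and f: "(\<lambda>(t, x). f t x) \<in> measurable (p \<Otimes>\<^sub>M \<nu>) \<nu>"
  shows "annealed_push p f \<nu> = distr (p \<Otimes>\<^sub>M \<nu>) \<nu> (\<lambda>(t, x). f t x)"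
proof -
  let ?D = "distr (p \<Otimes>\<^sub>M \<nu>) \<nu> (\<lambda>(t, x). f t x)"
  interpret \<nu>: sigma_finite_measure \<nu> by fact
  have "(\<integral>\<^sup>+t. emeasure (distr \<nu> \<nu> (f t)) A \<partial>p) = emeasure ?D A" if A: "A \<in> sets \<nu>" for A
  proof -
    have "emeasure ?D A = (\<integral>\<^sup>+t. emeasure \<nu> (Pair t -` ((\<lambda>(t, x). f t x) -` A \<inter> space (p \<Otimes>\<^sub>M \<nu>))) \<partial>p)"
      using f A by (simp add: emeasure_distr \<nu>.emeasure_pair_measure_alt)
    also have "\<dots> = (\<integral>\<^sup>+t. emeasure (distr \<nu> \<nu> (f t)) A \<partial>p)"
    proof (rule nn_integral_cong)
      fix t assume t: "t \<in> space p"
      have "f t \<in> measurable \<nu> \<nu>" using measurable_Pair2[OF f t] by simp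
      moreover have "Pair t -` ((\<lambda>(t, x). f t x) -` A \<inter> space (p \<Otimes>\<^sub>M \<nu>)) = f t -` A \<inter> space \<nu>"
        using t by (auto simp: space_pair_measure)
      ultimately show "emeasure \<nu> (Pair t -` ((\<lambda>(t, x). f t x) -` A \<inter> space (p \<Otimes>\<^sub>M \<nu>))) = emeasure (distr \<nu> \<nu> (f t)) A"
        using A by (simp add: emeasure_distr)
    qed
    finally show ?thesis by simp
  qed
  then have "annealed_push p f \<nu> = measure_of (space \<nu>) (sets \<nu>) (emeasure ?D)"
    unfolding annealed_push_def
    by (intro measure_of_eq sets.space_closed) (simp add: sets.sigma_sets_eq)
  also have "\<dots> = ?D" using measure_of_of_measure[of ?D] by simp
  finally show ?thesis .
qed

locale random_map =
  fixes m :: "'x measure" and p :: "'t measure" and f :: "'t \<Rightarrow> 'x \<Rightarrow> 'x"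
  assumes prob_m: "prob_space m" and prob_p: "prob_space p"
    and f_joint: "(\<lambda>(t, x). f t x) \<in> measurable (p \<Otimes>\<^sub>M m) m"
    and nonsing: "nonsingular (bernoulli p \<Otimes>\<^sub>M m) (skew f)"
begin

abbreviation "P \<equiv> bernoulli p"
abbreviation "mbar \<equiv> bernoulli p \<Otimes>\<^sub>M m"
abbreviation "F \<equiv> skew f"

lemma prob_P: "prob_space P" using prob_p by (rule prob_space_bernoulli)

sublocale M: prob_space m by (rule prob_m)
sublocale N: prob_space p by (rule prob_p)
sublocale P: prob_space P by (rule prob_P)
sublocale PM: pair_prob_space P m ..
sublocale NM: pair_prob_space p m ..
sublocale NP: pair_prob_space p P ..
sublocale PNM: pair_prob_space P "p \<Otimes>\<^sub>M m" ..

lemma F_measurable [measurable]: "F \<in> measurable mbar mbar"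
  using nonsing unfolding nonsingular_def by simp

lemma F_null: "A \<in> null_sets mbar \<Longrightarrow> F -` A \<inter> space mbar \<in> null_sets mbar"
  using nonsing unfolding nonsingular_def by simp

lemma f_measurable [measurable (raw)]:
  "g \<in> measurable N p \<Longrightarrow> h \<in> measurable N m \<Longrightarrow> (\<lambda>z. f (g z) (h z)) \<in> measurable N m"
  using measurable_compose[OF measurable_Pair f_joint] by simp

lemma coord_measurable [measurable]: "(\<lambda>\<omega>. \<omega> n) \<in> measurable P p"
  unfolding bernoulli_def by measurable

lemma shift_measurable [measurable]: "(\<lambda>\<omega> n. \<omega> (Suc n)) \<in> measurable P P"
  unfolding bernoulli_def by (rule measurable_abs_UNIV) measurable

lemma split_measurable [measurable]:
  "(\<lambda>z. (\<lambda>n. fst z (Suc n), fst z 0, snd z)) \<in> measurable mbar (P \<Otimes>\<^sub>M (p \<Otimes>\<^sub>M m))"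
proof -
  have 1: "(\<lambda>z. (\<lambda>n. fst z (Suc n))) \<in> measurable mbar P"
    using measurable_compose[OF measurable_fst shift_measurable] .
  have 2: "(\<lambda>z. fst z 0) \<in> measurable mbar p"
    using measurable_compose[OF measurable_fst coord_measurable] .
  show ?thesis by (intro measurable_Pair 1 2 measurable_snd)
qed

lemma case_nat_measurable: "(\<lambda>(s, \<omega>). case_nat s \<omega>) \<in> measurable (p \<Otimes>\<^sub>M P) P"
  unfolding bernoulli_def by measurable

lemma bernoulli_iter: "distr (p \<Otimes>\<^sub>M P) P (\<lambda>(s, \<omega>). case_nat s \<omega>) = P"
proof -
  interpret S: sequence_space p ..
  show ?thesis unfolding bernoulli_def by (rule S.PiM_iter)
qed

text \<open>
  The first coordinate of the noise is independent of the shifted noise. All integrals over one step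
  of the skew product are computed from this.
\<close>

lemma distr_split:
  "distr mbar (P \<Otimes>\<^sub>M (p \<Otimes>\<^sub>M m)) (\<lambda>z. (\<lambda>n. fst z (Suc n), fst z 0, snd z)) = P \<Otimes>\<^sub>M (p \<Otimes>\<^sub>M m)"
proof (rule measure_eqI)
  fix A assume "A \<in> sets (distr mbar (P \<Otimes>\<^sub>M (p \<Otimes>\<^sub>M m)) (\<lambda>z. (\<lambda>n. fst z (Suc n), fst z 0, snd z)))"
  then have A [measurable]: "A \<in> sets (P \<Otimes>\<^sub>M (p \<Otimes>\<^sub>M m))" by simp
  let ?a = "\<lambda>z. indicator A z :: ennreal"
  have a1: "(\<lambda>z. ?a (\<lambda>n. fst z (Suc n), fst z 0, snd z)) \<in> borel_measurable mbar"
    using measurable_compose[OF split_measurable borel_measurable_indicator[OF A]] .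
  have a2: "(\<lambda>\<omega>. \<integral>\<^sup>+x. ?a (\<lambda>n. \<omega> (Suc n), \<omega> 0, x) \<partial>m) \<in> borel_measurable P"
    using M.borel_measurable_nn_integral_fst[OF a1] by simp
  have a3: "(\<lambda>z. ?a (snd (fst z), fst (fst z), snd z)) \<in> borel_measurable ((p \<Otimes>\<^sub>M P) \<Otimes>\<^sub>M m)" by measurable
  have a4: "(\<lambda>(s, \<omega>). \<integral>\<^sup>+x. ?a (\<omega>, s, x) \<partial>m) \<in> borel_measurable (p \<Otimes>\<^sub>M P)"
    using M.borel_measurable_nn_integral_fst[OF a3] by (simp add: split_beta')
  have "emeasure (distr mbar (P \<Otimes>\<^sub>M (p \<Otimes>\<^sub>M m)) (\<lambda>z. (\<lambda>n. fst z (Suc n), fst z 0, snd z))) A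
      = (\<integral>\<^sup>+z. ?a (\<lambda>n. fst z (Suc n), fst z 0, snd z) \<partial>mbar)"
    using nn_integral_distr[OF split_measurable, of ?a] A by simp
  also have "\<dots> = (\<integral>\<^sup>+\<omega>. \<integral>\<^sup>+x. ?a (\<lambda>n. \<omega> (Suc n), \<omega> 0, x) \<partial>m \<partial>P)"
    using M.nn_integral_fst[OF a1] by simp
  also have "\<dots> = (\<integral>\<^sup>+\<omega>. \<integral>\<^sup>+x. ?a (\<lambda>n. \<omega> (Suc n), \<omega> 0, x) \<partial>m \<partial>distr (p \<Otimes>\<^sub>M P) P (\<lambda>(s, \<omega>). case_nat s \<omega>))"
    unfolding bernoulli_iter ..
  also have "\<dots> = (\<integral>\<^sup>+z. (case z of (s, \<omega>) \<Rightarrow> \<integral>\<^sup>+x. ?a (\<omega>, s, x) \<partial>m) \<partial>(p \<Otimes>\<^sub>M P))"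
    by (subst nn_integral_distr[OF case_nat_measurable]) (use a2 in \<open>simp_all add: split_beta'\<close>)
  also have "\<dots> = (\<integral>\<^sup>+s. \<integral>\<^sup>+\<omega>. \<integral>\<^sup>+x. ?a (\<omega>, s, x) \<partial>m \<partial>P \<partial>p)"
    using P.nn_integral_fst[OF a4] by simp
  also have "\<dots> = (\<integral>\<^sup>+\<omega>. \<integral>\<^sup>+s. \<integral>\<^sup>+x. ?a (\<omega>, s, x) \<partial>m \<partial>p \<partial>P)"
    using NP.Fubini'[of "\<lambda>s \<omega>. \<integral>\<^sup>+x. ?a (\<omega>, s, x) \<partial>m"] a4 by simp
  also have "\<dots> = (\<integral>\<^sup>+\<omega>. \<integral>\<^sup>+y. ?a (\<omega>, y) \<partial>(p \<Otimes>\<^sub>M m) \<partial>P)"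
  proof (rule nn_integral_cong)
    fix \<omega> assume \<omega>: "\<omega> \<in> space P"
    have "(\<lambda>y. ?a (\<omega>, y)) \<in> borel_measurable (p \<Otimes>\<^sub>M m)" using \<omega> by measurable
    from M.nn_integral_fst[OF this]
    show "(\<integral>\<^sup>+s. \<integral>\<^sup>+x. ?a (\<omega>, s, x) \<partial>m \<partial>p) = (\<integral>\<^sup>+y. ?a (\<omega>, y) \<partial>(p \<Otimes>\<^sub>M m))" .
  qed
  also have "\<dots> = emeasure (P \<Otimes>\<^sub>M (p \<Otimes>\<^sub>M m)) A"
    using NM.nn_integral_fst[of ?a P] A by simp
  finally show "emeasure (distr mbar (P \<Otimes>\<^sub>M (p \<Otimes>\<^sub>M m)) (\<lambda>z. (\<lambda>n. fst z (Suc n), fst z 0, snd z))) A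
      = emeasure (P \<Otimes>\<^sub>M (p \<Otimes>\<^sub>M m)) A" .
qed simp

lemma integral_split:
  fixes G :: "(nat \<Rightarrow> 't) \<times> 't \<times> 'x \<Rightarrow> real"
  assumes "G \<in> borel_measurable (P \<Otimes>\<^sub>M (p \<Otimes>\<^sub>M m))"
  shows "(LINT z|mbar. G (\<lambda>n. fst z (Suc n), fst z 0, snd z)) = (LINT z|(P \<Otimes>\<^sub>M (p \<Otimes>\<^sub>M m)). G z)"
    and "integrable mbar (\<lambda>z. G (\<lambda>n. fst z (Suc n), fst z 0, snd z)) \<longleftrightarrow> integrable (P \<Otimes>\<^sub>M (p \<Otimes>\<^sub>M m)) G"
  using integral_distr[OF split_measurable assms] integrable_distr_eq[OF split_measurable assms]
  unfolding distr_split by simp_all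

lemma distr_snd_prob:
  assumes "prob_space M1" "prob_space M2"
  shows "distr (M1 \<Otimes>\<^sub>M M2) M2 snd = M2"
proof (rule measure_eqI)
  interpret M1: prob_space M1 by fact
  interpret M2: prob_space M2 by fact
  fix A assume "A \<in> sets (distr (M1 \<Otimes>\<^sub>M M2) M2 snd)"
  then have A: "A \<in> sets M2" by simp
  have "snd -` A \<inter> space (M1 \<Otimes>\<^sub>M M2) = space M1 \<times> A"
    using sets.sets_into_space[OF A] by (auto simp: space_pair_measure)
  then show "emeasure (distr (M1 \<Otimes>\<^sub>M M2) M2 snd) A = emeasure M2 A"
    using A by (simp add: emeasure_distr M2.emeasure_pair_measure_Times M1.emeasure_space_1)
qed simp

definition Uf :: "('x \<Rightarrow> real) \<Rightarrow> 'x \<Rightarrow> real" where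
  "Uf g = (\<lambda>x. LINT t|p. g (f t x))"

lemma Uf_bmeas:
  assumes g: "g \<in> bmeas m"
  shows "Uf g \<in> bmeas m"
proof -
  obtain C where C: "0 \<le> C" "\<And>y. y \<in> space m \<Longrightarrow> \<bar>g y\<bar> \<le> C" using g by (metis bmeasE)
  note [measurable] = bmeas_measurable[OF g]
  have meas: "Uf g \<in> borel_measurable m"
    unfolding Uf_def by (rule N.borel_measurable_lebesgue_integral) measurable
  show ?thesis
  proof (rule bmeasI[OF meas])
    fix x assume x: "x \<in> space m"
    have fx: "f t x \<in> space m" if "t \<in> space p" for t
      using measurable_space[OF f_joint, of "(t, x)"] that x by (simp add: space_pair_measure)
    have "\<bar>Uf g x\<bar> \<le> (LINT t|p. \<bar>g (f t x)\<bar>)" unfolding Uf_def by (rule integral_abs_bound)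
    also have "\<dots> \<le> (LINT t|p. C)"
    proof (rule integral_mono_AE)
      have "(\<lambda>t. \<bar>g (f t x)\<bar>) \<in> borel_measurable p" using x by measurable
      then show "integrable p (\<lambda>t. \<bar>g (f t x)\<bar>)"
        by (rule N.integrable_const_bound[of _ C, rotated]) (use C(2) fx in auto)
    qed (use C(2) fx in auto)
    also have "\<dots> = C" by (simp add: N.prob_space)
    finally show "\<bar>Uf g x\<bar> \<le> C" .
  qed
qed

text \<open>
  Nonsingularity of the skew product, applied to the null set \<open>\<Omega> \<times> A\<close>, is what makes the annealed image
  of a measure with a density have a density.
\<close>

lemma f_null:
  assumes A: "A \<in> null_sets m"
  shows "AE z in p \<Otimes>\<^sub>M m. f (fst z) (snd z) \<notin> A"
proof -
  have As [measurable]: "A \<in> sets m" using A by auto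
  have "space P \<times> A \<in> null_sets mbar"
    using A by (auto simp: null_sets_def M.emeasure_pair_measure_Times)
  then have "AE z in mbar. z \<notin> F -` (space P \<times> A) \<inter> space mbar"
    by (intro AE_not_in F_null)
  then have "AE z in mbar. f (fst z 0) (snd z) \<notin> A"
    using AE_space
  proof eventually_elim
    case (elim z)
    then have "F z \<in> space mbar" using measurable_space[OF F_measurable] by blast
    then show ?case using elim by (cases z) (auto simp: skew_def space_pair_measure)
  qed
  then have "AE w in distr mbar (P \<Otimes>\<^sub>M (p \<Otimes>\<^sub>M m)) (\<lambda>z. (\<lambda>n. fst z (Suc n), fst z 0, snd z)). f (fst (snd w)) (snd (snd w)) \<notin> A"
    by (subst AE_distr_iff[OF split_measurable]) auto
  then have "AE w in P \<Otimes>\<^sub>M (p \<Otimes>\<^sub>M m). f (fst (snd w)) (snd (snd w)) \<notin> A" unfolding distr_split .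
  then have "AE z in distr (P \<Otimes>\<^sub>M (p \<Otimes>\<^sub>M m)) (p \<Otimes>\<^sub>M m) snd. f (fst z) (snd z) \<notin> A"
    by (subst AE_distr_iff[OF measurable_snd]) auto
  then show ?thesis
    unfolding distr_snd_prob[OF prob_P NM.prob_space_axioms] .
qed

lemma annealed_push_eq:
  assumes "finite_measure \<nu>" "sets \<nu> = sets m"
  shows "annealed_push p f \<nu> = distr (p \<Otimes>\<^sub>M \<nu>) \<nu> (\<lambda>(t, x). f t x)"
proof (rule annealed_push_eq_distr)
  interpret \<nu>: finite_measure \<nu> by fact
  show "sigma_finite_measure \<nu>" by unfold_locales
  show "sigma_finite_measure p" by unfold_locales
  show "(\<lambda>(t, x). f t x) \<in> measurable (p \<Otimes>\<^sub>M \<nu>) \<nu>"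
    using f_joint assms(2) by (simp cong: measurable_cong_sets)
qed

sublocale Lf: measure_push m "annealed_push p f" Uf
proof (intro measure_push.intro measure_push_axioms.intro prob_m)
  fix A assume "A \<in> sets m"
  show "AE y in m. 0 \<le> Uf (indicator A) y" unfolding Uf_def by (intro AE_I2 Bochner_Integration.integral_nonneg) simp
next
  show "AE y in m. Uf (\<lambda>_. 1) y = 1" unfolding Uf_def by (simp add: N.prob_space)
next
  fix w :: "'x \<Rightarrow> real" assume w: "integrable m w"
  then have wm [measurable]: "w \<in> borel_measurable m" by simp
  define \<nu> where "\<nu> = density m (\<lambda>y. ennreal (w y))"
  interpret \<nu>: finite_measure \<nu> unfolding \<nu>_def by (rule finite_measure_density_integrable[OF w])
  have \<nu>s [measurable_cong]: "sets \<nu> = sets m" unfolding \<nu>_def by simp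
  have f': "(\<lambda>(t, x). f t x) \<in> measurable (p \<Otimes>\<^sub>M \<nu>) \<nu>"
    using f_joint \<nu>s by (simp cong: measurable_cong_sets)
  have push: "annealed_push p f \<nu> = distr (p \<Otimes>\<^sub>M \<nu>) \<nu> (\<lambda>(t, x). f t x)"
    by (rule annealed_push_eq[OF \<nu>.finite_measure_axioms \<nu>s])
  interpret N\<nu>: finite_measure "p \<Otimes>\<^sub>M \<nu>"
    by (rule finite_measure_pair_measure) unfold_locales
  interpret pN\<nu>: pair_sigma_finite p \<nu> ..
  show "sets (annealed_push p f (density m (\<lambda>y. ennreal (w y)))) = sets m"
    unfolding \<nu>_def[symmetric] push using \<nu>s by simp
  show "finite_measure (annealed_push p f (density m (\<lambda>y. ennreal (w y))))"
    unfolding \<nu>_def[symmetric] push by (rule N\<nu>.finite_measure_distr[OF f'])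
  show "absolutely_continuous m (annealed_push p f (density m (\<lambda>y. ennreal (w y))))"
    unfolding \<nu>_def[symmetric] push absolutely_continuous_def
  proof
    fix A assume A: "A \<in> null_sets m"
    then have As [measurable]: "A \<in> sets m" by auto
    have "AE t in p. AE x in m. f t x \<notin> A" using NM.AE_pair[OF f_null[OF A]] by simp
    moreover have "absolutely_continuous m \<nu>" unfolding \<nu>_def by (rule absolutely_continuousI_density) simp
    ultimately have "AE t in p. AE x in \<nu>. f t x \<notin> A"
      using absolutely_continuous_AE[OF \<nu>s] by (auto elim: eventually_mono)
    moreover have "{z \<in> space (p \<Otimes>\<^sub>M \<nu>). f (fst z) (snd z) \<notin> A} \<in> sets (p \<Otimes>\<^sub>M \<nu>)" by measurable
    ultimately have "AE z in p \<Otimes>\<^sub>M \<nu>. f (fst z) (snd z) \<notin> A" by (intro pN\<nu>.AE_pair_measure) auto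
    then have "AE y in distr (p \<Otimes>\<^sub>M \<nu>) \<nu> (\<lambda>(t, x). f t x). y \<notin> A"
      by (subst AE_distr_iff[OF f']) (auto simp: split_beta')
    then show "A \<in> null_sets (distr (p \<Otimes>\<^sub>M \<nu>) \<nu> (\<lambda>(t, x). f t x))"
      by (subst AE_iff_null_sets) (use \<nu>s in auto)
  qed
  fix g assume g: "g \<in> bmeas m"
  then obtain C where C: "0 \<le> C" "\<And>y. y \<in> space m \<Longrightarrow> \<bar>g y\<bar> \<le> C" by (metis bmeasE)
  have gm [measurable]: "g \<in> borel_measurable m" using bmeas_measurable[OF g] .
  then have gm': "g \<in> borel_measurable \<nu>" using \<nu>s by (simp cong: measurable_cong_sets)
  have gf: "(\<lambda>z. g (case z of (t, x) \<Rightarrow> f t x)) \<in> borel_measurable (p \<Otimes>\<^sub>M \<nu>)" using measurable_compose[OF f' gm'] .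
  have gi: "integrable (p \<Otimes>\<^sub>M \<nu>) (\<lambda>(t, x). g (f t x))"
  proof (rule N\<nu>.integrable_const_bound[of _ C])
    show "AE z in p \<Otimes>\<^sub>M \<nu>. norm (case z of (t, x) \<Rightarrow> g (f t x)) \<le> C"
      using AE_space
    proof eventually_elim
      case (elim z)
      then show ?case using C(2) measurable_space[OF f' elim] sets_eq_imp_space_eq[OF \<nu>s] by (auto simp: split_beta')
    qed
  qed (use gf in \<open>simp add: split_beta'\<close>)
  have "(LINT y|annealed_push p f \<nu>. g y) = (LINT z|(p \<Otimes>\<^sub>M \<nu>). (case z of (t, x) \<Rightarrow> g (f t x)))"
    unfolding push using integral_distr[OF f' gm'] by (simp add: split_beta')
  also have "\<dots> = (LINT x|\<nu>. Uf g x)" unfolding Uf_def using pN\<nu>.integral_snd[OF gi] by simp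
  also have "\<dots> = (LINT y|m. max 0 (w y) * Uf g y)"
    unfolding \<nu>_def using bmeas_measurable[OF Uf_bmeas[OF g]] by (intro integral_density_max) auto
  finally show "(LINT y|annealed_push p f (density m (\<lambda>y. ennreal (w y))). g y) = (LINT y|m. max 0 (w y) * Uf g y)"
    unfolding \<nu>_def .
qed (rule Uf_bmeas)

sublocale LF: measure_push mbar "\<lambda>\<nu>. distr \<nu> \<nu> F" "\<lambda>g z. g (F z)"
proof (intro measure_push.intro measure_push_axioms.intro PM.prob_space_axioms)
  fix g :: "(nat \<Rightarrow> 't) \<times> 'x \<Rightarrow> real" assume g: "g \<in> bmeas mbar"
  then obtain C where C: "0 \<le> C" "\<And>y. y \<in> space mbar \<Longrightarrow> \<bar>g y\<bar> \<le> C" by (metis bmeasE)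
  show "(\<lambda>z. g (F z)) \<in> bmeas mbar"
    using measurable_compose[OF F_measurable bmeas_measurable[OF g]] C(2) measurable_space[OF F_measurable]
    by (intro bmeasI[of _ _ C]) auto
next
  fix w :: "(nat \<Rightarrow> 't) \<times> 'x \<Rightarrow> real" assume w: "integrable mbar w"
  define \<nu> where "\<nu> = density mbar (\<lambda>y. ennreal (w y))"
  interpret \<nu>: finite_measure \<nu> unfolding \<nu>_def by (rule finite_measure_density_integrable[OF w])
  have \<nu>s: "sets \<nu> = sets mbar" unfolding \<nu>_def by simp
  have F': "F \<in> measurable \<nu> \<nu>" using F_measurable \<nu>s by (simp cong: measurable_cong_sets)
  have ac: "absolutely_continuous mbar \<nu>" unfolding \<nu>_def using w by (intro absolutely_continuousI_density) simp
  show "sets (distr (density mbar (\<lambda>y. ennreal (w y))) (density mbar (\<lambda>y. ennreal (w y))) F) = sets mbar"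
    by simp
  show "finite_measure (distr (density mbar (\<lambda>y. ennreal (w y))) (density mbar (\<lambda>y. ennreal (w y))) F)"
    unfolding \<nu>_def[symmetric] by (rule \<nu>.finite_measure_distr[OF F'])
  show "absolutely_continuous mbar (distr (density mbar (\<lambda>y. ennreal (w y))) (density mbar (\<lambda>y. ennreal (w y))) F)"
    unfolding \<nu>_def[symmetric] absolutely_continuous_def
  proof
    fix A assume A: "A \<in> null_sets mbar"
    then have "F -` A \<inter> space mbar \<in> null_sets \<nu>"
      using ac F_null unfolding absolutely_continuous_def by auto
    then show "A \<in> null_sets (distr \<nu> \<nu> F)"
      using A \<nu>s F' sets_eq_imp_space_eq[OF \<nu>s] by (auto simp: null_sets_def emeasure_distr)
  qed
  fix g :: "(nat \<Rightarrow> 't) \<times> 'x \<Rightarrow> real" assume g: "g \<in> bmeas mbar"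
  have gm: "g \<in> borel_measurable \<nu>" using bmeas_measurable[OF g] \<nu>s by (simp cong: measurable_cong_sets)
  have "(LINT y|distr \<nu> \<nu> F. g y) = (LINT y|\<nu>. g (F y))" by (rule integral_distr[OF F' gm])
  also have "\<dots> = (LINT y|mbar. max 0 (w y) * g (F y))"
    unfolding \<nu>_def using w measurable_compose[OF F_measurable bmeas_measurable[OF g]] by (intro integral_density_max) auto
  finally show "(LINT y|distr (density mbar (\<lambda>y. ennreal (w y))) (density mbar (\<lambda>y. ennreal (w y))) F. g y)
      = (LINT y|mbar. max 0 (w y) * g (F y))" unfolding \<nu>_def .
qed auto

end

section \<open>Functions that do not depend on the noise\<close>

context random_map
begin

definition emb :: "('x \<Rightarrow> real) \<Rightarrow> (nat \<Rightarrow> 't) \<times> 'x \<Rightarrow> real" where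
  "emb \<phi> = (\<lambda>z. \<phi> (snd z))"

text \<open>Integration over the noise: a left inverse of \<open>emb\<close> that does not increase distances.\<close>

definition proj :: "((nat \<Rightarrow> 't) \<times> 'x \<Rightarrow> real) \<Rightarrow> 'x \<Rightarrow> real" where
  "proj \<phi> = (\<lambda>x. LINT \<omega>|P. \<phi> (\<omega>, x))"

lemma distr_mbar_snd: "distr mbar m snd = m"
  by (rule distr_snd_prob[OF prob_P prob_m])

lemma emb_integrable [simp, intro]: "integrable m \<phi> \<Longrightarrow> integrable mbar (emb \<phi>)"
  using integrable_distr_eq[of snd mbar m \<phi>] unfolding distr_mbar_snd emb_def by simp

lemma emb_integral: "\<phi> \<in> borel_measurable m \<Longrightarrow> (LINT z|mbar. emb \<phi> z) = (LINT x|m. \<phi> x)"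
  using integral_distr[of snd mbar m \<phi>] unfolding distr_mbar_snd emb_def by simp

lemma emb_bmeas: "g \<in> bmeas m \<Longrightarrow> emb g \<in> bmeas mbar"
  unfolding bmeas_def emb_def by (auto simp: space_pair_measure)

lemma emb_norm: "\<phi> \<in> borel_measurable m \<Longrightarrow> L1_norm mbar (emb \<phi>) = L1_norm m \<phi>"
  using emb_integral[of "\<lambda>x. \<bar>\<phi> x\<bar>"] unfolding L1_norm_def by (simp add: emb_def)

lemma emb_diff_norm:
  "integrable m \<phi> \<Longrightarrow> integrable m \<psi> \<Longrightarrow> L1_norm mbar (\<lambda>z. emb \<phi> z - emb \<psi> z) = L1_norm m (\<lambda>x. \<phi> x - \<psi> x)"
  using emb_norm[of "\<lambda>x. \<phi> x - \<psi> x"] by (simp add: emb_def)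

lemma AE_emb: "AE x in m. Q x \<Longrightarrow> AE z in mbar. Q (snd z)"
  using AE_distrD[of snd mbar m Q] unfolding distr_mbar_snd by simp

lemma AE_emb_iff: "{x \<in> space m. Q x} \<in> sets m \<Longrightarrow> (AE z in mbar. Q (snd z)) \<longleftrightarrow> (AE x in m. Q x)"
  using AE_distr_iff[of snd mbar m Q] unfolding distr_mbar_snd by simp

lemma emb_densities: "\<phi> \<in> densities m \<Longrightarrow> emb \<phi> \<in> densities mbar"
  using densitiesD[of \<phi> m] AE_emb[of "\<lambda>x. 0 \<le> \<phi> x"] emb_integral[of \<phi>] emb_integrable[of \<phi>]
  by (intro densitiesI) (auto simp: emb_def)

lemma proj_emb: "proj (emb \<phi>) = \<phi>"
  unfolding proj_def emb_def by (simp add: P.prob_space)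

lemma proj_integrable: "integrable mbar \<phi> \<Longrightarrow> integrable m (proj \<phi>)"
  using PM.integrable_snd[of "\<lambda>\<omega> x. \<phi> (\<omega>, x)"] unfolding proj_def by simp

lemma proj_integral:
  assumes \<phi>: "integrable mbar \<phi>" and g: "g \<in> bmeas m"
  shows "(LINT x|m. proj \<phi> x * g x) = (LINT z|mbar. \<phi> z * emb g z)"
proof -
  have i: "integrable mbar (\<lambda>z. \<phi> z * emb g z)" by (rule integrable_mult_bmeas[OF \<phi> emb_bmeas[OF g]])
  have "(LINT z|mbar. \<phi> z * emb g z) = (LINT x|m. LINT \<omega>|P. \<phi> (\<omega>, x) * emb g (\<omega>, x))"
    using PM.integral_snd[of "\<lambda>\<omega> x. \<phi> (\<omega>, x) * emb g (\<omega>, x)"] i by (simp add: split_beta')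
  then show ?thesis unfolding proj_def emb_def by simp
qed

lemma proj_norm_le:
  assumes \<phi>: "integrable mbar \<phi>" and \<psi>: "integrable mbar \<psi>"
  shows "L1_norm m (\<lambda>x. proj \<phi> x - proj \<psi> x) \<le> L1_norm mbar (\<lambda>z. \<phi> z - \<psi> z)"
proof -
  have d: "integrable mbar (\<lambda>z. \<bar>\<phi> z - \<psi> z\<bar>)" using \<phi> \<psi> by simp
  have 1: "AE x in m. integrable P (\<lambda>\<omega>. \<phi> (\<omega>, x))" using PM.AE_integrable_snd[of "\<lambda>\<omega> x. \<phi> (\<omega>, x)"] \<phi> by simp
  have 2: "AE x in m. integrable P (\<lambda>\<omega>. \<psi> (\<omega>, x))" using PM.AE_integrable_snd[of "\<lambda>\<omega> x. \<psi> (\<omega>, x)"] \<psi> by simp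
  have "L1_norm m (\<lambda>x. proj \<phi> x - proj \<psi> x) \<le> (LINT x|m. proj (\<lambda>z. \<bar>\<phi> z - \<psi> z\<bar>) x)"
    unfolding L1_norm_def
  proof (rule integral_mono_AE)
    show "AE x in m. \<bar>proj \<phi> x - proj \<psi> x\<bar> \<le> proj (\<lambda>z. \<bar>\<phi> z - \<psi> z\<bar>) x"
      using 1 2
    proof eventually_elim
      case (elim x)
      have "proj \<phi> x - proj \<psi> x = (LINT \<omega>|P. \<phi> (\<omega>, x) - \<psi> (\<omega>, x))" unfolding proj_def using elim by simp
      then show ?case using integral_abs_bound[of P "\<lambda>\<omega>. \<phi> (\<omega>, x) - \<psi> (\<omega>, x)"] unfolding proj_def by simp
    qed
  qed (use \<phi> \<psi> d in \<open>auto intro!: integrable_abs proj_integrable\<close>)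
  also have "\<dots> = L1_norm mbar (\<lambda>z. \<phi> z - \<psi> z)"
    using proj_integral[OF d, of "\<lambda>_. 1"] unfolding L1_norm_def by (simp add: emb_def)
  finally show ?thesis .
qed

lemma proj_emb_norm_le:
  "integrable mbar \<phi> \<Longrightarrow> integrable m \<psi> \<Longrightarrow> L1_norm m (\<lambda>x. proj \<phi> x - \<psi> x) \<le> L1_norm mbar (\<lambda>z. \<phi> z - emb \<psi> z)"
  using proj_norm_le[of \<phi> "emb \<psi>"] by (simp add: proj_emb)

lemma proj_densities:
  assumes "\<phi> \<in> densities mbar"
  shows "proj \<phi> \<in> densities m"
proof -
  note d = densitiesD[OF assms]
  have i: "integrable m (proj \<phi>)" by (rule proj_integrable[OF d(1)])
  show ?thesis
  proof (rule densitiesI[OF i])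
    show "AE x in m. 0 \<le> proj \<phi> x"
    proof (rule AE_le_by_testing)
      fix A assume A: "A \<in> sets m"
      have "0 \<le> (LINT z|mbar. \<phi> z * emb (indicator A) z)"
        using d(2) by (intro integral_nonneg_AE) (auto elim: eventually_mono simp: emb_def)
      then show "(LINT x|m. 0 * indicator A x) \<le> (LINT x|m. proj \<phi> x * indicator A x)"
        using proj_integral[OF d(1), of "indicator A"] A by simp
    qed (use i in auto)
    show "(LINT x|m. proj \<phi> x) = 1"
      using proj_integral[OF d(1), of "\<lambda>_. 1"] d(3) by (simp add: emb_def)
  qed
qed

lemma F_eq: "F z = (\<lambda>n. fst z (Suc n), f (fst z 0) (snd z))"
  by (cases z) (simp add: skew_def)

text \<open>
  One step of \<open>F\<close> uses up the coordinate 0 of the noise, so a factor that depends on it is averaged into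
  \<open>\<psi>\<close>, while a factor that depends on the later coordinates is moved back by one place.
\<close>

lemma LF_cylinder_step:
  assumes \<xi>: "integrable m \<xi>" and C0 [measurable]: "C0 \<in> sets p" and C [measurable]: "C \<in> sets P"
  obtains \<psi> where "integrable m \<psi>"
    "AE z in mbar. LF.L (\<lambda>z. indicator C0 (fst z 0) * indicator C (\<lambda>n. fst z (Suc n)) * \<xi> (snd z)) z
       = indicator C (fst z) * \<psi> (snd z)"
    "\<And>g. g \<in> bmeas m \<Longrightarrow> (LINT x|m. \<psi> x * g x)
       = (LINT y|(p \<Otimes>\<^sub>M m). indicator C0 (fst y) * \<xi> (snd y) * g (f (fst y) (snd y)))"
proof -
  have [measurable]: "\<xi> \<in> borel_measurable m" using \<xi> by simp
  \<comment> \<open>\<open>\<theta>\<close> carries the condition on the coordinate 0 only, \<open>\<Theta>\<close> below also the one on the later coordinates.\<close>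
  define \<theta> where "\<theta> = (\<lambda>z::(nat \<Rightarrow> 't) \<times> 'x. indicator C0 (fst z 0) * \<xi> (snd z))"
  have c0: "(\<lambda>z::(nat \<Rightarrow> 't) \<times> 'x. indicator C0 (fst z 0) :: real) \<in> bmeas mbar"
    by (rule bmeasI[of _ _ 1])
      (use measurable_compose[OF measurable_compose[OF measurable_fst coord_measurable] borel_measurable_indicator[OF C0]]
        in \<open>auto simp: indicator_def\<close>)
  have c1: "(\<lambda>z::(nat \<Rightarrow> 't) \<times> 'x. indicator C (\<lambda>n. fst z (Suc n)) :: real) \<in> bmeas mbar"
    by (rule bmeasI[of _ _ 1])
      (use measurable_compose[OF measurable_compose[OF measurable_fst shift_measurable] borel_measurable_indicator[OF C]]
        in \<open>auto simp: indicator_def\<close>)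
  have \<theta>i: "integrable mbar \<theta>"
    using integrable_mult_bmeas[OF emb_integrable[OF \<xi>] c0] unfolding \<theta>_def by (simp add: emb_def mult.commute)
  define \<psi> where "\<psi> = proj (LF.L \<theta>)"
  have \<psi>i: "integrable m \<psi>" unfolding \<psi>_def by (rule proj_integrable[OF LF.L_integrable[OF \<theta>i]])
  have test: "(LINT x|m. \<psi> x * g x) = (LINT y|(p \<Otimes>\<^sub>M m). indicator C0 (fst y) * \<xi> (snd y) * g (f (fst y) (snd y)))"
    if g: "g \<in> bmeas m" for g
  proof -
    note [measurable] = bmeas_measurable[OF g]
    let ?h = "\<lambda>y. indicator C0 (fst y) * \<xi> (snd y) * g (f (fst y) (snd y))"
    have h [measurable]: "?h \<in> borel_measurable (p \<Otimes>\<^sub>M m)" by measurable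
    have "(LINT x|m. \<psi> x * g x) = (LINT z|mbar. LF.L \<theta> z * emb g z)"
      unfolding \<psi>_def by (rule proj_integral[OF LF.L_integrable[OF \<theta>i] g])
    also have "\<dots> = (LINT z|mbar. \<theta> z * emb g (F z))" by (rule LF.duality[OF \<theta>i emb_bmeas[OF g]])
    also have "\<dots> = (LINT z|mbar. ?h (snd (\<lambda>n. fst z (Suc n), fst z 0, snd z)))"
      by (simp add: \<theta>_def emb_def F_eq)
    also have "\<dots> = (LINT w|(P \<Otimes>\<^sub>M (p \<Otimes>\<^sub>M m)). ?h (snd w))"
      by (rule integral_split(1)[of "\<lambda>w. ?h (snd w)"]) (rule measurable_compose[OF measurable_snd h])
    also have "\<dots> = (LINT y|(p \<Otimes>\<^sub>M m). ?h y)"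
      using integral_distr[OF measurable_snd h, of P] unfolding distr_snd_prob[OF prob_P NM.prob_space_axioms] by simp
    finally show ?thesis .
  qed
  define \<Theta> where "\<Theta> = (\<lambda>z. indicator C0 (fst z 0) * indicator C (\<lambda>n. fst z (Suc n)) * \<xi> (snd z))"
  have \<Theta>i: "integrable mbar \<Theta>"
    using integrable_mult_bmeas[OF \<theta>i c1] unfolding \<Theta>_def \<theta>_def by (simp add: mult_ac)
  have cC: "(\<lambda>z::(nat \<Rightarrow> 't) \<times> 'x. indicator C (fst z) :: real) \<in> bmeas mbar"
    by (rule bmeasI[of _ _ 1]) (auto simp: indicator_def)
  have Ri: "integrable mbar (\<lambda>z. indicator C (fst z) * \<psi> (snd z))"
    using integrable_mult_bmeas[OF emb_integrable[OF \<psi>i] cC] by (simp add: emb_def mult.commute)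
  have "AE z in mbar. LF.L \<Theta> z = indicator C (fst z) * \<psi> (snd z)"
  proof (rule AE_eq_by_testing[OF LF.L_integrable[OF \<Theta>i] Ri])
    fix A assume A [measurable]: "A \<in> sets mbar"
    let ?G = "\<lambda>w. indicator C (fst w) * (indicator C0 (fst (snd w)) * \<xi> (snd (snd w))
        * indicator A (fst w, f (fst (snd w)) (snd (snd w)))) :: real"
    have G: "?G \<in> borel_measurable (P \<Otimes>\<^sub>M (p \<Otimes>\<^sub>M m))" by measurable
    have eqG: "\<Theta> z * indicator A (F z) = ?G (\<lambda>n. fst z (Suc n), fst z 0, snd z)" for z
      by (simp add: \<Theta>_def F_eq)
    have "integrable mbar (\<lambda>z. \<Theta> z * indicator A (F z))"
      by (rule integrable_mult_bmeas[OF \<Theta>i LF.U_bmeas[OF bmeas_indicator[OF A]]])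
    then have Gi: "integrable (P \<Otimes>\<^sub>M (p \<Otimes>\<^sub>M m)) ?G"
      unfolding eqG using integral_split(2)[OF G] by blast
    have RAi: "integrable mbar (\<lambda>z. indicator C (fst z) * \<psi> (snd z) * indicator A z)"
      by (rule integrable_real_mult_indicator[OF A Ri])
    have "(LINT z|mbar. LF.L \<Theta> z * indicator A z) = (LINT z|mbar. \<Theta> z * indicator A (F z))"
      by (rule LF.duality[OF \<Theta>i bmeas_indicator[OF A]])
    also have "\<dots> = (LINT w|(P \<Otimes>\<^sub>M (p \<Otimes>\<^sub>M m)). ?G w)" unfolding eqG by (rule integral_split(1)[OF G])
    also have "\<dots> = (LINT \<omega>|P. LINT y|(p \<Otimes>\<^sub>M m). ?G (\<omega>, y))" by (rule PNM.integral_fst'[OF Gi, symmetric])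
    also have "\<dots> = (LINT \<omega>|P. LINT x|m. indicator C \<omega> * \<psi> x * indicator A (\<omega>, x))"
    proof (rule Bochner_Integration.integral_cong[OF refl])
      fix \<omega> assume \<omega>: "\<omega> \<in> space P"
      have "(\<lambda>x. indicator A (\<omega>, x) :: real) \<in> borel_measurable m" using \<omega> by measurable
      then have b: "(\<lambda>x. indicator A (\<omega>, x) :: real) \<in> bmeas m"
        by (rule bmeasI[of _ _ 1]) (auto simp: indicator_def)
      have "(LINT y|(p \<Otimes>\<^sub>M m). ?G (\<omega>, y)) = indicator C \<omega> * (LINT x|m. \<psi> x * indicator A (\<omega>, x))"
        unfolding test[OF b] by simp
      also have "\<dots> = (LINT x|m. indicator C \<omega> * \<psi> x * indicator A (\<omega>, x))" by (simp add: mult.assoc)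
      finally show "(LINT y|(p \<Otimes>\<^sub>M m). ?G (\<omega>, y)) = (LINT x|m. indicator C \<omega> * \<psi> x * indicator A (\<omega>, x))" .
    qed
    also have "\<dots> = (LINT z|mbar. indicator C (fst z) * \<psi> (snd z) * indicator A z)"
      using PM.integral_fst'[OF RAi] by simp
    finally show "(LINT z|mbar. LF.L \<Theta> z * indicator A z) = (LINT z|mbar. indicator C (fst z) * \<psi> (snd z) * indicator A z)" .
  qed
  then show ?thesis using that[OF \<psi>i _ test] unfolding \<Theta>_def by blast
qed

text \<open>The one-step formula without a condition on the noise.\<close>

lemma LF_emb:
  assumes \<phi>: "integrable m \<phi>"
  shows "AE z in mbar. LF.L (emb \<phi>) z = emb (Lf.L \<phi>) z"
proof -
  obtain \<psi> where \<psi>: "integrable m \<psi>"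
    "AE z in mbar. LF.L (\<lambda>z. indicator (space p) (fst z 0) * indicator (space P) (\<lambda>n. fst z (Suc n)) * \<phi> (snd z)) z
       = indicator (space P) (fst z) * \<psi> (snd z)"
    "\<And>g. g \<in> bmeas m \<Longrightarrow> (LINT x|m. \<psi> x * g x)
       = (LINT y|(p \<Otimes>\<^sub>M m). indicator (space p) (fst y) * \<phi> (snd y) * g (f (fst y) (snd y)))"
    by (rule LF_cylinder_step[OF \<phi> sets.top sets.top]) blast
  have [measurable]: "\<phi> \<in> borel_measurable m" using \<phi> by simp
  have sp: "indicator (space p) (fst z 0) * indicator (space P) (\<lambda>n. fst z (Suc n)) * \<phi> (snd z) = emb \<phi> z"
    if "z \<in> space mbar" for z
    using that measurable_space[OF coord_measurable] measurable_space[OF shift_measurable]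
    by (auto simp: space_pair_measure emb_def)
  have "AE z in mbar. LF.L (\<lambda>z. indicator (space p) (fst z 0) * indicator (space P) (\<lambda>n. fst z (Suc n)) * \<phi> (snd z)) z = LF.L (emb \<phi>) z"
  proof (rule LF.L_cong_AE)
    show "integrable mbar (\<lambda>z. indicator (space p) (fst z 0) * indicator (space P) (\<lambda>n. fst z (Suc n)) * \<phi> (snd z))"
      using emb_integrable[OF \<phi>] by (subst Bochner_Integration.integrable_cong[OF refl sp]) auto
  qed (use emb_integrable[OF \<phi>] sp in auto)
  moreover have "AE x in m. \<psi> x = Lf.L \<phi> x"
  proof (rule AE_eq_by_testing[OF \<psi>(1) Lf.L_integrable[OF \<phi>]])
    fix A assume A [measurable]: "A \<in> sets m"
    have a: "integrable (p \<Otimes>\<^sub>M m) (\<lambda>y. \<phi> (snd y))"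
      using integrable_distr_eq[of snd "p \<Otimes>\<^sub>M m" m \<phi>] \<phi> unfolding distr_snd_prob[OF prob_p prob_m] by simp
    have b: "(\<lambda>y. indicator A (f (fst y) (snd y))) \<in> bmeas (p \<Otimes>\<^sub>M m)"
      by (rule bmeasI[of _ _ 1]) (auto simp: indicator_def)
    have i: "integrable (p \<Otimes>\<^sub>M m) (\<lambda>(t, x). \<phi> x * indicator A (f t x))"
      using integrable_mult_bmeas[OF a b] by (simp add: split_beta')
    have "(LINT x|m. \<psi> x * indicator A x) = (LINT y|(p \<Otimes>\<^sub>M m). (case y of (t, x) \<Rightarrow> \<phi> x * indicator A (f t x)))"
      unfolding \<psi>(3)[OF bmeas_indicator[OF A]]
      by (rule Bochner_Integration.integral_cong[OF refl]) (auto simp: space_pair_measure)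
    also have "\<dots> = (LINT x|m. LINT t|p. \<phi> x * indicator A (f t x))" by (rule NM.integral_snd[OF i, symmetric])
    also have "\<dots> = (LINT x|m. \<phi> x * Uf (indicator A) x)" unfolding Uf_def by simp
    also have "\<dots> = (LINT x|m. Lf.L \<phi> x * indicator A x)" using Lf.duality[OF \<phi> bmeas_indicator[OF A]] by simp
    finally show "(LINT x|m. \<psi> x * indicator A x) = (LINT x|m. Lf.L \<phi> x * indicator A x)" .
  qed
  then have "AE z in mbar. \<psi> (snd z) = Lf.L \<phi> (snd z)" by (rule AE_emb)
  ultimately show ?thesis
    using \<psi>(2) AE_space by eventually_elim (auto simp: emb_def space_pair_measure)
qed

lemma LF_iter_emb:
  assumes \<phi>: "integrable m \<phi>"
  shows "AE z in mbar. (LF.L ^^ k) (emb \<phi>) z = emb ((Lf.L ^^ k) \<phi>) z"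
proof (induction k)
  case (Suc k)
  have i: "integrable m ((Lf.L ^^ k) \<phi>)" by (rule Lf.iter_integrable[OF \<phi>])
  have "AE z in mbar. LF.L ((LF.L ^^ k) (emb \<phi>)) z = LF.L (emb ((Lf.L ^^ k) \<phi>)) z"
    using Suc \<phi> i by (intro LF.L_cong_AE LF.iter_integrable emb_integrable)
  then show ?case using LF_emb[OF i] by eventually_elim simp
qed simp

lemma LF_cesaro_emb:
  assumes \<phi>: "integrable m \<phi>"
  shows "AE z in mbar. cesaro LF.L n (emb \<phi>) z = emb (cesaro Lf.L n \<phi>) z"
proof -
  have "AE z in mbar. \<forall>k. (LF.L ^^ k) (emb \<phi>) z = emb ((Lf.L ^^ k) \<phi>) z"
    unfolding AE_all_countable using LF_iter_emb[OF \<phi>] by blast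
  then show ?thesis by eventually_elim (simp add: cesaro_def emb_def)
qed

section \<open>Loss of memory of the noise\<close>

definition forgets_noise :: "((nat \<Rightarrow> 't) \<times> 'x \<Rightarrow> real) \<Rightarrow> bool" where
  "forgets_noise \<phi> \<longleftrightarrow> (\<forall>e>0. \<exists>N. \<forall>k\<ge>N. \<exists>\<psi>. integrable m \<psi> \<and>
     L1_norm mbar (\<lambda>z. (LF.L ^^ k) \<phi> z - emb \<psi> z) < e)"

lemma forgets_noiseE:
  assumes "forgets_noise \<phi>" "0 < e"
  obtains k \<psi> where "integrable m \<psi>" "L1_norm mbar (\<lambda>z. (LF.L ^^ k) \<phi> z - emb \<psi> z) < e"
proof -
  obtain N where "\<forall>k\<ge>N. \<exists>\<psi>. integrable m \<psi> \<and> L1_norm mbar (\<lambda>z. (LF.L ^^ k) \<phi> z - emb \<psi> z) < e"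
    using assms unfolding forgets_noise_def by blast
  then have "\<exists>\<psi>. integrable m \<psi> \<and> L1_norm mbar (\<lambda>z. (LF.L ^^ N) \<phi> z - emb \<psi> z) < e" by simp
  then show ?thesis using that by blast
qed

lemma forgets_noiseI:
  assumes \<phi>: "integrable mbar \<phi>"
    and approx: "\<And>e. 0 < e \<Longrightarrow> \<exists>k \<psi>. integrable m \<psi> \<and> L1_norm mbar (\<lambda>z. (LF.L ^^ k) \<phi> z - emb \<psi> z) < e"
  shows "forgets_noise \<phi>"
  unfolding forgets_noise_def
proof (intro allI impI)
  fix e :: real assume "0 < e"
  then obtain N \<psi> where \<psi>: "integrable m \<psi>" "L1_norm mbar (\<lambda>z. (LF.L ^^ N) \<phi> z - emb \<psi> z) < e"
    using approx by blast
  show "\<exists>N. \<forall>k\<ge>N. \<exists>\<psi>. integrable m \<psi> \<and> L1_norm mbar (\<lambda>z. (LF.L ^^ k) \<phi> z - emb \<psi> z) < e"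
  proof (intro exI[of _ N] allI impI)
    fix k assume "N \<le> k"
    then obtain j where k: "k = j + N" by (metis add.commute le_Suc_ex)
    interpret I: markov_operator mbar "LF.L ^^ j" "(\<lambda>g z. g (F z)) ^^ j" by (rule LF.markov_operator_iter)
    have i: "integrable m ((Lf.L ^^ j) \<psi>)" by (rule Lf.iter_integrable[OF \<psi>(1)])
    have i2: "integrable mbar ((LF.L ^^ N) \<phi>)" by (rule LF.iter_integrable[OF \<phi>])
    have "L1_norm mbar (\<lambda>z. (LF.L ^^ k) \<phi> z - emb ((Lf.L ^^ j) \<psi>) z)
        = L1_norm mbar (\<lambda>z. (LF.L ^^ j) ((LF.L ^^ N) \<phi>) z - (LF.L ^^ j) (emb \<psi>) z)"
      unfolding k funpow_add comp_apply using LF_iter_emb[OF \<psi>(1), of j]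
      by (intro L1_norm_cong_AE borel_measurable_diff borel_measurable_integrable I.L_integrable i2 emb_integrable i \<psi>(1))
        (auto elim: eventually_mono)
    also have "\<dots> \<le> L1_norm mbar (\<lambda>z. (LF.L ^^ N) \<phi> z - emb \<psi> z)"
      by (rule I.L_norm_diff_le[OF i2 emb_integrable[OF \<psi>(1)]])
    finally have "L1_norm mbar (\<lambda>z. (LF.L ^^ k) \<phi> z - emb ((Lf.L ^^ j) \<psi>) z) < e" using \<psi>(2) by linarith
    then show "\<exists>\<psi>. integrable m \<psi> \<and> L1_norm mbar (\<lambda>z. (LF.L ^^ k) \<phi> z - emb \<psi> z) < e" using i by blast
  qed
qed

text \<open>The iterates of \<open>\<L>\<^sub>F\<close> are contractions, so the property is closed under limits in \<open>L\<^sup>1\<close>.\<close>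

lemma forgets_noise_limit:
  assumes \<phi>: "integrable mbar \<phi>"
    and approx: "\<And>e. 0 < e \<Longrightarrow> \<exists>\<phi>'. integrable mbar \<phi>' \<and> forgets_noise \<phi>' \<and> L1_norm mbar (\<lambda>z. \<phi> z - \<phi>' z) < e"
  shows "forgets_noise \<phi>"
proof (rule forgets_noiseI[OF \<phi>])
  fix e :: real assume e: "0 < e"
  then obtain \<phi>' where \<phi>': "integrable mbar \<phi>'" "forgets_noise \<phi>'" "L1_norm mbar (\<lambda>z. \<phi> z - \<phi>' z) < e / 2"
    using approx[of "e / 2"] by auto
  obtain k \<psi> where \<psi>: "integrable m \<psi>" "L1_norm mbar (\<lambda>z. (LF.L ^^ k) \<phi>' z - emb \<psi> z) < e / 2"
    by (rule forgets_noiseE[OF \<phi>'(2), of "e / 2"]) (use e in auto)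
  interpret I: markov_operator mbar "LF.L ^^ k" "(\<lambda>g z. g (F z)) ^^ k" by (rule LF.markov_operator_iter)
  have "L1_norm mbar (\<lambda>z. (LF.L ^^ k) \<phi> z - emb \<psi> z)
      \<le> L1_norm mbar (\<lambda>z. (LF.L ^^ k) \<phi> z - (LF.L ^^ k) \<phi>' z) + L1_norm mbar (\<lambda>z. (LF.L ^^ k) \<phi>' z - emb \<psi> z)"
    by (intro L1_dist_triangle I.L_integrable \<phi> \<phi>' emb_integrable \<psi>)
  also have "\<dots> < e" using I.L_norm_diff_le[OF \<phi> \<phi>'(1)] \<phi>'(3) \<psi>(2) by linarith
  finally show "\<exists>k \<psi>. integrable m \<psi> \<and> L1_norm mbar (\<lambda>z. (LF.L ^^ k) \<phi> z - emb \<psi> z) < e" using \<psi>(1) by blast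
qed

lemma forgets_noise_cong:
  assumes "forgets_noise \<phi>" "integrable mbar \<phi>" "integrable mbar \<phi>'" "AE z in mbar. \<phi> z = \<phi>' z"
  shows "forgets_noise \<phi>'"
proof (rule forgets_noise_limit[OF assms(3)])
  fix e :: real assume "0 < e"
  moreover have "L1_norm mbar (\<lambda>z. \<phi>' z - \<phi> z) = 0"
    using assms by (subst L1_norm_eq_0_iff) (auto elim: eventually_mono)
  ultimately show "\<exists>\<phi>''. integrable mbar \<phi>'' \<and> forgets_noise \<phi>'' \<and> L1_norm mbar (\<lambda>z. \<phi>' z - \<phi>'' z) < e"
    using assms by (intro exI[of _ \<phi>]) auto
qed

lemma forgets_noise_lincomb:
  assumes \<phi>: "integrable mbar \<phi>" "forgets_noise \<phi>"
    and \<phi>': "integrable mbar \<phi>'" "forgets_noise \<phi>'"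
  shows "forgets_noise (\<lambda>z. a * \<phi> z + b * \<phi>' z)"
proof (rule forgets_noiseI)
  show "integrable mbar (\<lambda>z. a * \<phi> z + b * \<phi>' z)" using \<phi> \<phi>' by auto
  fix e :: real assume e: "0 < e"
  define d where "d = e / (\<bar>a\<bar> + \<bar>b\<bar> + 1)"
  have d: "0 < d" unfolding d_def using e by auto
  obtain N where N: "\<And>k. N \<le> k \<Longrightarrow> \<exists>\<psi>. integrable m \<psi> \<and> L1_norm mbar (\<lambda>z. (LF.L ^^ k) \<phi> z - emb \<psi> z) < d"
    using \<phi>(2) d unfolding forgets_noise_def by blast
  obtain N' where N': "\<And>k. N' \<le> k \<Longrightarrow> \<exists>\<psi>. integrable m \<psi> \<and> L1_norm mbar (\<lambda>z. (LF.L ^^ k) \<phi>' z - emb \<psi> z) < d"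
    using \<phi>'(2) d unfolding forgets_noise_def by blast
  define k where "k = max N N'"
  obtain \<psi> where \<psi>: "integrable m \<psi>" "L1_norm mbar (\<lambda>z. (LF.L ^^ k) \<phi> z - emb \<psi> z) < d"
    using N[of k] unfolding k_def by auto
  obtain \<psi>' where \<psi>': "integrable m \<psi>'" "L1_norm mbar (\<lambda>z. (LF.L ^^ k) \<phi>' z - emb \<psi>' z) < d"
    using N'[of k] unfolding k_def by auto
  interpret I: markov_operator mbar "LF.L ^^ k" "(\<lambda>g z. g (F z)) ^^ k" by (rule LF.markov_operator_iter)
  let ?\<psi> = "\<lambda>x. a * \<psi> x + b * \<psi>' x"
  let ?u = "\<lambda>z. (LF.L ^^ k) \<phi> z - emb \<psi> z" and ?v = "\<lambda>z. (LF.L ^^ k) \<phi>' z - emb \<psi>' z"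
  have ui: "integrable mbar ?u" "integrable mbar ?v"
    by (intro Bochner_Integration.integrable_diff I.L_integrable \<phi> \<phi>' emb_integrable \<psi> \<psi>')+
  have \<psi>i: "integrable m ?\<psi>" using \<psi>(1) \<psi>'(1) by auto
  have "AE z in mbar. (LF.L ^^ k) (\<lambda>z. a * \<phi> z + b * \<phi>' z) z - emb ?\<psi> z = a * ?u z + b * ?v z"
    using I.L_lincomb[OF \<phi>(1) \<phi>'(1), of a b] by eventually_elim (simp add: emb_def algebra_simps)
  then have "L1_norm mbar (\<lambda>z. (LF.L ^^ k) (\<lambda>z. a * \<phi> z + b * \<phi>' z) z - emb ?\<psi> z) = L1_norm mbar (\<lambda>z. a * ?u z + b * ?v z)"
    using ui \<phi>(1) \<phi>'(1) \<psi>i \<psi>(1) \<psi>'(1) by (intro L1_norm_cong_AE borel_measurable_integrable Bochner_Integration.integrable_diff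
        I.L_integrable emb_integrable Bochner_Integration.integrable_add integrable_mult_right) auto
  also have "\<dots> \<le> \<bar>a\<bar> * L1_norm mbar ?u + \<bar>b\<bar> * L1_norm mbar ?v"
    using L1_norm_triangle[of mbar "\<lambda>z. a * ?u z" "\<lambda>z. b * ?v z"] ui unfolding L1_norm_scale by simp
  also have "\<dots> \<le> \<bar>a\<bar> * d + \<bar>b\<bar> * d" using \<psi>(2) \<psi>'(2) by (intro add_mono mult_left_mono) auto
  also have "\<dots> < e"
  proof -
    have "d * (\<bar>a\<bar> + \<bar>b\<bar> + 1) = e" unfolding d_def by (simp add: add_nonneg_eq_0_iff add_nonneg_pos less_imp_neq[symmetric])
    then show ?thesis using d by (simp add: algebra_simps)
  qed
  finally show "\<exists>k \<psi>. integrable m \<psi> \<and> L1_norm mbar (\<lambda>z. (LF.L ^^ k) (\<lambda>z. a * \<phi> z + b * \<phi>' z) z - emb \<psi> z) < e"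
    using \<psi>i by blast
qed

lemma forgets_noise_step:
  assumes \<phi>: "integrable mbar \<phi>" and "forgets_noise (LF.L \<phi>)"
  shows "forgets_noise \<phi>"
proof (rule forgets_noiseI[OF \<phi>])
  fix e :: real assume "0 < e"
  then obtain k \<psi> where "integrable m \<psi>" "L1_norm mbar (\<lambda>z. (LF.L ^^ k) (LF.L \<phi>) z - emb \<psi> z) < e"
    using forgets_noiseE[OF assms(2)] by blast
  then show "\<exists>k \<psi>. integrable m \<psi> \<and> L1_norm mbar (\<lambda>z. (LF.L ^^ k) \<phi> z - emb \<psi> z) < e"
    by (intro exI[of _ "Suc k"] exI[of _ \<psi>]) (simp add: funpow_swap1)
qed

lemma forgets_noise_emb:
  assumes \<phi>: "integrable m \<phi>"
  shows "forgets_noise (emb \<phi>)"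
proof (rule forgets_noiseI[OF emb_integrable[OF \<phi>]])
  fix e :: real assume "0 < e"
  then show "\<exists>k \<psi>. integrable m \<psi> \<and> L1_norm mbar (\<lambda>z. (LF.L ^^ k) (emb \<phi>) z - emb \<psi> z) < e"
    using \<phi> by (intro exI[of _ 0] exI[of _ \<phi>]) (simp add: L1_norm_def)
qed

text \<open>After \<open>k\<close> steps all coordinates on which the cylinder imposes a condition have been used up.\<close>

lemma forgets_noise_cylinder:
  assumes "\<And>i. E i \<in> sets p" "integrable m \<phi>"
  shows "forgets_noise (\<lambda>z. indicator {\<omega> \<in> space P. \<forall>i<k. \<omega> i \<in> E i} (fst z) * \<phi> (snd z))"
  using assms
proof (induction k arbitrary: E \<phi>)
  case 0
  have "(\<lambda>z. indicator {\<omega> \<in> space P. \<forall>i<0. \<omega> i \<in> E i} (fst z) * \<phi> (snd z)) z = emb \<phi> z" if "z \<in> space mbar" for z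
    using that by (auto simp: emb_def space_pair_measure)
  moreover have "integrable mbar (\<lambda>z. indicator {\<omega> \<in> space P. \<forall>i<0. \<omega> i \<in> E i} (fst z) * \<phi> (snd z))"
    using emb_integrable[OF 0(2)] calculation by (subst Bochner_Integration.integrable_cong[OF refl, of _ _ "emb \<phi>"]) auto
  ultimately show ?case
    using 0(2) by (intro forgets_noise_cong[OF forgets_noise_emb[OF 0(2)]]) (auto intro!: AE_I2)
next
  case (Suc k)
  let ?C = "{\<omega> \<in> space P. \<forall>i<k. \<omega> i \<in> E (Suc i)}"
  let ?u = "\<lambda>z. indicator {\<omega> \<in> space P. \<forall>i<Suc k. \<omega> i \<in> E i} (fst z) * \<phi> (snd z)"
  note [measurable] = Suc.prems(1)
  have Es: "E i \<in> sets p" for i by (rule Suc.prems(1))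
  have C [measurable]: "{\<omega> \<in> space P. \<forall>i<n. \<omega> i \<in> E' i} \<in> sets P" if "\<And>i. E' i \<in> sets p" for E' and n :: nat
  proof -
    note [measurable] = that
    show ?thesis by measurable
  qed
  obtain \<psi> where \<psi>: "integrable m \<psi>"
    "AE z in mbar. LF.L (\<lambda>z. indicator (E 0) (fst z 0) * indicator ?C (\<lambda>n. fst z (Suc n)) * \<phi> (snd z)) z
       = indicator ?C (fst z) * \<psi> (snd z)"
    by (rule LF_cylinder_step[OF Suc.prems(2) Es C[of "\<lambda>i. E (Suc i)"]]) (use Es in blast)+
  have eq: "?u z = indicator (E 0) (fst z 0) * indicator ?C (\<lambda>n. fst z (Suc n)) * \<phi> (snd z)" if "z \<in> space mbar" for z
    using that measurable_space[OF shift_measurable, of "fst z"]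
    by (auto simp: space_pair_measure indicator_def less_Suc_eq_0_disj)
  have ui: "integrable mbar ?u"
  proof -
    have "(\<lambda>z. indicator {\<omega> \<in> space P. \<forall>i<Suc k. \<omega> i \<in> E i} (fst z) :: real) \<in> bmeas mbar"
      using C[of E "Suc k", OF Es]
      by (intro bmeasI[of _ _ 1] measurable_compose[OF measurable_fst borel_measurable_indicator]) (auto simp: indicator_def)
    from integrable_mult_bmeas[OF emb_integrable[OF Suc.prems(2)] this]
    show ?thesis by (simp add: emb_def mult.commute)
  qed
  have vi: "integrable mbar (\<lambda>z. indicator (E 0) (fst z 0) * indicator ?C (\<lambda>n. fst z (Suc n)) * \<phi> (snd z))"
    using ui by (subst Bochner_Integration.integrable_cong[OF refl, of _ _ ?u]) (simp_all only: eq)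
  have "AE z in mbar. LF.L ?u z = LF.L (\<lambda>z. indicator (E 0) (fst z 0) * indicator ?C (\<lambda>n. fst z (Suc n)) * \<phi> (snd z)) z"
    by (rule LF.L_cong_AE[OF ui vi AE_I2]) (rule eq)
  then have L: "AE z in mbar. indicator ?C (fst z) * \<psi> (snd z) = LF.L ?u z" using \<psi>(2) by eventually_elim simp
  have wi: "integrable mbar (\<lambda>z. indicator ?C (fst z) * \<psi> (snd z))"
  proof -
    have "(\<lambda>z. indicator ?C (fst z) :: real) \<in> bmeas mbar"
      using C[of "\<lambda>i. E (Suc i)" k, OF Es]
      by (intro bmeasI[of _ _ 1] measurable_compose[OF measurable_fst borel_measurable_indicator]) (auto simp: indicator_def)
    from integrable_mult_bmeas[OF emb_integrable[OF \<psi>(1)] this]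
    show ?thesis by (simp add: emb_def mult.commute)
  qed
  have "forgets_noise (\<lambda>z. indicator ?C (fst z) * \<psi> (snd z))"
    using Suc.IH[of "\<lambda>i. E (Suc i)" \<psi>] Es \<psi>(1) by blast
  then have "forgets_noise (LF.L ?u)"
    by (rule forgets_noise_cong[OF _ wi LF.L_integrable[OF ui] L])
  then show ?case by (rule forgets_noise_step[OF ui])
qed

lemma indicator_union_limit:
  fixes A :: "nat \<Rightarrow> 'z set" and \<phi> :: "'z \<Rightarrow> real"
  assumes \<phi>: "integrable N \<phi>" and A: "\<And>i. A i \<in> sets N" "disjoint_family A" and e: "0 < e"
  obtains n where "L1_norm N (\<lambda>z. indicator (\<Union>i. A i) z * \<phi> z - (\<Sum>i<n. indicator (A i) z * \<phi> z)) < e"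
proof -
  have [measurable]: "\<phi> \<in> borel_measurable N" "\<And>i. A i \<in> sets N" using \<phi> A by auto
  have part: "(\<Sum>i<n. indicator (A i) z * \<phi> z) = indicator (\<Union>i<n. A i) z * \<phi> z" for n z
  proof -
    have "(\<Sum>i<n. indicator (A i) z) = (indicator (\<Union>i<n. A i) z :: real)"
      using A(2) by (subst indicator_UN_disjoint) (auto simp: disjoint_family_on_def)
    then show ?thesis by (simp add: sum_distrib_right[symmetric])
  qed
  have "(\<lambda>n. LINT z|N. \<bar>indicator (\<Union>i. A i) z * \<phi> z - (\<Sum>i<n. indicator (A i) z * \<phi> z)\<bar>) \<longlonglongrightarrow> (LINT z|N. 0)"
  proof (rule integral_dominated_convergence[where w = "\<lambda>z. \<bar>\<phi> z\<bar>"])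
    show "AE z in N. (\<lambda>n. \<bar>indicator (\<Union>i. A i) z * \<phi> z - (\<Sum>i<n. indicator (A i) z * \<phi> z)\<bar>) \<longlonglongrightarrow> 0"
    proof (rule AE_I2)
      fix z
      have "(\<lambda>i. indicator (A i) z * \<phi> z) sums (indicator (\<Union>i. A i) z * \<phi> z)"
        using A(2) by (intro sums_mult2 indicator_sums) (auto simp: disjoint_family_on_def)
      then have "(\<lambda>n. indicator (\<Union>i. A i) z * \<phi> z - (\<Sum>i<n. indicator (A i) z * \<phi> z)) \<longlonglongrightarrow> 0"
        unfolding sums_def using tendsto_diff[OF tendsto_const, of _ _ _ "indicator (\<Union>i. A i) z * \<phi> z"] by fastforce
      then show "(\<lambda>n. \<bar>indicator (\<Union>i. A i) z * \<phi> z - (\<Sum>i<n. indicator (A i) z * \<phi> z)\<bar>) \<longlonglongrightarrow> 0"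
        by (rule tendsto_rabs_zero)
    qed
    show "AE z in N. norm \<bar>indicator (\<Union>i. A i) z * \<phi> z - (\<Sum>i<n. indicator (A i) z * \<phi> z)\<bar> \<le> \<bar>\<phi> z\<bar>" for n
      unfolding part by (auto simp: indicator_def)
  qed (use \<phi> in auto)
  then have "(\<lambda>n. L1_norm N (\<lambda>z. indicator (\<Union>i. A i) z * \<phi> z - (\<Sum>i<n. indicator (A i) z * \<phi> z))) \<longlonglongrightarrow> 0"
    unfolding L1_norm_def by simp
  from order_tendstoD(2)[OF this e] show ?thesis using that by (auto simp: eventually_sequentially)
qed

lemma forgets_noise_sum:
  fixes u :: "nat \<Rightarrow> (nat \<Rightarrow> 't) \<times> 'x \<Rightarrow> real"
  assumes "\<And>i. integrable mbar (u i)" "\<And>i. forgets_noise (u i)"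
  shows "forgets_noise (\<lambda>z. \<Sum>i<n. u i z)"
proof (induction n)
  case 0
  show ?case using forgets_noise_emb[of "\<lambda>_. 0"] by (simp add: emb_def)
next
  case (Suc n)
  have "forgets_noise (\<lambda>z. 1 * (\<Sum>i<n. u i z) + 1 * u n z)"
    using Suc assms by (intro forgets_noise_lincomb) auto
  then show ?case by simp
qed

text \<open>
  Induction over a generated \<open>\<sigma>\<close>-algebra. The map \<open>D\<close> translates its sets into subsets of \<open>\<Omega> \<times> X\<close>; it
  allows to treat first the events of the noise alone and then all measurable sets.
\<close>

lemma forgets_noise_dynkin:
  fixes D :: "'z set \<Rightarrow> ((nat \<Rightarrow> 't) \<times> 'x) set"
  assumes \<phi>: "integrable mbar \<phi>" and G: "Int_stable G" "G \<subseteq> Pow W" and A: "A \<in> sigma_sets W G"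
    and D: "\<And>A. A \<in> sigma_sets W G \<Longrightarrow> D A \<in> sets mbar"
    and D_empty: "D {} = {}" and D_compl: "\<And>A. A \<in> sigma_sets W G \<Longrightarrow> D (W - A) = space mbar - D A"
    and D_UN: "\<And>A :: nat \<Rightarrow> 'z set. D (\<Union>i. A i) = (\<Union>i. D (A i))"
    and D_Int: "\<And>A B. D (A \<inter> B) = D A \<inter> D B"
    and whole: "forgets_noise \<phi>"
    and generator: "\<And>A. A \<in> G \<Longrightarrow> forgets_noise (\<lambda>z. indicator (D A) z * \<phi> z)"
  shows "forgets_noise (\<lambda>z. indicator (D A) z * \<phi> z)"
proof -
  have i: "integrable mbar (\<lambda>z. indicator (D A) z * \<phi> z)" if "A \<in> sigma_sets W G" for A
    using integrable_real_mult_indicator[OF D[OF that] \<phi>] by (simp add: mult.commute)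
  show ?thesis
    using G A
  proof (induction rule: sigma_sets_induct_disjoint)
    case (basic A)
    then show ?case by (rule generator)
  next
    case empty
    show ?case using forgets_noise_emb[of "\<lambda>_. 0"] by (simp add: emb_def D_empty)
  next
    case (compl A)
    have "forgets_noise (\<lambda>z. 1 * \<phi> z + (-1) * (indicator (D A) z * \<phi> z))"
      by (rule forgets_noise_lincomb[OF \<phi> whole i[OF compl(1)] compl(2)])
    then show ?case
    proof (rule forgets_noise_cong)
      show "integrable mbar (\<lambda>z. 1 * \<phi> z + (-1) * (indicator (D A) z * \<phi> z))" using \<phi> i[OF compl(1)] by simp
      show "integrable mbar (\<lambda>z. indicator (D (W - A)) z * \<phi> z)" by (rule i[OF sigma_sets.Compl[OF compl(1)]])
      show "AE z in mbar. 1 * \<phi> z + (-1) * (indicator (D A) z * \<phi> z) = indicator (D (W - A)) z * \<phi> z"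
        using AE_space by eventually_elim (auto simp: D_compl[OF compl(1)] indicator_def)
    qed
  next
    case (union A)
    have As: "A i \<in> sigma_sets W G" for i using union(2) by auto
    have disj: "disjoint_family (\<lambda>i. D (A i))"
      using union(1) D_Int D_empty unfolding disjoint_family_on_def by metis
    have Un: "(\<Union>i. A i) \<in> sigma_sets W G" by (rule sigma_sets.Union[OF As])
    show ?case
    proof (rule forgets_noise_limit[OF i[OF Un]])
      fix e :: real assume e: "0 < e"
      obtain n where n: "L1_norm mbar (\<lambda>z. indicator (\<Union>i. D (A i)) z * \<phi> z - (\<Sum>i<n. indicator (D (A i)) z * \<phi> z)) < e"
        by (rule indicator_union_limit[OF \<phi> D[OF As] disj e])
      have "forgets_noise (\<lambda>z. \<Sum>i<n. indicator (D (A i)) z * \<phi> z)"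
        by (rule forgets_noise_sum[OF i[OF As] union(3)])
      moreover have "integrable mbar (\<lambda>z. \<Sum>i<n. indicator (D (A i)) z * \<phi> z)"
        using i[OF As] by (intro Bochner_Integration.integrable_sum)
      ultimately show "\<exists>\<phi>'. integrable mbar \<phi>' \<and> forgets_noise \<phi>' \<and>
          L1_norm mbar (\<lambda>z. indicator (D (\<Union>i. A i)) z * \<phi> z - \<phi>' z) < e"
        using n unfolding D_UN by blast
    qed
  qed
qed

lemma forgets_noise_fst:
  assumes \<phi>: "integrable m \<phi>" and C: "C \<in> sets P"
  shows "forgets_noise (\<lambda>z. indicator (C \<times> space m) z * emb \<phi> z)"
proof (rule forgets_noise_dynkin[where G = "prod_algebra (UNIV :: nat set) (\<lambda>_. p)" and W = "space P" and D = "\<lambda>C. C \<times> space m"])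
  have sig: "sets P = sigma_sets (space P) (prod_algebra (UNIV :: nat set) (\<lambda>_. p))"
    unfolding bernoulli_def sets_PiM space_PiM ..
  show "Int_stable (prod_algebra (UNIV :: nat set) (\<lambda>_. p))" by (rule Int_stable_prod_algebra)
  show "prod_algebra (UNIV :: nat set) (\<lambda>_. p) \<subseteq> Pow (space P)"
    unfolding bernoulli_def space_PiM by (rule prod_algebra_sets_into_space)
  show "C \<in> sigma_sets (space P) (prod_algebra (UNIV :: nat set) (\<lambda>_. p))" using C sig by simp
  show "A \<times> space m \<in> sets mbar" if "A \<in> sigma_sets (space P) (prod_algebra (UNIV :: nat set) (\<lambda>_. p))" for A
    using that sig by auto
  show "integrable mbar (emb \<phi>)" using \<phi> by simp
  show "forgets_noise (emb \<phi>)" by (rule forgets_noise_emb[OF \<phi>])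
  fix A assume "A \<in> prod_algebra (UNIV :: nat set) (\<lambda>_. p)"
  then obtain J E where A: "A = prod_emb UNIV (\<lambda>_. p) J (\<Pi>\<^sub>E j\<in>J. E j)" and J: "finite J" and E: "\<And>i. i \<in> J \<Longrightarrow> E i \<in> sets p"
    by (rule prod_algebraE) blast
  define E' where "E' i = (if i \<in> J then E i else space p)" for i
  obtain k where k: "J \<subseteq> {..<k}" using finite_nat_iff_bounded J by blast
  have "A = {\<omega> \<in> space P. \<forall>i<k. \<omega> i \<in> E' i}"
  proof -
    have "\<omega> \<in> A \<longleftrightarrow> \<omega> \<in> space P \<and> (\<forall>j\<in>J. \<omega> j \<in> E j)" for \<omega>
      unfolding A prod_emb_def by (auto simp: restrict_PiE_iff bernoulli_def space_PiM)
    moreover have "(\<forall>j\<in>J. \<omega> j \<in> E j) \<longleftrightarrow> (\<forall>i<k. \<omega> i \<in> E' i)" if "\<omega> \<in> space P" for \<omega>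
    proof
      assume "\<forall>j\<in>J. \<omega> j \<in> E j"
      then show "\<forall>i<k. \<omega> i \<in> E' i" using measurable_space[OF coord_measurable that] by (simp add: E'_def)
    next
      assume *: "\<forall>i<k. \<omega> i \<in> E' i"
      show "\<forall>j\<in>J. \<omega> j \<in> E j"
      proof
        fix j assume j: "j \<in> J"
        then have "j < k" using k by auto
        then have "\<omega> j \<in> E' j" using * by blast
        then show "\<omega> j \<in> E j" using j by (simp add: E'_def)
      qed
    qed
    ultimately show ?thesis by blast
  qed
  moreover have "forgets_noise (\<lambda>z. indicator {\<omega> \<in> space P. \<forall>i<k. \<omega> i \<in> E' i} (fst z) * \<phi> (snd z))"
    using E \<phi> by (intro forgets_noise_cylinder) (auto simp: E'_def)
  ultimately have "forgets_noise (\<lambda>z. indicator A (fst z) * \<phi> (snd z))" by simp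
  moreover have As: "A \<in> sets P" using \<open>A \<in> prod_algebra (UNIV :: nat set) (\<lambda>_. p)\<close> sig by auto
  have i: "integrable mbar (\<lambda>z. indicator (A \<times> space m) z * emb \<phi> z)"
    using integrable_real_mult_indicator[OF pair_measureI[OF As sets.top] emb_integrable[OF \<phi>]] by (simp add: mult.commute)
  have eq: "indicator (A \<times> space m) z * emb \<phi> z = indicator A (fst z) * \<phi> (snd z)" if "z \<in> space mbar" for z
    using that by (auto simp: emb_def space_pair_measure indicator_def)
  have i2: "integrable mbar (\<lambda>z. indicator A (fst z) * \<phi> (snd z))"
    using i by (subst (asm) Bochner_Integration.integrable_cong[OF refl eq])
  ultimately show "forgets_noise (\<lambda>z. indicator (A \<times> space m) z * emb \<phi> z)"
    by (intro forgets_noise_cong[OF _ i2 i]) (auto intro!: AE_I2 simp: eq)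
qed (auto simp: space_pair_measure)

text \<open>
  From cylinders to all events of the noise, to rectangles, to all measurable sets, to integrable
  functions.
\<close>

theorem integrable_forgets_noise:
  assumes "integrable mbar \<phi>"
  shows "forgets_noise \<phi>"
  using assms
proof (induction rule: integrable_induct)
  case (base A c)
  have "forgets_noise (\<lambda>z. indicator A z * emb (\<lambda>_. c) z)"
  proof (rule forgets_noise_dynkin[where G = "{a \<times> b | a b. a \<in> sets P \<and> b \<in> sets m}" and W = "space P \<times> space m" and D = "\<lambda>A. A"])
    show "A \<in> sigma_sets (space P \<times> space m) {a \<times> b | a b. a \<in> sets P \<and> b \<in> sets m}"
      using base(1) unfolding sets_pair_measure .
    show "forgets_noise (emb (\<lambda>_. c))" by (rule forgets_noise_emb) simp
    fix A assume "A \<in> {a \<times> b | a b. a \<in> sets P \<and> b \<in> sets m}"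
    then obtain a b where A: "A = a \<times> b" and a: "a \<in> sets P" and b: "b \<in> sets m" by auto
    have "integrable m (\<lambda>x. c * indicator b x)" using b by (intro integrable_real_mult_indicator) auto
    from forgets_noise_fst[OF this a]
    have "forgets_noise (\<lambda>z. indicator (a \<times> space m) z * emb (\<lambda>x. c * indicator b x) z)" .
    moreover have "(\<lambda>z. indicator (a \<times> space m) z * emb (\<lambda>x. c * indicator b x) z) = (\<lambda>z. indicator A z * emb (\<lambda>_. c) z)"
      using sets.sets_into_space[OF b] by (auto simp: emb_def A indicator_def fun_eq_iff)
    ultimately show "forgets_noise (\<lambda>z. indicator A z * emb (\<lambda>_. c) z)" by simp
  qed (auto simp: Int_stable_pair_measure_generator pair_measure_closed sets_pair_measure space_pair_measure)
  then show ?case by (simp add: emb_def)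
next
  case (add \<phi> \<psi>)
  then show ?case using forgets_noise_lincomb[of \<phi> \<psi> 1 1] by simp
next
  case (lim \<phi> s)
  show ?case
  proof (rule forgets_noise_limit[OF lim(4)])
    fix e :: real assume e: "0 < e"
    have "(\<lambda>i. LINT z|mbar. \<bar>\<phi> z - s i z\<bar>) \<longlonglongrightarrow> (LINT z|mbar. 0)"
    proof (rule integral_dominated_convergence[where w = "\<lambda>z. 3 * \<bar>\<phi> z\<bar>"])
      show "AE z in mbar. (\<lambda>i. \<bar>\<phi> z - s i z\<bar>) \<longlonglongrightarrow> 0"
      proof (rule AE_I2)
        fix z assume "z \<in> space mbar"
        from tendsto_diff[OF tendsto_const lim(2)[OF this], of "\<phi> z"]
        show "(\<lambda>i. \<bar>\<phi> z - s i z\<bar>) \<longlonglongrightarrow> 0" by (intro tendsto_rabs_zero) simp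
      qed
      show "AE z in mbar. norm \<bar>\<phi> z - s i z\<bar> \<le> 3 * \<bar>\<phi> z\<bar>" for i
      proof (rule AE_I2)
        fix z assume "z \<in> space mbar"
        from lim(3)[OF this, of i] show "norm \<bar>\<phi> z - s i z\<bar> \<le> 3 * \<bar>\<phi> z\<bar>"
          unfolding real_norm_def abs_idempotent by linarith
      qed
    qed (use lim in auto)
    then have "(\<lambda>i. L1_norm mbar (\<lambda>z. \<phi> z - s i z)) \<longlonglongrightarrow> 0" unfolding L1_norm_def by simp
    from order_tendstoD(2)[OF this e] obtain i where "L1_norm mbar (\<lambda>z. \<phi> z - s i z) < e"
      by (auto simp: eventually_sequentially)
    then show "\<exists>\<phi>'. integrable mbar \<phi>' \<and> forgets_noise \<phi>' \<and> L1_norm mbar (\<lambda>z. \<phi> z - \<phi>' z) < e"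
      using lim by blast
  qed
qed

text \<open>An invariant function equals its own iterates, which approach functions of \<open>x\<close> alone.\<close>

lemma LF_invariant_fiber_constant:
  assumes \<phi>: "integrable mbar \<phi>" "AE z in mbar. LF.L \<phi> z = \<phi> z"
  shows "AE z in mbar. \<phi> z = emb (proj \<phi>) z"
proof -
  have pi: "integrable m (proj \<phi>)" by (rule proj_integrable[OF \<phi>(1)])
  have "L1_norm mbar (\<lambda>z. \<phi> z - emb (proj \<phi>) z) \<le> e" if e: "0 < e" for e
  proof -
    obtain k \<psi> where \<psi>: "integrable m \<psi>" "L1_norm mbar (\<lambda>z. (LF.L ^^ k) \<phi> z - emb \<psi> z) < e / 2"
      by (rule forgets_noiseE[OF integrable_forgets_noise[OF \<phi>(1)], of "e / 2"]) (use e in auto)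
    have "L1_norm mbar (\<lambda>z. \<phi> z - emb \<psi> z) = L1_norm mbar (\<lambda>z. (LF.L ^^ k) \<phi> z - emb \<psi> z)"
      using LF.iter_invariant[OF \<phi>, of k] LF.iter_integrable[OF \<phi>(1), of k] emb_integrable[OF \<psi>(1)] \<phi>(1)
      by (intro L1_norm_cong_AE) (auto elim: eventually_mono)
    then have 1: "L1_norm mbar (\<lambda>z. \<phi> z - emb \<psi> z) < e / 2" using \<psi>(2) by simp
    have "L1_norm mbar (\<lambda>z. \<phi> z - emb (proj \<phi>) z) \<le> L1_norm mbar (\<lambda>z. \<phi> z - emb \<psi> z) + L1_norm mbar (\<lambda>z. emb \<psi> z - emb (proj \<phi>) z)"
      by (intro L1_dist_triangle \<phi> emb_integrable \<psi> pi)
    also have "L1_norm mbar (\<lambda>z. emb \<psi> z - emb (proj \<phi>) z) = L1_norm m (\<lambda>x. proj \<phi> x - \<psi> x)"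
      by (simp add: emb_diff_norm \<psi>(1) pi L1_norm_minus_commute)
    also have "\<dots> \<le> L1_norm mbar (\<lambda>z. \<phi> z - emb \<psi> z)" by (rule proj_emb_norm_le[OF \<phi>(1) \<psi>(1)])
    finally show ?thesis using 1 by linarith
  qed
  then have "L1_norm mbar (\<lambda>z. \<phi> z - emb (proj \<phi>) z) \<le> 0" by (intro field_le_epsilon[of _ 0]) simp
  then have "L1_norm mbar (\<lambda>z. \<phi> z - emb (proj \<phi>) z) = 0" by (intro antisym L1_norm_nonneg)
  then have "AE z in mbar. \<phi> z - emb (proj \<phi>) z = 0"
    using \<phi>(1) emb_integrable[OF pi] by (subst (asm) L1_norm_eq_0_iff) auto
  then show ?thesis by eventually_elim simp
qed

end

section \<open>Mean constrictivity of the annealed and the skew-product operator\<close>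

lemma continuous_map_L1_contraction:
  assumes "\<And>\<phi>. integrable \<eta> \<phi> \<Longrightarrow> integrable \<eta>' (G \<phi>)"
    and "\<And>\<phi> \<psi>. integrable \<eta> \<phi> \<Longrightarrow> integrable \<eta> \<psi> \<Longrightarrow>
      L1_norm \<eta>' (\<lambda>y. G \<phi> y - G \<psi> y) \<le> L1_norm \<eta> (\<lambda>y. \<phi> y - \<psi> y)"
  shows "continuous_map (L1_topology \<eta>) (L1_topology \<eta>') G"
  unfolding continuous_map_def
proof (intro conjI allI impI)
  show "G \<in> topspace (L1_topology \<eta>) \<rightarrow> topspace (L1_topology \<eta>')" using assms(1) by auto
  fix V assume V: "openin (L1_topology \<eta>') V"
  show "openin (L1_topology \<eta>) {\<phi> \<in> topspace (L1_topology \<eta>). G \<phi> \<in> V}"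
    unfolding openin_L1_topology
  proof (intro conjI ballI)
    fix \<phi> assume "\<phi> \<in> {\<phi> \<in> topspace (L1_topology \<eta>). G \<phi> \<in> V}"
    then have \<phi>: "integrable \<eta> \<phi>" "G \<phi> \<in> V" by auto
    obtain e where e: "0 < e" "\<And>\<psi>. integrable \<eta>' \<psi> \<Longrightarrow> L1_norm \<eta>' (\<lambda>y. \<psi> y - G \<phi> y) < e \<Longrightarrow> \<psi> \<in> V"
      using V \<phi>(2) unfolding openin_L1_topology by fastforce
    show "\<exists>e>0. \<forall>\<psi>\<in>L1 \<eta>. L1_norm \<eta> (\<lambda>y. \<psi> y - \<phi> y) < e \<longrightarrow> \<psi> \<in> {\<phi> \<in> topspace (L1_topology \<eta>). G \<phi> \<in> V}"
    proof (intro exI[of _ e] conjI ballI impI e(1))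
      fix \<psi> assume \<psi>: "\<psi> \<in> L1 \<eta>" "L1_norm \<eta> (\<lambda>y. \<psi> y - \<phi> y) < e"
      then have "L1_norm \<eta>' (\<lambda>y. G \<psi> y - G \<phi> y) < e" using assms(2)[of \<psi> \<phi>] \<phi>(1) by simp
      then show "\<psi> \<in> {\<phi> \<in> topspace (L1_topology \<eta>). G \<phi> \<in> V}" using \<psi>(1) assms(1) e(2) by simp
    qed
  qed auto
qed

lemma INF_L1_dist_tendsto_0_iff:
  assumes "K \<noteq> {}"
  shows "(\<lambda>n. INF \<psi>\<in>K. L1_norm \<eta> (\<lambda>y. x n y - \<psi> y)) \<longlonglongrightarrow> 0 \<longleftrightarrow>
    (\<forall>e>0. eventually (\<lambda>n. \<exists>\<psi>\<in>K. L1_norm \<eta> (\<lambda>y. x n y - \<psi> y) < e) sequentially)"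
proof -
  have bdd: "bdd_below ((\<lambda>\<psi>. L1_norm \<eta> (\<lambda>y. x n y - \<psi> y)) ` K)" for n
    by (rule bdd_belowI2[of _ 0]) simp
  have less: "(INF \<psi>\<in>K. L1_norm \<eta> (\<lambda>y. x n y - \<psi> y)) < e \<longleftrightarrow> (\<exists>\<psi>\<in>K. L1_norm \<eta> (\<lambda>y. x n y - \<psi> y) < e)" for n e
    by (rule cINF_less_iff[OF assms bdd])
  have nn: "0 \<le> (INF \<psi>\<in>K. L1_norm \<eta> (\<lambda>y. x n y - \<psi> y))" for n
    using assms by (intro cINF_greatest) auto
  have "(\<lambda>n. INF \<psi>\<in>K. L1_norm \<eta> (\<lambda>y. x n y - \<psi> y)) \<longlonglongrightarrow> 0 \<longleftrightarrow>
    (\<forall>e>0. eventually (\<lambda>n. (INF \<psi>\<in>K. L1_norm \<eta> (\<lambda>y. x n y - \<psi> y)) < e) sequentially)"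
    using nn unfolding tendsto_iff by (simp add: dist_real_def)
  then show ?thesis unfolding less .
qed

context random_map
begin

text \<open>
  Some iterate of a density of \<open>\<L>\<^sub>F\<close> is close to \<open>emb g\<close> for a density \<open>g\<close> on \<open>X\<close>, whose averages are attracted
  by \<open>emb ` K\<close>; and iterating does not change the limit behaviour of averages.
\<close>

theorem MC_f_imp_MC_F:
  assumes "MC m Lf.L"
  shows "MC mbar LF.L"
proof -
  obtain K where K: "compactin (L1_topology m) K" "K \<noteq> {}"
    and lim: "\<And>h. h \<in> densities m \<Longrightarrow> (\<lambda>n. INF \<psi>\<in>K. L1_norm m (\<lambda>y. cesaro Lf.L n h y - \<psi> y)) \<longlonglongrightarrow> 0"
    using assms unfolding MC_def by auto
  have KL: "\<And>\<psi>. \<psi> \<in> K \<Longrightarrow> integrable m \<psi>" using compactin_subset_topspace[OF K(1)] by auto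
  have "compactin (L1_topology mbar) (emb ` K)"
    by (rule image_compactin[OF K(1) continuous_map_L1_contraction]) (auto simp: emb_diff_norm)
  moreover have "emb ` K \<noteq> {}" using K(2) by simp
  moreover have "(\<lambda>n. INF \<psi>\<in>emb ` K. L1_norm mbar (\<lambda>y. cesaro LF.L n h y - \<psi> y)) \<longlonglongrightarrow> 0" if h: "h \<in> densities mbar" for h
    unfolding INF_L1_dist_tendsto_0_iff[OF \<open>emb ` K \<noteq> {}\<close>]
  proof (intro allI impI)
    fix e :: real assume e: "0 < e"
    note hd = densitiesD[OF h]
    obtain k \<psi> where \<psi>: "integrable m \<psi>" "L1_norm mbar (\<lambda>z. (LF.L ^^ k) h z - emb \<psi> z) < e / 8"
      by (rule forgets_noiseE[OF integrable_forgets_noise[OF hd(1)], of "e / 8"]) (use e in auto)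
    define u where "u = (LF.L ^^ k) h"
    have ui: "integrable mbar u" unfolding u_def by (rule LF.iter_integrable[OF hd(1)])
    have ud: "u \<in> densities mbar"
      using ui markov_operator.L_nonneg[OF LF.markov_operator_iter hd(1,2), of k]
        markov_operator.L_integral[OF LF.markov_operator_iter hd(1), of k] hd(3)
      unfolding u_def by (intro densitiesI) auto
    define g where "g = proj u"
    have g: "g \<in> densities m" unfolding g_def by (rule proj_densities[OF ud])
    have gi: "integrable m g" using densitiesD(1)[OF g] .
    have ug: "L1_norm mbar (\<lambda>z. u z - emb g z) < e / 4"
    proof -
      have "L1_norm mbar (\<lambda>z. u z - emb g z) \<le> L1_norm mbar (\<lambda>z. u z - emb \<psi> z) + L1_norm mbar (\<lambda>z. emb \<psi> z - emb g z)"
        by (intro L1_dist_triangle ui emb_integrable \<psi> gi)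
      also have "L1_norm mbar (\<lambda>z. emb \<psi> z - emb g z) = L1_norm m (\<lambda>x. proj u x - \<psi> x)"
        unfolding g_def by (simp add: emb_diff_norm \<psi>(1) gi[unfolded g_def] L1_norm_minus_commute)
      also have "\<dots> \<le> L1_norm mbar (\<lambda>z. u z - emb \<psi> z)" by (rule proj_emb_norm_le[OF ui \<psi>(1)])
      finally show ?thesis using \<psi>(2) unfolding u_def by linarith
    qed
    have e4: "0 < e / 4" using e by simp
    have "eventually (\<lambda>n. \<exists>\<psi>\<in>K. L1_norm m (\<lambda>y. cesaro Lf.L n g y - \<psi> y) < e / 4) sequentially"
      using lim[OF g] e4 unfolding INF_L1_dist_tendsto_0_iff[OF K(2)] by blast
    moreover have "eventually (\<lambda>n. L1_norm mbar (\<lambda>y. cesaro LF.L n u y - cesaro LF.L n h y) < e / 4) sequentially"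
      using order_tendstoD(2)[OF LF.cesaro_shift_limit[OF hd(1)] e4] unfolding u_def .
    moreover have "eventually (\<lambda>n. 0 < n) sequentially" by (rule eventually_gt_at_top)
    ultimately show "eventually (\<lambda>n. \<exists>\<psi>\<in>emb ` K. L1_norm mbar (\<lambda>y. cesaro LF.L n h y - \<psi> y) < e) sequentially"
    proof eventually_elim
      case (elim n)
      then obtain \<xi> where \<xi>: "\<xi> \<in> K" "L1_norm m (\<lambda>y. cesaro Lf.L n g y - \<xi> y) < e / 4" by blast
      interpret C: markov_operator mbar "cesaro LF.L n" "cesaro (\<lambda>g z. g (F z)) n"
        using elim(3) by (rule LF.markov_operator_cesaro)
      note ints = LF.cesaro_integrable[OF hd(1), of n] LF.cesaro_integrable[OF ui, of n]
        LF.cesaro_integrable[OF emb_integrable[OF gi], of n] emb_integrable[OF KL[OF \<xi>(1)]]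
        emb_integrable[OF Lf.cesaro_integrable[OF gi, of n]]
      have 1: "L1_norm mbar (\<lambda>y. cesaro LF.L n h y - emb \<xi> y)
          \<le> L1_norm mbar (\<lambda>y. cesaro LF.L n h y - cesaro LF.L n u y) + L1_norm mbar (\<lambda>y. cesaro LF.L n u y - emb \<xi> y)"
        by (intro L1_dist_triangle ints)
      have 2: "L1_norm mbar (\<lambda>y. cesaro LF.L n u y - emb \<xi> y)
          \<le> L1_norm mbar (\<lambda>y. cesaro LF.L n u y - cesaro LF.L n (emb g) y) + L1_norm mbar (\<lambda>y. cesaro LF.L n (emb g) y - emb \<xi> y)"
        by (intro L1_dist_triangle ints)
      have 3: "L1_norm mbar (\<lambda>y. cesaro LF.L n u y - cesaro LF.L n (emb g) y) \<le> L1_norm mbar (\<lambda>z. u z - emb g z)"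
        by (rule C.L_norm_diff_le[OF ui emb_integrable[OF gi]])
      have "L1_norm mbar (\<lambda>y. cesaro LF.L n (emb g) y - emb \<xi> y) = L1_norm mbar (\<lambda>y. emb (cesaro Lf.L n g) y - emb \<xi> y)"
        using LF_cesaro_emb[OF gi, of n] ints
        by (intro L1_norm_cong_AE borel_measurable_diff borel_measurable_integrable) (auto elim: eventually_mono)
      also have "\<dots> = L1_norm m (\<lambda>y. cesaro Lf.L n g y - \<xi> y)"
        by (rule emb_diff_norm[OF Lf.cesaro_integrable[OF gi] KL[OF \<xi>(1)]])
      finally have "L1_norm mbar (\<lambda>y. cesaro LF.L n h y - emb \<xi> y) < e"
        using 1 2 3 \<xi>(2) elim(2) ug L1_norm_minus_commute[of mbar "cesaro LF.L n h" "cesaro LF.L n u"] e by linarith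
      then show ?case using \<xi>(1) by blast
    qed
  qed
  ultimately show ?thesis unfolding MC_def by blast
qed

text \<open>The image of an attractor under \<open>proj\<close> is an attractor, since \<open>proj\<close> contracts and inverts \<open>emb\<close>.\<close>

theorem MC_F_imp_MC_f:
  assumes "MC mbar LF.L"
  shows "MC m Lf.L"
proof -
  obtain K where K: "compactin (L1_topology mbar) K" "K \<noteq> {}"
    and lim: "\<And>h. h \<in> densities mbar \<Longrightarrow> (\<lambda>n. INF \<psi>\<in>K. L1_norm mbar (\<lambda>y. cesaro LF.L n h y - \<psi> y)) \<longlonglongrightarrow> 0"
    using assms unfolding MC_def by auto
  have KL: "\<And>\<psi>. \<psi> \<in> K \<Longrightarrow> integrable mbar \<psi>" using compactin_subset_topspace[OF K(1)] by auto
  have "compactin (L1_topology m) (proj ` K)"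
    by (rule image_compactin[OF K(1) continuous_map_L1_contraction]) (auto intro: proj_integrable proj_norm_le)
  moreover have ne: "proj ` K \<noteq> {}" using K(2) by simp
  moreover have "(\<lambda>n. INF \<psi>\<in>proj ` K. L1_norm m (\<lambda>y. cesaro Lf.L n h y - \<psi> y)) \<longlonglongrightarrow> 0" if h: "h \<in> densities m" for h
    unfolding INF_L1_dist_tendsto_0_iff[OF ne]
  proof (intro allI impI)
    fix e :: real assume e: "0 < e"
    have hi: "integrable m h" using densitiesD(1)[OF h] .
    have "eventually (\<lambda>n. \<exists>\<psi>\<in>K. L1_norm mbar (\<lambda>y. cesaro LF.L n (emb h) y - \<psi> y) < e) sequentially"
      using lim[OF emb_densities[OF h]] e unfolding INF_L1_dist_tendsto_0_iff[OF K(2)] by blast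
    then show "eventually (\<lambda>n. \<exists>\<psi>\<in>proj ` K. L1_norm m (\<lambda>y. cesaro Lf.L n h y - \<psi> y) < e) sequentially"
    proof eventually_elim
      case (elim n)
      then obtain \<psi> where \<psi>: "\<psi> \<in> K" "L1_norm mbar (\<lambda>y. cesaro LF.L n (emb h) y - \<psi> y) < e" by blast
      have ci: "integrable m (cesaro Lf.L n h)" by (rule Lf.cesaro_integrable[OF hi])
      have "L1_norm m (\<lambda>y. cesaro Lf.L n h y - proj \<psi> y) = L1_norm m (\<lambda>y. proj (emb (cesaro Lf.L n h)) y - proj \<psi> y)"
        by (simp add: proj_emb)
      also have "\<dots> \<le> L1_norm mbar (\<lambda>y. emb (cesaro Lf.L n h) y - \<psi> y)"
        by (rule proj_norm_le[OF emb_integrable[OF ci] KL[OF \<psi>(1)]])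
      also have "\<dots> = L1_norm mbar (\<lambda>y. cesaro LF.L n (emb h) y - \<psi> y)"
        using LF_cesaro_emb[OF hi, of n] KL[OF \<psi>(1)] emb_integrable[OF ci] LF.cesaro_integrable[OF emb_integrable[OF hi], of n]
        by (intro L1_norm_cong_AE) (auto elim: eventually_mono)
      finally show ?case using \<psi> by force
    qed
  qed
  ultimately show ?thesis unfolding MC_def by blast
qed

end

section \<open>Invariant measures and forward invariant sets\<close>

lemma bmeas_iff_bounded: "g \<in> bmeas \<eta> \<longleftrightarrow> g \<in> borel_measurable \<eta> \<and> bounded (g ` space \<eta>)"
  unfolding bmeas_def by (auto simp: bounded_iff)

lemma prob_space_density_densities:
  assumes "h \<in> densities \<eta>"
  shows "prob_space (density \<eta> (\<lambda>y. ennreal (h y)))"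
proof (rule prob_spaceI)
  note h = densitiesD[OF assms]
  have "emeasure (density \<eta> (\<lambda>y. ennreal (h y))) (space \<eta>) = (\<integral>\<^sup>+y. ennreal (h y) \<partial>\<eta>)"
    using h by (subst emeasure_density) (auto intro!: nn_integral_cong)
  also have "\<dots> = 1" using nn_integral_eq_integral[OF h(1,2)] h(3) by simp
  finally show "emeasure (density \<eta> (\<lambda>y. ennreal (h y))) (space (density \<eta> (\<lambda>y. ennreal (h y)))) = 1" by simp
qed

lemma (in prob_space) absolutely_continuous_prob_density:
  assumes \<nu>: "prob_space \<nu>" "sets \<nu> = sets M" "absolutely_continuous M \<nu>"
  defines "h \<equiv> \<lambda>x. enn2real (RN_deriv M \<nu> x)"
  shows "h \<in> densities M" and "density M (\<lambda>x. ennreal (h x)) = \<nu>"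
    and "AE x in M. RN_deriv M \<nu> x = ennreal (h x)"
proof -
  interpret \<nu>: prob_space \<nu> by fact
  have sf: "sigma_finite_measure \<nu>" by unfold_locales
  note rn = sf \<nu>(3,2)
  show eq: "AE x in M. RN_deriv M \<nu> x = ennreal (h x)"
    using RN_deriv_finite[OF rn] by eventually_elim (simp add: h_def less_top)
  have "density M (\<lambda>x. ennreal (h x)) = density M (RN_deriv M \<nu>)"
    unfolding h_def using eq by (intro density_cong) (auto simp: h_def)
  then show "density M (\<lambda>x. ennreal (h x)) = \<nu>" using density_RN_deriv[OF \<nu>(3,2)] by simp
  show "h \<in> densities M"
  proof (rule densitiesI)
    show "integrable M h" using RN_deriv_integrable[OF rn, of "\<lambda>_. 1"] unfolding h_def by simp
    show "(LINT x|M. h x) = 1" using RN_deriv_integral[OF rn, of "\<lambda>_. 1"] \<nu>.prob_space unfolding h_def by simp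
  qed (simp add: h_def)
qed

context random_map
begin

lemma F_AE:
  assumes "AE z in mbar. Q z"
  shows "AE z in mbar. Q (F z)"
proof -
  obtain N where N: "N \<in> null_sets mbar" "{z \<in> space mbar. \<not> Q z} \<subseteq> N"
    using assms by (auto simp: eventually_ae_filter)
  have "AE z in mbar. z \<notin> F -` N \<inter> space mbar" by (rule AE_not_in[OF F_null[OF N(1)]])
  then show ?thesis
    using AE_space
  proof eventually_elim
    case (elim z)
    then show ?case using N(2) measurable_space[OF F_measurable elim(2)] by auto
  qed
qed

lemma F_iter_AE:
  assumes "AE z in mbar. Q z"
  shows "AE z in mbar. Q ((F ^^ n) z)"
proof (induction n)
  case (Suc n)
  show ?case using F_AE[OF Suc] by (simp add: funpow_swap1)
qed (use assms in simp)

lemma F_iter_measurable [measurable]: "(F ^^ n) \<in> measurable mbar mbar"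
  by (rule measurable_compose_n[OF F_measurable])

lemma forward_invariant_iter:
  assumes "AE z in mbar. z \<in> D \<longrightarrow> F z \<in> D"
  shows "AE z in mbar. \<forall>n k. n \<le> k \<longrightarrow> (F ^^ n) z \<in> D \<longrightarrow> (F ^^ k) z \<in> D"
proof -
  have "AE z in mbar. \<forall>n. (F ^^ n) z \<in> D \<longrightarrow> F ((F ^^ n) z) \<in> D"
    unfolding AE_all_countable using F_iter_AE[OF assms] by blast
  then show ?thesis
  proof eventually_elim
    case (elim z)
    have "(F ^^ k) z \<in> D" if "n \<le> k" "(F ^^ n) z \<in> D" for n k
      using that by (induction rule: dec_induct) (use elim in auto)
    then show ?case by blast
  qed
qed

text \<open>
  Ergodicity is stated for strictly invariant sets. The points that visit \<open>D\<close> infinitely often form such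
  a set \<open>D'\<close>. An orbit that has entered \<open>D\<close> stays there almost surely, so \<open>1\<^sub>D \<circ> F\<^sup>n\<close> converges to \<open>1\<^sub>D\<^sub>'\<close>,
  while its integral is constant by invariance; hence \<open>D\<close> and \<open>D'\<close> have the same measure.
\<close>

lemma ergodic_forward_invariant:
  assumes \<nu>: "prob_space \<nu>" "sets \<nu> = sets mbar" "distr \<nu> \<nu> F = \<nu>" "absolutely_continuous mbar \<nu>" "ergodic F \<nu>"
    and D: "D \<in> sets mbar" and fwd: "AE z in mbar. z \<in> D \<longrightarrow> F z \<in> D"
  shows "measure \<nu> D \<in> {0, 1}"
proof -
  interpret \<nu>: prob_space \<nu> by fact
  note [measurable_cong] = \<nu>(2)
  note [measurable] = D
  have sp: "space \<nu> = space mbar" by (rule sets_eq_imp_space_eq[OF \<nu>(2)])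
  define D' where "D' = {z \<in> space mbar. \<forall>n. \<exists>k\<ge>n. (F ^^ k) z \<in> D}"
  have D' [measurable]: "D' \<in> sets mbar" unfolding D'_def by measurable
  have "F -` D' \<inter> space mbar = D'"
  proof (intro equalityI subsetI)
    fix z assume "z \<in> F -` D' \<inter> space mbar"
    then have z: "z \<in> space mbar" "\<forall>n. \<exists>k\<ge>n. (F ^^ k) (F z) \<in> D" unfolding D'_def by auto
    have "\<exists>k\<ge>n. (F ^^ k) z \<in> D" for n
    proof -
      obtain k where "n \<le> k" "(F ^^ k) (F z) \<in> D" using z(2) by blast
      then show ?thesis by (intro exI[of _ "Suc k"]) (simp add: funpow_swap1)
    qed
    then show "z \<in> D'" using z(1) unfolding D'_def by simp
  next
    fix z assume "z \<in> D'"
    then have z: "z \<in> space mbar" "\<forall>n. \<exists>k\<ge>n. (F ^^ k) z \<in> D" unfolding D'_def by auto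
    have "\<exists>k\<ge>n. (F ^^ k) (F z) \<in> D" for n
    proof -
      obtain k where "Suc n \<le> k" "(F ^^ k) z \<in> D" using z(2) by blast
      then show ?thesis by (intro exI[of _ "k - 1"]) (cases k, auto simp: funpow_swap1)
    qed
    then show "z \<in> F -` D' \<inter> space mbar"
      using z(1) measurable_space[OF F_measurable z(1)] unfolding D'_def by simp
  qed
  then have erg: "measure \<nu> D' \<in> {0, 1}"
    using \<nu>(5) D' unfolding ergodic_def sp by (simp add: \<nu>(2))
  have F\<nu>: "F \<in> measurable \<nu> \<nu>" using F_measurable by (simp cong: measurable_cong_sets add: \<nu>(2))
  have iter: "(LINT z|\<nu>. indicator D ((F ^^ n) z)) = measure \<nu> D" for n
  proof (induction n)
    case 0
    then show ?case using D \<nu>(2) by (simp add: sp)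
  next
    case (Suc n)
    have mn: "(\<lambda>z. indicator D ((F ^^ n) z) :: real) \<in> borel_measurable \<nu>" by measurable
    have "(LINT z|\<nu>. indicator D ((F ^^ Suc n) z)) = (LINT z|\<nu>. indicator D ((F ^^ n) (F z)) :: real)"
      by (simp add: funpow_swap1)
    also have "\<dots> = (LINT z|distr \<nu> \<nu> F. indicator D ((F ^^ n) z))"
      using integral_distr[OF F\<nu> mn] by simp
    finally show ?case using Suc unfolding \<nu>(3) by simp
  qed
  have "AE z in \<nu>. \<forall>n k. n \<le> k \<longrightarrow> (F ^^ n) z \<in> D \<longrightarrow> (F ^^ k) z \<in> D"
    by (rule absolutely_continuous_AE[OF \<nu>(2) \<nu>(4) forward_invariant_iter[OF fwd]])
  then have "AE z in \<nu>. (\<lambda>n. indicator D ((F ^^ n) z) :: real) \<longlonglongrightarrow> indicator D' z"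
    using AE_space
  proof eventually_elim
    case (elim z)
    show ?case
    proof (cases "\<exists>n. (F ^^ n) z \<in> D")
      case True
      then obtain n where n: "(F ^^ n) z \<in> D" by blast
      then have "\<forall>k\<ge>n. (F ^^ k) z \<in> D" using elim(1) by blast
      moreover have "z \<in> D'"
      proof -
        have "\<exists>k\<ge>l. (F ^^ k) z \<in> D" for l
          using \<open>\<forall>k\<ge>n. (F ^^ k) z \<in> D\<close> by (intro exI[of _ "max l n"]) simp
        then show ?thesis using elim(2) unfolding D'_def sp by simp
      qed
      ultimately show ?thesis
        by (intro tendsto_eventually) (unfold eventually_sequentially, intro exI[of _ n], simp)
    next
      case False
      then have "z \<notin> D'" unfolding D'_def by auto
      then show ?thesis using False by (simp add: indicator_def)
    qed
  qed
  then have "(\<lambda>n. LINT z|\<nu>. indicator D ((F ^^ n) z) :: real) \<longlonglongrightarrow> (LINT z|\<nu>. indicator D' z)"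
    by (intro integral_dominated_convergence[where w = "\<lambda>_. 1"]) (auto simp: indicator_def)
  then have "measure \<nu> D = measure \<nu> D'"
    unfolding iter using D' \<nu>(2) by (simp add: sp LIMSEQ_const_iff)
  then show ?thesis using erg by simp
qed

lemma entering_probability_limit:
  assumes D [measurable]: "D \<in> sets mbar" and fwd: "AE z in mbar. z \<in> D \<longrightarrow> F z \<in> D"
    and hit: "AE z in mbar. \<exists>n. (F ^^ n) z \<in> D"
  shows "(\<lambda>n. LINT z|mbar. indicator D ((F ^^ n) z)) \<longlonglongrightarrow> (1 :: real)"
proof -
  have "AE z in mbar. (\<lambda>n. indicator D ((F ^^ n) z) :: real) \<longlonglongrightarrow> 1"
    using forward_invariant_iter[OF fwd] hit
  proof eventually_elim
    case (elim z)
    then obtain n where "(F ^^ n) z \<in> D" by blast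
    then have "\<forall>k\<ge>n. (F ^^ k) z \<in> D" using elim(1) by blast
    then show ?case
      by (intro tendsto_eventually) (unfold eventually_sequentially, intro exI[of _ n], simp)
  qed
  then have "(\<lambda>n. LINT z|mbar. indicator D ((F ^^ n) z) :: real) \<longlonglongrightarrow> (LINT z|mbar. 1)"
    by (intro integral_dominated_convergence[where w = "\<lambda>_. 1"]) (auto simp: indicator_def)
  then show ?thesis by (simp add: PM.prob_space)
qed

lemma UF_iter: "((\<lambda>g z. g (F z)) ^^ n) g z = g ((F ^^ n) z)"
  by (induction n arbitrary: z) (simp_all add: funpow_swap1)

text \<open>The mean of \<open>1\<^sub>A\<close> along random orbits, computed through the densities \<open>\<L>\<^sub>f\<^sup>n 1\<close> and \<open>\<L>\<^sub>F\<^sup>n 1\<close>, which agree.\<close>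

lemma Uf_iter_integral:
  assumes A: "A \<in> sets m"
  shows "(LINT x|m. (Uf ^^ n) (indicator A) x) = (LINT z|mbar. indicator A (snd ((F ^^ n) z)))"
proof -
  interpret I: markov_operator m "Lf.L ^^ n" "Uf ^^ n" by (rule Lf.markov_operator_iter)
  interpret J: markov_operator mbar "LF.L ^^ n" "(\<lambda>g z. g (F z)) ^^ n" by (rule LF.markov_operator_iter)
  have one: "integrable m (\<lambda>_. 1::real)" by simp
  have b: "indicator A \<in> bmeas m" using A by simp
  have i: "integrable m (\<lambda>x. (Lf.L ^^ n) (\<lambda>_. 1) x * indicator A x)"
    by (rule integrable_mult_bmeas[OF I.L_integrable[OF one] b])
  have "(LINT x|m. (Uf ^^ n) (indicator A) x) = (LINT x|m. (Lf.L ^^ n) (\<lambda>_. 1) x * indicator A x)"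
    using I.duality[OF one b] by simp
  also have "\<dots> = (LINT z|mbar. emb (\<lambda>x. (Lf.L ^^ n) (\<lambda>_. 1) x * indicator A x) z)"
    using emb_integral[of "\<lambda>x. (Lf.L ^^ n) (\<lambda>_. 1) x * indicator A x"] i by simp
  also have "\<dots> = (LINT z|mbar. (LF.L ^^ n) (emb (\<lambda>_. 1)) z * emb (indicator A) z)"
  proof (rule integral_cong_AE)
    show "AE z in mbar. emb (\<lambda>x. (Lf.L ^^ n) (\<lambda>_. 1) x * indicator A x) z = (LF.L ^^ n) (emb (\<lambda>_. 1)) z * emb (indicator A) z"
      using LF_iter_emb[OF one, of n] by eventually_elim (simp add: emb_def)
    show "emb (\<lambda>x. (Lf.L ^^ n) (\<lambda>_. 1) x * indicator A x) \<in> borel_measurable mbar" using emb_integrable[OF i] by simp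
    show "(\<lambda>z. (LF.L ^^ n) (emb (\<lambda>_. 1)) z * emb (indicator A) z) \<in> borel_measurable mbar"
      using integrable_mult_bmeas[OF J.L_integrable[OF emb_integrable[OF one]] emb_bmeas[OF b]] by simp
  qed
  also have "\<dots> = (LINT z|mbar. emb (\<lambda>_. 1) z * ((\<lambda>g z. g (F z)) ^^ n) (emb (indicator A)) z)"
    by (rule J.duality[OF emb_integrable[OF one] emb_bmeas[OF b]])
  also have "\<dots> = (LINT z|mbar. indicator A (snd ((F ^^ n) z)))" unfolding UF_iter by (simp add: emb_def)
  finally show ?thesis .
qed

text \<open>By absorption the part of the mass on \<open>\<Omega> \<times> A\<close> that one step keeps there is all of it.\<close>

lemma absorbing_forward:
  assumes A: "Lf.absorbing A"
  shows "AE z in mbar. snd z \<in> A \<longrightarrow> snd (F z) \<in> A"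
proof -
  have As: "A \<in> sets m" and Aa: "AE x in m. indicator A x \<le> Uf (indicator A) x" using A unfolding Lf.absorbing_def by auto
  have b: "indicator A \<in> bmeas m" using As by simp
  have iA: "integrable m (indicator A :: _ \<Rightarrow> real)" using M.integrable_bmeas[OF b] .
  let ?a = "emb (indicator A) :: _ \<Rightarrow> real"
  have ia: "integrable mbar ?a" by (rule emb_integrable[OF iA])
  have iaF: "integrable mbar (\<lambda>z. ?a z * ?a (F z))" by (rule integrable_mult_bmeas[OF ia LF.U_bmeas[OF emb_bmeas[OF b]]])
  have "(LINT z|mbar. ?a z) = (LINT x|m. indicator A x * indicator A x)"
    using emb_integral[of "indicator A :: _ \<Rightarrow> real"] As by (simp flip: indicator_inter_arith)
  also have "\<dots> \<le> (LINT x|m. indicator A x * Uf (indicator A) x)"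
    using Aa by (intro integral_mono_AE integrable_mult_bmeas iA b Uf_bmeas) (auto elim!: eventually_mono simp: indicator_def)
  also have "\<dots> = (LINT x|m. Lf.L (indicator A) x * indicator A x)" by (rule Lf.duality[OF iA b, symmetric])
  also have "\<dots> = (LINT z|mbar. emb (\<lambda>x. Lf.L (indicator A) x * indicator A x) z)"
    using emb_integral[of "\<lambda>x. Lf.L (indicator A) x * indicator A x"] integrable_mult_bmeas[OF Lf.L_integrable[OF iA] b] by simp
  also have "\<dots> = (LINT z|mbar. LF.L ?a z * ?a z)"
  proof (rule integral_cong_AE)
    show "AE z in mbar. emb (\<lambda>x. Lf.L (indicator A) x * indicator A x) z = LF.L ?a z * ?a z"
      using LF_emb[OF iA] by eventually_elim (simp add: emb_def)
    show "emb (\<lambda>x. Lf.L (indicator A) x * indicator A x) \<in> borel_measurable mbar"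
      using emb_integrable[OF integrable_mult_bmeas[OF Lf.L_integrable[OF iA] b]] by simp
    show "(\<lambda>z. LF.L ?a z * ?a z) \<in> borel_measurable mbar"
      using integrable_mult_bmeas[OF LF.L_integrable[OF ia] emb_bmeas[OF b]] by simp
  qed
  also have "\<dots> = (LINT z|mbar. ?a z * ?a (F z))" by (rule LF.duality[OF ia emb_bmeas[OF b]])
  finally have le: "(LINT z|mbar. ?a z) \<le> (LINT z|mbar. ?a z * ?a (F z))" .
  have "AE z in mbar. ?a z * ?a (F z) = ?a z"
    by (rule AE_eq_if_le_integral_eq[OF iaF ia _ le]) (auto simp: emb_def indicator_def)
  then show ?thesis by eventually_elim (auto simp: emb_def indicator_def split: if_splits)
qed

lemma pair_density_eq:
  assumes h: "h \<in> densities m"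
  shows "P \<Otimes>\<^sub>M density m (\<lambda>x. ennreal (h x)) = density mbar (\<lambda>z. ennreal (emb h z))"
proof -
  interpret D: prob_space "density m (\<lambda>x. ennreal (h x))" by (rule prob_space_density_densities[OF h])
  have sf: "sigma_finite_measure (density m (\<lambda>x. ennreal (h x)))" by unfold_locales
  have "density P (\<lambda>_. 1) \<Otimes>\<^sub>M density m (\<lambda>x. ennreal (h x)) = density mbar (\<lambda>(\<omega>, x). 1 * ennreal (h x))"
    using densitiesD(1)[OF h] by (intro pair_measure_density M.sigma_finite_measure_axioms sf) auto
  then show ?thesis by (simp add: density_1 emb_def split_beta')
qed

section \<open>From ergodic densities to physical measures\<close>

text \<open>
  For an \<open>F\<close>-invariant set \<open>A\<close> the function \<open>1\<^sub>A h\<close> is \<open>\<L>\<^sub>F\<close>-invariant, hence depends on \<open>x\<close> alone. So \<open>A\<close> is a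
  product with \<open>\<Omega>\<close> up to null sets, over the support of an \<open>\<L>\<^sub>f\<close>-invariant function, and ergodicity of \<open>h\<close>
  applies to this absorbing support.
\<close>

lemma ergodic_density_product:
  assumes erg: "ergodic_density m Lf.L h"
  defines "\<mu> \<equiv> density m (\<lambda>x. ennreal (h x))"
  shows "prob_space \<mu>" "sets \<mu> = sets m" "absolutely_continuous m \<mu>" "annealed_push p f \<mu> = \<mu>"
    "prob_space (P \<Otimes>\<^sub>M \<mu>)" "sets (P \<Otimes>\<^sub>M \<mu>) = sets mbar" "absolutely_continuous mbar (P \<Otimes>\<^sub>M \<mu>)"
    "distr (P \<Otimes>\<^sub>M \<mu>) (P \<Otimes>\<^sub>M \<mu>) F = P \<Otimes>\<^sub>M \<mu>" "ergodic F (P \<Otimes>\<^sub>M \<mu>)"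
proof -
  have inv: "invariant_density m Lf.L h" using erg unfolding Lf.ergodic_density_iff by simp
  note hd = Lf.invariant_densityD[OF inv]
  have hden: "h \<in> densities m" using inv unfolding invariant_density_def by simp
  note eden = emb_densities[OF hden] and ed = densitiesD[OF emb_densities[OF hden]]
  have pair: "P \<Otimes>\<^sub>M \<mu> = density mbar (\<lambda>z. ennreal (emb h z))" unfolding \<mu>_def by (rule pair_density_eq[OF hden])
  have einv: "AE z in mbar. LF.L (emb h) z = emb h z"
    using LF_emb[OF hd(1)] AE_emb[OF hd(4)] by eventually_elim (simp add: emb_def)
  show "prob_space \<mu>" unfolding \<mu>_def by (rule prob_space_density_densities[OF hden])
  show "sets \<mu> = sets m" unfolding \<mu>_def by simp
  show "absolutely_continuous m \<mu>" unfolding \<mu>_def using hd(1) by (intro absolutely_continuousI_density) simp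
  show "annealed_push p f \<mu> = \<mu>" unfolding \<mu>_def using Lf.invariant_iff_push[OF hd(1,2)] hd(4) by simp
  show "prob_space (P \<Otimes>\<^sub>M \<mu>)" unfolding pair by (rule prob_space_density_densities[OF eden])
  show sets: "sets (P \<Otimes>\<^sub>M \<mu>) = sets mbar" unfolding pair by simp
  show "absolutely_continuous mbar (P \<Otimes>\<^sub>M \<mu>)" unfolding pair using ed(1) by (intro absolutely_continuousI_density) simp
  show "distr (P \<Otimes>\<^sub>M \<mu>) (P \<Otimes>\<^sub>M \<mu>) F = P \<Otimes>\<^sub>M \<mu>"
    unfolding pair using LF.invariant_iff_push[OF ed(1,2)] einv by simp
  show "ergodic F (P \<Otimes>\<^sub>M \<mu>)"
    unfolding ergodic_def
  proof (intro ballI impI)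
    fix A assume "A \<in> sets (P \<Otimes>\<^sub>M \<mu>)" and "F -` A \<inter> space (P \<Otimes>\<^sub>M \<mu>) = A"
    then have A [measurable]: "A \<in> sets mbar" and Ainv: "F -` A \<inter> space mbar = A"
      using sets sets_eq_imp_space_eq[OF sets] by auto
    have "LF.absorbing A"
      unfolding LF.absorbing_def using A
    proof (intro conjI AE_I2)
      fix z assume "z \<in> space mbar"
      then show "indicator A z \<le> (indicator A (F z) :: real)" using Ainv by (auto simp: indicator_def)
    qed
    define \<phi> where "\<phi> = (\<lambda>z. emb h z * indicator A z)"
    have \<phi>i: "integrable mbar \<phi>" unfolding \<phi>_def by (rule integrable_real_mult_indicator[OF A ed(1)])
    have \<phi>inv: "AE z in mbar. LF.L \<phi> z = \<phi> z"
      unfolding \<phi>_def by (rule LF.absorbing_restrict[OF \<open>LF.absorbing A\<close> ed(1,2) einv])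
    \<comment> \<open>\<open>\<phi>\<close> takes only the values 0 and \<open>emb h\<close>, so \<open>g\<close> is \<open>h\<close> restricted to the support of \<open>g\<close>.\<close>
    define g where "g = proj \<phi>"
    have gi: "integrable m g" unfolding g_def by (rule proj_integrable[OF \<phi>i])
    then have [measurable]: "g \<in> borel_measurable m" "h \<in> borel_measurable m" using hd(1) by auto
    have \<phi>g: "AE z in mbar. \<phi> z = emb g z" unfolding g_def by (rule LF_invariant_fiber_constant[OF \<phi>i \<phi>inv])
    have "AE z in mbar. g (snd z) = 0 \<or> g (snd z) = h (snd z)"
      using \<phi>g
    proof eventually_elim
      case (elim z)
      then show ?case by (cases "z \<in> A") (auto simp: \<phi>_def emb_def)
    qed
    then have g_or: "AE x in m. g x = 0 \<or> g x = h x"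
      by (subst (asm) AE_emb_iff) auto
    have g0: "AE x in m. 0 \<le> g x" using g_or hd(2) by eventually_elim auto
    have "AE z in mbar. LF.L (emb g) z = LF.L \<phi> z"
      using \<phi>g by (intro LF.L_cong_AE emb_integrable gi \<phi>i) (auto elim: eventually_mono)
    then have "AE z in mbar. Lf.L g (snd z) = g (snd z)"
      using LF_emb[OF gi] \<phi>g \<phi>inv by eventually_elim (simp add: emb_def)
    moreover have "Lf.L g \<in> borel_measurable m" using Lf.L_integrable[OF gi] by simp
    ultimately have ginv: "AE x in m. Lf.L g x = g x"
      by (subst (asm) AE_emb_iff) auto
    have "Lf.absorbing (supp m g)" by (rule Lf.supp_absorbing[OF gi g0 ginv])
    then have "(LINT x|m. h x * indicator (supp m g) x) \<in> {0, 1}" using erg unfolding Lf.ergodic_density_iff by blast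
    moreover have "(LINT x|m. h x * indicator (supp m g) x) = (LINT x|m. g x)"
    proof (rule integral_cong_AE)
      show "AE x in m. h x * indicator (supp m g) x = g x"
        using g_or AE_space by eventually_elim (auto simp: supp_def indicator_def)
    qed auto
    moreover have "measure (P \<Otimes>\<^sub>M \<mu>) A = (LINT x|m. g x)"
    proof -
      have "measure (P \<Otimes>\<^sub>M \<mu>) A = (LINT z|mbar. \<phi> z)"
        unfolding pair \<phi>_def by (rule measure_density_eq_integral[OF ed(1,2) A])
      also have "\<dots> = (LINT z|mbar. emb g z)"
        using \<phi>g \<phi>i emb_integrable[OF gi] by (intro integral_cong_AE) auto
      finally show ?thesis by (simp add: emb_integral)
    qed
    ultimately show "measure (P \<Otimes>\<^sub>M \<mu>) A \<in> {0, 1}" by simp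
  qed
qed

text \<open>
  Birkhoff's theorem puts almost all of \<open>\<Omega> \<times> S\<close>, where \<open>S\<close> is the union of the supports, into the basins.
  Almost every orbit enters \<open>\<Omega> \<times> S\<close> by maximality of the support, and it does so outside of the
  exceptional set by nonsingularity. Basins being invariant, it was in a basin from the start.
\<close>

lemma FED_f_basins:
  assumes r: "1 \<le> r" and erg: "\<And>i. i < r \<Longrightarrow> ergodic_density m Lf.L (h i)"
    and maxsupp: "AE y in m. (\<lambda>n. dual_op m (Lf.L ^^ n) (indicator (supp m (\<lambda>y. (1 / real r) * (\<Sum>i<r. h i y)))) y) \<longlonglongrightarrow> 1"
    and \<phi>: "\<phi> \<in> bmeas mbar"
  shows "AE z in mbar. \<exists>i<r. z \<in> basin F (P \<Otimes>\<^sub>M density m (\<lambda>x. ennreal (h i x))) \<phi>"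
proof -
  define \<nu> where "\<nu> i = P \<Otimes>\<^sub>M density m (\<lambda>x. ennreal (h i x))" for i
  note prod = ergodic_density_product[OF erg]
  have inv: "\<And>i. i < r \<Longrightarrow> invariant_density m Lf.L (h i)" using erg unfolding Lf.ergodic_density_iff by auto
  note hd = Lf.invariant_densityD[OF inv]
  define H where "H = (\<lambda>y. (1 / real r) * (\<Sum>i<r. h i y))"
  define S where "S = supp m H"
  have Sa: "Lf.absorbing S" using Lf.invariant_mean(2)[OF inv r] unfolding S_def H_def .
  then have Sm [measurable]: "S \<in> sets m" unfolding Lf.absorbing_def by simp
  have sets\<nu>: "sets (\<nu> i) = sets mbar" if "i < r" for i using prod(6)[OF that] unfolding \<nu>_def .
  have \<phi>\<nu>: "\<phi> \<in> bmeas (\<nu> i)" if "i < r" for i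
    using \<phi> sets\<nu>[OF that] sets_eq_imp_space_eq[OF sets\<nu>[OF that]] unfolding bmeas_def
    by (simp cong: measurable_cong_sets)
  have F\<nu>: "F \<in> measurable (\<nu> i) (\<nu> i)" if "i < r" for i
    using F_measurable by (simp cong: measurable_cong_sets add: sets\<nu>[OF that])
  have "AE z in mbar. \<forall>i<r. 0 < h i (snd z) \<longrightarrow> z \<in> basin F (\<nu> i) \<phi>"
    unfolding AE_all_countable
  proof (intro allI)
    fix i
    show "AE z in mbar. i < r \<longrightarrow> 0 < h i (snd z) \<longrightarrow> z \<in> basin F (\<nu> i) \<phi>"
    proof (cases "i < r")
      case True
      have hden: "h i \<in> densities m" using inv[OF True] unfolding invariant_density_def by simp
      have "AE z in \<nu> i. z \<in> basin F (\<nu> i) \<phi>"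
        using ergodic_birkhoff[OF _ F\<nu>[OF True] _ _ \<phi>\<nu>[OF True]] prod(5,8,9)[OF True] unfolding \<nu>_def by blast
      then have "AE z in density mbar (\<lambda>z. ennreal (emb (h i) z)). z \<in> basin F (\<nu> i) \<phi>"
        unfolding pair_density_eq[OF hden, symmetric] \<nu>_def .
      then have "AE z in mbar. 0 < ennreal (emb (h i) z) \<longrightarrow> z \<in> basin F (\<nu> i) \<phi>"
        using emb_integrable[OF hd(1)[OF True]] by (subst (asm) AE_density) auto
      then show ?thesis by eventually_elim (auto simp: emb_def)
    qed simp
  qed
  moreover have "AE z in mbar. \<forall>i<r. 0 \<le> h i (snd z)"
    unfolding AE_all_countable using AE_emb[OF hd(2)] by auto
  ultimately have good: "AE z in mbar. snd z \<in> S \<longrightarrow> (\<exists>i<r. z \<in> basin F (\<nu> i) \<phi>)"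
  proof eventually_elim
    case (elim z)
    show ?case
    proof
      assume "snd z \<in> S"
      then have "(\<Sum>i<r. h i (snd z)) \<noteq> 0" unfolding S_def supp_def H_def by auto
      then obtain i where "i < r" "h i (snd z) \<noteq> 0" by (meson lessThan_iff sum.neutral)
      then show "\<exists>i<r. z \<in> basin F (\<nu> i) \<phi>" using elim by (intro exI[of _ i]) force
    qed
  qed
  have hit: "AE z in mbar. \<exists>n. snd ((F ^^ n) z) \<in> S"
  proof -
    \<comment> \<open>The orbits that never enter have at most the measure of those outside at time \<open>n\<close>, for each \<open>n\<close>.\<close>
    let ?V = "{z \<in> space mbar. \<forall>n. snd ((F ^^ n) z) \<notin> S}"
    have V [measurable]: "?V \<in> sets mbar" by measurable
    have "(\<lambda>n. LINT x|m. (Uf ^^ n) (indicator S) x) \<longlonglongrightarrow> 1"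
      using Lf.absorbing_limit_iff[OF Sa] maxsupp unfolding S_def H_def by blast
    then have lim: "(\<lambda>n. 1 - (LINT z|mbar. indicator S (snd ((F ^^ n) z)))) \<longlonglongrightarrow> (1 - 1 :: real)"
      unfolding Uf_iter_integral[OF Sm] by (intro tendsto_diff tendsto_const)
    have "measure mbar ?V \<le> 1 - (LINT z|mbar. indicator S (snd ((F ^^ n) z)))" for n
    proof -
      have mS: "(\<lambda>z. indicator S (snd ((F ^^ n) z)) :: real) \<in> borel_measurable mbar" by measurable
      have iS: "integrable mbar (\<lambda>z. indicator S (snd ((F ^^ n) z)) :: real)"
        by (rule PM.integrable_const_bound[of _ 1, OF _ mS]) (auto simp: indicator_def)
      have "measure mbar ?V = (LINT z|mbar. indicator ?V z)" by simp
      also have "\<dots> \<le> (LINT z|mbar. 1 - indicator S (snd ((F ^^ n) z)))"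
      proof (rule integral_mono)
        show "integrable mbar (indicator ?V :: _ \<Rightarrow> real)" by (rule PM.integrable_bmeas[OF bmeas_indicator[OF V]])
        show "integrable mbar (\<lambda>z. 1 - indicator S (snd ((F ^^ n) z)) :: real)"
          by (intro Bochner_Integration.integrable_diff iS) simp
        show "indicator ?V z \<le> (1 - indicator S (snd ((F ^^ n) z)) :: real)" for z
          by (auto simp: indicator_def)
      qed
      also have "\<dots> = 1 - (LINT z|mbar. indicator S (snd ((F ^^ n) z)))" using iS by (simp add: PM.prob_space)
      finally show ?thesis .
    qed
    then have "measure mbar ?V \<le> 1 - 1" by (intro LIMSEQ_le_const[OF lim]) auto
    then have "measure mbar ?V = 0" by (simp add: measure_le_0_iff)
    then have "AE z in mbar. z \<notin> ?V" using V by (simp add: PM.prob_eq_0)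
    then show ?thesis using AE_space by eventually_elim auto
  qed
  have "AE z in mbar. \<forall>n. snd ((F ^^ n) z) \<in> S \<longrightarrow> (\<exists>i<r. (F ^^ n) z \<in> basin F (\<nu> i) \<phi>)"
    unfolding AE_all_countable using F_iter_AE[OF good] by blast
  then show ?thesis
    using hit AE_space
  proof eventually_elim
    case (elim z)
    then obtain n i where i: "i < r" "(F ^^ n) z \<in> basin F (\<nu> i) \<phi>" by blast
    have "(F ^^ k) z \<in> basin F (\<nu> i) \<phi> \<longleftrightarrow> z \<in> basin F (\<nu> i) \<phi>" for k
    proof (induction k)
      case (Suc k)
      have "(F ^^ k) z \<in> space (\<nu> i)"
        using measurable_space[OF F_iter_measurable elim(3)] sets_eq_imp_space_eq[OF sets\<nu>[OF i(1)]] by simp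
      then show ?case using basin_invariant[OF F\<nu>[OF i(1)] \<phi>\<nu>[OF i(1)]] Suc by simp
    qed simp
    then show ?case using i unfolding \<nu>_def by blast
  qed
qed

lemma F_iter: "(F ^^ j) (\<omega>, x) = (\<lambda>n. \<omega> (n + j), random_iter f \<omega> j x)"
  by (induction j) (simp_all add: skew_def)

lemma basin_emb_iff:
  assumes \<mu>: "prob_space \<mu>" "sets \<mu> = sets m" and \<psi>: "\<psi> \<in> borel_measurable m" and \<omega>: "\<omega> \<in> space P"
  shows "(\<omega>, x) \<in> basin F (P \<Otimes>\<^sub>M \<mu>) (emb \<psi>) \<longleftrightarrow> x \<in> fiber_basin f \<omega> \<mu> \<psi>"
proof -
  have \<psi>': "\<psi> \<in> borel_measurable \<mu>" using \<psi> \<mu>(2) by (simp cong: measurable_cong_sets)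
  have "(LINT z|(P \<Otimes>\<^sub>M \<mu>). emb \<psi> z) = (LINT x|\<mu>. \<psi> x)"
    using integral_distr[OF measurable_snd \<psi>', of P] unfolding distr_snd_prob[OF prob_P \<mu>(1)] by (simp add: emb_def)
  then show ?thesis
    unfolding basin_def fiber_basin_def using \<omega> by (simp add: F_iter emb_def space_pair_measure)
qed

theorem FED_f_imp_FPM_random:
  assumes FED: "FED m Lf.L"
  shows "FPM_random p m f"
proof -
  obtain r :: nat and h where r: "1 \<le> r" and erg: "\<And>i. i < r \<Longrightarrow> ergodic_density m Lf.L (h i)"
    and disj: "disjoint_supports m r h"
    and maxsupp: "AE y in m. (\<lambda>n. dual_op m (Lf.L ^^ n) (indicator (supp m (\<lambda>y. (1 / real r) * (\<Sum>i<r. h i y)))) y) \<longlonglongrightarrow> 1"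
    using FED unfolding FED_def Let_def by auto
  define \<mu> where "\<mu> i = density m (\<lambda>x. ennreal (h i x))" for i
  note prod = ergodic_density_product[OF erg, folded \<mu>_def]
  have him: "h i \<in> borel_measurable m" if "i < r" for i
    using erg[OF that] Lf.invariant_densityD(1) unfolding Lf.ergodic_density_iff by auto
  have "ergodic_stationary p m f (\<mu> i)" if "i < r" for i
    unfolding ergodic_stationary_def stationary_prob_def using prod[OF that] by simp
  moreover have "absolutely_continuous m (\<mu> i)" if "i < r" for i using prod(3)[OF that] .
  moreover have "disjoint_supports m r (\<lambda>i. RN_deriv m (\<mu> i))"
    unfolding disjoint_supports_iff_AE[OF borel_measurable_RN_deriv]
  proof (intro allI impI)
    fix i j assume ij: "i < r" "j < r" "i \<noteq> j"
    have rn: "AE x in m. ennreal (h k x) = RN_deriv m (\<mu> k) x" if "k < r" for k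
      using him[OF that] unfolding \<mu>_def by (intro M.RN_deriv_unique) auto
    have "AE x in m. h i x = 0 \<or> h j x = 0"
      using disj ij him by (subst (asm) disjoint_supports_iff_AE) auto
    then show "AE x in m. RN_deriv m (\<mu> i) x = 0 \<or> RN_deriv m (\<mu> j) x = 0"
      using rn[OF ij(1)] rn[OF ij(2)] by eventually_elim (metis ennreal_0)
  qed
  moreover have "AE \<omega> in bernoulli p. AE x in m. x \<in> (\<Union>i<r. fiber_basin f \<omega> (\<mu> i) \<psi>)"
    if \<psi>: "\<psi> \<in> borel_measurable m" "bounded (\<psi> ` space m)" for \<psi>
  proof -
    have b: "emb \<psi> \<in> bmeas mbar" using \<psi> by (intro emb_bmeas) (simp add: bmeas_iff_bounded)
    have "AE z in mbar. \<exists>i<r. z \<in> basin F (P \<Otimes>\<^sub>M \<mu> i) (emb \<psi>)"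
      unfolding \<mu>_def by (rule FED_f_basins[OF r _ maxsupp b]) (rule erg)
    then have "AE \<omega> in P. AE x in m. \<exists>i<r. (\<omega>, x) \<in> basin F (P \<Otimes>\<^sub>M \<mu> i) (emb \<psi>)" by (rule PM.AE_pair)
    then show ?thesis
      using AE_space
    proof eventually_elim
      case (elim \<omega>)
      show ?case using elim(1)
        by eventually_elim (use basin_emb_iff[OF prod(1,2) \<psi>(1) elim(2)] in auto)
    qed
  qed
  ultimately show ?thesis unfolding FPM_random_def by blast
qed

text \<open>The same product measures \<open>\<P> \<times> h\<^sub>i m\<close> serve for the skew product; their fibre measures are constant.\<close>

theorem FED_f_imp_FPM_skew:
  assumes FED: "FED m Lf.L"
  shows "FPM_skew p m f"
proof -
  obtain r :: nat and h where r: "1 \<le> r" and erg: "\<And>i. i < r \<Longrightarrow> ergodic_density m Lf.L (h i)"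
    and maxsupp: "AE y in m. (\<lambda>n. dual_op m (Lf.L ^^ n) (indicator (supp m (\<lambda>y. (1 / real r) * (\<Sum>i<r. h i y)))) y) \<longlonglongrightarrow> 1"
    using FED unfolding FED_def Let_def by auto
  define \<mu> where "\<mu> i = density m (\<lambda>x. ennreal (h i x))" for i
  note prod = ergodic_density_product[OF erg, folded \<mu>_def]
  have inv: "invariant_prob mbar F (P \<Otimes>\<^sub>M \<mu> i)" if "i < r" for i
    unfolding invariant_prob_def using prod(5,6,8)[OF that] F_measurable
    by (simp cong: measurable_cong_sets)
  have mark: "markovian p m f (P \<Otimes>\<^sub>M \<mu> i)" if i: "i < r" for i
    unfolding markovian_def
  proof (intro conjI)
    show "invariant_prob (bernoulli p \<Otimes>\<^sub>M m) (skew f) (P \<Otimes>\<^sub>M \<mu> i)" using inv[OF i] .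
    interpret \<mu>: prob_space "\<mu> i" by (rule prod(1)[OF i])
    show "distr (P \<Otimes>\<^sub>M \<mu> i) P fst = P"
    proof (rule measure_eqI)
      fix A assume "A \<in> sets (distr (P \<Otimes>\<^sub>M \<mu> i) P fst)"
      then have A: "A \<in> sets P" by simp
      have "fst -` A \<inter> space (P \<Otimes>\<^sub>M \<mu> i) = A \<times> space (\<mu> i)"
        using sets.sets_into_space[OF A] by (auto simp: space_pair_measure)
      then show "emeasure (distr (P \<Otimes>\<^sub>M \<mu> i) P fst) A = emeasure P A"
        using A by (simp add: emeasure_distr \<mu>.emeasure_pair_measure_Times \<mu>.emeasure_space_1)
    qed simp
    show "\<exists>\<kappa>\<in>measurable p (prob_algebra m). \<forall>C\<in>sets (P \<Otimes>\<^sub>M \<mu> i).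
        emeasure (P \<Otimes>\<^sub>M \<mu> i) C = (\<integral>\<^sup>+\<omega>. emeasure (\<kappa> (\<omega> 0)) (Pair \<omega> -` C) \<partial>bernoulli p)"
      using prod(1,2)[OF i] by (intro bexI[of _ "\<lambda>_. \<mu> i"] ballI) (auto simp: \<mu>.emeasure_pair_measure_alt space_prob_algebra)
  qed
  have "emeasure mbar (\<Union>i<r. basin F (P \<Otimes>\<^sub>M \<mu> i) \<phi>) = 1"
    if \<phi>: "\<phi> \<in> borel_measurable mbar" "bounded (\<phi> ` space mbar)" for \<phi>
  proof -
    have b: "\<phi> \<in> bmeas mbar" using \<phi> by (simp add: bmeas_iff_bounded)
    have "AE z in mbar. \<exists>i<r. z \<in> basin F (P \<Otimes>\<^sub>M \<mu> i) \<phi>"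
      unfolding \<mu>_def by (rule FED_f_basins[OF r _ maxsupp b]) (rule erg)
    then have "AE z in mbar. z \<in> (\<Union>i<r. basin F (P \<Otimes>\<^sub>M \<mu> i) \<phi>)" by eventually_elim auto
    moreover have "(\<Union>i<r. basin F (P \<Otimes>\<^sub>M \<mu> i) \<phi>) \<in> sets mbar"
      using basin_sets[OF F_measurable \<phi>(1)] prod(6) by (intro sets.finite_UN) auto
    ultimately show ?thesis by (simp add: PM.emeasure_eq_1_AE)
  qed
  then show ?thesis
    unfolding FPM_skew_def Let_def using inv mark prod(7,9)
    by (intro exI[of _ r] exI[of _ "\<lambda>i. P \<Otimes>\<^sub>M \<mu> i"]) auto
qed

section \<open>From physical measures to ergodic densities\<close>

text \<open>An orbit that never meets \<open>D\<close> has averages 0 for the observable \<open>1\<^sub>D\<close>, whose mean is 1.\<close>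

lemma basin_enters:
  assumes \<nu>: "prob_space \<nu>" "sets \<nu> = sets mbar" and D: "D \<in> sets mbar" "measure \<nu> D = 1"
    and z: "z \<in> basin F \<nu> (indicator D)"
  shows "\<exists>n. (F ^^ n) z \<in> D"
proof (rule ccontr)
  assume "\<nexists>n. (F ^^ n) z \<in> D"
  then have "(\<lambda>n. (1 / real n) * (\<Sum>j<n. indicator D ((F ^^ j) z))) = (\<lambda>n. 0 :: real)" by (simp add: indicator_def)
  moreover have "(\<lambda>n. (1 / real n) * (\<Sum>j<n. indicator D ((F ^^ j) z))) \<longlonglongrightarrow> (LINT z|\<nu>. indicator D z :: real)"
    using z unfolding basin_def by simp
  moreover have "(LINT z|\<nu>. indicator D z :: real) = 1"
    using D sets_eq_imp_space_eq[OF \<nu>(2)] sets.sets_into_space[OF D(1)] by (simp add: Int_absorb2)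
  ultimately show False by (simp add: LIMSEQ_const_iff)
qed

text \<open>
  The densities of the given measures are invariant and ergodic. For maximality of the support the basin
  condition is applied to the indicator of the union of the supports.
\<close>

theorem FPM_random_imp_FED_f:
  assumes "FPM_random p m f"
  shows "FED m Lf.L"
proof -
  obtain r :: nat and \<mu> where es: "\<And>i. i < r \<Longrightarrow> ergodic_stationary p m f (\<mu> i)"
    and ac: "\<And>i. i < r \<Longrightarrow> absolutely_continuous m (\<mu> i)"
    and disj: "disjoint_supports m r (\<lambda>i. RN_deriv m (\<mu> i))"
    and basins: "\<And>\<psi>. \<psi> \<in> borel_measurable m \<Longrightarrow> bounded (\<psi> ` space m) \<Longrightarrow>
        AE \<omega> in bernoulli p. AE x in m. x \<in> (\<Union>i<r. fiber_basin f \<omega> (\<mu> i) \<psi>)"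
    using assms unfolding FPM_random_def by blast
  have st: "prob_space (\<mu> i)" "sets (\<mu> i) = sets m" "\<mu> i = annealed_push p f (\<mu> i)" "ergodic F (P \<Otimes>\<^sub>M \<mu> i)" if "i < r" for i
    using es[OF that] unfolding ergodic_stationary_def stationary_prob_def by auto
  define h where "h i = (\<lambda>x. enn2real (RN_deriv m (\<mu> i) x))" for i
  have hden: "h i \<in> densities m" and hdens: "density m (\<lambda>x. ennreal (h i x)) = \<mu> i"
    and hrn: "AE x in m. RN_deriv m (\<mu> i) x = ennreal (h i x)" if "i < r" for i
    using M.absolutely_continuous_prob_density[OF st(1,2)[OF that] ac[OF that]] unfolding h_def by auto
  note hd = densitiesD[OF hden]
  have inv: "invariant_density m Lf.L (h i)" if i: "i < r" for i
    unfolding invariant_density_def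
    using hden[OF i] Lf.invariant_iff_push[OF hd(1,2)[OF i]] st(3)[OF i] hdens[OF i] by simp
  have pair: "P \<Otimes>\<^sub>M \<mu> i = density mbar (\<lambda>z. ennreal (emb (h i) z))" if "i < r" for i
    using pair_density_eq[OF hden[OF that]] unfolding hdens[OF that] .
  have prob_pair: "prob_space (P \<Otimes>\<^sub>M \<mu> i)" if "i < r" for i
    unfolding pair[OF that] by (rule prob_space_density_densities[OF emb_densities[OF hden[OF that]]])
  have inv_pair: "distr (P \<Otimes>\<^sub>M \<mu> i) (P \<Otimes>\<^sub>M \<mu> i) F = P \<Otimes>\<^sub>M \<mu> i" if i: "i < r" for i
  proof -
    note ed = densitiesD[OF emb_densities[OF hden[OF i]]]
    have "AE z in mbar. LF.L (emb (h i)) z = emb (h i) z"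
      using LF_emb[OF hd(1)[OF i]] AE_emb[OF Lf.invariant_densityD(4)[OF inv[OF i]]] by eventually_elim (simp add: emb_def)
    then show ?thesis unfolding pair[OF i] using LF.invariant_iff_push[OF ed(1,2)] by simp
  qed
  have fwd: "AE z in mbar. z \<in> space P \<times> A \<longrightarrow> F z \<in> space P \<times> A" if "Lf.absorbing A" for A
    using absorbing_forward[OF that] AE_space
  proof eventually_elim
    case (elim z)
    then show ?case using measurable_space[OF F_measurable elim(2)] by (auto simp: space_pair_measure mem_Times_iff)
  qed
  have pair_measure: "measure (P \<Otimes>\<^sub>M \<mu> i) (space P \<times> A) = measure (\<mu> i) A" if i: "i < r" and A: "A \<in> sets m" for i A
  proof -
    interpret \<mu>: prob_space "\<mu> i" by (rule st(1)[OF i])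
    show ?thesis using A st(2)[OF i]
      by (simp add: measure_def \<mu>.emeasure_pair_measure_Times P.emeasure_space_1)
  qed
  have \<mu>h: "measure (\<mu> i) A = (LINT x|m. h i x * indicator A x)" if i: "i < r" and A: "A \<in> sets m" for i A
    using measure_density_eq_integral[OF hd(1,2)[OF i] A] unfolding hdens[OF i] .
  have erg: "ergodic_density m Lf.L (h i)" if i: "i < r" for i
    unfolding Lf.ergodic_density_iff
  proof (intro conjI allI impI inv i)
    fix A assume A: "Lf.absorbing A"
    then have As: "A \<in> sets m" unfolding Lf.absorbing_def by simp
    have "measure (P \<Otimes>\<^sub>M \<mu> i) (space P \<times> A) \<in> {0, 1}"
    proof (rule ergodic_forward_invariant[OF prob_pair[OF i] _ inv_pair[OF i] _ st(4)[OF i] _ fwd[OF A]])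
      show "sets (P \<Otimes>\<^sub>M \<mu> i) = sets mbar" unfolding pair[OF i] by simp
      show "absolutely_continuous mbar (P \<Otimes>\<^sub>M \<mu> i)"
        unfolding pair[OF i] using emb_integrable[OF hd(1)[OF i]] by (intro absolutely_continuousI_density) simp
      show "space P \<times> A \<in> sets mbar" using As by simp
    qed
    then show "(LINT x|m. h i x * indicator A x) \<in> {0, 1}"
      using pair_measure[OF i As] \<mu>h[OF i As] by simp
  qed
  have disj_h: "disjoint_supports m r h"
  proof (subst disjoint_supports_iff_AE)
    show "\<And>i. i < r \<Longrightarrow> h i \<in> borel_measurable m" using hd(1) by simp
    show "\<forall>i<r. \<forall>j<r. i \<noteq> j \<longrightarrow> (AE y in m. h i y = 0 \<or> h j y = 0)"
    proof (intro allI impI)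
      fix i j assume ij: "i < r" "j < r" "i \<noteq> j"
      then have "AE y in m. RN_deriv m (\<mu> i) y = 0 \<or> RN_deriv m (\<mu> j) y = 0"
        using disj by (subst (asm) disjoint_supports_iff_AE) auto
      then show "AE y in m. h i y = 0 \<or> h j y = 0" by eventually_elim (auto simp: h_def)
    qed
  qed
  have r: "1 \<le> r"
  proof (rule ccontr)
    assume "\<not> 1 \<le> r"
    moreover have "bounded ((\<lambda>_. 0 :: real) ` space m)" by (auto simp: bounded_iff)
    ultimately have "AE \<omega> in P. AE x in m. False" using basins[of "\<lambda>_. 0"] by (simp add: not_le)
    then show False by (simp add: M.AE_False P.AE_False)
  qed
  define H where "H = (\<lambda>y. (1 / real r) * (\<Sum>i<r. h i y))"
  define S where "S = supp m H"
  have Sa: "Lf.absorbing S" and hH: "AE y in m. \<forall>i<r. h i y \<le> real r * H y"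
    using Lf.invariant_mean(2,3)[OF inv r] unfolding S_def H_def by auto
  then have Sm [measurable]: "S \<in> sets m" unfolding Lf.absorbing_def by simp
  have \<mu>S: "measure (\<mu> i) S = 1" if i: "i < r" for i
  proof -
    have "AE y in m. h i y * indicator S y = h i y"
      using hH hd(2)[OF i] AE_space
    proof eventually_elim
      case (elim y)
      show ?case
      proof (cases "H y = 0")
        case True
        then show ?thesis using elim i by fastforce
      qed (use elim in \<open>simp add: S_def supp_def\<close>)
    qed
    then have "(LINT y|m. h i y * indicator S y) = (LINT y|m. h i y)"
      using hd(1)[OF i] by (intro integral_cong_AE) auto
    then show ?thesis using \<mu>h[OF i Sm] hd(3)[OF i] by simp
  qed
  have "AE \<omega> in P. AE x in m. x \<in> (\<Union>i<r. fiber_basin f \<omega> (\<mu> i) (indicator S))"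
    by (rule basins) (auto simp: bounded_iff indicator_def intro!: exI[of _ 1])
  then have "AE \<omega> in P. AE x in m. \<exists>n. (F ^^ n) (\<omega>, x) \<in> space P \<times> S"
    using AE_space
  proof eventually_elim
    case (elim \<omega>)
    show ?case using elim(1)
    proof eventually_elim
      case (elim x)
      then obtain i where i: "i < r" "x \<in> fiber_basin f \<omega> (\<mu> i) (indicator S)" by auto
      have "x \<in> space m" using i(2) sets_eq_imp_space_eq[OF st(2)[OF i(1)]] unfolding fiber_basin_def by simp
      then have ox: "(\<omega>, x) \<in> space mbar" using \<open>\<omega> \<in> space P\<close> by (simp add: space_pair_measure)
      have b: "(\<omega>, x) \<in> basin F (P \<Otimes>\<^sub>M \<mu> i) (emb (indicator S))"
        using basin_emb_iff[OF st(1,2)[OF i(1)] _ \<open>\<omega> \<in> space P\<close>] i(2) by simp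
      have eq: "emb (indicator S) z = (indicator (space P \<times> S) z :: real)" if "z \<in> space mbar" for z
        using that by (auto simp: emb_def indicator_def space_pair_measure)
      have orbit: "emb (indicator S) ((F ^^ j) (\<omega>, x)) = (indicator (space P \<times> S) ((F ^^ j) (\<omega>, x)) :: real)" for j
        by (rule eq[OF measurable_space[OF F_iter_measurable ox]])
      have sp: "space (P \<Otimes>\<^sub>M \<mu> i) = space mbar" using sets_eq_imp_space_eq[of "P \<Otimes>\<^sub>M \<mu> i" mbar] pair[OF i(1)] by simp
      have int: "(LINT z|(P \<Otimes>\<^sub>M \<mu> i). emb (indicator S) z) = (LINT z|(P \<Otimes>\<^sub>M \<mu> i). indicator (space P \<times> S) z :: real)"
        by (rule Bochner_Integration.integral_cong[OF refl]) (simp add: eq sp)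
      have b': "(\<omega>, x) \<in> basin F (P \<Otimes>\<^sub>M \<mu> i) (indicator (space P \<times> S))"
        using b unfolding basin_def mem_Collect_eq orbit int .
      show ?case
      proof (rule basin_enters[OF prob_pair[OF i(1)] _ _ _ b'])
        show "sets (P \<Otimes>\<^sub>M \<mu> i) = sets mbar" unfolding pair[OF i(1)] by simp
        show "space P \<times> S \<in> sets mbar" using Sm by simp
        show "measure (P \<Otimes>\<^sub>M \<mu> i) (space P \<times> S) = 1" unfolding pair_measure[OF i(1) Sm] by (rule \<mu>S[OF i(1)])
      qed
    qed
  qed
  then have hit: "AE z in mbar. \<exists>n. (F ^^ n) z \<in> space P \<times> S"
  proof (rule PM.AE_pair_measure[rotated])
    have [measurable]: "space P \<times> S \<in> sets mbar" using Sm by simp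
    show "{z \<in> space mbar. \<exists>n. (F ^^ n) z \<in> space P \<times> S} \<in> sets mbar" by measurable
  qed
  have "(\<lambda>n. LINT z|mbar. indicator (space P \<times> S) ((F ^^ n) z)) \<longlonglongrightarrow> (1::real)"
    by (rule entering_probability_limit[OF _ fwd[OF Sa] hit]) (use Sm in simp)
  moreover have "(LINT z|mbar. indicator (space P \<times> S) ((F ^^ n) z)) = (LINT x|m. (Uf ^^ n) (indicator S) x)" for n
    unfolding Uf_iter_integral[OF Sm]
  proof (rule Bochner_Integration.integral_cong[OF refl])
    fix z assume "z \<in> space mbar"
    then have "(F ^^ n) z \<in> space mbar" by (rule measurable_space[OF F_iter_measurable])
    then show "indicator (space P \<times> S) ((F ^^ n) z) = (indicator S (snd ((F ^^ n) z)) :: real)"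
      by (auto simp: indicator_def space_pair_measure mem_Times_iff)
  qed
  ultimately have "AE y in m. (\<lambda>n. dual_op m (Lf.L ^^ n) (indicator S) y) \<longlonglongrightarrow> 1"
    using Lf.absorbing_limit_iff[OF Sa] by simp
  then show ?thesis
    unfolding FED_def Let_def using r erg disj_h unfolding S_def H_def by blast
qed

text \<open>
  As for random maps, except that disjointness of the supports has to be derived. Repetitions among the
  given measures are removed first; two different ergodic measures differ on some set \<open>A\<close>, and their
  basins for the observable \<open>1\<^sub>A\<close> are disjoint.
\<close>

theorem FPM_skew_imp_FED_F:
  assumes "FPM_skew p m f"
  shows "FED mbar LF.L"
proof -
  obtain r0 :: nat and \<nu>0 where all: "\<And>i. i < r0 \<Longrightarrow> invariant_prob mbar F (\<nu>0 i) \<and> ergodic F (\<nu>0 i)"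
      "\<And>i. i < r0 \<Longrightarrow> absolutely_continuous mbar (\<nu>0 i)"
    and basins0: "\<And>\<phi>. \<phi> \<in> borel_measurable mbar \<Longrightarrow> bounded (\<phi> ` space mbar) \<Longrightarrow>
        emeasure mbar (\<Union>i<r0. basin F (\<nu>0 i) \<phi>) = 1"
    using assms unfolding FPM_skew_def Let_def by blast
  \<comment> \<open>\<open>\<nu>\<close> lists the given measures without repetition.\<close>
  define r where "r = card (\<nu>0 ` {..<r0})"
  obtain \<nu> where bij: "bij_betw \<nu> {0..<r} (\<nu>0 ` {..<r0})"
    using ex_bij_betw_nat_finite[of "\<nu>0 ` {..<r0}"] unfolding r_def by auto
  have range: "\<nu> ` {..<r} = \<nu>0 ` {..<r0}" using bij unfolding bij_betw_def atLeast0LessThan by simp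
  have distinct: "\<nu> i \<noteq> \<nu> j" if "i < r" "j < r" "i \<noteq> j" for i j
    using bij that unfolding bij_betw_def inj_on_def atLeast0LessThan by auto
  have st: "prob_space (\<nu> i)" "sets (\<nu> i) = sets mbar" "distr (\<nu> i) (\<nu> i) F = \<nu> i" "absolutely_continuous mbar (\<nu> i)"
    "ergodic F (\<nu> i)" "F \<in> measurable (\<nu> i) (\<nu> i)" if i: "i < r" for i
  proof -
    have "\<nu> i \<in> \<nu>0 ` {..<r0}" using i unfolding range[symmetric] by simp
    then obtain j where "j < r0" "\<nu> i = \<nu>0 j" by auto
    then show "prob_space (\<nu> i)" "sets (\<nu> i) = sets mbar" "distr (\<nu> i) (\<nu> i) F = \<nu> i" "absolutely_continuous mbar (\<nu> i)"
      "ergodic F (\<nu> i)" "F \<in> measurable (\<nu> i) (\<nu> i)"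
      using all unfolding invariant_prob_def by auto
  qed
  have basins: "AE z in mbar. \<exists>i<r. z \<in> basin F (\<nu> i) \<phi>" if \<phi>: "\<phi> \<in> bmeas mbar" for \<phi>
  proof -
    have "(\<Union>i<r0. basin F (\<nu>0 i) \<phi>) = (\<Union>i<r. basin F (\<nu> i) \<phi>)"
      using arg_cong[OF range, of "\<lambda>X. \<Union>\<nu>\<in>X. basin F \<nu> \<phi>"] by simp
    then have "emeasure mbar (\<Union>i<r. basin F (\<nu> i) \<phi>) = 1"
      using basins0[of \<phi>] \<phi> by (simp add: bmeas_iff_bounded)
    then have one: "measure mbar (\<Union>i<r. basin F (\<nu> i) \<phi>) = 1" unfolding measure_def by simp
    have B: "(\<Union>i<r. basin F (\<nu> i) \<phi>) \<in> sets mbar"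
      using basin_sets[OF F_measurable bmeas_measurable[OF \<phi>]] st(2) by (intro sets.finite_UN) auto
    have "AE z in mbar. z \<in> (\<Union>i<r. basin F (\<nu> i) \<phi>)" using PM.AE_in_set_eq_1[OF B] one by blast
    then show ?thesis by eventually_elim auto
  qed
  define h where "h i = (\<lambda>x. enn2real (RN_deriv mbar (\<nu> i) x))" for i
  have hden: "h i \<in> densities mbar" and hdens: "density mbar (\<lambda>x. ennreal (h i x)) = \<nu> i" if "i < r" for i
    using PM.absolutely_continuous_prob_density[OF st(1,2,4)[OF that]] unfolding h_def by auto
  note hd = densitiesD[OF hden]
  have inv: "invariant_density mbar LF.L (h i)" if i: "i < r" for i
    unfolding invariant_density_def
    using hden[OF i] LF.invariant_iff_push[OF hd(1,2)[OF i]] st(3)[OF i] hdens[OF i] by simp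
  have \<nu>h: "measure (\<nu> i) A = (LINT z|mbar. h i z * indicator A z)" if i: "i < r" and A: "A \<in> sets mbar" for i A
    using measure_density_eq_integral[OF hd(1,2)[OF i] A] unfolding hdens[OF i] .
  have fwd: "AE z in mbar. z \<in> A \<longrightarrow> F z \<in> A" if "LF.absorbing A" for A
  proof -
    have "AE z in mbar. indicator A z \<le> (indicator A (F z) :: real)" using that unfolding LF.absorbing_def by simp
    then show ?thesis by eventually_elim (auto simp: indicator_def split: if_splits)
  qed
  have erg: "ergodic_density mbar LF.L (h i)" if i: "i < r" for i
    unfolding LF.ergodic_density_iff
  proof (intro conjI allI impI inv i)
    fix A assume A: "LF.absorbing A"
    then have As: "A \<in> sets mbar" unfolding LF.absorbing_def by simp
    have "measure (\<nu> i) A \<in> {0, 1}"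
      by (rule ergodic_forward_invariant[OF st(1,2,3,4,5)[OF i] As fwd[OF A]])
    then show "(LINT z|mbar. h i z * indicator A z) \<in> {0, 1}" using \<nu>h[OF i As] by simp
  qed
  have disj: "disjoint_supports mbar r h"
  proof (subst disjoint_supports_iff_AE)
    show "\<And>i. i < r \<Longrightarrow> h i \<in> borel_measurable mbar" using hd(1) by simp
    show "\<forall>i<r. \<forall>j<r. i \<noteq> j \<longrightarrow> (AE y in mbar. h i y = 0 \<or> h j y = 0)"
    proof (intro allI impI)
      fix i j assume ij: "i < r" "j < r" "i \<noteq> j"
      interpret I: prob_space "\<nu> i" by (rule st(1)[OF ij(1)])
      interpret J: prob_space "\<nu> j" by (rule st(1)[OF ij(2)])
      obtain A where A: "A \<in> sets mbar" "measure (\<nu> i) A \<noteq> measure (\<nu> j) A"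
      proof (rule ccontr)
        assume no: "\<not> thesis"
        have "\<nu> i = \<nu> j"
        proof (rule measure_eqI)
          show "sets (\<nu> i) = sets (\<nu> j)" using st(2)[OF ij(1)] st(2)[OF ij(2)] by simp
          fix A assume "A \<in> sets (\<nu> i)"
          then have "A \<in> sets mbar" using st(2)[OF ij(1)] by simp
          then have "measure (\<nu> i) A = measure (\<nu> j) A" using no that by blast
          then show "emeasure (\<nu> i) A = emeasure (\<nu> j) A" by (simp add: I.emeasure_eq_measure J.emeasure_eq_measure)
        qed
        then show False using distinct[OF ij] by simp
      qed
      have typical: "AE z in mbar. 0 < h k z \<longrightarrow> z \<in> basin F (\<nu> k) (indicator A)" if k: "k < r" for k
      proof -
        have "indicator A \<in> bmeas (\<nu> k)" using A(1) st(2)[OF k] by simp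
        then have "AE z in \<nu> k. z \<in> basin F (\<nu> k) (indicator A)"
          by (rule ergodic_birkhoff[OF st(1)[OF k] st(6)[OF k] st(3)[OF k] st(5)[OF k]])
        then have "AE z in density mbar (\<lambda>z. ennreal (h k z)). z \<in> basin F (\<nu> k) (indicator A)" unfolding hdens[OF k] .
        then have "AE z in mbar. 0 < ennreal (h k z) \<longrightarrow> z \<in> basin F (\<nu> k) (indicator A)"
          using hd(1)[OF k] by (subst (asm) AE_density) auto
        then show ?thesis by eventually_elim auto
      qed
      have integral: "(LINT z|\<nu> k. indicator A z) = measure (\<nu> k) A" if "k < r" for k
        using A(1) st(2)[OF that] sets_eq_imp_space_eq[OF st(2)[OF that]] sets.sets_into_space[OF A(1)]
        by (simp add: Int_absorb2)
      have apart: "z \<notin> basin F (\<nu> i) (indicator A) \<or> z \<notin> basin F (\<nu> j) (indicator A)" for z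
      proof (rule ccontr)
        assume "\<not> ?thesis"
        then have "(LINT z|\<nu> i. indicator A z :: real) = (LINT z|\<nu> j. indicator A z)"
          unfolding basin_def using LIMSEQ_unique by blast
        then show False using A(2) integral ij by simp
      qed
      show "AE y in mbar. h i y = 0 \<or> h j y = 0"
        using typical[OF ij(1)] typical[OF ij(2)] hd(2)[OF ij(1)] hd(2)[OF ij(2)]
      proof eventually_elim
        case (elim y)
        then show ?case using apart[of y] by linarith
      qed
    qed
  qed
  have r: "1 \<le> r"
  proof (rule ccontr)
    assume "\<not> 1 \<le> r"
    then have "AE z in mbar. False" using basins[of "\<lambda>_. 0"] by (simp add: not_le)
    then show False by (simp add: PM.AE_False)
  qed
  define H where "H = (\<lambda>y. (1 / real r) * (\<Sum>i<r. h i y))"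
  define S where "S = supp mbar H"
  have Sa: "LF.absorbing S" and hH: "AE y in mbar. \<forall>i<r. h i y \<le> real r * H y"
    using LF.invariant_mean(2,3)[OF inv r] unfolding S_def H_def by auto
  then have Sm [measurable]: "S \<in> sets mbar" unfolding LF.absorbing_def by simp
  have \<nu>S: "measure (\<nu> i) S = 1" if i: "i < r" for i
  proof -
    have "AE y in mbar. h i y * indicator S y = h i y"
      using hH hd(2)[OF i] AE_space
    proof eventually_elim
      case (elim y)
      show ?case
      proof (cases "H y = 0")
        case True
        then show ?thesis using elim i by fastforce
      qed (use elim in \<open>simp add: S_def supp_def\<close>)
    qed
    then have "(LINT y|mbar. h i y * indicator S y) = (LINT y|mbar. h i y)"
      using hd(1)[OF i] by (intro integral_cong_AE) auto
    then show ?thesis using \<nu>h[OF i Sm] hd(3)[OF i] by simp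
  qed
  have hit: "AE z in mbar. \<exists>n. (F ^^ n) z \<in> S"
    using basins[OF bmeas_indicator[OF Sm]]
    by eventually_elim (use basin_enters[OF st(1,2) Sm \<nu>S] in blast)
  have "(\<lambda>n. LINT z|mbar. indicator S ((F ^^ n) z)) \<longlonglongrightarrow> (1::real)"
    by (rule entering_probability_limit[OF Sm fwd[OF Sa] hit])
  then have "AE y in mbar. (\<lambda>n. dual_op mbar (LF.L ^^ n) (indicator S) y) \<longlonglongrightarrow> 1"
    using LF.absorbing_limit_iff[OF Sa] by (simp add: UF_iter)
  then show ?thesis
    unfolding FED_def Let_def using r erg disj unfolding S_def H_def by blast
qed

end

theorem theorem2p6:
  fixes m :: "'x::polish_space measure"
    and p :: "'t measure"
    and f :: "'t \<Rightarrow> 'x \<Rightarrow> 'x"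
  assumes "prob_space m" and "sets m = sets borel"
    and "prob_space p"
    and "(\<lambda>(t, x). f t x) \<in> measurable (p \<Otimes>\<^sub>M m) m"
    and "nonsingular (bernoulli p \<Otimes>\<^sub>M m) (skew f)"
  defines "mbar \<equiv> bernoulli p \<Otimes>\<^sub>M m"
    and "Lf \<equiv> annealed_PF p m f"
    and "LF \<equiv> PF (bernoulli p \<Otimes>\<^sub>M m) (skew f)"
  shows "(MC m Lf \<longleftrightarrow> FED m Lf) \<and>
         (FED m Lf \<longleftrightarrow> APM m Lf) \<and>
         (APM m Lf \<longleftrightarrow> FPM_random p m f) \<and>
         (FPM_random p m f \<longleftrightarrow> MC mbar LF) \<and>
         (MC mbar LF \<longleftrightarrow> FED mbar LF) \<and>
         (FED mbar LF \<longleftrightarrow> APM mbar LF) \<and>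
         (APM mbar LF \<longleftrightarrow> FPM_skew p m f)"
proof -
  interpret R: random_map m p f using assms(1,3,4,5) by (rule random_map.intro)
  have L: "Lf = R.Lf.L" "LF = R.LF.L" unfolding Lf_def LF_def annealed_PF_def PF_def by simp_all
  show ?thesis
    unfolding L mbar_def
    using R.Lf.MC_imp_FED R.Lf.FED_imp_APM R.Lf.APM_imp_MC R.LF.MC_imp_FED R.LF.FED_imp_APM R.LF.APM_imp_MC
      R.MC_f_imp_MC_F R.MC_F_imp_MC_f R.FED_f_imp_FPM_random R.FED_f_imp_FPM_skew
      R.FPM_random_imp_FED_f R.FPM_skew_imp_FED_F
    by blast
qed

end
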